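(* Let $\Omega$ be the three-edge star graph described in the context, with edge lengths $l_1,l_2,l_3>0$, $l_2\ge l_3$, and let $q$ be a real-valued function on $\Omega$ whose restriction to each edge $e_j$ is continuous. Set $T_*=\max(l_2,\ l_1+l_3)$. Then there exists a constant $C$ depending only on $q,l_1,l_2,l_3$ such that the following holds. For every $T\ge T_*$ and every $\phi\in\mathcal H^1_0$ there exist controls $\mathbf f=(f_1,f_2)\in H^1_0(0,T)\times L^2(0,T)$ such that the solution $u^{\mathbf f}$ of the initial boundary value problem $$\partial_{tt}u-\partial_{xx}u+q(x)u=0,\quad x\in e_j,\ j=1,2,3,\ 0<t<T,\qquad u(\cdot,0)=u_t(\cdot,0)=0,$$ $$u_1(v_1,t)=f_1(t),\qquad u_2(v_2,t)=u_3(v_3,t)=0,$$ $$\partial u_2(v_0,t)-\partial u_1(v_0,t)=f_2(t),\quad \partial u_3(v_0,t)-\partial u_1(v_0,t)=0,\quad \sum_{j=1}^3u_j(v_0,t)=0$$ satisfies $$u^{\mathbf f}(x,T)=\phi(x)\quad\text{on }\Omega,$$ and $$\|f_1\|_{H^1(0,T)}+\|f_2\|_{L^2(0,T)}\le C\|\phi\|_{\mathcal H^1}.$$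
   Context: The star graph $\Omega$ has a central vertex $v_0$, boundary vertices $v_1,v_2,v_3$, and edges $e_1,e_2,e_3$, where $e_j$ joins $v_0$ and $v_j$ and is identified with the interval $(0,l_j)$. For a function $\phi$ on $\Omega$, $\phi_j$ denotes its restriction to $e_j$. $\partial u_j(v_0,t)$ denotes the spatial derivative of $u$ at $v_0$ along $e_j$ in the direction outward from the vertex $v_0$ (i.e. pointing from $v_0$ into the edge $e_j$). $\mathcal H^1$ is the space of functions on $\Omega$ whose restriction to each edge $e_j$ lies in $H^1(e_j)$, with norm $\|\phi\|^2_{\mathcal H^1}=\sum_{j=1}^3\big(\|\phi'\|^2_{L^2(e_j)}+\|\phi\|^2_{L^2(e_j)}\big)$. $\mathcal H^1_0$ is the space of $y\in\mathcal H^1$ with $y_1(v_1)=y_2(v_2)=y_3(v_3)=0$ and $\sum_{j=1}^3y_j(v_0)=0$. The solution $u^{\mathbf f}$ is understood in the usual generalized (weak) sense. As usual, $H^1_0(0,T)$ consists of the $H^1(0,T)$ functions vanishing at $0$ and $T$. *)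

theory Defs
  imports "HOL-Analysis.Analysis"
begin

definition L2_space :: "real \<Rightarrow> (real \<Rightarrow> real) \<Rightarrow> bool" where
  "L2_space l f \<longleftrightarrow>
     set_borel_measurable lebesgue {0<..<l} f \<and>
     set_integrable lebesgue {0<..<l} (\<lambda>x. (f x)\<^sup>2)"

definition L2_norm :: "real \<Rightarrow> (real \<Rightarrow> real) \<Rightarrow> real" where
  "L2_norm l f = sqrt (LINT x:{0<..<l}|lebesgue. (f x)\<^sup>2)"

text \<open>Test functions \<open>\<psi>\<close> are the compactly supported \<open>C\<^sup>1\<close> functions on the open interval \<open>(0, l)\<close>.\<close>

definition weak_deriv :: "real \<Rightarrow> (real \<Rightarrow> real) \<Rightarrow> (real \<Rightarrow> real) \<Rightarrow> bool" where
  "weak_deriv l f g \<longleftrightarrow>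
     (\<forall>\<psi> \<psi>'. (\<forall>x. (\<psi> has_real_derivative \<psi>' x) (at x)) \<longrightarrow> continuous_on UNIV \<psi>' \<longrightarrow>
        (\<exists>a b. 0 < a \<and> b < l \<and> (\<forall>x. x \<notin> {a..b} \<longrightarrow> \<psi> x = 0)) \<longrightarrow>
        (LINT x:{0<..<l}|lebesgue. f x * \<psi>' x) = - (LINT x:{0<..<l}|lebesgue. g x * \<psi> x))"

text \<open>
  An element of \<open>H\<^sup>1(0, l)\<close> is given by its continuous representative on \<open>[0, l]\<close>, so that
  point values and boundary values make sense. The weak derivative is unique up to null sets,
  and the choice made by \<open>wderiv\<close> only ever occurs inside integrals.
\<close>

definition H1_space :: "real \<Rightarrow> (real \<Rightarrow> real) \<Rightarrow> bool" where
  "H1_space l f \<longleftrightarrow> continuous_on {0..l} f \<and> (\<exists>g. L2_space l g \<and> weak_deriv l f g)"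

definition wderiv :: "real \<Rightarrow> (real \<Rightarrow> real) \<Rightarrow> real \<Rightarrow> real" where
  "wderiv l f = (SOME g. L2_space l g \<and> weak_deriv l f g)"

definition H1_norm :: "real \<Rightarrow> (real \<Rightarrow> real) \<Rightarrow> real" where
  "H1_norm l f = sqrt ((L2_norm l (wderiv l f))\<^sup>2 + (L2_norm l f)\<^sup>2)"

definition H10_space :: "real \<Rightarrow> (real \<Rightarrow> real) \<Rightarrow> bool" where
  "H10_space l f \<longleftrightarrow> H1_space l f \<and> f 0 = 0 \<and> f l = 0"

text \<open>
  A function on the star graph is a map \<open>\<phi> :: nat \<Rightarrow> real \<Rightarrow> real\<close>, where \<open>\<phi> j\<close> for
  \<open>j \<in> {1..3}\<close> is the restriction to the \<open>j\<close>-th edge. Each edge is parametrised from the centre: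
  \<open>x = 0\<close> is \<open>v\<^sub>0\<close> and \<open>x = l j\<close> is \<open>v\<^sub>j\<close>. Hence the derivative at \<open>v\<^sub>0\<close> in the direction
  outward from \<open>v\<^sub>0\<close> is the derivative in \<open>x\<close> at \<open>0\<close>.
\<close>

definition star_L2 :: "(nat \<Rightarrow> real) \<Rightarrow> (nat \<Rightarrow> real \<Rightarrow> real) \<Rightarrow> bool" where
  "star_L2 l \<phi> \<longleftrightarrow> (\<forall>j\<in>{1..3}. L2_space (l j) (\<phi> j))"

definition star_L2_norm :: "(nat \<Rightarrow> real) \<Rightarrow> (nat \<Rightarrow> real \<Rightarrow> real) \<Rightarrow> real" where
  "star_L2_norm l \<phi> = sqrt (\<Sum>j=1..3. (L2_norm (l j) (\<phi> j))\<^sup>2)"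

definition star_L2_inner :: "(nat \<Rightarrow> real) \<Rightarrow> (nat \<Rightarrow> real \<Rightarrow> real) \<Rightarrow> (nat \<Rightarrow> real \<Rightarrow> real) \<Rightarrow> real" where
  "star_L2_inner l \<phi> \<psi> = (\<Sum>j=1..3. LINT x:{0<..<l j}|lebesgue. \<phi> j x * \<psi> j x)"

definition star_H1 :: "(nat \<Rightarrow> real) \<Rightarrow> (nat \<Rightarrow> real \<Rightarrow> real) \<Rightarrow> bool" where
  "star_H1 l \<phi> \<longleftrightarrow> (\<forall>j\<in>{1..3}. H1_space (l j) (\<phi> j))"

definition star_H1_norm :: "(nat \<Rightarrow> real) \<Rightarrow> (nat \<Rightarrow> real \<Rightarrow> real) \<Rightarrow> real" where
  "star_H1_norm l \<phi> =
     sqrt (\<Sum>j=1..3. (L2_norm (l j) (wderiv (l j) (\<phi> j)))\<^sup>2 + (L2_norm (l j) (\<phi> j))\<^sup>2)"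

definition star_H10 :: "(nat \<Rightarrow> real) \<Rightarrow> (nat \<Rightarrow> real \<Rightarrow> real) \<Rightarrow> bool" where
  "star_H10 l y \<longleftrightarrow>
     star_H1 l y \<and> (\<forall>j\<in>{1..3}. y j (l j) = 0) \<and> (\<Sum>j=1..3. y j 0) = 0"

definition star_form ::
  "(nat \<Rightarrow> real \<Rightarrow> real) \<Rightarrow> (nat \<Rightarrow> real) \<Rightarrow> (nat \<Rightarrow> real \<Rightarrow> real) \<Rightarrow> (nat \<Rightarrow> real \<Rightarrow> real) \<Rightarrow> real" where
  "star_form q l y w =
     (\<Sum>j=1..3. LINT x:{0<..<l j}|lebesgue.
        wderiv (l j) (y j) x * wderiv (l j) (w j) x + q j x * y j x * w j x)"

text \<open>
  Weak (finite energy) solutions: \<open>u t\<close> is the state at time \<open>t\<close>, with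
  \<open>u \<in> C([0,T]; \<H>\<^sup>1) \<inter> C\<^sup>1([0,T]; L\<^sup>2(\<Omega>))\<close> and velocity \<open>v = u\<^sub>t\<close>. The Dirichlet
  conditions at \<open>v\<^sub>1, v\<^sub>2, v\<^sub>3\<close>, the condition \<open>\<Sum>\<^sub>j u\<^sub>j(v\<^sub>0,t) = 0\<close> and the initial conditions
  are imposed directly. The wave equation and the two derivative conditions at \<open>v\<^sub>0\<close> are encoded
  in the variational equation: multiplying the wave equation by \<open>w\<close> in \<open>\<H>\<^sup>1\<^sub>0\<close> and
  integrating by parts leaves the boundary term \<open>\<Sum>\<^sub>j \<partial>u\<^sub>j(v\<^sub>0,t) w\<^sub>j(v\<^sub>0)\<close>. Since
  \<open>\<partial>u\<^sub>3 = \<partial>u\<^sub>1\<close>, \<open>\<partial>u\<^sub>2 = \<partial>u\<^sub>1 + f\<^sub>2\<close> and \<open>\<Sum>\<^sub>j w\<^sub>j(v\<^sub>0) = 0\<close> there, it equals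
  \<open>f\<^sub>2(t) w\<^sub>2(v\<^sub>0)\<close>. So for every such \<open>w\<close> one has
  \<open>d/dt (u\<^sub>t, w) + a(u, w) + f\<^sub>2 w\<^sub>2(v\<^sub>0) = 0\<close> in the sense of distributions on \<open>(0,T)\<close>,
  where \<open>a\<close> is \<open>star_form q l\<close>.
\<close>

definition weak_solution ::
  "(nat \<Rightarrow> real \<Rightarrow> real) \<Rightarrow> (nat \<Rightarrow> real) \<Rightarrow> real \<Rightarrow> (real \<Rightarrow> real) \<Rightarrow> (real \<Rightarrow> real) \<Rightarrow>
   (real \<Rightarrow> nat \<Rightarrow> real \<Rightarrow> real) \<Rightarrow> bool" where
  "weak_solution q l T f1 f2 u \<longleftrightarrow>
     (\<forall>t\<in>{0..T}. star_H1 l (u t) \<and>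
        ((\<lambda>s. star_H1_norm l (\<lambda>j x. u s j x - u t j x)) \<longlongrightarrow> 0) (at t within {0..T})) \<and>
     (\<exists>v. (\<forall>t\<in>{0..T}. star_L2 l (v t) \<and>
            ((\<lambda>s. star_L2_norm l (\<lambda>j x. (u s j x - u t j x) / (s - t) - v t j x)) \<longlongrightarrow> 0)
              (at t within {0..T}) \<and>
            ((\<lambda>s. star_L2_norm l (\<lambda>j x. v s j x - v t j x)) \<longlongrightarrow> 0) (at t within {0..T})) \<and>
          star_L2_norm l (v 0) = 0 \<and>
          (\<forall>w. star_H10 l w \<longrightarrow>
             weak_deriv T (\<lambda>t. star_L2_inner l (v t) w)
                          (\<lambda>t. - (star_form q l (u t) w + f2 t * w 2 0)))) \<and>
     (\<forall>j\<in>{1..3}. \<forall>x\<in>{0..l j}. u 0 j x = 0) \<and>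
     (\<forall>t\<in>{0..T}. u t 1 (l 1) = f1 t \<and> u t 2 (l 2) = 0 \<and> u t 3 (l 3) = 0 \<and>
        (\<Sum>j=1..3. u t j 0) = 0)"

end

theory Submission
  imports Defs
begin

text \<open>
  With \<open>s = t - T\<close> the controls are read off as traces at \<open>v\<^sub>1\<close> and \<open>v\<^sub>0\<close> of a solution on \<open>s \<le> 0\<close> that vanishes
  for \<open>s \<le> - T\<^sub>*\<close> and equals \<open>\<phi>\<close> at \<open>s = 0\<close>; uniqueness of finite energy solutions shows that it is the
  controlled one. On edge 2 a wave entering at \<open>v\<^sub>0\<close> reaches any state vanishing at \<open>v\<^sub>2\<close> in time \<open>l\<^sub>2\<close>; let \<open>g\<close> be
  its trace at \<open>v\<^sub>0\<close>. After reversing the sign of \<open>u\<close> on edge 3, the edges 1 and 3 form a string of length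
  \<open>l\<^sub>1 + l\<^sub>3\<close>, and the remaining vertex conditions say that \<open>u\<close> jumps by \<open>g\<close> across \<open>v\<^sub>0\<close> while its derivative
  is continuous. A solution with this jump consists of the waves leaving \<open>v\<^sub>0\<close> and their reflection at \<open>v\<^sub>3\<close>. Its
  deviation from \<open>\<phi>\<close> at \<open>s = 0\<close> is a continuous function on the string, vanishing at \<open>v\<^sub>3\<close>, which a wave entering
  at \<open>v\<^sub>1\<close> corrects in time \<open>l\<^sub>1 + l\<^sub>3\<close>. In characteristic coordinates each of these problems is a Volterra
  equation, so the solutions are bounded linearly by the data. For uniqueness, testing the equation for
  the difference at time \<open>t\<close> with its own state and integrating gives an energy identity for its time
  integral, and Gronwall's inequality applies.
\<close>

section \<open>Integrals on the line\<close>

text \<open>The two free controls decouple the graph. Since \<open>f2\<close> is free, the flux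
  balance at v0 puts no condition on edge 2, which is steered alone and passes only its trace g to
  the string. Since \<open>f1\<close> is free, the end v1 of the string puts no condition either,
  and waves leave there without reflection. Edge 2, and with it the jump g, starts at time - l2, the
  correcting wave at - (l1 + l3); T_* is the larger of the two spans. For longer T the star rests
  first, so the constants do not depend on T. That the values of \<phi> at v0 sum to zero is exactly
  what makes the deviation continuous across v0 at the final time. The obstacle is regularity: the
  data are only in H^1, and the potential of the string may jump at v0. Hence every solution is a
  superposition of travelling waves with profile in \<open>AC2\<close> and of Goursat integrals of
  sources that may jump at fixed positions. The latter are only C^1, so the wave equation is carried
  in an integrated form throughout. In the uniqueness proof the state is the test function because
  the velocity lies merely in L^2.\<close>

lemmas set_LINT_def = set_lebesgue_integral_def
lemmas LINT_cong = Bochner_Integration.integral_cong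
lemmas LINT_nonneg = Bochner_Integration.integral_nonneg
lemmas LINT_integrable_bound = Bochner_Integration.integrable_bound

abbreviation lborel2 :: "(real \<times> real) measure" where "lborel2 \<equiv> lborel \<Otimes>\<^sub>M lborel"

lemma integrable_bounded_support:
  fixes f :: "'a::euclidean_space \<Rightarrow> real"
  assumes "f \<in> borel_measurable borel" "\<And>x. \<bar>f x\<bar> \<le> M" "\<And>x. x \<notin> cbox a b \<Longrightarrow> f x = 0"
  shows "integrable lborel f"
proof (rule integrableI_bounded_set[where A="cbox a b" and B=M])
  show "AE x in lborel. x \<in> cbox a b \<longrightarrow> norm (f x) \<le> M" using assms(2) by simp
  show "AE x in lborel. x \<notin> cbox a b \<longrightarrow> f x = 0" using assms(3) by simp
  show "emeasure lborel (cbox a b) < \<infinity>" by (simp add: emeasure_lborel_cbox_eq)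
qed (use assms in auto)

lemma integrable_bounded_support_plane:
  fixes f :: "real \<times> real \<Rightarrow> real"
  assumes "f \<in> borel_measurable borel" "\<And>z. \<bar>f z\<bar> \<le> M"
    "\<And>x y. \<not> (a \<le> x \<and> x \<le> b \<and> c \<le> y \<and> y \<le> d) \<Longrightarrow> f (x, y) = 0"
  shows "integrable (lborel2) f"
  unfolding lborel_prod
proof (rule integrable_bounded_support[where a="(a,c)" and b="(b,d)", OF assms(1,2)])
  fix z assume "z \<notin> cbox (a, c) (b, d)"
  thus "f z = 0" using assms(3)[of "fst z" "snd z"] by (cases z) (auto simp: cbox_Pair_eq)
qed

lemma set_integrable_if_integrable:
  fixes f :: "'a \<Rightarrow> real"
  shows "integrable M f \<Longrightarrow> A \<in> sets M \<Longrightarrow> set_integrable M A f"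
  unfolding set_integrable_def by (rule integrable_mult_indicator)

lemma set_integral_abs_bound:
  fixes f :: "'a \<Rightarrow> real"
  shows "\<bar>LINT x:A|M. f x\<bar> \<le> (LINT x:A|M. \<bar>f x\<bar>)"
proof -
  have "\<bar>LINT x:A|M. f x\<bar> \<le> (LINT x|M. \<bar>indicator A x *\<^sub>R f x\<bar>)"
    unfolding set_LINT_def by (rule integral_abs_bound)
  thus ?thesis by (simp add: set_LINT_def abs_mult)
qed

text \<open>Dominated convergence with |f| as majorant: the indicators of the half-lines converge
  off the point b, a null set.\<close>

lemma isCont_integral_atMost:
  fixes f :: "real \<Rightarrow> real"
  assumes f: "integrable lborel f"
  shows "isCont (\<lambda>b. LBINT x:{..b}. f x) b"
  unfolding continuous_at_sequentially comp_def
proof safe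
  fix X assume X: "X \<longlonglongrightarrow> b"
  have [measurable]: "f \<in> borel_measurable lborel" using f by simp
  show "(\<lambda>n. LBINT x:{..X n}. f x) \<longlonglongrightarrow> (LBINT x:{..b}. f x)"
    unfolding set_LINT_def
  proof (rule integral_dominated_convergence[where w="\<lambda>x. \<bar>f x\<bar>"])
    have "AE x in lborel. x \<noteq> b" by (rule AE_lborel_singleton)
    thus "AE x in lborel. (\<lambda>n. indicator {..X n} x *\<^sub>R f x) \<longlonglongrightarrow> indicator {..b} x *\<^sub>R f x"
    proof eventually_elim
      fix x assume "x \<noteq> b"
      have "eventually (\<lambda>n. indicator {..X n} x *\<^sub>R f x = indicator {..b} x *\<^sub>R f x) sequentially"
      proof (cases "x < b")
        case True
        from order_tendstoD(1)[OF X this] show ?thesis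
          by eventually_elim (use True in \<open>auto simp: indicator_def\<close>)
      next
        case False
        hence "x > b" using \<open>x \<noteq> b\<close> by simp
        from order_tendstoD(2)[OF X this] show ?thesis
          by eventually_elim (use \<open>x > b\<close> in \<open>auto simp: indicator_def\<close>)
      qed
      thus "(\<lambda>n. indicator {..X n} x *\<^sub>R f x) \<longlonglongrightarrow> indicator {..b} x *\<^sub>R f x"
        by (rule tendsto_eventually)
    qed
  qed (use f in \<open>auto simp: indicator_def\<close>)
qed

lemma integral_atMost_diff:
  fixes f :: "real \<Rightarrow> real"
  assumes f: "integrable lborel f" and "c \<le> b"
  shows "(LBINT x:{..b}. f x) - (LBINT x:{..c}. f x) = (LBINT x:{c..b}. f x)"
proof -
  have "(LBINT x:{..c} \<union> {c<..b}. f x) = (LBINT x:{..c}. f x) + (LBINT x:{c<..b}. f x)"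
    by (rule set_integral_Un) (auto intro!: set_integrable_if_integrable f)
  moreover have "{..c} \<union> {c<..b} = {..b}" using assms by auto
  moreover have "(LBINT x:{c<..b}. f x) = (LBINT x:{c..b}. f x)"
  proof (rule set_integral_discrete_difference[where X="{c}"])
    show "{c<..b} - {c..b} \<union> ({c..b} - {c<..b}) \<subseteq> {c}" by auto
  qed auto
  ultimately show ?thesis by simp
qed

text \<open>Splitting the half-line at b - 1 leaves a Henstock-Kurzweil integral over a compact
  interval, to which the fundamental theorem applies.\<close>

lemma DERIV_integral_atMost:
  fixes f :: "real \<Rightarrow> real"
  assumes f: "integrable lborel f" and c: "continuous_on UNIV f"
  shows "((\<lambda>b. LBINT x:{..b}. f x) has_real_derivative f b) (at b)"
proof -
  have c': "continuous_on {b-1..b+1} f" using c continuous_on_subset by blast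
  have "((\<lambda>y. integral {b-1..y} f) has_real_derivative f b) (at b within {b-1..b+1})"
    by (rule integral_has_real_derivative[OF c']) auto
  hence "((\<lambda>y. integral {b-1..y} f) has_real_derivative f b) (at b)"
    by (subst (asm) at_within_interior) auto
  hence D: "((\<lambda>y. (LBINT x:{..b-1}. f x) + integral {b-1..y} f) has_real_derivative f b) (at b)"
    by (auto intro!: derivative_eq_intros)
  have "eventually (\<lambda>y. y > b - 1) (nhds b)"
    by (rule order_tendstoD(1)[OF tendsto_ident_at[where s=UNIV, THEN tendsto_at_iff_tendsto_nhds[THEN iffD1]]]) auto
  hence "eventually (\<lambda>y. (LBINT x:{..b-1}. f x) + integral {b-1..y} f = (LBINT x:{..y}. f x)) (nhds b)"
  proof eventually_elim
    case (elim y)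
    have "(LBINT x:{b-1..y}. f x) = integral {b-1..y} f"
      by (rule set_borel_integral_eq_integral(2)) (auto intro!: set_integrable_if_integrable f)
    thus ?case using integral_atMost_diff[OF f, of "b-1" y] elim by simp
  qed
  from DERIV_cong_ev[OF refl this refl] D show ?thesis by simp
qed

lemma set_integral_FTC:
  fixes F f :: "real \<Rightarrow> real"
  assumes "a \<le> b" "\<And>x. x \<in> {a..b} \<Longrightarrow> (F has_real_derivative f x) (at x)" "continuous_on {a..b} f"
  shows "(LBINT x:{a..b}. f x) = F b - F a"
proof -
  have "(f has_integral (F b - F a)) {a..b}"
    using assms by (intro fundamental_theorem_of_calculus)
      (auto simp: has_real_derivative_iff_has_vector_derivative[symmetric] intro: DERIV_subset)
  moreover have "(LBINT x:{a..b}. f x) = integral {a..b} f"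
    by (rule set_borel_integral_eq_integral(2)) (intro borel_integrable_atLeastAtMost' assms)
  ultimately show ?thesis by (simp add: integral_unique)
qed

section \<open>Mean-square approximation and continuity of translations\<close>

text \<open>Two applications of dominated convergence: f is truncated at a level N, and an almost
  everywhere approximation of f by continuous functions is truncated at the same level, which makes
  it dominated. Each error is below e/4, and splitting the square costs a factor 2 on each.\<close>

lemma L2_approx_continuous:
  fixes f :: "real \<Rightarrow> real"
  assumes f[measurable]: "f \<in> borel_measurable borel" and f2: "integrable lborel (\<lambda>x. (f x)\<^sup>2)" and e: "e > 0"
  shows "\<exists>g M. continuous_on UNIV g \<and> (\<forall>x. \<bar>g x\<bar> \<le> M) \<and> (LBINT x:{a..b}. (f x - g x)\<^sup>2) < e"
proof -
  define cl where "cl N y = max (- N) (min N y)" for N y :: real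
  have clb: "\<bar>cl N y\<bar> \<le> N" if "N \<ge> 0" for N y using that by (auto simp: cl_def)
  have cln: "\<bar>cl N y\<bar> \<le> \<bar>y\<bar>" if "N \<ge> 0" for N y using that by (auto simp: cl_def)
  have [measurable]: "cl N \<in> borel_measurable borel" for N unfolding cl_def by measurable
  have "(\<lambda>n. LBINT x:{a..b}. (f x - cl (real n) (f x))\<^sup>2) \<longlonglongrightarrow> (LBINT x:{a..b}. 0)"
    unfolding set_LINT_def
  proof (rule integral_dominated_convergence[where w="\<lambda>x. 4 * (f x)\<^sup>2"])
    show "AE x in lborel. (\<lambda>n. indicator {a..b} x *\<^sub>R (f x - cl (real n) (f x))\<^sup>2) \<longlonglongrightarrow> indicator {a..b} x *\<^sub>R 0"
    proof (intro AE_I2 tendsto_eventually)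
      fix x
      obtain m where "\<bar>f x\<bar> < real m" using reals_Archimedean2 by blast
      hence "eventually (\<lambda>n. \<bar>f x\<bar> < real n) sequentially"
        by (intro eventually_sequentiallyI[of m]) auto
      thus "\<forall>\<^sub>F n in sequentially. indicator {a..b} x *\<^sub>R (f x - cl (real n) (f x))\<^sup>2 = indicator {a..b} x *\<^sub>R 0"
        by eventually_elim (auto simp: cl_def)
    qed
    show "AE x in lborel. norm (indicator {a..b} x *\<^sub>R (f x - cl (real n) (f x))\<^sup>2) \<le> 4 * (f x)\<^sup>2" for n
    proof (intro AE_I2)
      fix x
      have "\<bar>f x - cl (real n) (f x)\<bar> \<le> \<bar>2 * f x\<bar>" using cln[of "real n" "f x"] by linarith
      hence "(f x - cl (real n) (f x))\<^sup>2 \<le> 4 * (f x)\<^sup>2" by (subst (asm) abs_le_square_iff) (simp add: power_mult_distrib)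
      thus "norm (indicator {a..b} x *\<^sub>R (f x - cl (real n) (f x))\<^sup>2) \<le> 4 * (f x)\<^sup>2" by (simp add: indicator_def)
    qed
  qed (use f2 in auto)
  hence "(\<lambda>n. LBINT x:{a..b}. (f x - cl (real n) (f x))\<^sup>2) \<longlonglongrightarrow> 0" by simp
  from order_tendstoD(2)[OF this, of "e/4"] e obtain n where n: "(LBINT x:{a..b}. (f x - cl (real n) (f x))\<^sup>2) < e/4"
    by (auto simp: eventually_sequentially)
  define N where "N = real n"
  have N: "N \<ge> 0" by (simp add: N_def)
  have "f measurable_on UNIV"
    by (rule lebesgue_measurable_imp_measurable_on_real) (auto intro: measurable_completion)
  then obtain Z g where Z: "negligible Z" and g: "\<And>k. continuous_on UNIV (g k)"
    and lim: "\<And>x. x \<notin> Z \<Longrightarrow> (\<lambda>k. g k x) \<longlonglongrightarrow> f x"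
    unfolding measurable_on_def by auto
  have [measurable]: "g k \<in> borel_measurable borel" for k using g by (rule borel_measurable_continuous_onI)
  have "AE x in lebesgue. x \<notin> Z" using Z by (simp add: negligible_iff_null_sets AE_not_in)
  hence Z': "AE x in lborel. x \<notin> Z" by (simp add: AE_completion_iff)
  have "(\<lambda>k. LBINT x:{a..b}. (cl N (f x) - cl N (g k x))\<^sup>2) \<longlonglongrightarrow> (LBINT x:{a..b}. 0)"
    unfolding set_LINT_def
  proof (rule integral_dominated_convergence[where w="\<lambda>x. indicator {a..b} x *\<^sub>R (4 * N\<^sup>2)"])
    show "AE x in lborel. (\<lambda>k. indicator {a..b} x *\<^sub>R (cl N (f x) - cl N (g k x))\<^sup>2) \<longlonglongrightarrow> indicator {a..b} x *\<^sub>R 0"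
      using Z'
    proof eventually_elim
      case (elim x)
      have "(\<lambda>k. indicator {a..b} x *\<^sub>R (cl N (f x) - cl N (g k x))\<^sup>2) \<longlonglongrightarrow> indicator {a..b} x *\<^sub>R (cl N (f x) - cl N (f x))\<^sup>2"
        unfolding cl_def by (intro tendsto_intros lim elim)
      thus ?case by simp
    qed
    show "AE x in lborel. norm (indicator {a..b} x *\<^sub>R (cl N (f x) - cl N (g k x))\<^sup>2) \<le> indicator {a..b} x *\<^sub>R (4 * N\<^sup>2)" for k
    proof (intro AE_I2)
      fix x
      have "\<bar>cl N (f x) - cl N (g k x)\<bar> \<le> \<bar>2 * N\<bar>" using clb[OF N, of "f x"] clb[OF N, of "g k x"] by linarith
      hence "(cl N (f x) - cl N (g k x))\<^sup>2 \<le> 4 * N\<^sup>2" by (subst (asm) abs_le_square_iff) (simp add: power_mult_distrib)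
      thus "norm (indicator {a..b} x *\<^sub>R (cl N (f x) - cl N (g k x))\<^sup>2) \<le> indicator {a..b} x *\<^sub>R (4 * N\<^sup>2)" by (simp add: indicator_def)
    qed
    show "integrable lborel (\<lambda>x. indicator {a..b} x *\<^sub>R (4 * N\<^sup>2))"
      by (rule integrable_bounded_support[where M="4*N\<^sup>2" and a=a and b=b]) (auto simp: indicator_def)
  qed auto
  hence "(\<lambda>k. LBINT x:{a..b}. (cl N (f x) - cl N (g k x))\<^sup>2) \<longlonglongrightarrow> 0" by simp
  from order_tendstoD(2)[OF this, of "e/4"] e obtain k where k: "(LBINT x:{a..b}. (cl N (f x) - cl N (g k x))\<^sup>2) < e/4"
    by (auto simp: eventually_sequentially)
  have I1: "set_integrable lborel {a..b} (\<lambda>x. (f x - cl N (f x))\<^sup>2)"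
    unfolding set_integrable_def
  proof (rule LINT_integrable_bound[where f="\<lambda>x. 4 * (f x)\<^sup>2"])
    show "AE x in lborel. norm (indicator {a..b} x *\<^sub>R (f x - cl N (f x))\<^sup>2) \<le> norm (4 * (f x)\<^sup>2)"
    proof (intro AE_I2)
      fix x
      have "\<bar>f x - cl N (f x)\<bar> \<le> \<bar>2 * f x\<bar>" using cln[OF N, of "f x"] by linarith
      hence "(f x - cl N (f x))\<^sup>2 \<le> 4 * (f x)\<^sup>2" by (subst (asm) abs_le_square_iff) (simp add: power_mult_distrib)
      thus "norm (indicator {a..b} x *\<^sub>R (f x - cl N (f x))\<^sup>2) \<le> norm (4 * (f x)\<^sup>2)" by (simp add: indicator_def)
    qed
  qed (use f2 in auto)
  have I2: "set_integrable lborel {a..b} (\<lambda>x. (cl N (f x) - cl N (g k x))\<^sup>2)"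
    unfolding set_integrable_def
  proof (rule integrable_bounded_support[where M="4*N\<^sup>2" and a=a and b=b])
    fix x
    have "\<bar>cl N (f x) - cl N (g k x)\<bar> \<le> \<bar>2 * N\<bar>" using clb[OF N, of "f x"] clb[OF N, of "g k x"] by linarith
    hence "(cl N (f x) - cl N (g k x))\<^sup>2 \<le> 4 * N\<^sup>2" by (subst (asm) abs_le_square_iff) (simp add: power_mult_distrib)
    thus "\<bar>indicator {a..b} x *\<^sub>R (cl N (f x) - cl N (g k x))\<^sup>2\<bar> \<le> 4 * N\<^sup>2" by (simp add: indicator_def)
  qed auto
  have "(LBINT x:{a..b}. (f x - cl N (g k x))\<^sup>2) \<le> 
     (LBINT x:{a..b}. 2 * (f x - cl N (f x))\<^sup>2 + 2 * (cl N (f x) - cl N (g k x))\<^sup>2)"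
    unfolding set_LINT_def
  proof (rule integral_mono')
    show "integrable lborel (\<lambda>x. indicator {a..b} x *\<^sub>R (2 * (f x - cl N (f x))\<^sup>2 + 2 * (cl N (f x) - cl N (g k x))\<^sup>2))"
      using set_integral_add(1)[OF set_integrable_mult_right[of 2, OF I1] set_integrable_mult_right[of 2, OF I2]]
      by (simp add: set_integrable_def)
    fix x
    have "(p + q)\<^sup>2 \<le> 2 * p\<^sup>2 + 2 * q\<^sup>2" for p q :: real
      using sum_squares_bound[of p q] by (simp add: power2_sum)
    from this[of "f x - cl N (f x)" "cl N (f x) - cl N (g k x)"]
    show "indicator {a..b} x *\<^sub>R (f x - cl N (g k x))\<^sup>2 \<le> indicator {a..b} x *\<^sub>R (2 * (f x - cl N (f x))\<^sup>2 + 2 * (cl N (f x) - cl N (g k x))\<^sup>2)"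
      by (simp add: indicator_def)
  qed auto
  also have "\<dots> = 2 * (LBINT x:{a..b}. (f x - cl N (f x))\<^sup>2) + 2 * (LBINT x:{a..b}. (cl N (f x) - cl N (g k x))\<^sup>2)"
    using I1 I2 by simp
  also have "\<dots> < e" using n k by (simp add: N_def)
  finally have "(LBINT x:{a..b}. (f x - cl N (g k x))\<^sup>2) < e" .
  moreover have "continuous_on UNIV (\<lambda>x. cl N (g k x))" unfolding cl_def by (intro continuous_intros g)
  ultimately show ?thesis using clb[OF N] by blast
qed

lemma sum_sq_le: "(p + q)\<^sup>2 \<le> 2 * p\<^sup>2 + 2 * q\<^sup>2" for p q :: real
  using sum_squares_bound[of p q] by (simp add: power2_sum)

lemma abs_mult_le_sq: "\<bar>p * q\<bar> \<le> p\<^sup>2 + q\<^sup>2" for p q :: real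
proof -
  have "2 * \<bar>p\<bar> * \<bar>q\<bar> \<le> p\<^sup>2 + q\<^sup>2" using sum_squares_bound[of "\<bar>p\<bar>" "\<bar>q\<bar>"] by simp
  moreover have "0 \<le> \<bar>p\<bar> * \<bar>q\<bar>" by simp
  ultimately show ?thesis unfolding abs_mult by linarith
qed

text \<open>A continuous g, close to a in mean square on \<open>J\<close>, is compared with its
  translate by uniform continuity. The bounded support of a confines the integrand to
  \<open>J'\<close>; the interval \<open>J\<close> is wider by 1 on each side so that it also
  contains the shifted points.\<close>

lemma L2_translation:
  fixes a :: "real \<Rightarrow> real"
  assumes a[measurable]: "a \<in> borel_measurable borel" and a2: "integrable lborel (\<lambda>x. (a x)\<^sup>2)"
    and supp: "\<And>x. R < \<bar>x\<bar> \<Longrightarrow> a x = 0"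
  shows "((\<lambda>h. LBINT x. (a (x + h) - a x)\<^sup>2) \<longlongrightarrow> 0) (at 0)"
proof (rule tendstoI)
  fix e :: real assume e: "e > 0"
  define R' where "R' = max R 0"
  have R': "R' \<ge> 0" and supp': "\<And>x. R' < \<bar>x\<bar> \<Longrightarrow> a x = 0" using supp by (auto simp: R'_def)
  define J where "J = {- R' - 2 .. R' + 2}"
  define J' where "J' = {- R' - 1 .. R' + 1}"
  have "e / 20 > 0" using e by simp
  from L2_approx_continuous[OF a a2 this, of "-R'-2" "R'+2"]
  obtain g M where g: "continuous_on UNIV g" and gM: "\<And>x. \<bar>g x\<bar> \<le> M" and ge: "(LBINT x:J. (a x - g x)\<^sup>2) < e / 20"
    unfolding J_def by blast
  have [measurable]: "g \<in> borel_measurable borel" using g by (rule borel_measurable_continuous_onI)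
  \<comment> \<open>Chosen so that the middle term 2 * (2 R' + 2) * \<eta>^2 equals e/5; the two
    approximation terms are below 4 * e/20 each.\<close>
  define \<eta> where "\<eta> = sqrt (e / (20 * (R' + 1)))"
  have \<eta>: "\<eta> > 0" "\<eta>\<^sup>2 = e / (20 * (R' + 1))" using e R' by (auto simp: \<eta>_def)
  have "uniformly_continuous_on J g"
    by (rule compact_uniformly_continuous) (auto simp: J_def intro: continuous_on_subset[OF g])
  from this[unfolded uniformly_continuous_on_def, rule_format, OF \<eta>(1)]
  obtain d where d: "d > 0" "\<And>x y. x \<in> J \<Longrightarrow> y \<in> J \<Longrightarrow> dist y x < d \<Longrightarrow> dist (g y) (g x) < \<eta>" by blast
  have g2: "integrable lborel (\<lambda>x. indicator J x * (g x)\<^sup>2)"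
  proof (rule integrable_bounded_support[where M="M\<^sup>2" and a="-R'-2" and b="R'+2"])
    show "\<bar>indicator J x * (g x)\<^sup>2\<bar> \<le> M\<^sup>2" for x
      using gM[of x] power_mono[OF gM[of x], of 2] by (auto simp: indicator_def)
  qed (auto simp: J_def)
  have ag: "integrable lborel (\<lambda>x. indicator J x * (a x - g x)\<^sup>2)"
  proof (rule LINT_integrable_bound)
    show "integrable lborel (\<lambda>x. 2 * (a x)\<^sup>2 + 2 * (indicator J x * (g x)\<^sup>2))" using a2 g2 by simp
    show "AE x in lborel. norm (indicator J x * (a x - g x)\<^sup>2) \<le> norm (2 * (a x)\<^sup>2 + 2 * (indicator J x * (g x)\<^sup>2))"
    proof (intro AE_I2)
      fix x
      show "norm (indicator J x * (a x - g x)\<^sup>2) \<le> norm (2 * (a x)\<^sup>2 + 2 * (indicator J x * (g x)\<^sup>2))"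
        using sum_sq_le[of "a x" "- g x"] by (auto simp: indicator_def)
    qed
  qed (auto simp: J_def)
  have I0: "(LBINT x. indicator J x * (a x - g x)\<^sup>2) < e / 20" using ge by (simp add: set_LINT_def)
  have "dist (LBINT x. (a (x + h) - a x)\<^sup>2) 0 < e" if h: "\<bar>h\<bar> < d" "\<bar>h\<bar> < 1" for h
  proof -
    have ag': "integrable lborel (\<lambda>x. indicator J (x + h) * (a (x + h) - g (x + h))\<^sup>2)"
      using lborel_integrable_real_affine[OF ag, of 1 h] by (simp add: add.commute)
    have I1: "(LBINT x. indicator J (x + h) * (a (x + h) - g (x + h))\<^sup>2) < e / 20"
      using I0 lborel_integral_real_affine[of 1 "\<lambda>x. indicator J x * (a x - g x)\<^sup>2" h] by (simp add: add.commute)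
    have J': "integrable lborel (\<lambda>x. indicator J' x * \<eta>\<^sup>2)"
      by (rule integrable_bounded_support[where M="\<eta>\<^sup>2" and a="-R'-1" and b="R'+1"]) (auto simp: indicator_def J'_def)
    have "(LBINT x. (a (x + h) - a x)\<^sup>2) \<le> (LBINT x. 4 * (indicator J (x + h) * (a (x + h) - g (x + h))\<^sup>2)
       + 4 * (indicator J x * (a x - g x)\<^sup>2) + 2 * (indicator J' x * \<eta>\<^sup>2))"
    proof (rule integral_mono')
      fix x
      show "(a (x + h) - a x)\<^sup>2 \<le> 4 * (indicator J (x + h) * (a (x + h) - g (x + h))\<^sup>2)
       + 4 * (indicator J x * (a x - g x)\<^sup>2) + 2 * (indicator J' x * \<eta>\<^sup>2)"
      proof (cases "x \<in> J'")
        case False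
        hence "a x = 0" "a (x + h) = 0" using h by (auto simp: J'_def intro!: supp')
        thus ?thesis by simp
      next
        case True
        hence J: "x \<in> J" "x + h \<in> J" using h by (auto simp: J'_def J_def)
        hence "\<bar>g (x + h) - g x\<bar> < \<eta>" using d(2)[of x "x+h"] h by (simp add: dist_real_def)
        hence "(g (x + h) - g x)\<^sup>2 \<le> \<eta>\<^sup>2" by (subst abs_le_square_iff[symmetric]) auto
        moreover have "(a (x + h) - a x)\<^sup>2 \<le> 2 * ((a (x+h) - g (x+h)) + (g x - a x))\<^sup>2 + 2 * (g (x + h) - g x)\<^sup>2"
          using sum_sq_le[of "(a (x+h) - g (x+h)) + (g x - a x)" "g (x + h) - g x"] by (simp add: algebra_simps)
        moreover have "((a (x+h) - g (x+h)) + (g x - a x))\<^sup>2 \<le> 2 * (a (x+h) - g (x+h))\<^sup>2 + 2 * (a x - g x)\<^sup>2"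
          using sum_sq_le[of "a (x+h) - g (x+h)" "g x - a x"] by (simp add: power2_commute)
        ultimately show ?thesis using J True by simp
      qed
    qed (use ag ag' J' in auto)
    also have "\<dots> = 4 * (LBINT x. indicator J (x + h) * (a (x + h) - g (x + h))\<^sup>2)
       + 4 * (LBINT x. indicator J x * (a x - g x)\<^sup>2) + 2 * (LBINT x. indicator J' x * \<eta>\<^sup>2)"
      using ag ag' J' by simp
    also have "(LBINT x. indicator J' x * \<eta>\<^sup>2) = (2 * R' + 2) * \<eta>\<^sup>2"
      using R' by (simp add: J'_def)
    also have "\<dots> = e / 10" using R' by (simp add: \<eta> field_simps)
    finally have "(LBINT x. (a (x + h) - a x)\<^sup>2) < e" using I0 I1 e by simp
    moreover have "0 \<le> (LBINT x. (a (x + h) - a x)\<^sup>2)" by simp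
    ultimately show ?thesis by simp
  qed
  moreover have "eventually (\<lambda>h. \<bar>h\<bar> < d \<and> \<bar>h\<bar> < 1) (at (0::real))"
    using d(1) by (auto simp: eventually_at intro!: exI[of _ "min d 1"])
  ultimately show "\<forall>\<^sub>F h in at 0. dist (LBINT x. (a (x + h) - a x)\<^sup>2) 0 < e"
    by (auto elim: eventually_mono)
qed

section \<open>Primitives of square integrable functions, Cauchy-Schwarz, integration by
  parts\<close>

text \<open>The profiles of travelling waves: absolutely continuous functions with square integrable
  derivative that vanish far to the left. To the right of the support of a they are constant,
  possibly nonzero.\<close>

definition AC2 :: "(real \<Rightarrow> real) \<Rightarrow> (real \<Rightarrow> real) \<Rightarrow> bool" where
  "AC2 A a \<longleftrightarrow> a \<in> borel_measurable borel \<and> integrable lborel (\<lambda>x. (a x)\<^sup>2) \<and>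
     (\<exists>R. \<forall>x. R < \<bar>x\<bar> \<longrightarrow> a x = 0) \<and> (\<forall>x. A x = (LBINT y:{..x}. a y))"

lemma integrable_L2_support:
  fixes a :: "real \<Rightarrow> real"
  assumes [measurable]: "a \<in> borel_measurable borel" and a2: "integrable lborel (\<lambda>x. (a x)\<^sup>2)"
    and supp: "\<And>x. R < \<bar>x\<bar> \<Longrightarrow> a x = 0"
  shows "integrable lborel a"
proof (rule LINT_integrable_bound)
  have "integrable lborel (indicat_real {-R..R})" 
    by (rule integrable_bounded_support[where M=1 and a="-R" and b=R]) auto
  thus "integrable lborel (\<lambda>x. (a x)\<^sup>2 + indicator {-R..R} x)" using a2 by simp
  show "AE x in lborel. norm (a x) \<le> norm ((a x)\<^sup>2 + indicator {-R..R} x)"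
  proof (intro AE_I2)
    fix x
    show "norm (a x) \<le> norm ((a x)\<^sup>2 + indicator {-R..R} x)"
    proof (cases "\<bar>x\<bar> \<le> R")
      case True
      have "\<bar>a x\<bar> \<le> (a x)\<^sup>2 + 1" using sum_squares_bound[of "\<bar>a x\<bar>" 1] by simp
      thus ?thesis using True by (auto simp: abs_le_iff)
    qed (use supp in auto)
  qed
qed auto

lemma AC2_D:
  assumes "AC2 A a"
  shows "a \<in> borel_measurable borel" "integrable lborel (\<lambda>x. (a x)\<^sup>2)" "integrable lborel a"
    "A x = (LBINT y:{..x}. a y)"
proof -
  from assms obtain R where *: "a \<in> borel_measurable borel" "integrable lborel (\<lambda>x. (a x)\<^sup>2)"
    "\<And>x. R < \<bar>x\<bar> \<Longrightarrow> a x = 0" "A x = (LBINT y:{..x}. a y)"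
    unfolding AC2_def by blast
  from integrable_L2_support[OF *(1-3)] show "integrable lborel a" by simp
  from * show "a \<in> borel_measurable borel" "integrable lborel (\<lambda>x. (a x)\<^sup>2)" "A x = (LBINT y:{..x}. a y)"
    by blast+
qed

lemma AC2_diff: "AC2 A a \<Longrightarrow> x \<le> y \<Longrightarrow> A y - A x = (LBINT z:{x..y}. a z)"
  by (simp add: integral_atMost_diff[OF AC2_D(3)] AC2_D(4))

lemma AC2_isCont: "AC2 A a \<Longrightarrow> isCont A x"
proof -
  assume *: "AC2 A a"
  have "A = (\<lambda>x. LBINT y:{..x}. a y)" using AC2_D(4)[OF *] by (intro ext)
  thus ?thesis using isCont_integral_atMost[OF AC2_D(3)[OF *]] by simp
qed

lemma AC2_zero:
  assumes "AC2 A a" "\<And>z. z \<le> x \<Longrightarrow> a z = 0" shows "A x = 0"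
proof -
  have "(LBINT y:{..x}. a y) = (LBINT y:{..x}. 0)"
    by (rule set_lebesgue_integral_cong) (use assms in auto)
  thus ?thesis using AC2_D(4)[OF assms(1)] by simp
qed

lemma AC2_add:
  assumes "AC2 A a" "AC2 B b" shows "AC2 (\<lambda>x. A x + B x) (\<lambda>x. a x + b x)"
proof -
  note [measurable] = AC2_D(1)[OF assms(1)] AC2_D(1)[OF assms(2)]
  have "integrable lborel (\<lambda>x. (a x + b x)\<^sup>2)"
  proof (rule LINT_integrable_bound)
    show "integrable lborel (\<lambda>x. 2 * (a x)\<^sup>2 + 2 * (b x)\<^sup>2)" using AC2_D(2)[OF assms(1)] AC2_D(2)[OF assms(2)] by simp
    show "AE x in lborel. norm ((a x + b x)\<^sup>2) \<le> norm (2 * (a x)\<^sup>2 + 2 * (b x)\<^sup>2)"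
      using sum_sq_le by (intro AE_I2) (auto intro: order_trans)
  qed auto
  moreover obtain R1 where "\<forall>x. R1 < \<bar>x\<bar> \<longrightarrow> a x = 0" using assms(1) by (auto simp: AC2_def)
  moreover obtain R2 where "\<forall>x. R2 < \<bar>x\<bar> \<longrightarrow> b x = 0" using assms(2) by (auto simp: AC2_def)
  moreover have "A x + B x = (LBINT y:{..x}. a y + b y)" for x
    using AC2_D(3,4)[OF assms(1)] AC2_D(3,4)[OF assms(2)]
    by (subst set_integral_add(2)) (auto intro!: set_integrable_if_integrable)
  ultimately show ?thesis unfolding AC2_def
    by (intro conjI) (auto intro!: exI[of _ "max R1 R2"])
qed

lemma AC2_scale:
  assumes "AC2 A a" shows "AC2 (\<lambda>x. c * A x) (\<lambda>x. c * a x)"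
  using assms unfolding AC2_def by (auto simp: power_mult_distrib) 

lemma AC2_shift:
  assumes "AC2 A a" shows "AC2 (\<lambda>x. A (x + c)) (\<lambda>x. a (x + c))"
proof -
  note [measurable] = AC2_D(1)[OF assms]
  obtain R where R: "\<forall>x. R < \<bar>x\<bar> \<longrightarrow> a x = 0" using assms by (auto simp: AC2_def)
  have "integrable lborel (\<lambda>x. (a (x + c))\<^sup>2)"
    using lborel_integrable_real_affine[OF AC2_D(2)[OF assms], of 1 c] by (simp add: add.commute)
  moreover have "\<forall>x. R + \<bar>c\<bar> < \<bar>x\<bar> \<longrightarrow> a (x + c) = 0" using R by auto
  moreover have "A (x + c) = (LBINT y:{..x}. a (y + c))" for x
  proof -
    have "A (x + c) = (LBINT y. indicator {..x+c} y *\<^sub>R a y)" by (simp add: AC2_D(4)[OF assms] set_LINT_def)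
    also have "\<dots> = (LBINT y. indicator {..x+c} (c + 1 * y) *\<^sub>R a (c + 1 * y))"
      by (subst lborel_integral_real_affine[where c=1 and t=c]) auto
    also have "\<dots> = (LBINT y. indicator {..x} y *\<^sub>R a (y + c))"
      by (rule LINT_cong) (auto simp: indicator_def add.commute)
    finally show ?thesis by (simp add: set_LINT_def)
  qed
  ultimately show ?thesis unfolding AC2_def by auto
qed

text \<open>Cauchy-Schwarz against the constant 1, read off from the nonnegative integral of ((b -
  a) f - I)^2, where I is the integral of f.\<close>

lemma set_integral_CS:
  fixes f :: "real \<Rightarrow> real"
  assumes ab: "a \<le> b" and [measurable]: "f \<in> borel_measurable borel" and f2: "set_integrable lborel {a..b} (\<lambda>x. (f x)\<^sup>2)"
  shows "set_integrable lborel {a..b} f" "(LBINT x:{a..b}. f x)\<^sup>2 \<le> (b - a) * (LBINT x:{a..b}. (f x)\<^sup>2)"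
proof -
  have one: "set_integrable lborel {a..b} (\<lambda>x. c)" for c :: real
    unfolding set_integrable_def by (rule integrable_bounded_support[where M="\<bar>c\<bar>" and a=a and b=b]) (auto simp: indicator_def)
  show f: "set_integrable lborel {a..b} f"
    unfolding set_integrable_def
  proof (rule LINT_integrable_bound)
    show "integrable lborel (\<lambda>x. indicator {a..b} x *\<^sub>R ((f x)\<^sup>2 + 1))"
      using set_integral_add(1)[OF f2 one[of 1]] by (simp add: set_integrable_def)
    have "\<bar>f x\<bar> \<le> (f x)\<^sup>2 + 1" for x using sum_squares_bound[of "\<bar>f x\<bar>" 1] by simp
    thus "AE x in lborel. norm (indicator {a..b} x *\<^sub>R f x) \<le> norm (indicator {a..b} x *\<^sub>R ((f x)\<^sup>2 + 1))"
      by (intro AE_I2) (auto simp: indicator_def abs_le_iff)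
  qed auto
  define I where "I = (LBINT x:{a..b}. f x)"
  have "0 \<le> (LBINT x:{a..b}. ((b - a) * f x - I)\<^sup>2)" 
    unfolding set_LINT_def by (rule LINT_nonneg) auto
  also have "\<dots> = (LBINT x:{a..b}. (b - a)\<^sup>2 * (f x)\<^sup>2 - 2 * (b-a) * I * f x + I\<^sup>2)"
    by (intro set_lebesgue_integral_cong) (auto simp: power2_eq_square algebra_simps)
  also have "\<dots> = (b - a)\<^sup>2 * (LBINT x:{a..b}. (f x)\<^sup>2) - 2 * (b-a) * I * I + (b-a) * I\<^sup>2"
    using f f2 one ab by (subst set_integral_add(2), auto simp: I_def set_integral_const)
  finally have *: "(b - a) * I\<^sup>2 \<le> (b - a) * ((b - a) * (LBINT x:{a..b}. (f x)\<^sup>2))"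
    by (simp add: power2_eq_square algebra_simps)
  show "(LBINT x:{a..b}. f x)\<^sup>2 \<le> (b - a) * (LBINT x:{a..b}. (f x)\<^sup>2)"
  proof (cases "a = b")
    case True
    have "(LBINT x:{a..b}. f x) = 0" using True
      by (simp add: set_LINT_def) (rule integral_eq_zero_AE, use AE_lborel_singleton[of b] in eventually_elim, auto simp: indicator_def)
    thus ?thesis using True by simp
  next
    case False thus ?thesis using * ab by (simp add: I_def)
  qed
qed

lemma set_integrable_const_Icc: "set_integrable lborel {a..b} (\<lambda>x::real. c :: real)"
  unfolding set_integrable_def
  by (rule integrable_bounded_support[where M="\<bar>c\<bar>" and a=a and b=b]) (auto simp: indicator_def)

lemma integrable_times:
  fixes f g :: "real \<Rightarrow> real"
  assumes f: "integrable lborel f" and g: "integrable lborel g"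
  shows "integrable (lborel2) (\<lambda>(x, y). f x * g y)"
proof (rule lborel_pair.Fubini_integrable)
  have [measurable]: "f \<in> borel_measurable borel" "g \<in> borel_measurable borel" using f g by auto
  show "(\<lambda>(x, y). f x * g y) \<in> borel_measurable (lborel2)" by measurable
qed (use f g in \<open>auto simp: abs_mult\<close>)

text \<open>The two integrals on the left are those of f(x) g(y) over the triangles into which the
  diagonal cuts the square, so Fubini gives the identity for merely integrable f and g.\<close>

lemma integral_by_parts:
  fixes f g :: "real \<Rightarrow> real"
  assumes f: "set_integrable lborel {0..l} f" and g: "set_integrable lborel {0..l} g"
  shows "(LBINT x:{0..l}. f x * (LBINT y:{0..x}. g y)) + (LBINT x:{0..l}. g x * (LBINT y:{0..x}. f y))
    = (LBINT x:{0..l}. f x) * (LBINT x:{0..l}. g x)"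
    "set_integrable lborel {0..l} (\<lambda>x. f x * (LBINT y:{0..x}. g y))"
proof -
  define F where "F x = indicator {0..l} x * f x" for x
  define G where "G x = indicator {0..l} x * g x" for x
  have F: "integrable lborel F" and G: "integrable lborel G" using f g by (auto simp: F_def[abs_def] G_def[abs_def] set_integrable_def)
  note FG = integrable_times[OF F G]
  note GF = integrable_times[OF G F]
  have [measurable]: "F \<in> borel_measurable borel" "G \<in> borel_measurable borel" using F G by auto
  have FGi: "integrable (lborel2) (\<lambda>(x, y). (if y \<le> x then F x * G y else 0))"
    if F: "F \<in> borel_measurable borel" "G \<in> borel_measurable borel" 
    and FG: "integrable (lborel2) (\<lambda>(x, y). F x * G y)" for F G :: "real \<Rightarrow> real"
  proof (rule LINT_integrable_bound[OF FG])
    note [measurable] = F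
    show "(\<lambda>(x, y). if y \<le> x then F x * G y else 0) \<in> borel_measurable (lborel2)" by measurable
  qed auto
  have e1: "indicator {0..l} x *\<^sub>R (f x * (LBINT y:{0..x}. g y)) = (LBINT y. (if y \<le> x then F x * G y else 0))" for x
  proof -
    have "(LBINT y. (if y \<le> x then F x * G y else 0)) = (LBINT y. F x * (indicator {0..x} y * g y))"
      by (rule LINT_cong) (auto simp: F_def G_def indicator_def)
    thus ?thesis by (simp add: F_def set_LINT_def)
  qed
  have e2: "indicator {0..l} x *\<^sub>R (g x * (LBINT y:{0..x}. f y)) = (LBINT y. (if y \<le> x then G x * F y else 0))" for x
  proof -
    have "(LBINT y. (if y \<le> x then G x * F y else 0)) = (LBINT y. G x * (indicator {0..x} y * f y))"
      by (rule LINT_cong) (auto simp: F_def G_def indicator_def)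
    thus ?thesis by (simp add: G_def set_LINT_def)
  qed
  from lborel_pair.integrable_fst'[OF FGi[OF _ _ FG]]
  show int: "set_integrable lborel {0..l} (\<lambda>x. f x * (LBINT y:{0..x}. g y))"
    unfolding set_integrable_def e1 by simp
  have GFi': "integrable (lborel2) (\<lambda>(x, y). (if x \<le> y then F x * G y else 0))"
  proof -
    have "integrable (lborel2) (\<lambda>(x, y). (\<lambda>(x, y). if y \<le> x then G x * F y else 0) (y, x))"
      by (rule lborel_pair.integrable_product_swap, rule FGi[OF _ _ GF]) auto
    moreover have "(\<lambda>(x, y). (\<lambda>(x, y). if y \<le> x then G x * F y else 0) (y, x)) = (\<lambda>(x, y). if x \<le> y then F x * G y else 0)"
      by (auto simp: fun_eq_iff)
    ultimately show ?thesis by simp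
  qed
  have "(LBINT x:{0..l}. g x * (LBINT y:{0..x}. f y)) = (LBINT x. (LBINT y. (if y \<le> x then G x * F y else 0)))"
    unfolding set_LINT_def[of _ "{0..l}"] e2 by simp
  also have "\<dots> = (LBINT y. (LBINT x. (if y \<le> x then G x * F y else 0)))"
    using lborel_pair.Fubini_integral[OF FGi[OF _ _ GF]] by simp
  finally have s2: "(LBINT x:{0..l}. g x * (LBINT y:{0..x}. f y)) = (LBINT x. (LBINT y. (if x \<le> y then F x * G y else 0)))"
    unfolding mult.commute[of "F x" "G y" for x y] .
  have s1: "(LBINT x:{0..l}. f x * (LBINT y:{0..x}. g y)) = (LBINT x. (LBINT y. (if y \<le> x then F x * G y else 0)))"
    unfolding set_LINT_def[of _ "{0..l}"] e1 by simp
  have "(LBINT x. (LBINT y. (if y \<le> x then F x * G y else 0))) + (LBINT x. (LBINT y. (if x \<le> y then F x * G y else 0)))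
    = (LBINT x. (LBINT y. (if y \<le> x then F x * G y else 0)) + (LBINT y. (if x \<le> y then F x * G y else 0)))"
    using lborel_pair.integrable_fst'[OF FGi[OF _ _ FG]] lborel_pair.integrable_fst'[OF GFi'] by simp
  also have "\<dots> = (LBINT x. (LBINT y. F x * G y))"
  proof (rule LINT_cong)
    fix x
    have i1: "integrable lborel (\<lambda>y. if y \<le> x then F x * G y else 0)"
      by (rule LINT_integrable_bound[where f="\<lambda>y. F x * G y"]) (use G in simp_all)
    have i2: "integrable lborel (\<lambda>y. if x \<le> y then F x * G y else 0)"
      by (rule LINT_integrable_bound[where f="\<lambda>y. F x * G y"]) (use G in simp_all)
    have "(LBINT y. (if y \<le> x then F x * G y else 0)) + (LBINT y. (if x \<le> y then F x * G y else 0)) =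
      (LBINT y. (if y \<le> x then F x * G y else 0) + (if x \<le> y then F x * G y else 0))"
      using i1 i2 by simp
    also have "\<dots> = (LBINT y. F x * G y)"
    proof (rule integral_cong_AE)
      show "AE y in lborel. (if y \<le> x then F x * G y else 0) + (if x \<le> y then F x * G y else 0) = F x * G y"
        using AE_lborel_singleton[of x] by eventually_elim auto
    qed auto
    finally show "(LBINT y. (if y \<le> x then F x * G y else 0)) + (LBINT y. (if x \<le> y then F x * G y else 0)) = (LBINT y. F x * G y)" .
  qed simp
  also have "\<dots> = (LBINT x:{0..l}. f x) * (LBINT x:{0..l}. g x)"
    by (simp add: set_LINT_def F_def G_def)
  finally show "(LBINT x:{0..l}. f x * (LBINT y:{0..x}. g y)) + (LBINT x:{0..l}. g x * (LBINT y:{0..x}. f y))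
    = (LBINT x:{0..l}. f x) * (LBINT x:{0..l}. g x)" using s1 s2 by simp
qed

section \<open>Weak derivatives\<close>

text \<open>The definitions of the problem integrate over open intervals with respect to Lebesgue
  measure, the constructions work with Borel functions on closed intervals. This lemma and the next
  pass between the two.\<close>

lemma set_integral_lebesgue_eq_lborel:
  fixes f :: "real \<Rightarrow> real"
  assumes "f \<in> borel_measurable borel"
  shows "(LINT x:{0<..<l}|lebesgue. f x) = (LBINT x:{0..l}. f x)"
proof -
  have "(LINT x:{0<..<l}|lebesgue. f x) = (LBINT x:{0<..<l}. f x)"
    unfolding set_LINT_def using assms by (subst integral_completion) auto
  also have "\<dots> = (LBINT x:{0..l}. f x)"
    by (rule set_integral_discrete_difference[where X="{0,l}"]) auto
  finally show ?thesis .
qed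

lemma set_integrable_lebesgue_eq_lborel:
  fixes f :: "real \<Rightarrow> real"
  assumes "f \<in> borel_measurable borel"
  shows "set_integrable lebesgue {0<..<l} f \<longleftrightarrow> set_integrable lborel {0..l} f"
proof -
  have "set_integrable lebesgue {0<..<l} f = set_integrable lborel {0<..<l} f"
    unfolding set_integrable_def using assms by (subst integrable_completion) auto
  also have "\<dots> = set_integrable lborel {0..l} f"
    by (rule set_integrable_discrete_difference[where X="{0,l}"]) auto
  finally show ?thesis .
qed

lemma set_borel_measurable_rep:
  fixes g :: "real \<Rightarrow> real"
  assumes "set_borel_measurable lebesgue {0<..<l} g"
  shows "\<exists>g'. g' \<in> borel_measurable borel \<and> (AE x in lebesgue. x \<in> {0<..<l} \<longrightarrow> g x = g' x)"
proof -
  have "(\<lambda>x. indicator {0<..<l} x *\<^sub>R g x) \<in> borel_measurable lebesgue"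
    using assms by (simp add: set_borel_measurable_def)
  from completion_ex_borel_measurable_real[OF this]
  obtain h where h: "h \<in> borel_measurable lborel" "AE x in lborel. indicator {0<..<l} x *\<^sub>R g x = h x" by blast
  have "AE x in lebesgue. x \<in> {0<..<l} \<longrightarrow> g x = h x"
    using AE_completion[OF h(2)] by eventually_elim (auto simp: indicator_def)
  thus ?thesis using h by auto
qed

lemma set_integral_cong_AE_lebesgue:
  fixes f g :: "real \<Rightarrow> real"
  assumes "set_borel_measurable lebesgue S f" "set_borel_measurable lebesgue S g"
    "AE x in lebesgue. x \<in> S \<longrightarrow> f x = g x"
  shows "(LINT x:S|lebesgue. f x) = (LINT x:S|lebesgue. g x)"
    "set_integrable lebesgue S f \<longleftrightarrow> set_integrable lebesgue S g"
proof -
  have ae: "AE x in lebesgue. indicator S x *\<^sub>R f x = indicator S x *\<^sub>R g x"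
    using assms(3) by eventually_elim (auto simp: indicator_def)
  show "(LINT x:S|lebesgue. f x) = (LINT x:S|lebesgue. g x)"
    unfolding set_LINT_def
    by (rule integral_cong_AE) (use assms ae in \<open>auto simp: set_borel_measurable_def\<close>)
  show "set_integrable lebesgue S f \<longleftrightarrow> set_integrable lebesgue S g"
    unfolding set_integrable_def
    by (rule integrable_cong_AE) (use assms ae in \<open>auto simp: set_borel_measurable_def\<close>)
qed

lemma set_borel_measurable_mult:
  fixes f g :: "real \<Rightarrow> real"
  assumes "set_borel_measurable M S f" "set_borel_measurable M S g"
  shows "set_borel_measurable M S (\<lambda>x. f x * g x)"
proof -
  have "(\<lambda>x. indicator S x *\<^sub>R (f x * g x)) = (\<lambda>x. (indicator S x *\<^sub>R f x) * (indicator S x *\<^sub>R g x))"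
    by (auto simp: indicator_def)
  thus ?thesis using assms unfolding set_borel_measurable_def by simp
qed

lemma set_borel_measurable_add:
  fixes f g :: "real \<Rightarrow> real"
  assumes "set_borel_measurable M S f" "set_borel_measurable M S g"
  shows "set_borel_measurable M S (\<lambda>x. f x + g x)"
proof -
  have "(\<lambda>x. indicator S x *\<^sub>R (f x + g x)) = (\<lambda>x. (indicator S x *\<^sub>R f x) + (indicator S x *\<^sub>R g x))"
    by (auto simp: indicator_def)
  thus ?thesis using assms unfolding set_borel_measurable_def by simp
qed

lemma borel_imp_set_borel_measurable_lebesgue:
  fixes f :: "real \<Rightarrow> real"
  shows "f \<in> borel_measurable borel \<Longrightarrow> set_borel_measurable lebesgue {0<..<l::real} f"
  unfolding set_borel_measurable_def by (rule measurable_completion) simp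

lemma continuous_imp_set_borel_measurable_lebesgue:
  fixes f :: "real \<Rightarrow> real"
  assumes "continuous_on {0..l} f" shows "set_borel_measurable lebesgue {0<..<l} f"
proof -
  have "set_borel_measurable borel {0<..<l} f"
    by (rule set_measurable_continuous_on) (auto intro: continuous_on_subset[OF assms])
  thus ?thesis unfolding set_borel_measurable_def using measurable_completion[of _ lborel] by simp
qed

lemma continuous_on_integral_atMost:
  fixes f :: "real \<Rightarrow> real"
  shows "integrable lborel f \<Longrightarrow> continuous_on S (\<lambda>b. LBINT x:{..b}. f x)"
  by (intro continuous_at_imp_continuous_on ballI isCont_integral_atMost)

section \<open>Absolutely continuous representatives of H^1 functions\<close>

text \<open>Absolute continuity on [0,l] with a Borel derivative. For l > 0, continuous f and
  integrable Borel g it is equivalent to \<open>weak_deriv\<close>, and it is the form used for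
  computation.\<close>

definition prim :: "real \<Rightarrow> (real \<Rightarrow> real) \<Rightarrow> (real \<Rightarrow> real) \<Rightarrow> bool" where
  "prim l f g \<longleftrightarrow> g \<in> borel_measurable borel \<and> set_integrable lborel {0..l} g \<and>
     (\<forall>x\<in>{0..l}. f x = f 0 + (LBINT y:{0..x}. g y))"

lemma isCont_integral_Icc:
  assumes "set_integrable lborel {0..l::real} (g :: real \<Rightarrow> real)"
  shows "continuous_on {0..l} (\<lambda>x. LBINT y:{0..x}. g y)"
proof -
  define G where "G x = indicator {0..l} x * g x" for x
  have G: "integrable lborel G" using assms by (auto simp: G_def[abs_def] set_integrable_def)
  have "continuous_on {0..l} (\<lambda>x. LBINT y:{..x}. G y)"
    by (rule continuous_on_integral_atMost[OF G])
  thus ?thesis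
  proof (rule continuous_on_eq)
    fix x assume "x \<in> {0..l}"
    thus "(LBINT y:{..x}. G y) = (LBINT y:{0..x}. g y)"
      unfolding set_LINT_def
      by (intro LINT_cong) (auto simp: G_def indicator_def)
  qed
qed

lemma prim_continuous_on: "prim l f g \<Longrightarrow> continuous_on {0..l} f"
  unfolding prim_def
  by (rule continuous_on_eq[where f="\<lambda>x. f 0 + (LBINT y:{0..x}. g y)"],
      intro continuous_on_add continuous_on_const isCont_integral_Icc) metis+

lemma prim_imp_weak_deriv:
  assumes p: "prim l f g" and l: "l > 0" shows "weak_deriv l f g"
  unfolding weak_deriv_def
proof (intro allI impI)
  fix \<psi> \<psi>' assume d: "\<forall>x. (\<psi> has_real_derivative \<psi>' x) (at x)" and c: "continuous_on UNIV \<psi>'"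
    and s: "\<exists>a b. 0 < a \<and> b < l \<and> (\<forall>x. x \<notin> {a..b} \<longrightarrow> \<psi> x = 0)"
  from s have z: "\<psi> 0 = 0" "\<psi> l = 0" by auto
  have [measurable]: "\<psi>' \<in> borel_measurable borel" using c by (rule borel_measurable_continuous_onI)
  have cp: "continuous_on UNIV \<psi>" using d by (auto intro!: continuous_at_imp_continuous_on DERIV_isCont)
  hence [measurable]: "\<psi> \<in> borel_measurable borel" by (rule borel_measurable_continuous_onI)
  have [measurable]: "g \<in> borel_measurable borel" and gi: "set_integrable lborel {0..l} g" using p by (auto simp: prim_def)
  have \<psi>: "(LBINT y:{0..x}. \<psi>' y) = \<psi> x" if "x \<ge> 0" for x
    using that by (subst set_integral_FTC) (use d c z in \<open>auto intro: continuous_on_subset\<close>)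
  have \<psi>'i: "set_integrable lborel {0..l} \<psi>'" by (rule borel_integrable_atLeastAtMost') (use c in \<open>auto intro: continuous_on_subset\<close>)
  define G where "G x = indicator {0..l} x * g x" for x
  have G: "integrable lborel G" using gi by (auto simp: G_def[abs_def] set_integrable_def)
  \<comment> \<open>Nothing is known about f outside [0,l]; \<open>F\<close> agrees with f there and
    is continuous, hence Borel, on the whole line.\<close>
  define F where "F x = f 0 + (LBINT y:{..x}. G y)" for x
  have F: "F x = f 0 + (LBINT y:{0..x}. g y)" if "x \<in> {0..l}" for x
    unfolding F_def set_LINT_def using that
    by (intro arg_cong2[where f="(+)"] refl LINT_cong) (auto simp: G_def indicator_def)
  have Fc: "continuous_on UNIV F" unfolding F_def
    by (intro continuous_on_add continuous_on_const continuous_on_integral_atMost G)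
  hence [measurable]: "F \<in> borel_measurable borel" by (rule borel_measurable_continuous_onI)
  have fF: "f x = F x" if "x \<in> {0..l}" for x using F[OF that] that p unfolding prim_def by metis
  have "(LINT x:{0<..<l}|lebesgue. f x * \<psi>' x) = (LINT x:{0<..<l}|lebesgue. F x * \<psi>' x)"
    by (rule set_lebesgue_integral_cong) (use fF in auto)
  also have "\<dots> = (LBINT x:{0..l}. F x * \<psi>' x)" by (rule set_integral_lebesgue_eq_lborel) auto
  also have "\<dots> = (LBINT x:{0..l}. f 0 * \<psi>' x + \<psi>' x * (LBINT y:{0..x}. g y))"
    by (rule set_lebesgue_integral_cong) (use F in \<open>auto simp: algebra_simps\<close>)
  also have "\<dots> = f 0 * (LBINT x:{0..l}. \<psi>' x) + (LBINT x:{0..l}. \<psi>' x * (LBINT y:{0..x}. g y))"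
    using \<psi>'i integral_by_parts(2)[OF \<psi>'i gi] by simp
  also have "\<dots> = - (LBINT x:{0..l}. g x * (LBINT y:{0..x}. \<psi>' y))"
    using integral_by_parts(1)[OF \<psi>'i gi] \<psi>[of l] l z by simp
  also have "(LBINT x:{0..l}. g x * (LBINT y:{0..x}. \<psi>' y)) = (LBINT x:{0..l}. g x * \<psi> x)"
    by (rule set_lebesgue_integral_cong) (use \<psi> in auto)
  also have "\<dots> = (LINT x:{0<..<l}|lebesgue. g x * \<psi> x)" by (rule set_integral_lebesgue_eq_lborel[symmetric]) auto
  finally show "(LINT x:{0<..<l}|lebesgue. f x * \<psi>' x) = - (LINT x:{0<..<l}|lebesgue. g x * \<psi> x)" .
qed

text \<open>The lemma of du Bois-Reymond. The difference D of f and the primitive of g has weak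
  derivative zero. Testing with a primitive of \<kappa> (D - c) turns this into a vanishing integral
  of \<kappa> (D - c)^2. That primitive is admissible because test functions need only be
  C^1.\<close>

lemma weak_deriv_imp_prim:
  assumes l: "l > 0" and fc: "continuous_on {0..l} f" and g[measurable]: "g \<in> borel_measurable borel"
    and gi: "set_integrable lborel {0..l} g" and w: "weak_deriv l f g"
  shows "prim l f g"
proof -
  define G where "G x = indicator {0..l} x * g x" for x
  have G: "integrable lborel G" using gi by (auto simp: G_def[abs_def] set_integrable_def)
  define P where "P x = (LBINT y:{..x}. G y)" for x
  have P: "P x = (LBINT y:{0..x}. g y)" if "x \<in> {0..l}" for x
    unfolding P_def set_LINT_def using that
    by (intro LINT_cong) (auto simp: G_def indicator_def)
  have Pc: "continuous_on UNIV P" unfolding P_def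
    by (rule continuous_on_integral_atMost[OF G])
  define F where "F x = f (max 0 (min l x))" for x
  have Fc: "continuous_on UNIV F" unfolding F_def
    by (rule continuous_on_compose2[OF fc]) (use l in \<open>auto intro!: continuous_intros\<close>)
  have F: "F x = f x" if "x \<in> {0..l}" for x using that by (auto simp: F_def)
  define D where "D x = F x - P x" for x
  have Dc: "continuous_on UNIV D" unfolding D_def by (intro continuous_intros Fc Pc)
  have [measurable]: "F \<in> borel_measurable borel" "D \<in> borel_measurable borel" "P \<in> borel_measurable borel"
    using Fc Dc Pc by (auto intro: borel_measurable_continuous_onI)
  have const: "D x = D y" if xy: "0 < x" "x < y" "y < l" for x y
  proof -
    \<comment> \<open>Any interval compactly inside (0,l) with x and y in its interior would serve;
      \<kappa> is a bump that is positive inside it and zero outside.\<close>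
    define a where "a = x / 2"
    define b where "b = (y + l) / 2"
    have ab: "0 < a" "a < x" "y < b" "b < l" "a < b" using xy by (auto simp: a_def b_def)
    define \<kappa> where "\<kappa> t = max 0 ((t - a) * (b - t))" for t
    have \<kappa>c: "continuous_on UNIV \<kappa>" unfolding \<kappa>_def by (intro continuous_intros)
    have \<kappa>0: "\<kappa> t = 0" if "t \<notin> {a..b}" for t
      using that ab by (auto simp: \<kappa>_def mult_le_0_iff intro!: max_absorb1)
    have \<kappa>n: "\<kappa> t \<ge> 0" for t by (simp add: \<kappa>_def)
    have \<kappa>p: "\<kappa> t > 0" if "a < t" "t < b" for t using that by (auto simp: \<kappa>_def less_max_iff_disj)
    have int: "integrable lborel (\<lambda>t. \<kappa> t * h t)" if h: "continuous_on UNIV h" for h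
    proof -
      have "set_integrable lborel {a..b} (\<lambda>t. \<kappa> t * h t)"
        by (rule borel_integrable_atLeastAtMost') (auto intro!: continuous_intros continuous_on_subset[OF h] continuous_on_subset[OF \<kappa>c])
      moreover have "(\<lambda>t. indicator {a..b} t *\<^sub>R (\<kappa> t * h t)) = (\<lambda>t. \<kappa> t * h t)"
      proof
        fix t show "indicator {a..b} t *\<^sub>R (\<kappa> t * h t) = \<kappa> t * h t" by (cases "t \<in> {a..b}") (use \<kappa>0 in auto)
      qed
      ultimately show ?thesis by (simp add: set_integrable_def)
    qed
    have i1: "integrable lborel \<kappa>" using int[of "\<lambda>_. 1"] by simp
    have zero: "\<kappa> t * (h t)\<^sup>2 = 0" if h: "continuous_on UNIV h" and z: "(LBINT t. \<kappa> t * (h t)\<^sup>2) = 0" for h t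
    proof (cases "t \<in> {a..b}")
      case True
      have i: "integrable lborel (\<lambda>t. \<kappa> t * (h t)\<^sup>2)" by (rule int) (intro continuous_intros h)
      have "(\<lambda>t. indicator {a..b} t *\<^sub>R (\<kappa> t * (h t)\<^sup>2)) = (\<lambda>t. \<kappa> t * (h t)\<^sup>2)"
      proof
        fix t show "indicator {a..b} t *\<^sub>R (\<kappa> t * (h t)\<^sup>2) = \<kappa> t * (h t)\<^sup>2" by (cases "t \<in> {a..b}") (use \<kappa>0 in auto)
      qed
      hence "(LBINT t:{a..b}. \<kappa> t * (h t)\<^sup>2) = 0" using z by (simp add: set_LINT_def)
      moreover have "set_integrable lborel {a..b} (\<lambda>t. \<kappa> t * (h t)\<^sup>2)" using i by (intro set_integrable_if_integrable) auto
      ultimately have "((\<lambda>t. \<kappa> t * (h t)\<^sup>2) has_integral 0) {a..b}"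
        using set_borel_integral_eq_integral by (metis has_integral_integral)
      moreover have "continuous_on {a..b} (\<lambda>t. \<kappa> t * (h t)\<^sup>2)"
        by (intro continuous_intros continuous_on_subset[OF h] continuous_on_subset[OF \<kappa>c]) auto
      ultimately show ?thesis
        using has_integral_0_cbox_imp_0[of a b "\<lambda>t. \<kappa> t * (h t)\<^sup>2" t] \<kappa>n True ab by auto
    qed (simp add: \<kappa>0)
    define S where "S = (LBINT t. \<kappa> t)"
    have "S \<noteq> 0"
    proof
      assume "S = 0"
      with zero[of "\<lambda>_. 1" x] \<kappa>p[of x] ab xy show False by (simp add: S_def)
    qed
    \<comment> \<open>The weighted mean of D: it makes m integrate to zero, so that the primitive
      \<psi> of m vanishes again to the right of b.\<close>
    define c where "c = (LBINT t. \<kappa> t * D t) / S"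
    define m where "m t = \<kappa> t * (D t - c)" for t
    have mi: "integrable lborel m" unfolding m_def by (rule int) (intro continuous_intros Dc)
    have mc: "continuous_on UNIV m" unfolding m_def by (intro continuous_intros Dc \<kappa>c)
    have [measurable]: "m \<in> borel_measurable borel" using mc by (rule borel_measurable_continuous_onI)
    have m0: "(LBINT t. m t) = 0"
    proof -
      have "(LBINT t. m t) = (LBINT t. \<kappa> t * D t - c * \<kappa> t)" by (simp add: m_def algebra_simps)
      also have "\<dots> = (LBINT t. \<kappa> t * D t) - c * S" using int[OF Dc] i1 by (simp add: S_def)
      finally show ?thesis using \<open>S \<noteq> 0\<close> by (simp add: c_def)
    qed
    define \<psi> where "\<psi> x = (LBINT t:{..x}. m t)" for x
    have d\<psi>: "(\<psi> has_real_derivative m x) (at x)" for x unfolding \<psi>_def by (rule DERIV_integral_atMost[OF mi mc])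
    have s\<psi>: "\<psi> x = 0" if "x \<notin> {a..b}" for x
    proof (cases "x < a")
      case True
      have "\<psi> x = (LBINT t:{..x}. 0)" unfolding \<psi>_def
        by (rule set_lebesgue_integral_cong) (use True \<kappa>0 in \<open>auto simp: m_def\<close>)
      thus ?thesis by simp
    next
      case False
      hence "x > b" using that by auto
      have "\<psi> x = (LBINT t. m t)" unfolding \<psi>_def set_LINT_def
        by (rule LINT_cong) (use \<open>x > b\<close> \<kappa>0 in \<open>auto simp: m_def indicator_def\<close>)
      thus ?thesis using m0 by simp
    qed
    have c\<psi>: "continuous_on UNIV \<psi>" using d\<psi> by (auto intro!: continuous_at_imp_continuous_on DERIV_isCont)
    hence [measurable]: "\<psi> \<in> borel_measurable borel" by (rule borel_measurable_continuous_onI)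
    have \<psi>': "\<psi> x = (LBINT t:{0..x}. m t)" for x
      unfolding \<psi>_def set_LINT_def
      by (rule LINT_cong) (use \<kappa>0 ab in \<open>auto simp: m_def indicator_def\<close>)
    have mi': "set_integrable lborel {0..l} m" using mi by (intro set_integrable_if_integrable) auto
    have full: "(LBINT t:{0..l}. h t * m t) = (LBINT t. h t * m t)" for h
      unfolding set_LINT_def
    proof (rule LINT_cong)
      fix t show "indicator {0..l} t *\<^sub>R (h t * m t) = h t * m t"
        using \<kappa>0[of t] ab by (cases "t \<in> {0..l}") (auto simp: m_def)
    qed simp
    have "(LINT t:{0<..<l}|lebesgue. f t * m t) = - (LINT t:{0<..<l}|lebesgue. g t * \<psi> t)"
      using w[unfolded weak_deriv_def, rule_format, of \<psi> m] d\<psi> mc s\<psi> ab by blast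
    also have "(LINT t:{0<..<l}|lebesgue. f t * m t) = (LINT t:{0<..<l}|lebesgue. F t * m t)"
      by (rule set_lebesgue_integral_cong) (use F in auto)
    also have "\<dots> = (LBINT t. F t * m t)" by (subst set_integral_lebesgue_eq_lborel) (auto simp: full)
    also have "(LINT t:{0<..<l}|lebesgue. g t * \<psi> t) = (LBINT t:{0..l}. g t * \<psi> t)"
      by (rule set_integral_lebesgue_eq_lborel) auto
    also have "\<dots> = - (LBINT t:{0..l}. m t * (LBINT y:{0..t}. g y))"
      using integral_by_parts(1)[OF gi mi'] s\<psi>[of l] ab by (simp add: \<psi>'[symmetric])
    also have "(LBINT t:{0..l}. m t * (LBINT y:{0..t}. g y)) = (LBINT t:{0..l}. P t * m t)"
      by (rule set_lebesgue_integral_cong) (use P in auto)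
    also have "\<dots> = (LBINT t. P t * m t)" by (rule full)
    finally have eq: "(LBINT t. F t * m t) = (LBINT t. P t * m t)" by simp
    have iF: "integrable lborel (\<lambda>t. F t * m t)"
      using int[of "\<lambda>t. F t * (D t - c)"] Fc Dc by (simp add: m_def mult.left_commute continuous_intros)
    have iP: "integrable lborel (\<lambda>t. P t * m t)"
      using int[of "\<lambda>t. P t * (D t - c)"] Pc Dc by (simp add: m_def mult.left_commute continuous_intros)
    have "(LBINT t. \<kappa> t * (D t - c)\<^sup>2) = (LBINT t. F t * m t - P t * m t - c * m t)"
      by (rule LINT_cong) (auto simp: m_def D_def power2_eq_square algebra_simps)
    also have "\<dots> = 0" using iF iP mi eq m0 by simp
    finally have z: "\<kappa> t * (D t - c)\<^sup>2 = 0" for t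
      using zero[of "\<lambda>t. D t - c" t] Dc by (simp add: continuous_intros)
    show ?thesis using z[of x] z[of y] \<kappa>p[of x] \<kappa>p[of y] ab xy by simp
  qed
  have all: "D x = D (l/2)" if "x \<in> {0<..<l}" for x
  proof -
    consider "x = l/2" | "x < l/2" | "l/2 < x" by linarith
    thus ?thesis
    proof cases
      case 2 show ?thesis by (rule const) (use 2 that l in auto)
    next
      case 3 show ?thesis by (rule const[symmetric]) (use 3 that l in auto)
    next
      case 1 show ?thesis unfolding 1 ..
    qed
  qed
  have Dl: "D x = D (l/2)" if "x \<in> {0..l}" for x
  proof (rule continuous_constant_on_closure[where S="{0<..<l}" and f=D and a="D (l/2)"])
    show "continuous_on (closure {0<..<l}) D" using Dc continuous_on_subset by blast
    show "x \<in> closure {0<..<l}" using that l by simp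
    show "D y = D (l/2)" if "y \<in> {0<..<l}" for y by (rule all[OF that])
  qed
  have D: "D x = D 0" if "x \<in> {0..l}" for x
    by (rule trans[OF Dl[OF that] Dl[symmetric]]) (use l in simp)
  have "P 0 = 0"
  proof -
    have "P 0 = (LBINT y:{0..0}. g y)" using P l by simp
    also have "\<dots> = 0" unfolding set_LINT_def
      by (rule integral_eq_zero_AE, use AE_lborel_singleton[of 0] in eventually_elim) (auto simp: indicator_def)
    finally show ?thesis .
  qed
  hence "f x = f 0 + (LBINT y:{0..x}. g y)" if "x \<in> {0..l}" for x
  proof -
    have "F x - P x = F 0 - P 0" using D[OF that] unfolding D_def .
    moreover have "F x = f x" "F 0 = f 0" using F that l by auto
    ultimately show ?thesis using P[OF that] \<open>P 0 = 0\<close> by linarith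
  qed
  thus ?thesis unfolding prim_def using gi g by blast
qed

definition prim2 :: "real \<Rightarrow> (real \<Rightarrow> real) \<Rightarrow> (real \<Rightarrow> real) \<Rightarrow> bool" where
  "prim2 l f g \<longleftrightarrow> prim l f g \<and> set_integrable lborel {0..l} (\<lambda>x. (g x)\<^sup>2)"

lemma prim_D:
  assumes "prim l f g"
  shows "g \<in> borel_measurable borel" "set_integrable lborel {0..l} g"
    "x \<in> {0..l} \<Longrightarrow> f x = f 0 + (LBINT y:{0..x}. g y)"
  using assms unfolding prim_def by blast+

text \<open>The positive and the negative part of h are densities of finite measures that agree on
  all half-lines and hence coincide; densities are unique almost everywhere.\<close>

lemma zero_AE_if_primitive_zero:
  fixes h :: "real \<Rightarrow> real"
  assumes h: "integrable lborel h" and z: "\<And>x. (LBINT y:{x<..}. h y) = 0"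
  shows "AE x in lborel. h x = 0"
proof -
  have [measurable]: "h \<in> borel_measurable borel" using h by auto
  define p where "p x = max 0 (h x)" for x
  define m where "m x = max 0 (- h x)" for x
  have p: "integrable lborel p" and m: "integrable lborel m" unfolding p_def m_def using h by auto
  have [measurable]: "p \<in> borel_measurable borel" "m \<in> borel_measurable borel" unfolding p_def m_def by auto
  have em: "emeasure (density lborel (\<lambda>x. ennreal (f x))) {x<..} = ennreal (LBINT y:{x<..}. f y)"
    if "integrable lborel f" "\<And>x. f x \<ge> 0" for f :: "real \<Rightarrow> real" and x
  proof -
    have [measurable]: "f \<in> borel_measurable borel" using that by auto
    have "emeasure (density lborel (\<lambda>x. ennreal (f x))) {x<..} = (\<integral>\<^sup>+ y. ennreal (f y) * indicator {x<..} y \<partial>lborel)"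
      by (rule emeasure_density) auto
    also have "\<dots> = (\<integral>\<^sup>+ y. ennreal (indicator {x<..} y *\<^sub>R f y) \<partial>lborel)"
      by (rule nn_integral_cong) (auto simp: indicator_def)
    also have "\<dots> = ennreal (LBINT y:{x<..}. f y)"
      unfolding set_LINT_def
    proof (rule nn_integral_eq_integral)
      show "integrable lborel (\<lambda>y. indicator {x<..} y *\<^sub>R f y)" by (rule integrable_mult_indicator) (use that in auto)
    qed (use that in auto)
    finally show ?thesis .
  qed
  have eq: "(LBINT y:{x<..}. p y) = (LBINT y:{x<..}. m y)" for x
  proof -
    have "(LBINT y:{x<..}. h y) = (LBINT y:{x<..}. p y - m y)"
      by (rule set_lebesgue_integral_cong) (auto simp: p_def m_def)
    also have "\<dots> = (LBINT y:{x<..}. p y) - (LBINT y:{x<..}. m y)"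
      by (rule set_integral_diff(2)) (intro set_integrable_if_integrable p m, simp)+
    finally show ?thesis using z[of x] by simp
  qed
  have dens: "density lborel (\<lambda>x. ennreal (p x)) = density lborel (\<lambda>x. ennreal (m x))"
  proof (rule measure_eqI_lessThan)
    fix x
    show "emeasure (density lborel (\<lambda>x. ennreal (p x))) {x<..} < \<infinity>" by (subst em) (auto simp: p, auto simp: p_def)
    show "emeasure (density lborel (\<lambda>x. ennreal (p x))) {x<..} = emeasure (density lborel (\<lambda>x. ennreal (m x))) {x<..}"
      by (subst (1 2) em) (auto simp: p m eq, auto simp: p_def m_def)
  qed auto
  have "AE x in lborel. ennreal (p x) = ennreal (m x)"
    by (rule sigma_finite_measure.density_unique_iff[OF sigma_finite_lborel, THEN iffD1, OF _ _ dens]) auto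
  thus ?thesis
  proof eventually_elim
    case (elim x) thus ?case by (auto simp: p_def m_def max_def split: if_splits)
  qed
qed

text \<open>The difference of the two derivatives, extended by zero, has vanishing integral over
  every half-line.\<close>

lemma prim_unique_AE:
  assumes "prim l f g1" "prim l f g2"
  shows "AE x in lborel. x \<in> {0..l} \<longrightarrow> g1 x = g2 x"
proof -
  define h where "h x = indicator {0..l} x *\<^sub>R g1 x - indicator {0..l} x *\<^sub>R g2 x" for x
  have i: "set_integrable lborel {0..l} g1" "set_integrable lborel {0..l} g2" using assms by (simp_all add: prim_D)
  hence hi: "integrable lborel h"
    unfolding h_def[abs_def] set_integrable_def by (rule Bochner_Integration.integrable_diff)
  have at: "(LBINT y:{..x}. h y) = 0" if "x \<in> {0..l}" for x
  proof -
    have s: "set_integrable lborel {0..x} g1" "set_integrable lborel {0..x} g2"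
      using that by (auto intro: set_integrable_subset[OF i(1)] set_integrable_subset[OF i(2)])
    have "(LBINT y:{..x}. h y) = (LBINT y:{0..x}. g1 y - g2 y)"
      unfolding set_LINT_def using that
      by (intro LINT_cong) (auto simp: h_def indicator_def)
    also have "\<dots> = (LBINT y:{0..x}. g1 y) - (LBINT y:{0..x}. g2 y)" using s by simp
    also have "\<dots> = (f x - f 0) - (f x - f 0)"
    proof -
      have "f x = f 0 + (LBINT y:{0..x}. g1 y)" "f x = f 0 + (LBINT y:{0..x}. g2 y)"
        using assms that unfolding prim_def by blast+
      thus ?thesis by linarith
    qed
    finally show ?thesis by simp
  qed
  have tot: "(LBINT y. h y) = 0"
  proof (cases "0 \<le> l")
    case True
    have "(LBINT y. h y) = (LBINT y:{..l}. h y)"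
      unfolding set_LINT_def
      by (intro LINT_cong) (auto simp: h_def indicator_def)
    thus ?thesis using at[of l] True by simp
  qed (simp add: h_def)
  have at': "(LBINT y:{..x}. h y) = 0" for x
  proof -
    consider "x \<in> {0..l}" | "x < 0" | "x > l" by force
    thus ?thesis
    proof cases
      case 2
      have "(LBINT y:{..x}. h y) = (LBINT y:{..x}. 0)"
        by (rule set_lebesgue_integral_cong) (use 2 in \<open>auto simp: h_def\<close>)
      thus ?thesis by simp
    next
      case 3
      have "(LBINT y:{..x}. h y) = (LBINT y. h y)"
        unfolding set_LINT_def using 3
        by (intro LINT_cong) (auto simp: h_def indicator_def)
      thus ?thesis using tot by simp
    qed (rule at)
  qed
  have "AE x in lborel. h x = 0"
  proof (rule zero_AE_if_primitive_zero[OF hi])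
    fix x
    have "(LBINT y:{..x} \<union> {x<..}. h y) = (LBINT y:{..x}. h y) + (LBINT y:{x<..}. h y)"
      by (rule set_integral_Un) (auto intro!: set_integrable_if_integrable hi)
    moreover have "{..x} \<union> {x<..} = UNIV" by auto
    ultimately show "(LBINT y:{x<..}. h y) = 0" using at'[of x] tot by (simp add: set_LINT_def)
  qed
  thus ?thesis by eventually_elim (auto simp: h_def)
qed

lemma L2_space_borel_iff:
  assumes "g \<in> borel_measurable borel"
  shows "L2_space l g \<longleftrightarrow> set_integrable lborel {0..l} (\<lambda>x. (g x)\<^sup>2)"
proof -
  have "(\<lambda>x. (g x)\<^sup>2) \<in> borel_measurable borel" using assms by measurable
  from set_integrable_lebesgue_eq_lborel[OF this] borel_imp_set_borel_measurable_lebesgue[OF assms]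
  show ?thesis by (auto simp: L2_space_def)
qed

lemma L2_norm_borel:
  assumes "g \<in> borel_measurable borel"
  shows "L2_norm l g = sqrt (LBINT x:{0..l}. (g x)\<^sup>2)"
proof -
  have "(\<lambda>x. (g x)\<^sup>2) \<in> borel_measurable borel" using assms by measurable
  from set_integral_lebesgue_eq_lborel[OF this] show ?thesis by (simp add: L2_norm_def)
qed

lemma L2_norm_cong_AE:
  assumes "set_borel_measurable lebesgue {0<..<l} f" "set_borel_measurable lebesgue {0<..<l} g"
    "AE x in lebesgue. x \<in> {0<..<l} \<longrightarrow> f x = g x"
  shows "L2_norm l f = L2_norm l g"
proof -
  have "(LINT x:{0<..<l}|lebesgue. (f x)\<^sup>2) = (LINT x:{0<..<l}|lebesgue. (g x)\<^sup>2)"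
  proof (rule set_integral_cong_AE_lebesgue(1))
    show "set_borel_measurable lebesgue {0<..<l} (\<lambda>x. (f x)\<^sup>2)" "set_borel_measurable lebesgue {0<..<l} (\<lambda>x. (g x)\<^sup>2)"
      using set_borel_measurable_mult[OF assms(1) assms(1)] set_borel_measurable_mult[OF assms(2) assms(2)]
      by (simp_all add: power2_eq_square)
  qed (use assms(3) in \<open>eventually_elim, auto\<close>)
  thus ?thesis by (simp add: L2_norm_def)
qed

lemma weak_deriv_cong:
  assumes "weak_deriv l f g"
    "set_borel_measurable lebesgue {0<..<l} g" "set_borel_measurable lebesgue {0<..<l} g'"
    "AE x in lebesgue. x \<in> {0<..<l} \<longrightarrow> g x = g' x" "\<And>x. x \<in> {0<..<l} \<Longrightarrow> f x = f' x"
  shows "weak_deriv l f' g'"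
  unfolding weak_deriv_def
proof (intro allI impI)
  fix \<psi> \<psi>' assume d: "\<forall>x. (\<psi> has_real_derivative \<psi>' x) (at x)" and c: "continuous_on UNIV \<psi>'"
    and s: "\<exists>a b. 0 < a \<and> b < l \<and> (\<forall>x. x \<notin> {a..b} \<longrightarrow> \<psi> x = 0)"
  have "continuous_on {0..l} \<psi>" using d by (auto intro!: continuous_at_imp_continuous_on DERIV_isCont)
  hence m: "set_borel_measurable lebesgue {0<..<l} \<psi>" by (rule continuous_imp_set_borel_measurable_lebesgue)
  have "(LINT x:{0<..<l}|lebesgue. f' x * \<psi>' x) = (LINT x:{0<..<l}|lebesgue. f x * \<psi>' x)"
    by (rule set_lebesgue_integral_cong) (use assms(5) in auto)
  also have "\<dots> = - (LINT x:{0<..<l}|lebesgue. g x * \<psi> x)"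
    using assms(1) d c s unfolding weak_deriv_def by blast
  also have "(LINT x:{0<..<l}|lebesgue. g x * \<psi> x) = (LINT x:{0<..<l}|lebesgue. g' x * \<psi> x)"
  proof (rule set_integral_cong_AE_lebesgue(1))
    show "AE x in lebesgue. x \<in> {0<..<l} \<longrightarrow> g x * \<psi> x = g' x * \<psi> x" using assms(4) by eventually_elim auto
  qed (intro set_borel_measurable_mult assms m)+
  finally show "(LINT x:{0<..<l}|lebesgue. f' x * \<psi>' x) = - (LINT x:{0<..<l}|lebesgue. g' x * \<psi> x)" .
qed

lemma L2_space_rep:
  assumes "L2_space l g"
  shows "\<exists>g'. g' \<in> borel_measurable borel \<and> set_integrable lborel {0..l} (\<lambda>x. (g' x)\<^sup>2) \<and>
    (AE x in lebesgue. x \<in> {0<..<l} \<longrightarrow> g x = g' x)"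
proof -
  have m: "set_borel_measurable lebesgue {0<..<l} g" and i: "set_integrable lebesgue {0<..<l} (\<lambda>x. (g x)\<^sup>2)"
    using assms by (auto simp: L2_space_def)
  from set_borel_measurable_rep[OF m] obtain g' where g': "g' \<in> borel_measurable borel"
    and ae: "AE x in lebesgue. x \<in> {0<..<l} \<longrightarrow> g x = g' x" by blast
  note m' = borel_imp_set_borel_measurable_lebesgue[OF g', of l]
  have "set_integrable lebesgue {0<..<l} (\<lambda>x. (g' x)\<^sup>2)"
  proof (subst set_integral_cong_AE_lebesgue(2)[where g="\<lambda>x. (g x)\<^sup>2"])
    show "set_borel_measurable lebesgue {0<..<l} (\<lambda>x. (g' x)\<^sup>2)" "set_borel_measurable lebesgue {0<..<l} (\<lambda>x. (g x)\<^sup>2)"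
      using set_borel_measurable_mult[OF m m] set_borel_measurable_mult[OF m' m'] by (simp_all add: power2_eq_square)
    show "AE x in lebesgue. x \<in> {0<..<l} \<longrightarrow> (g' x)\<^sup>2 = (g x)\<^sup>2" using ae by eventually_elim auto
  qed (rule i)
  moreover have "(\<lambda>x. (g' x)\<^sup>2) \<in> borel_measurable borel" using g' by measurable
  ultimately show ?thesis using g' ae set_integrable_lebesgue_eq_lborel by blast
qed

lemma set_integrable_if_square:
  fixes f :: "real \<Rightarrow> real"
  assumes "f \<in> borel_measurable borel" "set_integrable lborel {a..b} (\<lambda>x. (f x)\<^sup>2)"
  shows "set_integrable lborel {a..b} f"
proof (cases "a \<le> b")
  case True thus ?thesis using set_integral_CS(1) assms by blast
qed (simp add: set_integrable_def)

lemma H1_space_D: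
  assumes l: "l > 0" and H: "H1_space l f"
  shows "\<exists>g. prim2 l f g \<and> (AE x in lebesgue. x \<in> {0<..<l} \<longrightarrow> wderiv l f x = g x)"
    "L2_space l (wderiv l f)" "weak_deriv l f (wderiv l f)"
proof -
  have "\<exists>g. L2_space l g \<and> weak_deriv l f g" using H by (auto simp: H1_space_def)
  from someI_ex[OF this] show w: "L2_space l (wderiv l f)" "weak_deriv l f (wderiv l f)" by (auto simp: wderiv_def)
  from L2_space_rep[OF w(1)] obtain g where g: "g \<in> borel_measurable borel" "set_integrable lborel {0..l} (\<lambda>x. (g x)\<^sup>2)"
    "AE x in lebesgue. x \<in> {0<..<l} \<longrightarrow> wderiv l f x = g x" by blast
  have "weak_deriv l f g"
    by (rule weak_deriv_cong[OF w(2) _ _ g(3)])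
       (use w(1) g(1) in \<open>auto simp: L2_space_def intro: borel_imp_set_borel_measurable_lebesgue\<close>)
  hence "prim l f g" using weak_deriv_imp_prim[OF l _ g(1)] H set_integrable_if_square[OF g(1,2)] by (auto simp: H1_space_def)
  thus "\<exists>g. prim2 l f g \<and> (AE x in lebesgue. x \<in> {0<..<l} \<longrightarrow> wderiv l f x = g x)"
    using g by (auto simp: prim2_def)
qed

text \<open>Removes the choice in \<open>wderiv\<close>: it agrees almost everywhere with whatever
  Borel derivative is at hand.\<close>

lemma prim2_H1:
  assumes l: "l > 0" and p: "prim2 l f g"
  shows "H1_space l f" "AE x in lebesgue. x \<in> {0<..<l} \<longrightarrow> wderiv l f x = g x"
    "(L2_norm l (wderiv l f))\<^sup>2 = (LBINT x:{0..l}. (g x)\<^sup>2)"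
proof -
  have pp: "prim l f g" and g: "g \<in> borel_measurable borel" "set_integrable lborel {0..l} (\<lambda>x. (g x)\<^sup>2)"
    using p prim_D(1) unfolding prim2_def by blast+
  show H: "H1_space l f" unfolding H1_space_def
    using prim_continuous_on[OF pp] prim_imp_weak_deriv[OF pp l] L2_space_borel_iff[OF g(1)] g(2) by blast
  from H1_space_D(1)[OF l H] obtain g' where g': "prim2 l f g'" "AE x in lebesgue. x \<in> {0<..<l} \<longrightarrow> wderiv l f x = g' x" by blast
  have "AE x in lborel. x \<in> {0..l} \<longrightarrow> g' x = g x"
    by (rule prim_unique_AE[OF _ pp]) (use g' in \<open>auto simp: prim2_def\<close>)
  hence "AE x in lebesgue. x \<in> {0..l} \<longrightarrow> g' x = g x" by (rule AE_completion)
  with g'(2) show ae: "AE x in lebesgue. x \<in> {0<..<l} \<longrightarrow> wderiv l f x = g x"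
    by eventually_elim auto
  have "L2_norm l (wderiv l f) = L2_norm l g"
    by (rule L2_norm_cong_AE[OF _ _ ae])
       (use H1_space_D(2)[OF l H] g(1) in \<open>auto simp: L2_space_def intro: borel_imp_set_borel_measurable_lebesgue\<close>)
  thus "(L2_norm l (wderiv l f))\<^sup>2 = (LBINT x:{0..l}. (g x)\<^sup>2)"
    by (simp add: L2_norm_borel[OF g(1)] set_LINT_def)
qed

section \<open>Goursat integrals\<close>

lemma fst_snd_borel_measurable [measurable]:
  "fst \<in> borel_measurable (borel :: (real \<times> real) measure)" "snd \<in> borel_measurable (borel :: (real \<times> real) measure)"
  by (intro borel_measurable_continuous_onI continuous_intros)+

text \<open>\<open>gours H\<close> solves \<open>u\<^sub>a\<^sub>b = H\<close> with zero data on the axes if \<open>H\<close> lives on the first quadrant.\<close>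

definition gours :: "(real \<times> real \<Rightarrow> real) \<Rightarrow> real \<Rightarrow> real \<Rightarrow> real" where
  "gours H a b = (LBINT x:{..a}. (LBINT y:{..b}. H (x, y)))"

text \<open>The derivative of \<open>gours H\<close> in its first variable; the one in the second
  variable is \<open>row (flip H) b a\<close>. See \<open>gours_has_derivative\<close>.\<close>

definition row :: "(real \<times> real \<Rightarrow> real) \<Rightarrow> real \<Rightarrow> real \<Rightarrow> real" where
  "row H a b = (LBINT y:{..b}. H (a, y))"

definition bsrc :: "real \<Rightarrow> real \<Rightarrow> (real \<times> real \<Rightarrow> real) \<Rightarrow> bool" where
  "bsrc R M H \<longleftrightarrow> H \<in> borel_measurable borel \<and> 0 \<le> R \<and> 0 \<le> M \<and> (\<forall>z. \<bar>H z\<bar> \<le> M) \<and>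
     (\<forall>a b. \<not> (0 \<le> a \<and> a \<le> R \<and> 0 \<le> b \<and> b \<le> R) \<longrightarrow> H (a, b) = 0)"

lemma bsrc_D:
  assumes "bsrc R M H"
  shows "H \<in> borel_measurable borel" "0 \<le> R" "0 \<le> M" "\<bar>H z\<bar> \<le> M"
    "\<not> (0 \<le> a \<and> a \<le> R \<and> 0 \<le> b \<and> b \<le> R) \<Longrightarrow> H (a, b) = 0"
  using assms unfolding bsrc_def by blast+

abbreviation flip :: "(real \<times> real \<Rightarrow> real) \<Rightarrow> real \<times> real \<Rightarrow> real" where
  "flip H \<equiv> \<lambda>z. H (prod.swap z)"

lemma bsrc_swap:
  assumes H: "bsrc R M H" shows "bsrc R M (flip H)"
proof -
  note [measurable] = bsrc_D(1)[OF H]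
  have "(\<lambda>z. H (snd z, fst z)) \<in> borel_measurable borel" by measurable
  thus ?thesis using H unfolding bsrc_def by (auto simp: prod.swap_def)
qed

lemma bsrc_integrable:
  assumes H: "bsrc R M H"
  shows "integrable lborel (\<lambda>y. H (a, y))" "integrable (lborel2) H"
proof -
  note [measurable] = bsrc_D(1)[OF H]
  show "integrable lborel (\<lambda>y. H (a, y))"
    by (rule integrable_bounded_support[where M=M and a=0 and b=R]) (use bsrc_D[OF H] in auto)
  show "integrable (lborel2) H"
    by (rule integrable_bounded_support_plane[where M=M and a=0 and b=R and c=0 and d=R, OF bsrc_D(1,4)[OF H] bsrc_D(5)[OF H]]) auto
qed

lemma row_le:
  assumes H: "bsrc R M H" shows "\<bar>row H a b\<bar> \<le> M * R"
proof -
  have "\<bar>row H a b\<bar> \<le> (LBINT y:{..b}. \<bar>H (a, y)\<bar>)" unfolding row_def by (rule set_integral_abs_bound)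
  also have "\<dots> \<le> (LBINT y. indicator {0..R} y * M)"
    unfolding set_LINT_def
  proof (rule integral_mono')
    show "integrable lborel (\<lambda>y. indicator {0..R} y * M)"
      by (rule integrable_bounded_support[where M=M and a=0 and b=R]) (use bsrc_D(3)[OF H] in \<open>auto simp: indicator_def\<close>)
    show "indicat_real {..b} y *\<^sub>R \<bar>H (a, y)\<bar> \<le> indicator {0..R} y * M" for y
      using bsrc_D(4)[OF H, of "(a,y)"] bsrc_D(5)[OF H, of a y] bsrc_D(3)[OF H] by (auto simp: indicator_def)
  qed (use bsrc_D(3)[OF H] in \<open>auto simp: indicator_def\<close>)
  also have "\<dots> = M * R" using bsrc_D(2)[OF H] by simp
  finally show ?thesis .
qed

lemma row_zero:
  assumes H: "bsrc R M H" and "a < 0 \<or> a > R \<or> b \<le> 0" shows "row H a b = 0"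
proof -
  have "row H a b = (LBINT y:{..b}. 0)"
    unfolding row_def set_LINT_def
  proof (rule integral_cong_AE)
    show "AE y in lborel. indicator {..b} y *\<^sub>R H (a, y) = indicator {..b} y *\<^sub>R 0"
      using AE_lborel_singleton[of 0]
    proof eventually_elim
      case (elim y)
      thus ?case using assms(2) bsrc_D(5)[OF H, of a y] by (auto simp: indicator_def)
    qed
  qed (use bsrc_D(1)[OF H] in auto)
  thus ?thesis by simp
qed

lemma row_measurable:
  assumes H: "bsrc R M H" shows "(\<lambda>a. row H a b) \<in> borel_measurable borel"
proof -
  note [measurable] = bsrc_D(1)[OF H]
  show ?thesis unfolding row_def set_LINT_def
    by (rule lborel.borel_measurable_lebesgue_integral[of "\<lambda>a y. indicator {..b} y *\<^sub>R H (a, y)" borel, unfolded case_prod_unfold]) measurable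
qed

lemma row_integrable:
  assumes H: "bsrc R M H" shows "integrable lborel (\<lambda>a. row H a b)"
  by (rule integrable_bounded_support[where M="M*R" and a=0 and b=R])
     (use row_measurable[OF H] row_le[OF H] row_zero[OF H] in auto)

lemma gours_row: "gours H a b = (LBINT x:{..a}. row H x b)"
  by (simp add: gours_def row_def)

lemma gours_swap:
  assumes H: "bsrc R M H" shows "gours H a b = gours (flip H) b a"
proof -
  note [measurable] = bsrc_D(1)[OF H]
  define F where "F x y = indicator {..a} x * (indicator {..b} y * H (x, y))" for x y
  have "integrable (lborel2) (case_prod F)"
  proof (rule integrable_bounded_support_plane[where M=M and a=0 and b=R and c=0 and d=R])
    show "case_prod F \<in> borel_measurable borel" unfolding F_def case_prod_unfold by measurable
    show "\<bar>case_prod F z\<bar> \<le> M" for z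
      using bsrc_D(3)[OF H] bsrc_D(4)[OF H, of z] by (cases z) (auto simp: F_def indicator_def)
  qed (use bsrc_D(5)[OF H] in \<open>auto simp: F_def\<close>)
  from lborel_pair.Fubini_integral[OF this]
  have "(LBINT x. (LBINT y. F x y)) = (LBINT y. (LBINT x. F x y))" by simp
  moreover have "(LBINT x. F x y) = indicator {..b} y * (LBINT x. indicator {..a} x * H (x, y))" for y
    unfolding F_def by (subst mult.left_commute) simp
  moreover have "(LBINT y. F x y) = indicator {..a} x * (LBINT y. indicator {..b} y * H (x, y))" for x
    unfolding F_def by simp
  ultimately show ?thesis unfolding gours_def set_LINT_def by (simp add: prod.swap_def)
qed

lemma gours_Lipschitz1:
  assumes H: "bsrc R M H" shows "\<bar>gours H a b - gours H a' b\<bar> \<le> M * R * \<bar>a - a'\<bar>"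
proof -
  have *: "\<bar>gours H a b - gours H a' b\<bar> \<le> M * R * \<bar>a - a'\<bar>" if "a' \<le> a" for a a'
  proof -
    have "gours H a b - gours H a' b = (LBINT x:{a'..a}. row H x b)"
      unfolding gours_row by (rule integral_atMost_diff[OF row_integrable[OF H] that])
    also have "\<bar>\<dots>\<bar> \<le> (LBINT x:{a'..a}. \<bar>row H x b\<bar>)" by (rule set_integral_abs_bound)
    also have "\<dots> \<le> (LBINT x:{a'..a}. M * R)"
      by (rule set_integral_mono)
         (use row_le[OF H] row_integrable[OF H] in \<open>auto intro!: set_integrable_if_integrable set_integrable_const_Icc\<close>)
    also have "\<dots> = M * R * \<bar>a - a'\<bar>" using that by (simp add: set_integral_const)
    finally show ?thesis .
  qed
  show ?thesis
  proof (cases "a' \<le> a")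
    case False thus ?thesis using *[of a a'] by (simp add: abs_minus_commute)
  qed (rule *)
qed

lemma gours_Lipschitz:
  assumes H: "bsrc R M H"
  shows "\<bar>gours H a b - gours H a' b'\<bar> \<le> M * R * (\<bar>a - a'\<bar> + \<bar>b - b'\<bar>)"
proof -
  have "\<bar>gours H a' b - gours H a' b'\<bar> \<le> M * R * \<bar>b - b'\<bar>"
    unfolding gours_swap[OF H] by (rule gours_Lipschitz1[OF bsrc_swap[OF H]])
  with gours_Lipschitz1[OF H, of a b a'] show ?thesis by (simp add: distrib_left)
qed

lemma gours_continuous:
  assumes H: "bsrc R M H" shows "continuous_on UNIV (\<lambda>z. gours H (fst z) (snd z))"
proof -
  have "isCont (\<lambda>z. gours H (fst z) (snd z)) z" for z
    unfolding isCont_def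
  proof (rule Lim_null_comparison[where g="\<lambda>w. M * R * (\<bar>fst w - fst z\<bar> + \<bar>snd w - snd z\<bar>)", THEN Lim_null[THEN iffD2]])
    show "\<forall>\<^sub>F w in at z. norm (gours H (fst w) (snd w) - gours H (fst z) (snd z)) \<le> M * R * (\<bar>fst w - fst z\<bar> + \<bar>snd w - snd z\<bar>)"
      using gours_Lipschitz[OF H] by (intro always_eventually) auto
    have "((\<lambda>w. M * R * (\<bar>fst w - fst z\<bar> + \<bar>snd w - snd z\<bar>)) \<longlongrightarrow> M * R * (\<bar>fst z - fst z\<bar> + \<bar>snd z - snd z\<bar>)) (at z)"
      by (intro tendsto_intros)
    thus "((\<lambda>w. M * R * (\<bar>fst w - fst z\<bar> + \<bar>snd w - snd z\<bar>)) \<longlongrightarrow> 0) (at z)" by simp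
  qed
  thus ?thesis by (intro continuous_at_imp_continuous_on ballI)
qed

lemma gours_zero:
  assumes H: "bsrc R M H" and "a \<le> 0 \<or> b \<le> 0" shows "gours H a b = 0"
proof -
  have b: "gours H a b = 0" if H: "bsrc R M H" and "b \<le> 0" for a b H
    unfolding gours_row using row_zero[OF H] that by (simp add: set_LINT_def)
  show ?thesis using assms(2) b[OF H] b[OF bsrc_swap[OF H]] gours_swap[OF H] by metis
qed

lemma gours_le:
  assumes H: "bsrc R M H" shows "\<bar>gours H a b\<bar> \<le> M * R * R"
proof -
  have "\<bar>gours H a b\<bar> \<le> (LBINT x:{..a}. \<bar>row H x b\<bar>)" unfolding gours_row by (rule set_integral_abs_bound)
  also have "\<dots> \<le> (LBINT x. indicator {0..R} x * (M * R))"
    unfolding set_LINT_def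
  proof (rule integral_mono')
    show "integrable lborel (\<lambda>y. indicator {0..R} y * (M * R))"
      by (rule integrable_bounded_support[where M="M*R" and a=0 and b=R]) (use bsrc_D(2,3)[OF H] in \<open>auto simp: indicator_def\<close>)
    show "indicat_real {..a} x *\<^sub>R \<bar>row H x b\<bar> \<le> indicator {0..R} x * (M * R)" for x
      using row_le[OF H, of x b] row_zero[OF H, of x b] bsrc_D(2,3)[OF H] by (auto simp: indicator_def)
  qed (use bsrc_D(2,3)[OF H] in \<open>auto simp: indicator_def\<close>)
  also have "\<dots> = M * R * R" using bsrc_D(2)[OF H] by simp
  finally show ?thesis .
qed

section \<open>The Volterra equation in characteristic coordinates\<close>

lemma bsrc_mult:
  assumes "bsrc R M Q" "u \<in> borel_measurable borel" "\<And>z. \<bar>u z\<bar> \<le> m" "m \<ge> 0"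
  shows "bsrc R (M * m) (\<lambda>z. Q z * u z)"
  unfolding bsrc_def
proof (intro conjI allI impI)
  note [measurable] = bsrc_D(1)[OF assms(1)] assms(2)
  show "(\<lambda>z. Q z * u z) \<in> borel_measurable borel" by measurable
  show "\<bar>Q z * u z\<bar> \<le> M * m" for z unfolding abs_mult
    by (rule mult_mono) (use bsrc_D[OF assms(1)] assms in auto)
qed (use bsrc_D[OF assms(1)] assms in auto)

lemma row_diff: "bsrc R M H \<Longrightarrow> bsrc R' M' H' \<Longrightarrow> row (\<lambda>z. H z - H' z) a b = row H a b - row H' a b"
  unfolding row_def by (rule set_integral_diff(2)) (auto intro!: set_integrable_if_integrable bsrc_integrable)

lemma gours_diff:
  assumes "bsrc R M H" "bsrc R' M' H'"
  shows "gours (\<lambda>z. H z - H' z) a b = gours H a b - gours H' a b"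
  unfolding gours_row row_diff[OF assms]
  by (rule set_integral_diff(2)) (intro set_integrable_if_integrable row_integrable[OF assms(1)] row_integrable[OF assms(2)], simp)+

text \<open>Integrating the exponential weight in a gains the factor 1 / lam. The weight is frozen
  outside [0,R], where Q vanishes, so that it stays bounded on the plane.\<close>

lemma gours_weighted:
  assumes Q: "bsrc R M Q" and v[measurable]: "v \<in> borel_measurable borel" and c: "c \<ge> 0" and lam: "lam > 0"
    and vb: "\<And>a b. \<bar>v (a, b)\<bar> \<le> c * exp (lam * max 0 (min R a))"
  shows "\<bar>gours (\<lambda>z. Q z * v z) a b\<bar> \<le> M * R * c / lam * exp (lam * max 0 (min R a))"
proof (cases "a \<le> 0")
  case True
  have "\<bar>v z\<bar> \<le> c * exp (lam * R)" for z
    using order_trans[OF vb[of "fst z" "snd z"], of "c * exp (lam * R)"] bsrc_D(2)[OF Q] c lam by (simp add: mult_left_mono)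
  from gours_zero[OF bsrc_mult[OF Q v this]] True c lam bsrc_D[OF Q] show ?thesis by simp
next
  case False
  define X where "X = max 0 (min R a)"
  have X: "X \<ge> 0" "X \<le> R" "X \<le> a" using False bsrc_D(2)[OF Q] by (auto simp: X_def)
  note [measurable] = bsrc_D(1)[OF Q]
  have R: "R \<ge> 0" and M: "M \<ge> 0" using bsrc_D[OF Q] by auto
  have vR: "\<bar>v z\<bar> \<le> c * exp (lam * R)" for z
    using order_trans[OF vb[of "fst z" "snd z"], of "c * exp (lam * R)"] R c lam by (simp add: mult_left_mono)
  note QV = bsrc_mult[OF Q v vR]
  have QV': "bsrc R (M * (c * exp (lam * R))) (\<lambda>z. Q z * v z)" by (rule QV) (use c in auto)
  have rb: "\<bar>row (\<lambda>z. Q z * v z) x b\<bar> \<le> M * R * c * exp (lam * x)" if x: "0 \<le> x" "x \<le> R" for x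
  proof -
    have "\<bar>row (\<lambda>z. Q z * v z) x b\<bar> \<le> (LBINT y:{..b}. \<bar>Q (x, y) * v (x, y)\<bar>)" unfolding row_def by (rule set_integral_abs_bound)
    also have "\<dots> \<le> (LBINT y. indicator {0..R} y * (M * (c * exp (lam * x))))"
      unfolding set_LINT_def
    proof (rule integral_mono')
      show "integrable lborel (\<lambda>y. indicator {0..R} y * (M * (c * exp (lam * x))))"
        by (rule integrable_bounded_support[where M="M * (c * exp (lam * x))" and a=0 and b=R]) (use M c in \<open>auto simp: indicator_def\<close>)
      show "indicat_real {..b} y *\<^sub>R \<bar>Q (x, y) * v (x, y)\<bar> \<le> indicator {0..R} y * (M * (c * exp (lam * x)))" for y
      proof (cases "0 \<le> y \<and> y \<le> R")
        case True
        have "\<bar>Q (x, y) * v (x, y)\<bar> \<le> M * (c * exp (lam * x))" unfolding abs_mult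
          by (rule mult_mono) (use bsrc_D[OF Q] vb[of x y] x M in auto)
        thus ?thesis using True M c by (auto simp: indicator_def)
      next
        case False thus ?thesis using bsrc_D(5)[OF Q, of x y] by (auto simp: indicator_def)
      qed
    qed (use M c in \<open>auto simp: indicator_def\<close>)
    also have "\<dots> = M * R * c * exp (lam * x)" using R by simp
    finally show ?thesis .
  qed
  have "\<bar>gours (\<lambda>z. Q z * v z) a b\<bar> \<le> (LBINT x:{..a}. \<bar>row (\<lambda>z. Q z * v z) x b\<bar>)" unfolding gours_row by (rule set_integral_abs_bound)
  also have "\<dots> \<le> (LBINT x:{0..X}. M * R * c * exp (lam * x))"
    unfolding set_LINT_def
  proof (rule integral_mono')
    show "integrable lborel (\<lambda>x. indicator {0..X} x *\<^sub>R (M * R * c * exp (lam * x)))"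
      unfolding set_integrable_def[symmetric] by (rule borel_integrable_atLeastAtMost') (intro continuous_intros)
    show "indicat_real {..a} x *\<^sub>R \<bar>row (\<lambda>z. Q z * v z) x b\<bar> \<le> indicator {0..X} x *\<^sub>R (M * R * c * exp (lam * x))" for x
    proof (cases "0 \<le> x \<and> x \<le> R \<and> x \<le> a")
      case True thus ?thesis using rb[of x] by (auto simp: X_def indicator_def)
    next
      case False thus ?thesis using row_zero[OF QV', of x b] R M c by (auto simp: indicator_def)
    qed
  qed (use R M c in \<open>auto simp: indicator_def\<close>)
  also have "\<dots> = M * R * c / lam * exp (lam * X) - M * R * c / lam * exp (lam * 0)"
    by (rule set_integral_FTC[OF X(1)]) (use lam in \<open>auto intro!: derivative_eq_intros continuous_intros\<close>)
  also have "\<dots> \<le> M * R * c / lam * exp (lam * X)" using R M c lam by simp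
  finally show ?thesis by (simp add: X_def)
qed

text \<open>The integral equation is of Volterra type in \<open>a\<close>, so the weight \<open>exp (lam * a)\<close> with \<open>lam\<close> large
  turns the right-hand side into a contraction.\<close>

lemma volterra_exists:
  assumes Q: "bsrc R M Q" and \<beta>[measurable]: "\<beta> \<in> borel_measurable borel"
    and u0[measurable]: "u0 \<in> borel_measurable borel" and m: "\<And>z. \<bar>u0 z\<bar> \<le> m"
  shows "\<exists>u. u \<in> borel_measurable borel \<and> (\<forall>z. \<bar>u z\<bar> \<le> 2 * exp ((4 * M * R + 1) * R) * m) \<and>
    (\<forall>a b. u (a, b) = u0 (a, b) + gours (\<lambda>z. Q z * u z) a (\<beta> a) - gours (\<lambda>z. Q z * u z) a b)"
proof -
  \<comment> \<open>The operator K below contains two Goursat integrals, each bounded by M R / lam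
    \<le> 1/4 of the weighted norm, so K halves this norm.\<close>
  define lam where "lam = 4 * M * R + 1"
  have R: "R \<ge> 0" and M: "M \<ge> 0" using bsrc_D[OF Q] by auto
  have lam: "lam > 0" using R M by (simp add: lam_def add_nonneg_pos)
  have m0: "m \<ge> 0" using order_trans[OF abs_ge_zero m[of undefined]] .
  define E where "E a = exp (lam * max 0 (min R a))" for a
  have E1: "E a \<ge> 1" and ER: "E a \<le> exp (lam * R)" for a using lam R by (auto simp: E_def)
  define K where "K v z = gours (\<lambda>z. Q z * v z) (fst z) (\<beta> (fst z)) - gours (\<lambda>z. Q z * v z) (fst z) (snd z)" for v z
  define ok where "ok c v \<longleftrightarrow> v \<in> borel_measurable borel \<and> c \<ge> 0 \<and> (\<forall>a b. \<bar>v (a, b)\<bar> \<le> c * E a)" for c and v :: "real \<times> real \<Rightarrow> real"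
  have okb: "bsrc R (M * (c * exp (lam * R))) (\<lambda>z. Q z * v z)" if "ok c v" for c v
  proof (rule bsrc_mult[OF Q])
    fix z show "\<bar>v z\<bar> \<le> c * exp (lam * R)"
      using that ER[of "fst z"] order_trans[of "\<bar>v z\<bar>" "c * E (fst z)" "c * exp (lam * R)"]
      by (cases z) (auto simp: ok_def mult_left_mono)
  qed (use that in \<open>auto simp: ok_def\<close>)
  have Kok: "ok (c / 2) (K v)" if v: "ok c v" for c v
    unfolding ok_def
  proof (intro conjI allI)
    have [measurable]: "(\<lambda>z. gours (\<lambda>z. Q z * v z) (fst z) (snd z)) \<in> borel_measurable borel"
      by (rule borel_measurable_continuous_onI[OF gours_continuous[OF okb[OF v]]])
    have "(\<lambda>z::real \<times> real. \<beta> (fst z)) \<in> borel_measurable borel"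
      by (rule measurable_compose[OF fst_snd_borel_measurable(1) \<beta>])
    hence P: "(\<lambda>z::real \<times> real. (fst z, \<beta> (fst z))) \<in> borel_measurable borel"
      by (rule borel_measurable_Pair[OF fst_snd_borel_measurable(1)])
    have "(\<lambda>z::real \<times> real. gours (\<lambda>z. Q z * v z) (fst z) (\<beta> (fst z))) \<in> borel_measurable borel"
      using measurable_compose[OF P borel_measurable_continuous_onI[OF gours_continuous[OF okb[OF v]]]] by simp
    thus "K v \<in> borel_measurable borel" unfolding K_def[abs_def] by simp
    show "c / 2 \<ge> 0" using v by (simp add: ok_def)
    fix a b
    have "\<bar>gours (\<lambda>z. Q z * v z) a b\<bar> \<le> c / 4 * E a" for b
    proof -
      have "\<bar>gours (\<lambda>z. Q z * v z) a b\<bar> \<le> M * R * c / lam * E a"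
        unfolding E_def by (rule gours_weighted[OF Q]) (use v lam in \<open>auto simp: ok_def E_def\<close>)
      also have "M * R * c / lam \<le> c / 4"
        using v R M by (auto simp: lam_def ok_def field_simps add_pos_nonneg mult_left_le intro!: divide_le_eq[THEN iffD2])
      finally show ?thesis using E1[of a] by (simp add: mult_right_mono)
    qed
    from this[of b] this[of "\<beta> a"] show "\<bar>K v (a, b)\<bar> \<le> c / 2 * E a"
      unfolding K_def fst_conv snd_conv by linarith
  qed
  have Kdiff: "K (\<lambda>z. v z - w z) z = K v z - K w z" if "ok c v" "ok d w" for v w c d z
    using gours_diff[OF okb[OF that(1)] okb[OF that(2)]] by (simp add: K_def right_diff_distrib)
  \<comment> \<open>The Neumann series of the fixed point equation; its n-th term has weighted norm
    at most m / 2^n.\<close>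
  define v where "v n = (K ^^ n) u0" for n
  have vok: "ok (m / 2 ^ n) (v n)" for n
  proof (induction n)
    case 0
    have "m \<le> m * E a" for a using mult_left_mono[OF E1[of a] m0] by simp
    thus ?case using m m0 by (auto simp: v_def ok_def intro: order_trans)
  next
    case (Suc n) from Kok[OF this] show ?case by (simp add: v_def mult.commute)
  qed
  define S where "S n z = (\<Sum>k<n. v k z)" for n z
  have geo: "summable (\<lambda>k. C / 2 ^ k)" "(\<Sum>k. C / 2 ^ k) = 2 * C" for C :: real
  proof -
    have "(\<lambda>k. C * (1/2) ^ k) sums (C * (1 / (1 - 1/2)))" by (intro sums_mult geometric_sums) auto
    hence "(\<lambda>k. C / 2 ^ k) sums (2 * C)" by (simp add: power_divide mult.commute)
    thus "summable (\<lambda>k. C / 2 ^ k)" "(\<Sum>k. C / 2 ^ k) = 2 * C" by (auto simp: sums_iff)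
  qed
  have vb: "\<bar>v n (a, b)\<bar> \<le> (m * E a) / 2 ^ n" for n a b using vok[of n] by (auto simp: ok_def)
  have sv: "summable (\<lambda>k. \<bar>v k z\<bar>)" for z
  proof (rule summable_comparison_test'[OF geo(1)])
    show "norm \<bar>v k z\<bar> \<le> m * E (fst z) / 2 ^ k" for k using vb[of k "fst z" "snd z"] by simp
  qed
  have sv': "summable (\<lambda>k. v k z)" for z by (rule summable_rabs_cancel[OF sv])
  define u where "u z = (\<Sum>k. v k z)" for z
  have [measurable]: "v k \<in> borel_measurable borel" for k using vok by (auto simp: ok_def)
  have um: "u \<in> borel_measurable borel" unfolding u_def[abs_def] by measurable
  have tail: "\<bar>u (a, b) - S n (a, b)\<bar> \<le> (2 * m / 2 ^ n) * E a" for a b n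
  proof -
    have "u (a, b) - S n (a, b) = (\<Sum>k. v (k + n) (a, b))"
      unfolding u_def S_def by (subst suminf_minus_initial_segment[OF sv']) simp
    also have "\<bar>\<dots>\<bar> \<le> (\<Sum>k. \<bar>v (k + n) (a, b)\<bar>)"
      by (rule summable_rabs) (use sv[of "(a,b)"] summable_iff_shift[of "\<lambda>k. \<bar>v k (a,b)\<bar>" n] in auto)
    also have "\<dots> \<le> (\<Sum>k. (m * E a / 2 ^ n) / 2 ^ k)"
    proof (rule suminf_le)
      show "\<bar>v (k + n) (a, b)\<bar> \<le> m * E a / 2 ^ n / 2 ^ k" for k
        using vb[of "k + n" a b] by (simp add: power_add mult.commute)
      show "summable (\<lambda>k. \<bar>v (k + n) (a, b)\<bar>)" using sv[of "(a,b)"] summable_iff_shift[of "\<lambda>k. \<bar>v k (a,b)\<bar>" n] by blast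
      show "summable (\<lambda>k. m * E a / 2 ^ n / 2 ^ k)" by (rule geo(1))
    qed
    also have "\<dots> = (2 * m / 2 ^ n) * E a" by (subst geo(2)) simp
    finally show ?thesis .
  qed
  have Sm: "S n \<in> borel_measurable borel" for n unfolding S_def[abs_def] by measurable
  have uok: "ok (2 * m) u" using tail[of _ _ 0] um m0 by (auto simp: ok_def S_def)
  have Sok: "ok (4 * m) (S n)" for n
    unfolding ok_def
  proof (intro conjI allI)
    fix a b
    have "2 * m / 2 ^ n \<le> 2 * m" using m0 by (simp add: divide_le_eq mult_le_cancel_left1)
    hence "(2 * m / 2 ^ n) * E a \<le> 2 * m * E a" using E1[of a] by (intro mult_right_mono) auto
    moreover have "\<bar>u (a, b)\<bar> \<le> 2 * m * E a" using uok unfolding ok_def by blast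
    ultimately show "\<bar>S n (a, b)\<bar> \<le> 4 * m * E a" using tail[of a b n] by linarith
  qed (use Sm m0 in auto)
  have SK: "S (Suc n) z = u0 z + K (S n) z" for n z
  proof (induction n)
    case 0
    have "K (\<lambda>z. 0) z = 0" for z by (simp add: K_def gours_def)
    thus ?case by (simp add: S_def v_def)
  next
    case (Suc n)
    have e: "(\<lambda>z. S (Suc n) z - S n z) = v n" by (simp add: S_def)
    have "S (Suc (Suc n)) z = S (Suc n) z + K (v n) z" by (simp add: S_def v_def)
    also have "K (v n) z = K (S (Suc n)) z - K (S n) z" using Kdiff[OF Sok Sok, of "Suc n" n z] by (simp add: e)
    finally show ?case using Suc by simp
  qed
  \<comment> \<open>Limit in \<open>SK\<close>: by linearity the error is K applied to the tail of
    the series, whose weighted norm is at most 2 m / 2^n, and K halves it.\<close>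
  have eq: "u z = u0 z + K u z" for z
  proof -
    obtain a b where z: "z = (a, b)" by (cases z)
    have "(\<lambda>n. S n z) \<longlonglongrightarrow> u z" unfolding S_def u_def using summable_LIMSEQ[OF sv'] .
    hence "(\<lambda>n. S (Suc n) z) \<longlonglongrightarrow> u z" by (rule LIMSEQ_Suc)
    moreover have "(\<lambda>n. S (Suc n) z) \<longlonglongrightarrow> u0 z + K u z"
      unfolding SK
    proof (intro tendsto_intros, rule Lim_null_comparison[where g="\<lambda>n. (m * E a) / 2 ^ n", THEN Lim_null[THEN iffD2]])
      show "\<forall>\<^sub>F n in sequentially. norm (K (S n) z - K u z) \<le> m * E a / 2 ^ n"
      proof (intro always_eventually allI)
        fix n
        have "ok (2 * m / 2 ^ n) (\<lambda>z. S n z - u z)" using tail[of _ _ n] Sm um m0 by (auto simp: ok_def abs_minus_commute)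
        from Kok[OF this] have "\<bar>K (\<lambda>z. S n z - u z) (a, b)\<bar> \<le> (2 * m / 2 ^ n) / 2 * E a" by (auto simp: ok_def)
        thus "norm (K (S n) z - K u z) \<le> m * E a / 2 ^ n" using Kdiff[OF Sok uok] by (simp add: z)
      qed
      show "(\<lambda>n. m * E a / 2 ^ n) \<longlonglongrightarrow> 0" using summable_LIMSEQ_zero[OF geo(1)] .
    qed
    ultimately show ?thesis by (rule LIMSEQ_unique)
  qed
  show ?thesis
  proof (intro exI[of _ u] conjI allI)
    show "\<bar>u z\<bar> \<le> 2 * exp ((4 * M * R + 1) * R) * m" for z
    proof (cases z)
      case (Pair a b)
      have "\<bar>u z\<bar> \<le> 2 * m * E a" using uok Pair by (auto simp: ok_def)
      also have "\<dots> \<le> 2 * m * exp (lam * R)" using ER[of a] m0 by (intro mult_left_mono) auto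
      finally show ?thesis by (simp add: lam_def mult_ac)
    qed
    show "u (a, b) = u0 (a, b) + gours (\<lambda>z. Q z * u z) a (\<beta> a) - gours (\<lambda>z. Q z * u z) a b" for a b
      using eq[of "(a,b)"] by (simp add: K_def)
  qed (rule um)
qed

text \<open>The lines \<open>a - b = const\<close>, along which the source may jump, are the points of fixed position; they
  are transversal to the characteristics, so \<open>gours H\<close> is still continuously differentiable.\<close>

definition pc :: "real \<Rightarrow> real \<Rightarrow> real set \<Rightarrow> (real \<times> real \<Rightarrow> real) \<Rightarrow> bool" where
  "pc R M N H \<longleftrightarrow> bsrc R M H \<and> finite N \<and> (\<forall>a b. a - b \<notin> N \<longrightarrow> isCont H (a, b))"

section \<open>Differentiability of Goursat integrals of sources with jumps\<close>

lemma pc_swap: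
  assumes "pc R M N H" shows "pc R M (uminus ` N) (flip H)"
  unfolding pc_def
proof (intro conjI allI impI)
  show "bsrc R M (flip H)" using assms bsrc_swap by (auto simp: pc_def)
  show "finite (uminus ` N)" using assms by (auto simp: pc_def)
  fix a b :: real assume "a - b \<notin> uminus ` N"
  hence "b - a \<notin> N" by force
  hence c: "isCont H (b, a)" using assms by (auto simp: pc_def)
  have "isCont prod.swap (a, b)" unfolding prod.swap_def
    by (intro continuous_intros)
  from isCont_o2[OF this] c show "isCont (flip H) (a, b)" by simp
qed

text \<open>The vertical line through a meets the lines a - y = const of possible jumps in finitely
  many points only. Off these and off the end point b the integrand converges, and the bound M on
  the support dominates it.\<close>

lemma row_continuous:
  assumes H: "pc R M N H" shows "continuous_on UNIV (\<lambda>z. row H (fst z) (snd z))"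
proof (intro continuous_at_imp_continuous_on ballI)
  fix z :: "real \<times> real"
  obtain a b where z: "z = (a, b)" by (cases z)
  have B: "bsrc R M H" and N: "finite N" and c: "\<And>a b. a - b \<notin> N \<Longrightarrow> isCont H (a, b)" using H by (auto simp: pc_def)
  note [measurable] = bsrc_D(1)[OF B]
  show "isCont (\<lambda>z. row H (fst z) (snd z)) z"
    unfolding continuous_at_sequentially comp_def
  proof (intro allI impI)
    fix X assume X: "X \<longlonglongrightarrow> z"
    have X1: "(\<lambda>n. fst (X n)) \<longlonglongrightarrow> a" and X2: "(\<lambda>n. snd (X n)) \<longlonglongrightarrow> b"
      using tendsto_fst[OF X] tendsto_snd[OF X] by (auto simp: z)
    have fin: "finite (insert b ((\<lambda>k. a - k) ` N))" using N by simp
    have ae: "AE y in lborel. y \<notin> insert b ((\<lambda>k. a - k) ` N)"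
      by (rule AE_not_in[OF finite_imp_null_set_lborel[OF fin]])
    show "(\<lambda>n. row H (fst (X n)) (snd (X n))) \<longlonglongrightarrow> row H (fst z) (snd z)"
      unfolding row_def set_LINT_def
    proof (rule integral_dominated_convergence[where w="\<lambda>y. indicator {0..R} y * M"])
      show "integrable lborel (\<lambda>y. indicator {0..R} y * M)"
        by (rule integrable_bounded_support[where M=M and a=0 and b=R]) (use bsrc_D(3)[OF B] in \<open>auto simp: indicator_def\<close>)
      show "AE y in lborel. norm (indicat_real {..snd (X n)} y *\<^sub>R H (fst (X n), y)) \<le> indicator {0..R} y * M" for n
        using bsrc_D(3)[OF B] bsrc_D(4)[OF B] bsrc_D(5)[OF B, of "fst (X n)"] by (intro AE_I2) (auto simp: indicator_def)
      show "AE y in lborel. (\<lambda>n. indicat_real {..snd (X n)} y *\<^sub>R H (fst (X n), y)) \<longlonglongrightarrow> indicat_real {..snd z} y *\<^sub>R H (fst z, y)"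
        using ae
      proof eventually_elim
        case (elim y)
        have "a - y \<notin> N" using elim by force
        have cH: "(\<lambda>n. H (fst (X n), y)) \<longlonglongrightarrow> H (a, y)"
          by (rule isCont_tendsto_compose[OF c[OF \<open>a - y \<notin> N\<close>]]) (intro tendsto_intros X1)
        have ind: "eventually (\<lambda>n. indicat_real {..snd (X n)} y = indicat_real {..b} y) sequentially"
        proof (cases "y < b")
          case True
          from order_tendstoD(1)[OF X2 this] show ?thesis
            by eventually_elim (use True in \<open>auto simp: indicator_def\<close>)
        next
          case False
          hence "y > b" using elim by auto
          from order_tendstoD(2)[OF X2 this] show ?thesis
            by eventually_elim (use \<open>y > b\<close> in \<open>auto simp: indicator_def\<close>)
        qed
        have "(\<lambda>n. indicat_real {..b} y *\<^sub>R H (fst (X n), y)) \<longlonglongrightarrow> indicat_real {..b} y *\<^sub>R H (a, y)"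
          by (intro tendsto_intros cH)
        hence "(\<lambda>n. indicat_real {..snd (X n)} y *\<^sub>R H (fst (X n), y)) \<longlonglongrightarrow> indicat_real {..b} y *\<^sub>R H (a, y)"
        proof (rule Lim_transform_eventually)
          show "\<forall>\<^sub>F n in sequentially. indicat_real {..b} y *\<^sub>R H (fst (X n), y) = indicat_real {..snd (X n)} y *\<^sub>R H (fst (X n), y)"
            using ind by eventually_elim simp
        qed
        thus ?case by (simp add: z)
      qed
    qed auto
  qed
qed

lemma row_compose_continuous:
  assumes H: "pc R M N H" and "continuous_on S f" "continuous_on S g"
  shows "continuous_on S (\<lambda>x. row H (f x) (g x))"
  using continuous_on_compose2[OF row_continuous[OF H] continuous_on_Pair[OF assms(2,3)]] by simp

text \<open>A source may be nonzero on the axis a = 0 itself; continuity of \<open>row\<close> from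
  the left removes this case.\<close>

lemma row_zero':
  assumes H: "pc R M N H" and "a \<le> 0 \<or> b \<le> 0" shows "row H a b = 0"
proof -
  have B: "bsrc R M H" using H by (simp add: pc_def)
  have c: "continuous_on UNIV (\<lambda>a. row H a b)" by (rule row_compose_continuous[OF H]) (intro continuous_intros)+
  have "row H 0 b = 0"
  proof (rule continuous_constant_on_closure[where S="{..<0}" and f="\<lambda>a. row H a b" and a=0])
    show "continuous_on (closure {..<0}) (\<lambda>a. row H a b)" using c continuous_on_subset by blast
    show "(0::real) \<in> closure {..<0}" by simp
  qed (use row_zero[OF B] in auto)
  thus ?thesis using row_zero[OF B, of a b] assms(2) by (cases "a = 0") auto
qed

text \<open>Both partial derivatives exist, by the fundamental theorem and by symmetry, and the one
  in b is jointly continuous, which gives total differentiability.\<close>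

lemma gours_has_derivative:
  assumes H: "pc R M N H"
  shows "((\<lambda>z. gours H (fst z) (snd z)) has_derivative
     (\<lambda>d. row H a b * fst d + row (flip H) b a * snd d)) (at (a, b))"
proof -
  have B: "bsrc R M H" using H by (simp add: pc_def)
  have d1: "((\<lambda>x. gours H x y) has_real_derivative row H x y) (at x)" if "pc R M N H" for H N x y
  proof -
    have B: "bsrc R M H" using that by (simp add: pc_def)
    show ?thesis unfolding gours_row
      by (rule DERIV_integral_atMost[OF row_integrable[OF B]], rule row_compose_continuous[OF that]) (intro continuous_intros)+
  qed
  have d2: "((\<lambda>y. gours H x y) has_real_derivative row (flip H) y x) (at y)" for x y
    using d1[OF pc_swap[OF H], of x y] gours_swap[OF B] by simp
  have "((\<lambda>(x, y). gours H x y) has_derivative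
     (\<lambda>(tx, ty). row H a b * tx + blinfun_scaleR_left (row (flip H) b a) ty)) (at (a, b) within UNIV \<times> UNIV)"
  proof (rule has_derivative_partialsI)
    show "((\<lambda>x. gours H x b) has_derivative (*) (row H a b)) (at a within UNIV)"
      using d1[OF H] by (simp add: has_field_derivative_def)
    show "((\<lambda>y. gours H x y) has_derivative blinfun_apply (blinfun_scaleR_left (row (flip H) y x))) (at y within UNIV)" for x y
      using d2 by (simp add: has_field_derivative_def mult_commute_abs)
    have "continuous_on UNIV (\<lambda>z. row (flip H) (snd z) (fst z))"
      by (rule row_compose_continuous[OF pc_swap[OF H]]) (intro continuous_intros)+
    hence "((\<lambda>z. row (flip H) (snd z) (fst z)) \<longlongrightarrow> row (flip H) b a) (at (a, b))"
      by (auto simp: continuous_on_def dest: bspec[of _ _ "(a,b)"])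
    thus "continuous (at (a, b) within UNIV \<times> UNIV) (\<lambda>(x, y). blinfun_scaleR_left (row (flip H) y x))"
      unfolding continuous_within case_prod_unfold by (auto intro!: tendsto_intros)
  qed auto
  thus ?thesis by (simp add: case_prod_unfold mult.commute)
qed

lemma gours_DERIV:
  assumes H: "pc R M N H" and "(f has_real_derivative f') (at t)" "(g has_real_derivative g') (at t)"
  shows "((\<lambda>t. gours H (f t) (g t)) has_real_derivative
     (row H (f t) (g t) * f' + row (flip H) (g t) (f t) * g')) (at t)"
proof -
  have "((\<lambda>t. (f t, g t)) has_derivative (\<lambda>h. (f' * h, g' * h))) (at t)"
    using assms(2,3) unfolding has_field_derivative_def by (rule has_derivative_Pair)
  from diff_chain_at[OF this gours_has_derivative[OF H, of "f t" "g t"]]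
  have "((\<lambda>t. gours H (f t) (g t)) has_derivative
      (\<lambda>h. row H (f t) (g t) * (f' * h) + row (flip H) (g t) (f t) * (g' * h))) (at t)"
    by (simp add: comp_def)
  also have "(\<lambda>h. row H (f t) (g t) * (f' * h) + row (flip H) (g t) (f t) * (g' * h)) =
      (*) (row H (f t) (g t) * f' + row (flip H) (g t) (f t) * g')"
    by (auto simp: algebra_simps)
  finally show ?thesis unfolding has_field_derivative_def .
qed

text \<open>The function w(x,s) = \<open>row H (s - x + c) (s + x + d)\<close> satisfies w_s + w_x =
  2 H, since its first argument is constant and the second grows at rate 2 along that direction.
  This is the equation integrated over [0,y] and all times up to s. As \<open>row\<close> need not
  be differentiable in its first argument, the identity is obtained from Fubini in characteristic
  coordinates.\<close>

lemma row_transport: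
  assumes H: "pc R M N H" and y: "y \<ge> 0"
  shows "(LBINT x:{0..y}. row H (s - x + c) (s + x + d)) =
    (LBINT r:{..s}. row H (r + c) (r + d)) - (LBINT r:{..s}. row H (r - y + c) (r + y + d))
    + (LBINT r:{..s}. (LBINT x:{0..y}. 2 * H (r - x + c, r + x + d)))"
proof -
  have B: "bsrc R M H" using H by (simp add: pc_def)
  note [measurable] = bsrc_D(1)[OF B]
  have R: "R \<ge> 0" and M: "M \<ge> 0" using bsrc_D[OF B] by auto
  \<comment> \<open>In terms of \<xi>, the first argument of \<open>row\<close>: A, P and Q are the
    three line integrals, and F is the integrand of the double integral over the region swept
    out.\<close>
  define A where "A \<xi> = indicator {s - y + c..s + c} \<xi> * row H \<xi> (2 * s + c + d - \<xi>)" for \<xi>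
  define P where "P \<xi> = indicator {..s + c} \<xi> * row H \<xi> (\<xi> - c + d)" for \<xi>
  define Q where "Q \<xi> = indicator {..s - y + c} \<xi> * row H \<xi> (\<xi> + 2 * y - c + d)" for \<xi>
  define F where "F \<xi> b = (if b \<le> 2 * s - \<xi> + c + d \<and> \<xi> - c + d \<le> b \<and> b \<le> \<xi> - c + d + 2 * y then H (\<xi>, b) else 0)" for \<xi> b
  have int: "integrable lborel (\<lambda>\<xi>. indicator S \<xi> * row H \<xi> (p \<xi>))"
    if [measurable]: "S \<in> sets borel" and p: "continuous_on UNIV p" for S p
  proof (rule integrable_bounded_support[where M="M*R" and a=0 and b=R])
    have [measurable]: "(\<lambda>\<xi>. row H \<xi> (p \<xi>)) \<in> borel_measurable borel"
      by (rule borel_measurable_continuous_onI, rule row_compose_continuous[OF H continuous_on_id p])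
    show "(\<lambda>\<xi>. indicator S \<xi> * row H \<xi> (p \<xi>)) \<in> borel_measurable borel" by measurable
    show "\<bar>indicat_real S \<xi> * row H \<xi> (p \<xi>)\<bar> \<le> M * R" for \<xi> using row_le[OF B] R M by (auto simp: indicator_def)
  qed (use row_zero[OF B] in auto)
  have iA: "integrable lborel A" unfolding A_def by (rule int) (auto intro!: continuous_intros)
  have iP: "integrable lborel P" unfolding P_def by (rule int) (auto intro!: continuous_intros)
  have iQ: "integrable lborel Q" unfolding Q_def by (rule int) (auto intro!: continuous_intros)
  have 1: "(LBINT x:{0..y}. row H (s - x + c) (s + x + d)) = (LBINT \<xi>. A \<xi>)"
  proof -
    have "(LBINT x:{0..y}. row H (s - x + c) (s + x + d)) =
      (LBINT \<xi>. indicator {0..y} ((s + c) + (-1) * \<xi>) *\<^sub>R row H (s - ((s + c) + (-1) * \<xi>) + c) (s + ((s + c) + (-1) * \<xi>) + d))"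
      unfolding set_LINT_def by (subst lborel_integral_real_affine[where c="-1" and t="s + c"]) auto
    also have "\<dots> = (LBINT \<xi>. A \<xi>)"
      by (rule LINT_cong) (auto simp: A_def indicator_def algebra_simps)
    finally show ?thesis .
  qed
  have 2: "(LBINT r:{..s}. row H (r + c) (r + d)) = (LBINT \<xi>. P \<xi>)"
  proof -
    have "(LBINT r:{..s}. row H (r + c) (r + d)) =
      (LBINT \<xi>. indicator {..s} (- c + 1 * \<xi>) *\<^sub>R row H (- c + 1 * \<xi> + c) (- c + 1 * \<xi> + d))"
      unfolding set_LINT_def by (subst lborel_integral_real_affine[where c=1 and t="- c"]) auto
    also have "\<dots> = (LBINT \<xi>. P \<xi>)"
      by (rule LINT_cong) (auto simp: P_def indicator_def algebra_simps)
    finally show ?thesis .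
  qed
  have 3: "(LBINT r:{..s}. row H (r - y + c) (r + y + d)) = (LBINT \<xi>. Q \<xi>)"
  proof -
    have "(LBINT r:{..s}. row H (r - y + c) (r + y + d)) =
      (LBINT \<xi>. indicator {..s} ((y - c) + 1 * \<xi>) *\<^sub>R row H ((y - c) + 1 * \<xi> - y + c) ((y - c) + 1 * \<xi> + y + d))"
      unfolding set_LINT_def by (subst lborel_integral_real_affine[where c=1 and t="y - c"]) auto
    also have "\<dots> = (LBINT \<xi>. Q \<xi>)"
      by (rule LINT_cong) (auto simp: Q_def indicator_def algebra_simps)
    finally show ?thesis .
  qed
  define G where "G r \<xi> = (if r \<le> s \<and> 0 \<le> r + c - \<xi> \<and> r + c - \<xi> \<le> y then 2 * H (\<xi>, 2 * r - \<xi> + c + d) else 0)" for r \<xi>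
  have G: "integrable (lborel2) (case_prod G)"
  proof (rule integrable_bounded_support_plane[where M="2*M" and a="(- \<bar>c\<bar> - \<bar>d\<bar>)" and b="R + \<bar>c\<bar> + \<bar>d\<bar>" and c=0 and d=R])
    show "case_prod G \<in> borel_measurable borel" unfolding G_def case_prod_unfold by measurable
    show "\<bar>case_prod G z\<bar> \<le> 2 * M" for z using bsrc_D(4)[OF B] M by (cases z) (auto simp: G_def abs_mult)
    fix r \<xi> assume n: "\<not> (- \<bar>c\<bar> - \<bar>d\<bar> \<le> r \<and> r \<le> R + \<bar>c\<bar> + \<bar>d\<bar> \<and> 0 \<le> \<xi> \<and> \<xi> \<le> R)"
    have "H (\<xi>, 2 * r - \<xi> + c + d) = 0"
    proof (rule bsrc_D(5)[OF B], rule notI)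
      assume "0 \<le> \<xi> \<and> \<xi> \<le> R \<and> 0 \<le> 2 * r - \<xi> + c + d \<and> 2 * r - \<xi> + c + d \<le> R"
      thus False using n by linarith
    qed
    thus "case_prod G (r, \<xi>) = 0" by (simp add: G_def)
  qed
  have 4: "(LBINT r:{..s}. (LBINT x:{0..y}. 2 * H (r - x + c, r + x + d))) = (LBINT \<xi>. (LBINT b. F \<xi> b))"
  proof -
    have "indicator {..s} r *\<^sub>R (LBINT x:{0..y}. 2 * H (r - x + c, r + x + d)) = (LBINT \<xi>. G r \<xi>)" for r
    proof -
      have "(LBINT x:{0..y}. 2 * H (r - x + c, r + x + d)) = 
        (LBINT \<xi>. indicator {0..y} ((r + c) + (-1) * \<xi>) *\<^sub>R (2 * H (r - ((r + c) + (-1) * \<xi>) + c, r + ((r + c) + (-1) * \<xi>) + d)))"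
        unfolding set_LINT_def by (subst lborel_integral_real_affine[where c="-1" and t="r + c"]) auto
      hence "indicator {..s} r *\<^sub>R (LBINT x:{0..y}. 2 * H (r - x + c, r + x + d)) = 
        (LBINT \<xi>. indicator {..s} r *\<^sub>R (indicator {0..y} ((r + c) + (-1) * \<xi>) *\<^sub>R (2 * H (r - ((r + c) + (-1) * \<xi>) + c, r + ((r + c) + (-1) * \<xi>) + d))))"
        by simp
      also have "\<dots> = (LBINT \<xi>. G r \<xi>)"
        by (rule LINT_cong) (auto simp: G_def indicator_def algebra_simps)
      finally show ?thesis .
    qed
    hence "(LBINT r:{..s}. (LBINT x:{0..y}. 2 * H (r - x + c, r + x + d))) = (LBINT r. (LBINT \<xi>. G r \<xi>))"
      by (subst set_LINT_def) simp
    also have "\<dots> = (LBINT \<xi>. (LBINT r. G r \<xi>))" using lborel_pair.Fubini_integral[OF G] by simp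
    also have "\<dots> = (LBINT \<xi>. (LBINT b. F \<xi> b))"
    proof (rule LINT_cong)
      fix \<xi>
      \<comment> \<open>The substitution b = 2 r - \<xi> + c + d has Jacobian 1/2, which cancels the
        factor 2 of the source.\<close>
      have "(LBINT r. G r \<xi>) = (1/2) * (LBINT b. G ((\<xi> - c - d) / 2 + (1/2) * b) \<xi>)"
        by (subst lborel_integral_real_affine[where c="1/2" and t="(\<xi> - c - d) / 2"]) auto
      also have "\<dots> = (LBINT b. (1/2) * G ((\<xi> - c - d) / 2 + (1/2) * b) \<xi>)" by simp
      also have "\<dots> = (LBINT b. F \<xi> b)"
      proof (rule LINT_cong)
        fix b
        have e: "2 * ((\<xi> - c - d) / 2 + (1/2) * b) - \<xi> + c + d = b" by (simp add: field_simps)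
        have "((\<xi> - c - d) / 2 + (1/2) * b \<le> s \<and> 0 \<le> (\<xi> - c - d) / 2 + (1/2) * b + c - \<xi> \<and> (\<xi> - c - d) / 2 + (1/2) * b + c - \<xi> \<le> y) \<longleftrightarrow>
          (b \<le> 2 * s - \<xi> + c + d \<and> \<xi> - c + d \<le> b \<and> b \<le> \<xi> - c + d + 2 * y)" by (auto simp: field_simps)
        thus "(1/2) * G ((\<xi> - c - d) / 2 + (1/2) * b) \<xi> = F \<xi> b" unfolding G_def F_def e by auto
      qed simp
      finally show "(LBINT r. G r \<xi>) = (LBINT b. F \<xi> b)" .
    qed simp
    finally show ?thesis .
  qed
  \<comment> \<open>For fixed \<xi>, apart from the two end points, the inner integral is an
    increment of \<open>row\<close> in b. The cases distinguish whether \<xi> lies to the right of,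
    to the left of, or inside the interval on which A lives.\<close>
  have "(LBINT \<xi>. (LBINT b. F \<xi> b)) = (LBINT \<xi>. A \<xi> - P \<xi> + Q \<xi>)"
  proof (rule integral_cong_AE)
    show "(\<lambda>\<xi>. LBINT b. F \<xi> b) \<in> borel_measurable lborel" unfolding F_def by measurable
    show "(\<lambda>\<xi>. A \<xi> - P \<xi> + Q \<xi>) \<in> borel_measurable lborel" using iA iP iQ by simp
    show "AE \<xi> in lborel. (LBINT b. F \<xi> b) = A \<xi> - P \<xi> + Q \<xi>"
      using AE_lborel_singleton[of "s - y + c"] AE_lborel_singleton[of "s + c"]
    proof eventually_elim
      case (elim \<xi>)
      have df: "(LBINT b:{p..q}. H (\<xi>, b)) = row H \<xi> q - row H \<xi> p" if "p \<le> q" for p q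
        unfolding row_def by (rule integral_atMost_diff[OF bsrc_integrable(1)[OF B] that, symmetric])
      consider "\<xi> > s + c" | "\<xi> < s - y + c" | "s - y + c < \<xi>" "\<xi> < s + c" using elim by linarith
      thus ?case
      proof cases
        case 1
        have "F \<xi> b = 0" for b using 1 by (auto simp: F_def)
        thus ?thesis using 1 y by (simp add: A_def P_def Q_def)
      next
        case 2
        have "(LBINT b. F \<xi> b) = (LBINT b:{\<xi> - c + d..\<xi> - c + d + 2 * y}. H (\<xi>, b))"
          unfolding set_LINT_def
          by (rule LINT_cong) (use 2 in \<open>auto simp: F_def indicator_def\<close>)
        thus ?thesis using 2 y by (simp add: A_def P_def Q_def df algebra_simps)
      next
        case 3
        have "(LBINT b. F \<xi> b) = (LBINT b:{\<xi> - c + d..2 * s - \<xi> + c + d}. H (\<xi>, b))"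
          unfolding set_LINT_def
          by (rule LINT_cong) (use 3 in \<open>auto simp: F_def indicator_def\<close>)
        also have "\<dots> = row H \<xi> (2 * s - \<xi> + c + d) - row H \<xi> (\<xi> - c + d)" by (rule df) (use 3 in auto)
        finally show ?thesis using 3 y by (simp add: A_def P_def Q_def algebra_simps)
      qed
    qed
  qed
  also have "\<dots> = (LBINT \<xi>. A \<xi>) - (LBINT \<xi>. P \<xi>) + (LBINT \<xi>. Q \<xi>)" using iA iP iQ by simp
  finally show ?thesis unfolding 1 2 3 4 by simp
qed

section \<open>Solutions on one edge\<close>

definition sqint :: "real \<Rightarrow> real \<Rightarrow> real \<Rightarrow> (real \<Rightarrow> real) \<Rightarrow> bool" where
  "sqint a b K f \<longleftrightarrow> f \<in> borel_measurable borel \<and> set_integrable lborel {a..b} (\<lambda>x. (f x)\<^sup>2) \<and>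
     (LBINT x:{a..b}. (f x)\<^sup>2) \<le> K"

lemma sqint_scale:
  assumes "sqint a b K f" shows "sqint a b (c\<^sup>2 * K) (\<lambda>x. c * f x)"
  using assms unfolding sqint_def by (auto simp: power_mult_distrib mult_left_mono)

lemma sqint_mono: "sqint a b K f \<Longrightarrow> K \<le> K' \<Longrightarrow> sqint a b K' f"
  by (auto simp: sqint_def)

lemma sqint_add:
  assumes f: "sqint a b K f" and g: "sqint a b K' g"
  shows "sqint a b (2 * K + 2 * K') (\<lambda>x. f x + g x)"
proof -
  have [measurable]: "f \<in> borel_measurable borel" "g \<in> borel_measurable borel" using f g by (auto simp: sqint_def)
  have i: "set_integrable lborel {a..b} (\<lambda>x. 2 * (f x)\<^sup>2 + 2 * (g x)\<^sup>2)"
    using f g by (intro set_integral_add) (auto simp: sqint_def)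
  have m: "(\<lambda>x. indicator {a..b} x *\<^sub>R (f x + g x)\<^sup>2) \<in> borel_measurable lborel" by measurable
  have i2: "set_integrable lborel {a..b} (\<lambda>x. (f x + g x)\<^sup>2)"
    unfolding set_integrable_def
  proof (rule LINT_integrable_bound[OF i[unfolded set_integrable_def] m], rule AE_I2)
    fix x
    show "norm (indicator {a..b} x *\<^sub>R (f x + g x)\<^sup>2) \<le> norm (indicator {a..b} x *\<^sub>R (2 * (f x)\<^sup>2 + 2 * (g x)\<^sup>2))"
      using sum_sq_le[of "f x" "g x"] by (simp add: indicator_def)
  qed
  have "(LBINT x:{a..b}. (f x + g x)\<^sup>2) \<le> (LBINT x:{a..b}. 2 * (f x)\<^sup>2 + 2 * (g x)\<^sup>2)"
    by (rule set_integral_mono[OF i2 i]) (rule sum_sq_le)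
  also have "\<dots> = 2 * (LBINT x:{a..b}. (f x)\<^sup>2) + 2 * (LBINT x:{a..b}. (g x)\<^sup>2)"
    using f g by (subst set_integral_add(2)) (auto simp: sqint_def)
  also have "\<dots> \<le> 2 * K + 2 * K'" using f g by (auto simp: sqint_def)
  finally show ?thesis using i2 by (auto simp: sqint_def)
qed

lemma sqint_integrable: "sqint a b K f \<Longrightarrow> a \<le> c \<Longrightarrow> d \<le> b \<Longrightarrow> set_integrable lborel {c..d} f"
proof -
  assume *: "sqint a b K f" "a \<le> c" "d \<le> b"
  hence "set_integrable lborel {a..b} f" using set_integrable_if_square by (auto simp: sqint_def)
  thus ?thesis by (rule set_integrable_subset) (use * in auto)
qed

lemma slice_measurable:
  fixes f :: "real \<times> real \<Rightarrow> real"
  assumes [measurable]: "f \<in> borel_measurable borel"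
  shows "(\<lambda>x. f (x, s)) \<in> borel_measurable borel" "(\<lambda>s. f (x, s)) \<in> borel_measurable borel"
  by measurable

lemma set_integral_param_integrable:
  fixes h :: "real \<times> real \<Rightarrow> real"
  assumes [measurable]: "h \<in> borel_measurable borel" and B: "\<And>z. \<bar>h z\<bar> \<le> B"
  shows "set_integrable lborel {c..d} (\<lambda>x. h (x, r))" "set_integrable lborel {a..b} (\<lambda>r. LBINT x:{c..d}. h (x, r))"
proof -
  have B0: "B \<ge> 0" using order_trans[OF abs_ge_zero B[of undefined]] .
  have "set_integrable lborel {c..d} (\<lambda>x. h (x, r))" for r
    unfolding set_integrable_def
    by (rule integrable_bounded_support[where M=B and a=c and b=d]) (use B B0 in \<open>auto simp: indicator_def\<close>)
  thus "set_integrable lborel {c..d} (\<lambda>x. h (x, r))" .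
  have "integrable (lborel2) (\<lambda>z. indicator {a..b} (fst z) * (indicator {c..d} (snd z) * h (snd z, fst z)))"
    by (rule integrable_bounded_support_plane[where M=B and a=a and b=b and c=c and d=d])
       (use B B0 in \<open>auto simp: indicator_def\<close>)
  from lborel_pair.integrable_fst'[OF this]
  show "set_integrable lborel {a..b} (\<lambda>r. LBINT x:{c..d}. h (x, r))"
    by (simp add: set_integrable_def set_LINT_def)
qed

text \<open>The last clause is the integrated form of \<open>u\<^sub>t\<^sub>t - u\<^sub>x\<^sub>x = h\<close> over the rectangle
  \<open>[0, y] \<times> [- S, s]\<close>. Time runs over \<open>s \<le> 0\<close>, with \<open>s = 0\<close> the final time.\<close>

definition edge_sol :: "real \<Rightarrow> real \<Rightarrow> real \<Rightarrow> (real \<times> real \<Rightarrow> real) \<Rightarrow> (real \<times> real \<Rightarrow> real) \<Rightarrow>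
    (real \<times> real \<Rightarrow> real) \<Rightarrow> (real \<times> real \<Rightarrow> real) \<Rightarrow> bool" where
  "edge_sol l S K h u ux ut \<longleftrightarrow>
     (ux \<in> borel_measurable borel \<and> ut \<in> borel_measurable borel \<and> h \<in> borel_measurable borel \<and> (\<exists>B. \<forall>z. \<bar>h z\<bar> \<le> B)) \<and>
     (\<forall>x\<in>{0..l}. \<forall>s\<le>-S. u (x, s) = 0 \<and> ux (x, s) = 0 \<and> ut (x, s) = 0) \<and>
     (\<forall>x\<in>{0..l}. \<forall>s\<le>0. (u (x, s))\<^sup>2 \<le> K) \<and>
     (\<forall>s\<le>0. sqint 0 l K (\<lambda>x. ux (x, s)) \<and> sqint 0 l K (\<lambda>x. ut (x, s))) \<and>
     (\<forall>x\<in>{0..l}. sqint (- S) 0 K (\<lambda>s. ux (x, s)) \<and> sqint (- S) 0 K (\<lambda>s. ut (x, s))) \<and>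
     (\<forall>x\<in>{0..l}. \<forall>s\<le>0. u (x, s) = u (0, s) + (LBINT y:{0..x}. ux (y, s))) \<and>
     (\<forall>x\<in>{0..l}. \<forall>s\<in>{-S..0}. u (x, s) = (LBINT r:{-S..s}. ut (x, r))) \<and>
     (\<forall>s\<le>0. ((\<lambda>r. LBINT x:{0..l}. (ux (x, r) - ux (x, s))\<^sup>2) \<longlongrightarrow> 0) (at s within {..0}) \<and>
        ((\<lambda>r. LBINT x:{0..l}. (ut (x, r) - ut (x, s))\<^sup>2) \<longlongrightarrow> 0) (at s within {..0})) \<and>
     (\<forall>y\<in>{0..l}. \<forall>s\<in>{-S..0}. (LBINT x:{0..y}. ut (x, s)) =
        (LBINT r:{-S..s}. ux (y, r) - ux (0, r)) + (LBINT r:{-S..s}. (LBINT x:{0..y}. h (x, r))))"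

lemma edge_solD:
  assumes "edge_sol l S K h u ux ut"
  shows "ux \<in> borel_measurable borel" "ut \<in> borel_measurable borel" "h \<in> borel_measurable borel" "\<exists>B. \<forall>z. \<bar>h z\<bar> \<le> B"
    "x \<in> {0..l} \<Longrightarrow> s \<le> - S \<Longrightarrow> u (x, s) = 0" "x \<in> {0..l} \<Longrightarrow> s \<le> - S \<Longrightarrow> ux (x, s) = 0"
    "x \<in> {0..l} \<Longrightarrow> s \<le> - S \<Longrightarrow> ut (x, s) = 0"
    "x \<in> {0..l} \<Longrightarrow> s \<le> 0 \<Longrightarrow> (u (x, s))\<^sup>2 \<le> K"
    "s \<le> 0 \<Longrightarrow> sqint 0 l K (\<lambda>x. ux (x, s))" "s \<le> 0 \<Longrightarrow> sqint 0 l K (\<lambda>x. ut (x, s))"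
    "x \<in> {0..l} \<Longrightarrow> sqint (- S) 0 K (\<lambda>s. ux (x, s))" "x \<in> {0..l} \<Longrightarrow> sqint (- S) 0 K (\<lambda>s. ut (x, s))"
    "x \<in> {0..l} \<Longrightarrow> s \<le> 0 \<Longrightarrow> u (x, s) = u (0, s) + (LBINT y:{0..x}. ux (y, s))"
    "x \<in> {0..l} \<Longrightarrow> s \<in> {-S..0} \<Longrightarrow> u (x, s) = (LBINT r:{-S..s}. ut (x, r))"
    "s \<le> 0 \<Longrightarrow> ((\<lambda>r. LBINT x:{0..l}. (ux (x, r) - ux (x, s))\<^sup>2) \<longlongrightarrow> 0) (at s within {..0})"
    "s \<le> 0 \<Longrightarrow> ((\<lambda>r. LBINT x:{0..l}. (ut (x, r) - ut (x, s))\<^sup>2) \<longlongrightarrow> 0) (at s within {..0})"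
    "y \<in> {0..l} \<Longrightarrow> s \<in> {-S..0} \<Longrightarrow> (LBINT x:{0..y}. ut (x, s)) =
        (LBINT r:{-S..s}. ux (y, r) - ux (0, r)) + (LBINT r:{-S..s}. (LBINT x:{0..y}. h (x, r)))"
  using assms unfolding edge_sol_def by blast+

lemma L2_continuity_add:
  assumes f: "\<And>s. s \<le> 0 \<Longrightarrow> sqint 0 l K (\<lambda>x. f (x, s))" and g: "\<And>s. s \<le> 0 \<Longrightarrow> sqint 0 l K' (\<lambda>x. g (x, s))"
    and fl: "((\<lambda>r. LBINT x:{0..l}. (f (x, r) - f (x, s))\<^sup>2) \<longlongrightarrow> 0) (at s within {..0})"
    and gl: "((\<lambda>r. LBINT x:{0..l}. (g (x, r) - g (x, s))\<^sup>2) \<longlongrightarrow> 0) (at s within {..0})" and s: "s \<le> (0::real)"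
  shows "((\<lambda>r. LBINT x:{0..l}. ((f (x, r) + g (x, r)) - (f (x, s) + g (x, s)))\<^sup>2) \<longlongrightarrow> 0) (at s within {..0})"
proof (rule tendsto_sandwich[OF _ _ tendsto_const])
  have "((\<lambda>r. 2 * (LBINT x:{0..l}. (f (x, r) - f (x, s))\<^sup>2) + 2 * (LBINT x:{0..l}. (g (x, r) - g (x, s))\<^sup>2)) \<longlongrightarrow> 2 * 0 + 2 * 0) (at s within {..0})"
    by (intro tendsto_intros fl gl)
  thus "((\<lambda>r. 2 * (LBINT x:{0..l}. (f (x, r) - f (x, s))\<^sup>2) + 2 * (LBINT x:{0..l}. (g (x, r) - g (x, s))\<^sup>2)) \<longlongrightarrow> 0) (at s within {..0})"
    by simp
  show "\<forall>\<^sub>F r in at s within {..0}. 0 \<le> (LBINT x:{0..l}. ((f (x, r) + g (x, r)) - (f (x, s) + g (x, s)))\<^sup>2)"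
    unfolding set_LINT_def by (intro always_eventually allI LINT_nonneg) auto
  have "\<forall>\<^sub>F r in at s within {..0}. r \<le> 0" by (auto simp: eventually_at_filter)
  thus "\<forall>\<^sub>F r in at s within {..0}. (LBINT x:{0..l}. ((f (x, r) + g (x, r)) - (f (x, s) + g (x, s)))\<^sup>2)
     \<le> 2 * (LBINT x:{0..l}. (f (x, r) - f (x, s))\<^sup>2) + 2 * (LBINT x:{0..l}. (g (x, r) - g (x, s))\<^sup>2)"
  proof eventually_elim
    case (elim r)
    have d: "sqint 0 l (LBINT x:{0..l}. (p (x, r) - p (x, s))\<^sup>2) (\<lambda>x. p (x, r) - p (x, s))"
      if "\<And>s. s \<le> 0 \<Longrightarrow> sqint 0 l C (\<lambda>x. p (x, s))" for p :: "real \<times> real \<Rightarrow> real" and C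
      using sqint_add[OF that[OF elim] sqint_scale[OF that[OF s], of "-1"]] by (simp add: sqint_def)
    from sqint_add[OF d[OF f] d[OF g]] show ?case by (simp add: sqint_def algebra_simps)
  qed
qed

lemma edge_sol_add:
  assumes 1: "edge_sol l S K h u ux ut" and 2: "edge_sol l S K' h' u' ux' ut'" and l: "l \<ge> 0" and S: "S \<ge> 0"
  shows "edge_sol l S (2 * K + 2 * K') (\<lambda>z. h z + h' z) (\<lambda>z. u z + u' z) (\<lambda>z. ux z + ux' z) (\<lambda>z. ut z + ut' z)"
proof -
  note d1 = edge_solD[OF 1] and d2 = edge_solD[OF 2]
  from d1(4) d2(4) obtain B B' where B: "\<And>z. \<bar>h z\<bar> \<le> B" and B': "\<And>z. \<bar>h' z\<bar> \<le> B'" by blast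
  have hb: "\<bar>h z + h' z\<bar> \<le> B + B'" for z using B[of z] B'[of z] by linarith
  have 6: "u (x, s) + u' (x, s) = u (0, s) + u' (0, s) + (LBINT y:{0..x}. ux (y, s) + ux' (y, s))"
    if "x \<in> {0..l}" "s \<le> 0" for x s
    using d1(13)[OF that] d2(13)[OF that] sqint_integrable[OF d1(9)[OF that(2)], of 0 x] sqint_integrable[OF d2(9)[OF that(2)], of 0 x] that
    by simp
  have 7: "u (x, s) + u' (x, s) = (LBINT r:{-S..s}. ut (x, r) + ut' (x, r))"
    if "x \<in> {0..l}" "s \<in> {-S..0}" for x s
    using d1(14)[OF that] d2(14)[OF that] sqint_integrable[OF d1(12)[OF that(1)], of "-S" s] sqint_integrable[OF d2(12)[OF that(1)], of "-S" s] that
    by simp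
  have 9: "(LBINT x:{0..y}. ut (x, s) + ut' (x, s)) =
        (LBINT r:{-S..s}. (ux (y, r) + ux' (y, r)) - (ux (0, r) + ux' (0, r))) + (LBINT r:{-S..s}. (LBINT x:{0..y}. h (x, r) + h' (x, r)))"
    if that: "y \<in> {0..l}" "s \<in> {-S..0}" for y s
  proof -
    have s0: "s \<le> 0" and l0: "0 \<in> {0..l}" using that l by auto
    have i: "set_integrable lborel {-S..s} (\<lambda>r. ux (y, r))" "set_integrable lborel {-S..s} (\<lambda>r. ux (0, r))"
      "set_integrable lborel {-S..s} (\<lambda>r. ux' (y, r))" "set_integrable lborel {-S..s} (\<lambda>r. ux' (0, r))"
      using sqint_integrable[OF d1(11)[OF that(1)], of "-S" s] sqint_integrable[OF d2(11)[OF that(1)], of "-S" s]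
        sqint_integrable[OF d1(11)[OF l0], of "-S" s] sqint_integrable[OF d2(11)[OF l0], of "-S" s] s0 by auto
    have a: "(LBINT r:{-S..s}. (ux (y, r) + ux' (y, r)) - (ux (0, r) + ux' (0, r))) =
      (LBINT r:{-S..s}. ux (y, r) - ux (0, r)) + (LBINT r:{-S..s}. ux' (y, r) - ux' (0, r))"
      using i by simp
    have b: "(LBINT r:{-S..s}. (LBINT x:{0..y}. h (x, r) + h' (x, r))) =
       (LBINT r:{-S..s}. (LBINT x:{0..y}. h (x, r))) + (LBINT r:{-S..s}. (LBINT x:{0..y}. h' (x, r)))"
      using set_integral_param_integrable[OF d1(3) B] set_integral_param_integrable[OF d2(3) B'] by simp
    have c: "(LBINT x:{0..y}. ut (x, s) + ut' (x, s)) = (LBINT x:{0..y}. ut (x, s)) + (LBINT x:{0..y}. ut' (x, s))"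
      using sqint_integrable[OF d1(10)[OF s0], of 0 y] sqint_integrable[OF d2(10)[OF s0], of 0 y] that by simp
    show ?thesis unfolding a b c d1(17)[OF that] d2(17)[OF that] by simp
  qed
  have 3: "(u (x, s) + u' (x, s))\<^sup>2 \<le> 2 * K + 2 * K'" if "x \<in> {0..l}" "s \<le> 0" for x s
    using sum_sq_le[of "u (x, s)" "u' (x, s)"] d1(8)[OF that] d2(8)[OF that] by linarith
  have 8: "((\<lambda>r. LBINT x:{0..l}. ((ux (x, r) + ux' (x, r)) - (ux (x, s) + ux' (x, s)))\<^sup>2) \<longlongrightarrow> 0) (at s within {..0})"
     "((\<lambda>r. LBINT x:{0..l}. ((ut (x, r) + ut' (x, r)) - (ut (x, s) + ut' (x, s)))\<^sup>2) \<longlongrightarrow> 0) (at s within {..0})"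
    if "s \<le> 0" for s
    using L2_continuity_add[OF d1(9) d2(9) d1(15)[OF that] d2(15)[OF that] that]
      L2_continuity_add[OF d1(10) d2(10) d1(16)[OF that] d2(16)[OF that] that] by auto
  have m: "(\<lambda>z. ux z + ux' z) \<in> borel_measurable borel" "(\<lambda>z. ut z + ut' z) \<in> borel_measurable borel" "(\<lambda>z. h z + h' z) \<in> borel_measurable borel"
    using d1(1-3) d2(1-3) by auto
  show ?thesis
    unfolding edge_sol_def
    apply (intro conjI ballI allI impI)
    subgoal by (rule m)
    subgoal by (rule m)
    subgoal by (rule m)
    subgoal using hb by blast
    subgoal for x s using d1(5)[of x s] d2(5)[of x s] by simp
    subgoal for x s using d1(6)[of x s] d2(6)[of x s] by simp
    subgoal for x s using d1(7)[of x s] d2(7)[of x s] by simp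
    subgoal by (rule 3)
    subgoal by (rule sqint_add[OF d1(9) d2(9)])
    subgoal by (rule sqint_add[OF d1(10) d2(10)])
    subgoal by (rule sqint_add[OF d1(11) d2(11)])
    subgoal by (rule sqint_add[OF d1(12) d2(12)])
    subgoal by (rule 6)
    subgoal by (rule 7)
    subgoal by (rule 8)
    subgoal by (rule 8)
    subgoal by (rule 9)
    done
qed

lemma edge_sol_scale:
  assumes 1: "edge_sol l S K h u ux ut"
  shows "edge_sol l S (c\<^sup>2 * K) (\<lambda>z. c * h z) (\<lambda>z. c * u z) (\<lambda>z. c * ux z) (\<lambda>z. c * ut z)"
proof -
  note d1 = edge_solD[OF 1]
  from d1(4) obtain B where B: "\<And>z. \<bar>h z\<bar> \<le> B" by blast
  have L: "((\<lambda>r. LBINT x:{0..l}. (c * f (x, r) - c * f (x, s))\<^sup>2) \<longlongrightarrow> 0) (at s within {..0})"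
    if f: "((\<lambda>r. LBINT x:{0..l}. (f (x, r) - f (x, s))\<^sup>2) \<longlongrightarrow> 0) (at s within {..0})" for f :: "real \<times> real \<Rightarrow> real" and s
  proof -
    have "(\<lambda>r. LBINT x:{0..l}. (c * f (x, r) - c * f (x, s))\<^sup>2) = (\<lambda>r. c\<^sup>2 * (LBINT x:{0..l}. (f (x, r) - f (x, s))\<^sup>2))"
      by (simp add: right_diff_distrib[symmetric] power_mult_distrib)
    moreover have "((\<lambda>r. c\<^sup>2 * (LBINT x:{0..l}. (f (x, r) - f (x, s))\<^sup>2)) \<longlongrightarrow> c\<^sup>2 * 0) (at s within {..0})"
      by (intro tendsto_intros f)
    ultimately show ?thesis by simp
  qed
  have hb: "\<bar>c * h z\<bar> \<le> \<bar>c\<bar> * B" for z using B[of z] by (simp add: abs_mult mult_left_mono)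
  have m: "(\<lambda>z. c * ux z) \<in> borel_measurable borel" "(\<lambda>z. c * ut z) \<in> borel_measurable borel" "(\<lambda>z. c * h z) \<in> borel_measurable borel"
    using d1(1-3) by auto
  have 9: "(LBINT x:{0..y}. c * ut (x, s)) =
        (LBINT r:{-S..s}. c * ux (y, r) - c * ux (0, r)) + (LBINT r:{-S..s}. (LBINT x:{0..y}. c * h (x, r)))"
    if "y \<in> {0..l}" "s \<in> {-S..0}" for y s
    using d1(17)[OF that] by (simp add: right_diff_distrib[symmetric] distrib_left)
  show ?thesis
    unfolding edge_sol_def
    apply (intro conjI ballI allI impI)
    subgoal by (rule m)
    subgoal by (rule m)
    subgoal by (rule m)
    subgoal using hb by blast
    subgoal for x s using d1(5)[of x s] by simp
    subgoal for x s using d1(6)[of x s] by simp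
    subgoal for x s using d1(7)[of x s] by simp
    subgoal for x s using d1(8)[of x s] by (simp add: power_mult_distrib mult_left_mono)
    subgoal by (rule sqint_scale[OF d1(9)])
    subgoal by (rule sqint_scale[OF d1(10)])
    subgoal by (rule sqint_scale[OF d1(11)])
    subgoal by (rule sqint_scale[OF d1(12)])
    subgoal for x s using d1(13)[of x s] by (simp add: distrib_left)
    subgoal for x s using d1(14)[of x s] by simp
    subgoal by (rule L[OF d1(15)])
    subgoal by (rule L[OF d1(16)])
    subgoal by (rule 9)
    done
qed

section \<open>Travelling waves and Goursat integrals as edge solutions\<close>

lemma AC2_int_shift:
  assumes "AC2 A a" "p \<le> q" shows "(LBINT r:{p..q}. a (r + c)) = A (q + c) - A (p + c)"
  using AC2_diff[OF AC2_shift[OF assms(1)] assms(2)] by simp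

lemma set_integral_reflect_Icc:
  fixes f :: "real \<Rightarrow> real"
  shows "(LBINT y:{a..b}. f (c - y)) = (LBINT y:{c - b..c - a}. f y)"
    "set_integrable lborel {c - b..c - a} f \<Longrightarrow> set_integrable lborel {a..b} (\<lambda>y. f (c - y))"
proof -
  have e: "indicator {c - b..c - a} (c + - 1 * y) *\<^sub>R f (c + - 1 * y) = indicator {a..b} y *\<^sub>R f (c - y)" for y
    by (auto simp: indicator_def)
  have "(LBINT y:{c - b..c - a}. f y) = (LBINT y. indicator {c - b..c - a} (c + - 1 * y) *\<^sub>R f (c + - 1 * y))"
    unfolding set_LINT_def by (subst lborel_integral_real_affine[where c="-1" and t=c]) auto
  thus "(LBINT y:{a..b}. f (c - y)) = (LBINT y:{c - b..c - a}. f y)"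
    unfolding e by (simp add: set_LINT_def)
  assume "set_integrable lborel {c - b..c - a} f"
  from lborel_integrable_real_affine[OF this[unfolded set_integrable_def], of "-1" c]
  show "set_integrable lborel {a..b} (\<lambda>y. f (c - y))" unfolding e set_integrable_def by simp
qed

lemma set_integral_reflect:
  fixes f :: "real \<Rightarrow> real"
  shows "(LBINT x:{0..y}. f (y - x)) = (LBINT x:{0..y}. f x)"
  using set_integral_reflect_Icc(1)[of 0 y f y] by simp

text \<open>Every clause reduces to the profile: translation and reflection preserve the L^2 norm,
  which gives the energy bounds; time continuity is the continuity of translations in L^2; and as
  u_t = \<sigma> u_x, the integrated wave equation is the fundamental theorem for A.\<close>

lemma edge_sol_wave:
  assumes A: "AC2 A a" and \<sigma>: "\<sigma> = 1 \<or> \<sigma> = -1" and K: "\<And>z. (A z)\<^sup>2 \<le> K" "(LBINT z. (a z)\<^sup>2) \<le> K"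
    and z: "\<And>x s. x \<in> {0..l} \<Longrightarrow> s \<le> - S \<Longrightarrow> a (s + \<sigma> * x + c) = 0" and l: "l \<ge> 0"
  shows "edge_sol l S K (\<lambda>_. 0) (\<lambda>(x, s). A (s + \<sigma> * x + c)) (\<lambda>(x, s). \<sigma> * a (s + \<sigma> * x + c)) (\<lambda>(x, s). a (s + \<sigma> * x + c))"
proof -
  note [measurable] = AC2_D(1)[OF A]
  have \<sigma>2: "\<sigma> * \<sigma> = 1" "\<sigma>\<^sup>2 = 1" "\<bar>\<sigma>\<bar> = 1" "\<sigma> \<noteq> 0" using \<sigma> by auto
  note a2 = AC2_D(2)[OF A]
  have aff: "integrable lborel (\<lambda>x. f (p + \<sigma> * x))" "(LBINT x. f (p + \<sigma> * x)) = (LBINT x. f x)"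
    if "integrable lborel f" for f :: "real \<Rightarrow> real" and p
    using lborel_integrable_real_affine[OF that \<sigma>2(4), of p] lborel_integral_real_affine[OF \<sigma>2(4), of f p] \<sigma>2(3) by auto
  have aff1: "integrable lborel (\<lambda>s. f (p + s))" "(LBINT s. f (p + s)) = (LBINT x. f x)"
    if "integrable lborel f" for f :: "real \<Rightarrow> real" and p
    using lborel_integrable_real_affine[OF that, of 1 p] lborel_integral_real_affine[of 1 f p] by auto
  have A0: "A (s + \<sigma> * x + c) = 0" if "x \<in> {0..l}" "s \<le> - S" for x s
  proof (rule AC2_zero[OF A])
    fix w assume "w \<le> s + \<sigma> * x + c"
    thus "a w = 0" using z[OF that(1), of "w - \<sigma> * x - c"] that by (simp add: algebra_simps)
  qed
  have sub: "set_integrable lborel S f" "(LBINT x:S. f x) \<le> (LBINT x. f x)"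
    if "integrable lborel f" "\<And>x. f x \<ge> 0" "S \<in> sets borel" for f :: "real \<Rightarrow> real" and S
  proof -
    show s: "set_integrable lborel S f" using that by (intro set_integrable_if_integrable) auto
    show "(LBINT x:S. f x) \<le> (LBINT x. f x)" unfolding set_LINT_def
      by (rule integral_mono[OF s[unfolded set_integrable_def] that(1)]) (use that(2) in \<open>auto simp: indicator_def\<close>)
  qed
  have sq4: "sqint 0 l K (\<lambda>x. \<tau> * a (s + \<sigma> * x + c))" if \<tau>: "\<tau>\<^sup>2 = 1" for s \<tau>
    unfolding sqint_def
  proof (intro conjI)
    have e: "(\<tau> * a (s + \<sigma> * x + c))\<^sup>2 = (a ((s + c) + \<sigma> * x))\<^sup>2" for x using \<tau> by (simp add: power_mult_distrib algebra_simps)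
    show "set_integrable lborel {0..l} (\<lambda>x. (\<tau> * a (s + \<sigma> * x + c))\<^sup>2)" unfolding e using sub(1)[OF aff(1)[OF a2]] by simp
    show "(LBINT x:{0..l}. (\<tau> * a (s + \<sigma> * x + c))\<^sup>2) \<le> K" unfolding e
      using sub(2)[OF aff(1)[OF a2, of "s+c"], of "{0..l}"] aff(2)[OF a2, of "s+c"] K(2) by simp
  qed measurable
  have sq5: "sqint (- S) 0 K (\<lambda>s. \<tau> * a (s + \<sigma> * x + c))" if \<tau>: "\<tau>\<^sup>2 = 1" for x \<tau>
    unfolding sqint_def
  proof (intro conjI)
    have e: "(\<tau> * a (s + \<sigma> * x + c))\<^sup>2 = (a ((\<sigma> * x + c) + s))\<^sup>2" for s using \<tau> by (simp add: power_mult_distrib algebra_simps)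
    show "set_integrable lborel {-S..0} (\<lambda>s. (\<tau> * a (s + \<sigma> * x + c))\<^sup>2)" unfolding e using sub(1)[OF aff1(1)[OF a2]] by simp
    show "(LBINT s:{-S..0}. (\<tau> * a (s + \<sigma> * x + c))\<^sup>2) \<le> K" unfolding e
      using sub(2)[OF aff1(1)[OF a2, of "\<sigma> * x + c"], of "{-S..0}"] aff1(2)[OF a2, of "\<sigma> * x + c"] K(2) by simp
  qed measurable
  have wint: "(LBINT y:{0..x}. a (s + \<sigma> * y + c)) = \<sigma> * (A (s + \<sigma> * x + c) - A (s + c))" if x: "x \<ge> 0" for x s
  proof (cases "\<sigma> = 1")
    case True
    have "(LBINT y:{0..x}. a (s + \<sigma> * y + c)) = (LBINT y:{0..x}. a (y + (s + c)))" using True by (simp add: algebra_simps)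
    also have "\<dots> = A (x + (s + c)) - A (0 + (s + c))" by (rule AC2_int_shift[OF A x])
    finally show ?thesis using True by (simp add: algebra_simps)
  next
    case False
    hence F: "\<sigma> = -1" using \<sigma> by simp
    have "(LBINT y:{0..x}. a (s + \<sigma> * y + c)) = (LBINT y:{0..x}. a ((x - y) + (s - x + c)))" using F by (simp add: algebra_simps)
    also have "\<dots> = (LBINT y:{0..x}. a (y + (s - x + c)))" by (rule set_integral_reflect[of x "\<lambda>y. a (y + (s - x + c))"])
    also have "\<dots> = A (x + (s - x + c)) - A (0 + (s - x + c))" by (rule AC2_int_shift[OF A x])
    finally show ?thesis using F by (simp add: algebra_simps)
  qed
  have tint: "(LBINT r:{-S..s}. a (r + \<sigma> * x + c)) = A (s + \<sigma> * x + c)" if "x \<in> {0..l}" "s \<ge> - S" for x s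
    using AC2_int_shift[OF A that(2), of "\<sigma> * x + c"] A0[OF that(1), of "- S"] by (simp add: algebra_simps)
  have tr: "((\<lambda>r. LBINT x:{0..l}. (\<tau> * a (r + \<sigma> * x + c) - \<tau> * a (s + \<sigma> * x + c))\<^sup>2) \<longlongrightarrow> 0) (at s within {..0})"
    if \<tau>: "\<tau>\<^sup>2 = 1" for s \<tau>
  proof (rule tendsto_sandwich[OF _ _ tendsto_const])
    obtain R where R: "\<And>x. R < \<bar>x\<bar> \<Longrightarrow> a x = 0" using A by (auto simp: AC2_def)
    have "((\<lambda>r. r - s) \<longlongrightarrow> s - s) (at s within {..0})" by (intro tendsto_intros)
    hence "filterlim (\<lambda>r. r - s) (at 0) (at s within {..0})" 
      by (auto simp: filterlim_at eventually_at_filter)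
    from filterlim_compose[OF L2_translation[OF AC2_D(1)[OF A] a2 R] this]
    show "((\<lambda>r. LBINT x. (a (x + (r - s)) - a x)\<^sup>2) \<longlongrightarrow> 0) (at s within {..0})" by simp
    show "\<forall>\<^sub>F r in at s within {..0}. 0 \<le> (LBINT x:{0..l}. (\<tau> * a (r + \<sigma> * x + c) - \<tau> * a (s + \<sigma> * x + c))\<^sup>2)"
      unfolding set_LINT_def by (intro always_eventually allI LINT_nonneg) auto
    show "\<forall>\<^sub>F r in at s within {..0}. (LBINT x:{0..l}. (\<tau> * a (r + \<sigma> * x + c) - \<tau> * a (s + \<sigma> * x + c))\<^sup>2) \<le> (LBINT x. (a (x + (r - s)) - a x)\<^sup>2)"
    proof (intro always_eventually allI)
      fix r
      have i: "integrable lborel (\<lambda>x. (a (x + (r - s)) - a x)\<^sup>2)"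
        using AC2_D(2)[OF AC2_add[OF AC2_shift[OF A, of "r - s"] AC2_scale[OF A, of "-1"]]] by simp
      have e: "(\<tau> * a (r + \<sigma> * x + c) - \<tau> * a (s + \<sigma> * x + c))\<^sup>2 = (a ((s + c) + \<sigma> * x + (r - s)) - a ((s + c) + \<sigma> * x))\<^sup>2" for x
        unfolding right_diff_distrib[symmetric] power_mult_distrib \<tau> by (simp add: algebra_simps)
      show "(LBINT x:{0..l}. (\<tau> * a (r + \<sigma> * x + c) - \<tau> * a (s + \<sigma> * x + c))\<^sup>2) \<le> (LBINT x. (a (x + (r - s)) - a x)\<^sup>2)"
        unfolding e using sub(2)[OF aff(1)[OF i, of "s + c"], of "{0..l}"] aff(2)[OF i, of "s+c"] by simp
    qed
  qed
  have 9: "(LBINT x:{0..y}. a (s + \<sigma> * x + c)) =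
        (LBINT r:{-S..s}. \<sigma> * a (r + \<sigma> * y + c) - \<sigma> * a (r + \<sigma> * 0 + c)) + (LBINT r:{-S..s}. (LBINT x:{0..y}. 0))"
    if "y \<in> {0..l}" "s \<in> {-S..0}" for y s
  proof -
    have l0: "0 \<in> {0..l}" using l by auto
    have i: "set_integrable lborel {-S..s} (\<lambda>r. \<sigma> * a (r + \<sigma> * x + c))" for x
      using sqint_integrable[OF sq5[OF \<sigma>2(2), of x], of "-S" s] that by auto
    have "(LBINT r:{-S..s}. \<sigma> * a (r + \<sigma> * y + c) - \<sigma> * a (r + \<sigma> * 0 + c)) =
      \<sigma> * A (s + \<sigma> * y + c) - \<sigma> * A (s + \<sigma> * 0 + c)"
      unfolding set_integral_diff(2)[OF i i] using tint[OF that(1), of s] tint[OF l0, of s] that by simp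
    thus ?thesis using wint[of y s] that by (simp add: algebra_simps)
  qed
  show ?thesis
    unfolding edge_sol_def prod.case
    apply (intro conjI ballI allI impI)
    subgoal unfolding case_prod_unfold by measurable
    subgoal unfolding case_prod_unfold by measurable
    subgoal by simp
    subgoal by auto
    subgoal by (rule A0)
    subgoal by (simp add: z)
    subgoal by (rule z)
    subgoal by (rule K)
    subgoal by (rule sq4[OF \<sigma>2(2)])
    subgoal using sq4[of 1] by simp
    subgoal by (rule sq5[OF \<sigma>2(2)])
    subgoal using sq5[of 1] by simp
    subgoal for x s using wint[of x s] \<sigma>2(1) by (simp add: mult.assoc[symmetric])
    subgoal for x s using tint[of x s] by simp
    subgoal by (rule tr[OF \<sigma>2(2)])
    subgoal using tr[of 1] by simp
    subgoal by (rule 9)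
    done
qed

text \<open>For C^1 functions only the integrated wave equation has to be supplied. The constant (1
  + l + S) B^2 dominates B^2, l B^2 and S B^2, the bounds for the pointwise clause and for the
  integrals in x and in time.\<close>

lemma edge_sol_C1:
  assumes l: "l \<ge> 0" and S: "S \<ge> 0" and B: "B \<ge> 0"
    and cx: "continuous_on UNIV ux" and ct: "continuous_on UNIV ut"
    and dx: "\<And>x s. ((\<lambda>x. u (x, s)) has_real_derivative ux (x, s)) (at x)"
    and dt: "\<And>x s. ((\<lambda>s. u (x, s)) has_real_derivative ut (x, s)) (at s)"
    and b: "\<And>z. \<bar>u z\<bar> \<le> B" "\<And>z. \<bar>ux z\<bar> \<le> B" "\<And>z. \<bar>ut z\<bar> \<le> B"
    and z: "\<And>x s. x \<in> {0..l} \<Longrightarrow> s \<le> - S \<Longrightarrow> u (x, s) = 0 \<and> ux (x, s) = 0 \<and> ut (x, s) = 0"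
    and h: "h \<in> borel_measurable borel" "\<And>z. \<bar>h z\<bar> \<le> Bh"
    and cons: "\<And>y s. y \<in> {0..l} \<Longrightarrow> s \<in> {-S..0} \<Longrightarrow> (LBINT x:{0..y}. ut (x, s)) =
        (LBINT r:{-S..s}. ux (y, r) - ux (0, r)) + (LBINT r:{-S..s}. (LBINT x:{0..y}. h (x, r)))"
  shows "edge_sol l S ((1 + l + S) * B\<^sup>2) h u ux ut"
proof -
  have m[measurable]: "ux \<in> borel_measurable borel" "ut \<in> borel_measurable borel"
    using cx ct by (auto intro: borel_measurable_continuous_onI)
  have slice: "continuous_on T (\<lambda>x. f (x, s))" "continuous_on T (\<lambda>s. f (x, s))" if "continuous_on UNIV f" for f :: "real \<times> real \<Rightarrow> real" and T s x
    by (rule continuous_on_compose2[OF that], auto intro!: continuous_intros)+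
  have sqB: "(f z)\<^sup>2 \<le> B\<^sup>2" if "\<And>z. \<bar>f z\<bar> \<le> B" for f :: "real \<times> real \<Rightarrow> real" and z
    using power_mono[OF that[of z], of 2] by simp
  have KB: "B\<^sup>2 \<le> (1 + l + S) * B\<^sup>2" "l * B\<^sup>2 \<le> (1 + l + S) * B\<^sup>2" "S * B\<^sup>2 \<le> (1 + l + S) * B\<^sup>2"
    using l S by (auto intro!: mult_right_mono simp: mult_le_cancel_right1)
  have sq: "sqint p q K f" if f: "f \<in> borel_measurable borel" "\<And>x. (f x)\<^sup>2 \<le> B\<^sup>2" "p \<le> q" "(q - p) * B\<^sup>2 \<le> K" for f p q K
    unfolding sqint_def
  proof (intro conjI)
    have [measurable]: "f \<in> borel_measurable borel" by (rule f)
    show i: "set_integrable lborel {p..q} (\<lambda>x. (f x)\<^sup>2)"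
      unfolding set_integrable_def
      by (rule integrable_bounded_support[where M="B\<^sup>2" and a=p and b=q]) (use f in \<open>auto simp: indicator_def\<close>)
    have "(LBINT x:{p..q}. (f x)\<^sup>2) \<le> (LBINT x:{p..q}. B\<^sup>2)"
      by (rule set_integral_mono[OF i set_integrable_const_Icc]) (rule f)
    also have "\<dots> = (q - p) * B\<^sup>2" using f by (simp add: set_integral_const)
    finally show "(LBINT x:{p..q}. (f x)\<^sup>2) \<le> K" using f by simp
  qed (rule f)
  have tr: "((\<lambda>r. LBINT x:{0..l}. (f (x, r) - f (x, s))\<^sup>2) \<longlongrightarrow> 0) (at s within {..0})"
    if f: "continuous_on UNIV f" "\<And>z. \<bar>f z\<bar> \<le> B" for f :: "real \<times> real \<Rightarrow> real" and s
    unfolding tendsto_at_iff_sequentially comp_def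
  proof (intro allI impI)
    fix X :: "nat \<Rightarrow> real" assume X: "X \<longlonglongrightarrow> s"
    have [measurable]: "f \<in> borel_measurable borel" using f by (auto intro: borel_measurable_continuous_onI)
    have "(\<lambda>n. LBINT x:{0..l}. (f (x, X n) - f (x, s))\<^sup>2) \<longlonglongrightarrow> (LBINT x:{0..l}. 0)"
      unfolding set_LINT_def
    proof (rule integral_dominated_convergence[where w="\<lambda>x. indicator {0..l} x * (4 * B\<^sup>2)"])
      show "integrable lborel (\<lambda>x. indicator {0..l} x * (4 * B\<^sup>2))"
        by (rule integrable_bounded_support[where M="4 * B\<^sup>2" and a=0 and b=l]) (auto simp: indicator_def)
      show "AE x in lborel. (\<lambda>n. indicat_real {0..l} x *\<^sub>R (f (x, X n) - f (x, s))\<^sup>2) \<longlonglongrightarrow> indicator {0..l} x *\<^sub>R 0"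
      proof (intro AE_I2)
        fix x
        have "isCont (\<lambda>s. f (x, s)) s" using slice(2)[OF f(1), of UNIV x] by (simp add: continuous_on_eq_continuous_at)
        from isCont_tendsto_compose[OF this X]
        have "(\<lambda>n. indicat_real {0..l} x *\<^sub>R (f (x, X n) - f (x, s))\<^sup>2) \<longlonglongrightarrow> indicator {0..l} x *\<^sub>R (f (x, s) - f (x, s))\<^sup>2"
          by (intro tendsto_intros)
        thus "(\<lambda>n. indicat_real {0..l} x *\<^sub>R (f (x, X n) - f (x, s))\<^sup>2) \<longlonglongrightarrow> indicator {0..l} x *\<^sub>R 0" by simp
      qed
      show "AE x in lborel. norm (indicat_real {0..l} x *\<^sub>R (f (x, X n) - f (x, s))\<^sup>2) \<le> indicator {0..l} x * (4 * B\<^sup>2)" for n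
      proof (intro AE_I2)
        fix x
        have "\<bar>f (x, X n) - f (x, s)\<bar> \<le> \<bar>2 * B\<bar>" using f(2)[of "(x, X n)"] f(2)[of "(x, s)"] by linarith
        hence "(f (x, X n) - f (x, s))\<^sup>2 \<le> 4 * B\<^sup>2" by (subst (asm) abs_le_square_iff) (simp add: power_mult_distrib)
        thus "norm (indicat_real {0..l} x *\<^sub>R (f (x, X n) - f (x, s))\<^sup>2) \<le> indicator {0..l} x * (4 * B\<^sup>2)" by (simp add: indicator_def)
      qed
    qed measurable
    thus "(\<lambda>n. LBINT x:{0..l}. (f (x, X n) - f (x, s))\<^sup>2) \<longlonglongrightarrow> 0" by simp
  qed
  have 6: "u (x, s) = u (0, s) + (LBINT y:{0..x}. ux (y, s))" if "x \<in> {0..l}" for x s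
    using set_integral_FTC[of 0 x "\<lambda>x. u (x, s)" "\<lambda>x. ux (x, s)"] that dx slice(1)[OF cx] by simp
  have 7: "u (x, s) = (LBINT r:{-S..s}. ut (x, r))" if "x \<in> {0..l}" "s \<in> {-S..0}" for x s
    using set_integral_FTC[of "-S" s "\<lambda>s. u (x, s)" "\<lambda>s. ut (x, s)"] that dt slice(2)[OF ct] z[OF that(1), of "-S"] by simp
  show ?thesis
    unfolding edge_sol_def prod.case
    apply (intro conjI ballI allI impI)
    subgoal by (rule m)
    subgoal by (rule m)
    subgoal by (rule h)
    subgoal using h(2) by blast
    subgoal using z by blast
    subgoal using z by blast
    subgoal using z by blast
    subgoal for x s by (rule order_trans[OF sqB[OF b(1)] KB(1)])
    subgoal by (rule sq[OF slice_measurable(1)[OF m(1)]], rule sqB[OF b(2)]) (use KB l in simp_all)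
    subgoal by (rule sq[OF slice_measurable(1)[OF m(2)]], rule sqB[OF b(3)]) (use KB l in simp_all)
    subgoal by (rule sq[OF slice_measurable(2)[OF m(1)]], rule sqB[OF b(2)]) (use KB S in simp_all)
    subgoal by (rule sq[OF slice_measurable(2)[OF m(2)]], rule sqB[OF b(3)]) (use KB S in simp_all)
    subgoal by (rule 6)
    subgoal by (rule 7)
    subgoal by (rule tr[OF cx b(2)])
    subgoal by (rule tr[OF ct b(3)])
    subgoal by (rule cons)
    done
qed

text \<open>The Goursat integral is only C^1, so its second derivatives are avoided:
  \<open>row_transport\<close> is applied to each of its two characteristic derivatives, and the
  sources 2 H add up to the 4 H of u_tt - u_xx = 4 u_ab. The support condition says that for s \<le>
  - S one characteristic coordinate is nonpositive. The bound M (R R + 2 R) covers both M R R for u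
  and 2 M R for its derivatives.\<close>

lemma edge_sol_gours:
  assumes H: "pc R M N H" and l: "l \<ge> 0" and S: "S \<ge> 0"
    and supp: "\<And>x. x \<in> {0..l} \<Longrightarrow> c - x \<le> S \<or> x + d \<le> S"
  shows "edge_sol l S ((1 + l + S) * (M * (R * R + 2 * R))\<^sup>2) (\<lambda>(x, s). 4 * H (s - x + c, s + x + d))
    (\<lambda>(x, s). gours H (s - x + c) (s + x + d))
    (\<lambda>(x, s). - row H (s - x + c) (s + x + d) + row (flip H) (s + x + d) (s - x + c))
    (\<lambda>(x, s). row H (s - x + c) (s + x + d) + row (flip H) (s + x + d) (s - x + c))"
proof -
  define Hs where "Hs z = H (prod.swap z)" for z
  have Hs: "pc R M (uminus ` N) Hs" unfolding Hs_def using pc_swap[OF H] .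
  have B: "bsrc R M H" and Bs: "bsrc R M Hs" using H Hs by (auto simp: pc_def)
  have R: "R \<ge> 0" and M: "M \<ge> 0" using bsrc_D[OF B] by auto
  note [measurable] = bsrc_D(1)[OF B] bsrc_D(1)[OF Bs]
  have z: "s - x + c \<le> 0 \<or> s + x + d \<le> 0" if "x \<in> {0..l}" "s \<le> - S" for x s using supp[OF that(1)] that by auto
  \<comment> \<open>Strict inequality, since H need not vanish on the axes themselves.\<close>
  have Hz: "H (s - x + c, s + x + d) = 0" if "x \<in> {0..l}" "s < - S" for x s
    by (rule bsrc_D(5)[OF B]) (use supp[OF that(1)] that in auto)
  have cH: "continuous_on UNIV (\<lambda>z. row H (snd z - fst z + c) (snd z + fst z + d))"
    by (rule row_compose_continuous[OF H]) (intro continuous_intros)+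
  have cHs: "continuous_on UNIV (\<lambda>z. row Hs (snd z + fst z + d) (snd z - fst z + c))"
    by (rule row_compose_continuous[OF Hs]) (intro continuous_intros)+
  have rl: "\<bar>row H a b\<bar> \<le> M * R" "\<bar>row Hs a b\<bar> \<le> M * R" for a b using row_le[OF B] row_le[OF Bs] by auto
  have gl: "\<bar>gours H a b\<bar> \<le> M * R * R" for a b by (rule gours_le[OF B])
  have Bd: "M * R * R \<le> M * (R * R + 2 * R)" "2 * (M * R) \<le> M * (R * R + 2 * R)" "0 \<le> M * (R * R + 2 * R)" using R M by (auto simp: algebra_simps)
  have Bt: "\<bar>row H a b + row Hs a' b'\<bar> \<le> M * (R * R + 2 * R)" "\<bar>- row H a b + row Hs a' b'\<bar> \<le> M * (R * R + 2 * R)" for a b a' b'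
    using rl(1)[of a b] rl(2)[of a' b'] Bd(2) by linarith+
  have restrict: "(LBINT r:{..s}. f r) = (LBINT r:{-S..s}. f r)" if "\<And>r. r < - S \<Longrightarrow> f r = 0" for f :: "real \<Rightarrow> real" and s
    unfolding set_LINT_def
  proof (rule LINT_cong)
    fix r show "indicator {..s} r *\<^sub>R f r = indicator {-S..s} r *\<^sub>R f r" using that[of r] by (cases "r < - S") (auto simp: indicator_def)
  qed simp
  have hb: "\<bar>(case z of (x, s) \<Rightarrow> 4 * H (s - x + c, s + x + d))\<bar> \<le> 4 * M" for z
    using bsrc_D(4)[OF B] by (cases z) (auto simp: abs_mult)
  have hm[measurable]: "(\<lambda>(x, s). H (s - x + c, s + x + d)) \<in> borel_measurable borel" unfolding case_prod_unfold by measurable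
  have hm4: "(\<lambda>(x, s). 4 * H (s - x + c, s + x + d)) \<in> borel_measurable borel" unfolding case_prod_unfold by measurable
  have cons: "(LBINT x:{0..y}. row H (s - x + c) (s + x + d) + row Hs (s + x + d) (s - x + c)) =
     (LBINT r:{-S..s}. (- row H (r - y + c) (r + y + d) + row Hs (r + y + d) (r - y + c)) - (- row H (r - 0 + c) (r + 0 + d) + row Hs (r + 0 + d) (r - 0 + c)))
     + (LBINT r:{-S..s}. (LBINT x:{0..y}. 4 * H (r - x + c, r + x + d)))"
    if y: "y \<in> {0..l}" and s: "s \<in> {-S..0}" for y s
  proof -
    have yy: "y \<ge> 0" and l0: "0 \<in> {0..l}" using y l by auto
    have rz: "row H (r - x + c) (r + x + d) = 0" "row Hs (r + x + d) (r - x + c) = 0" if "x \<in> {0..l}" "r < - S" for x r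
      using z[OF that(1), of r] that row_zero'[OF H] row_zero'[OF Hs] by auto
    have Iz: "(LBINT x:{0..y}. 2 * H (r - x + c, r + x + d)) = 0" if "r < - S" for r
    proof -
      have "(LBINT x:{0..y}. 2 * H (r - x + c, r + x + d)) = (LBINT x:{0..y}. 0)"
        by (rule set_lebesgue_integral_cong) (use Hz that y in auto)
      thus ?thesis by simp
    qed
    define I where "I = (LBINT r:{-S..s}. (LBINT x:{0..y}. 2 * H (r - x + c, r + x + d)))"
    have t1: "(LBINT x:{0..y}. row H (s - x + c) (s + x + d)) =
      (LBINT r:{-S..s}. row H (r + c) (r + d)) - (LBINT r:{-S..s}. row H (r - y + c) (r + y + d)) + I"
      using row_transport[OF H yy, of s c d] restrict[of "\<lambda>r. row H (r + c) (r + d)" s] rz(1)[OF l0]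
        restrict[of "\<lambda>r. row H (r - y + c) (r + y + d)" s] rz(1)[OF y] restrict[of "\<lambda>r. LBINT x:{0..y}. 2 * H (r - x + c, r + x + d)" s, OF Iz] by (simp add: I_def)
    \<comment> \<open>The reflection of x in [0,y] brings the other characteristic derivative, which
      travels in the opposite direction, into the form of \<open>row_transport\<close>; this
      exchanges the roles of the two ends and hence the signs.\<close>
    have t2: "(LBINT x:{0..y}. row Hs (s + x + d) (s - x + c)) =
      (LBINT r:{-S..s}. row Hs (r + y + d) (r - y + c)) - (LBINT r:{-S..s}. row Hs (r + d) (r + c)) + I"
    proof -
      have A: "(LBINT x:{0..y}. row Hs (s + x + d) (s - x + c)) = (LBINT x:{0..y}. row Hs (s - x + (d + y)) (s + x + (c - y)))"
        using set_integral_reflect[of y "\<lambda>x. row Hs (s + x + d) (s - x + c)"] by (simp add: algebra_simps)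
      have p1: "(LBINT r:{..s}. row Hs (r + (d + y)) (r + (c - y))) = (LBINT r:{-S..s}. row Hs (r + y + d) (r - y + c))"
        using restrict[of "\<lambda>r. row Hs (r + y + d) (r - y + c)" s] rz(2)[OF y] by (simp add: algebra_simps)
      have p2: "(LBINT r:{..s}. row Hs (r - y + (d + y)) (r + y + (c - y))) = (LBINT r:{-S..s}. row Hs (r + d) (r + c))"
        using restrict[of "\<lambda>r. row Hs (r + d) (r + c)" s] rz(2)[OF l0] by (simp add: algebra_simps)
      have inner: "(LBINT x:{0..y}. 2 * Hs (r - x + (d + y), r + x + (c - y))) = (LBINT x:{0..y}. 2 * H (r - x + c, r + x + d))" for r
        using set_integral_reflect[of y "\<lambda>x. 2 * H (r - x + c, r + x + d)"] by (simp add: Hs_def algebra_simps)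
      have p3: "(LBINT r:{..s}. (LBINT x:{0..y}. 2 * Hs (r - x + (d + y), r + x + (c - y)))) = I"
        unfolding inner I_def by (rule restrict) (rule Iz)
      show ?thesis unfolding A row_transport[OF Hs yy] p1 p2 p3 ..
    qed
    have iH: "set_integrable lborel {p..q} (\<lambda>x. row H (f x) (g x))" "set_integrable lborel {p..q} (\<lambda>x. row Hs (f x) (g x))"
      if "continuous_on {p..q} f" "continuous_on {p..q} g" for p q :: real and f g
    proof -
      show "set_integrable lborel {p..q} (\<lambda>x. row H (f x) (g x))"
        by (rule borel_integrable_atLeastAtMost', rule row_compose_continuous[OF H that])
      show "set_integrable lborel {p..q} (\<lambda>x. row Hs (f x) (g x))"
        by (rule borel_integrable_atLeastAtMost', rule row_compose_continuous[OF Hs that])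
    qed
    have I4: "(LBINT r:{-S..s}. (LBINT x:{0..y}. 4 * H (r - x + c, r + x + d))) = I + I"
    proof -
      have "(LBINT x:{0..y}. 4 * H (r - x + c, r + x + d)) = 2 * (LBINT x:{0..y}. 2 * H (r - x + c, r + x + d))" for r by simp
      thus ?thesis by (simp add: I_def)
    qed
    have e1: "(LBINT x:{0..y}. row H (s - x + c) (s + x + d) + row Hs (s + x + d) (s - x + c)) =
      (LBINT x:{0..y}. row H (s - x + c) (s + x + d)) + (LBINT x:{0..y}. row Hs (s + x + d) (s - x + c))"
      by (rule set_integral_add(2)) (intro iH continuous_intros)+
    have e2: "(LBINT r:{-S..s}. (- row H (r - y + c) (r + y + d) + row Hs (r + y + d) (r - y + c)) - (- row H (r - 0 + c) (r + 0 + d) + row Hs (r + 0 + d) (r - 0 + c)))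
      = (LBINT r:{-S..s}. (row Hs (r + y + d) (r - y + c) - row H (r - y + c) (r + y + d)) - (row Hs (r + d) (r + c) - row H (r + c) (r + d)))"
      by simp
    also have "\<dots> = (LBINT r:{-S..s}. row Hs (r + y + d) (r - y + c)) - (LBINT r:{-S..s}. row H (r - y + c) (r + y + d))
       - ((LBINT r:{-S..s}. row Hs (r + d) (r + c)) - (LBINT r:{-S..s}. row H (r + c) (r + d)))"
      by (subst set_integral_diff(2), (intro set_integral_diff(1) iH continuous_intros)+, subst (1 2) set_integral_diff(2), (intro iH continuous_intros)+) simp
    finally show ?thesis unfolding e1 t1 t2 I4 by simp
  qed
  have dx: "((\<lambda>x. gours H (s - x + c) (s + x + d)) has_real_derivative (- row H (s - x + c) (s + x + d) + row Hs (s + x + d) (s - x + c))) (at x)" for x s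
  proof -
    have "((\<lambda>x. s - x + c) has_real_derivative - 1) (at x)" "((\<lambda>x. s + x + d) has_real_derivative 1) (at x)"
      by (auto intro!: derivative_eq_intros)
    from gours_DERIV[OF H this] show ?thesis unfolding Hs_def[abs_def] by simp
  qed
  have dt: "((\<lambda>s. gours H (s - x + c) (s + x + d)) has_real_derivative (row H (s - x + c) (s + x + d) + row Hs (s + x + d) (s - x + c))) (at s)" for x s
  proof -
    have "((\<lambda>s. s - x + c) has_real_derivative 1) (at s)" "((\<lambda>s. s + x + d) has_real_derivative 1) (at s)"
      by (auto intro!: derivative_eq_intros)
    from gours_DERIV[OF H this] show ?thesis unfolding Hs_def[abs_def] by simp
  qed
  show ?thesis
    unfolding Hs_def[symmetric]
  proof (rule edge_sol_C1[OF l S Bd(3) _ _ _ _ _ _ _ _ hm4 hb])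
    show "continuous_on UNIV (\<lambda>(x, s). - row H (s - x + c) (s + x + d) + row Hs (s + x + d) (s - x + c))"
      unfolding case_prod_unfold by (intro continuous_on_add continuous_on_minus cH cHs)
    show "continuous_on UNIV (\<lambda>(x, s). row H (s - x + c) (s + x + d) + row Hs (s + x + d) (s - x + c))"
      unfolding case_prod_unfold by (intro continuous_on_add cH cHs)
  next
    fix x s assume "x \<in> {0..l}" "s \<le> - S"
    from z[OF this] show "(case (x, s) of (x, s) \<Rightarrow> gours H (s - x + c) (s + x + d)) = 0 \<and>
       (case (x, s) of (x, s) \<Rightarrow> - row H (s - x + c) (s + x + d) + row Hs (s + x + d) (s - x + c)) = 0 \<and>
       (case (x, s) of (x, s) \<Rightarrow> row H (s - x + c) (s + x + d) + row Hs (s + x + d) (s - x + c)) = 0"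
      using gours_zero[OF B] row_zero'[OF H] row_zero'[OF Hs] by auto
  qed (use dx dt cons Bt order_trans[OF gl Bd(1)] in \<open>auto split: prod.splits\<close>)
qed

text \<open>The form for edges along which the first characteristic coordinate grows with x.\<close>

lemma edge_sol_gours':
  assumes H: "pc R M N H" and l: "l \<ge> 0" and S: "S \<ge> 0"
    and supp: "\<And>x. x \<in> {0..l} \<Longrightarrow> d - x \<le> S \<or> x + c \<le> S"
  shows "edge_sol l S ((1 + l + S) * (M * (R * R + 2 * R))\<^sup>2) (\<lambda>(x, s). 4 * H (s + x + c, s - x + d))
    (\<lambda>(x, s). gours H (s + x + c) (s - x + d))
    (\<lambda>(x, s). row H (s + x + c) (s - x + d) - row (flip H) (s - x + d) (s + x + c))
    (\<lambda>(x, s). row H (s + x + c) (s - x + d) + row (flip H) (s - x + d) (s + x + c))"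
  using edge_sol_gours[OF pc_swap[OF H] l S supp] H
  by (simp add: pc_def gours_swap[of R M H, symmetric] add.commute[of "row (flip H) p q" for p q])

section \<open>From edge solutions to the variational formulation\<close>

lemma sqint_product_integrable:
  fixes f :: "real \<times> real \<Rightarrow> real"
  assumes [measurable]: "f \<in> borel_measurable borel" and K: "\<And>y. y \<in> {c..d} \<Longrightarrow> sqint a b K (\<lambda>x. f (x, y))"
  shows "integrable (lborel2) (\<lambda>(y, x). indicator {c..d} y * (indicator {a..b} x * (f (x, y))\<^sup>2))"
proof (rule lborel_pair.Fubini_integrable)
  show "(\<lambda>(y, x). indicator {c..d} y * (indicator {a..b} x * (f (x, y))\<^sup>2)) \<in> borel_measurable (lborel2)"
    unfolding case_prod_unfold by measurable
  have e: "(LBINT x. norm (case (y, x) of (y, x) \<Rightarrow> indicator {c..d} y * (indicator {a..b} x * (f (x, y))\<^sup>2)))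
      = indicator {c..d} y * (LBINT x:{a..b}. (f (x, y))\<^sup>2)" for y
    by (simp add: set_LINT_def abs_mult)
  show "integrable lborel (\<lambda>y. LBINT x. norm (case (y, x) of (y, x) \<Rightarrow> indicator {c..d} y * (indicator {a..b} x * (f (x, y))\<^sup>2)))"
    unfolding e
  proof (rule integrable_bounded_support[where M="\<bar>K\<bar>" and a=c and b=d])
    show "(\<lambda>y. indicator {c..d} y * (LBINT x:{a..b}. (f (x, y))\<^sup>2)) \<in> borel_measurable borel"
      unfolding set_LINT_def by measurable
    fix y
    have "0 \<le> (LBINT x:{a..b}. (f (x, y))\<^sup>2)"
      unfolding set_LINT_def by (rule LINT_nonneg) auto
    thus "\<bar>indicat_real {c..d} y * (LBINT x:{a..b}. (f (x, y))\<^sup>2)\<bar> \<le> \<bar>K\<bar>"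
      using K[of y] by (auto simp: indicator_def sqint_def)
  qed auto
  show "AE y in lborel. integrable lborel (\<lambda>x. case (y, x) of (y, x) \<Rightarrow> indicator {c..d} y * (indicator {a..b} x * (f (x, y))\<^sup>2))"
  proof (intro AE_I2)
    fix y
    show "integrable lborel (\<lambda>x. case (y, x) of (y, x) \<Rightarrow> indicator {c..d} y * (indicator {a..b} x * (f (x, y))\<^sup>2))"
      using K[of y] by (cases "y \<in> {c..d}") (auto simp: sqint_def set_integrable_def)
  qed
qed

text \<open>As w(l) = 0, pairing u_t with w is minus the integral of w'(y) times the integral of u_t
  over [0,y]. The rectangle identity is substituted for the latter, and Fubini moves the time
  integral outside. The boundary term at 0 survives because w(0) is free.\<close>

lemma edge_sol_weak:
  assumes E: "edge_sol l S K h u ux ut" and l: "l \<ge> 0" and S: "S \<ge> 0"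
    and w: "prim2 l w w'" and wl: "w l = 0"
  defines "J \<equiv> \<lambda>r. - w 0 * ux (0, r) - (LBINT y:{0..l}. ux (y, r) * w' y) + (LBINT x:{0..l}. h (x, r) * w x)"
  shows "set_integrable lborel {-S..0} J" "J \<in> borel_measurable borel"
    "s \<in> {-S..0} \<Longrightarrow> (LBINT x:{0..l}. ut (x, s) * w x) = (LBINT r:{-S..s}. J r)"
proof -
  note d = edge_solD[OF E]
  note [measurable] = d(1-3)
  have wp: "prim l w w'" and wq: "set_integrable lborel {0..l} (\<lambda>x. (w' x)\<^sup>2)" using w by (auto simp: prim2_def)
  have [measurable]: "w' \<in> borel_measurable borel" and wi: "set_integrable lborel {0..l} w'" using prim_D[OF wp] by auto
  from d(4) obtain B where B: "\<And>z. \<bar>h z\<bar> \<le> B" by blast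
  have B0: "B \<ge> 0" using order_trans[OF abs_ge_zero B[of undefined]] .
  have wint: "(LBINT y:{0..x}. w' y) = w x - w 0" if "x \<in> {0..l}" for x using prim_D(3)[OF wp that] by simp
  have wl0: "(LBINT y:{0..l}. w' y) = - w 0" using wint[of l] l wl by simp
  have l0: "0 \<in> {0..l}" using l by auto
  define A where "A r y = indicator {-S..0} r * (indicator {0..l} y * (ux (y, r) * w' y))" for r y
  have iA: "integrable (lborel2) (case_prod A)"
  proof -
    have i1: "integrable (lborel2) (\<lambda>(r, y). indicator {-S..0} r * (indicator {0..l} y * (ux (y, r))\<^sup>2))"
      by (rule sqint_product_integrable[OF d(1)]) (use d(9) in auto)
    have i2: "integrable (lborel2) (\<lambda>(r, y). indicat_real {-S..0} r * (indicator {0..l} y * (w' y)\<^sup>2))"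
      by (rule integrable_times) (use wq set_integrable_const_Icc[of "-S" 0 1] in \<open>auto simp: set_integrable_def\<close>)
    show ?thesis
    proof (rule LINT_integrable_bound[OF Bochner_Integration.integrable_add[OF i1 i2]])
      show "case_prod A \<in> borel_measurable (lborel2)" unfolding A_def case_prod_unfold by measurable
      show "AE z in lborel2. norm (case_prod A z) \<le> norm ((case z of (r, y) \<Rightarrow> indicator {-S..0} r * (indicator {0..l} y * (ux (y, r))\<^sup>2)) + (case z of (r, y) \<Rightarrow> indicat_real {-S..0} r * (indicator {0..l} y * (w' y)\<^sup>2)))"
        using abs_mult_le_sq by (intro AE_I2) (auto simp: A_def indicator_def)
    qed
  qed
  define C where "C r y = indicator {-S..0} r * (indicator {0..l} y * (w' y * (LBINT x:{0..y}. h (x, r))))" for r y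
  have iC: "integrable (lborel2) (case_prod C)"
  proof -
    have i2: "integrable (lborel2) (\<lambda>(r, y). (indicat_real {-S..0} r * (B * l)) * (indicator {0..l} y * w' y))"
      by (rule integrable_times) (use wi set_integrable_const_Icc[of "-S" 0 "B * l"] in \<open>auto simp: set_integrable_def\<close>)
    show ?thesis
    proof (rule LINT_integrable_bound[OF i2])
      have [measurable]: "(\<lambda>z. LBINT x. indicator {0..snd z} x *\<^sub>R h (x, fst z)) \<in> borel_measurable (lborel2)"
      proof (rule lborel.borel_measurable_lebesgue_integral)
        have "(\<lambda>p. (if 0 \<le> snd p \<and> snd p \<le> snd (fst p) then h (snd p, fst (fst p)) else 0)) \<in> borel_measurable ((lborel2) \<Otimes>\<^sub>M lborel)"
          by measurable
        also have "(\<lambda>p. (if 0 \<le> snd p \<and> snd p \<le> snd (fst p) then h (snd p, fst (fst p)) else 0)) = (\<lambda>(z, x). indicator {0..snd z} x *\<^sub>R h (x, fst z))"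
          by (auto simp: fun_eq_iff indicator_def)
        finally show "(\<lambda>(z, x). indicator {0..snd z} x *\<^sub>R h (x, fst z)) \<in> borel_measurable ((lborel2) \<Otimes>\<^sub>M lborel)" .
      qed
      show "case_prod C \<in> borel_measurable (lborel2)"
        unfolding C_def case_prod_unfold set_LINT_def by measurable
      have hb: "\<bar>LBINT x:{0..y}. h (x, r)\<bar> \<le> B * l" if "y \<in> {0..l}" for y r
      proof -
        have "\<bar>LBINT x:{0..y}. h (x, r)\<bar> \<le> (LBINT x:{0..y}. \<bar>h (x, r)\<bar>)" by (rule set_integral_abs_bound)
        also have "\<dots> \<le> (LBINT x:{0..y}. B)"
          by (rule set_integral_mono[OF set_integrable_abs[OF set_integral_param_integrable(1)[OF d(3) B]] set_integrable_const_Icc]) (rule B)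
        also have "\<dots> \<le> B * l" using that B0 by (simp add: set_integral_const mult_left_mono mult.commute)
        finally show ?thesis .
      qed
      show "AE z in lborel2. norm (case_prod C z) \<le> norm (case z of (r, y) \<Rightarrow> (indicat_real {-S..0} r * (B * l)) * (indicator {0..l} y * w' y))"
      proof (intro AE_I2)
        fix z :: "real \<times> real"
        obtain r y where z: "z = (r, y)" by (cases z)
        show "norm (case_prod C z) \<le> norm (case z of (r, y) \<Rightarrow> (indicat_real {-S..0} r * (B * l)) * (indicator {0..l} y * w' y))"
          using mult_left_mono[OF hb[of y r] abs_ge_zero[of "w' y"]] B0 l unfolding z
          by (auto simp: C_def indicator_def abs_mult mult_ac)
      qed
    qed
  qed
  define Jh where "Jh r = (LBINT x:{0..l}. h (x, r) * w x)" for r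
  \<comment> \<open>A Borel function on the line that agrees with w on [0,l]; it makes the
    measurability of \<open>Jh\<close> visible.\<close>
  define W where "W x = w 0 + (LBINT y. indicator {0..l} y * (indicator {..x} y * w' y))" for x
  have Wc: "continuous_on UNIV W"
  proof -
    have "integrable lborel (\<lambda>y. indicator {0..l} y * w' y)" using wi by (simp add: set_integrable_def)
    from continuous_on_integral_atMost[OF this, of UNIV] show ?thesis
      unfolding W_def set_LINT_def by (intro continuous_intros) (simp add: mult.left_commute)
  qed
  have [measurable]: "W \<in> borel_measurable borel" using Wc by (rule borel_measurable_continuous_onI)
  have Ww: "W x = w x" if "x \<in> {0..l}" for x
  proof -
    have "(LBINT y. indicator {0..l} y * (indicator {..x} y * w' y)) = (LBINT y:{0..x}. w' y)"
      unfolding set_LINT_def using that by (intro LINT_cong) (auto simp: indicator_def)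
    thus ?thesis using wint[OF that] by (simp add: W_def)
  qed
  have JhW: "Jh r = (LBINT x:{0..l}. h (x, r) * W x)" for r
    unfolding Jh_def by (rule set_lebesgue_integral_cong) (auto simp: Ww)
  have [measurable]: "Jh \<in> borel_measurable borel"
    unfolding JhW[abs_def] set_LINT_def by measurable
  \<comment> \<open>Integration by parts takes the derivative off w; since w(l) = 0, only minus the
    pairing of the source with w remains.\<close>
  have Cw: "(LBINT y:{0..l}. w' y * (LBINT x:{0..y}. h (x, r))) = - Jh r" for r
  proof -
    note hi = set_integral_param_integrable(1)[OF d(3) B, of 0 l r]
    have "(LBINT x:{0..l}. h (x, r) * (LBINT y:{0..x}. w' y)) + (LBINT y:{0..l}. w' y * (LBINT x:{0..y}. h (x, r)))
      = (LBINT x:{0..l}. h (x, r)) * (- w 0)"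
      using integral_by_parts(1)[OF hi wi] wl0 by simp
    moreover have "(LBINT x:{0..l}. h (x, r) * (LBINT y:{0..x}. w' y)) = (LBINT x:{0..l}. h (x, r) * w x - h (x, r) * w 0)"
      by (rule set_lebesgue_integral_cong) (auto simp: wint right_diff_distrib)
    moreover have "(LBINT x:{0..l}. h (x, r) * w x - h (x, r) * w 0) = Jh r - (LBINT x:{0..l}. h (x, r)) * w 0"
    proof -
      have "set_integrable lborel {0..l} (\<lambda>x. h (x, r) * w x)"
      proof -
        have "set_integrable lborel {0..l} (\<lambda>x. h (x, r) * (LBINT y:{0..x}. w' y) + h (x, r) * w 0)"
          using integral_by_parts(2)[OF hi wi] hi by (intro set_integral_add(1)) auto
        also have "?this \<longleftrightarrow> ?thesis" by (rule set_integrable_cong) (auto simp: wint algebra_simps)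
        finally show ?thesis .
      qed
      thus ?thesis using hi by (simp add: Jh_def)
    qed
    ultimately show ?thesis by simp
  qed
  have iJA: "set_integrable lborel {-S..0} (\<lambda>r. LBINT y:{0..l}. ux (y, r) * w' y)"
    using lborel_pair.integrable_fst'[OF iA] by (simp add: A_def set_integrable_def set_LINT_def)
  have iJC: "set_integrable lborel {-S..0} Jh"
  proof -
    have "(LBINT y. C r y) = - (indicator {-S..0} r *\<^sub>R Jh r)" for r
      using Cw[of r] by (simp add: C_def set_LINT_def)
    thus ?thesis using lborel_pair.integrable_fst'[OF iC] by (simp add: set_integrable_def)
  qed
  have i0: "set_integrable lborel {-S..0} (\<lambda>r. ux (0, r))" by (rule sqint_integrable[OF d(11)[OF l0]]) auto
  have Je: "J = (\<lambda>r. - w 0 * ux (0, r) - (LBINT y:{0..l}. ux (y, r) * w' y) + Jh r)" by (simp add: J_def Jh_def)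
  show "set_integrable lborel {-S..0} J" unfolding Je
    by (intro set_integral_add(1) set_integral_diff(1) iJA iJC set_integrable_mult_right i0)
  show "J \<in> borel_measurable borel" unfolding Je set_LINT_def by measurable
  assume s: "s \<in> {-S..0}"
  have s0: "s \<le> 0" using s by auto
  have sub: "set_integrable lborel {-S..s} f" if "set_integrable lborel {-S..0} f" for f :: "real \<Rightarrow> real"
    by (rule set_integrable_subset[OF that]) (use s in auto)
  have ui: "set_integrable lborel {0..l} (\<lambda>x. ut (x, s))" by (rule sqint_integrable[OF d(10)[OF s0]]) auto
  have "(LBINT x:{0..l}. ut (x, s) * w x) = (LBINT x:{0..l}. ut (x, s) * (LBINT y:{0..x}. w' y) + ut (x, s) * w 0)"
    by (rule set_lebesgue_integral_cong) (auto simp: wint algebra_simps)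
  also have "\<dots> = (LBINT x:{0..l}. ut (x, s) * (LBINT y:{0..x}. w' y)) + (LBINT x:{0..l}. ut (x, s)) * w 0"
    using integral_by_parts(2)[OF ui wi] ui by simp
  also have "\<dots> = - (LBINT y:{0..l}. w' y * (LBINT x:{0..y}. ut (x, s)))"
    using integral_by_parts(1)[OF ui wi] wl0 by simp
  \<comment> \<open>Here the rectangle identity enters, for each y separately.\<close>
  also have "(LBINT y:{0..l}. w' y * (LBINT x:{0..y}. ut (x, s))) =
     (LBINT y:{0..l}. w' y * (LBINT r:{-S..s}. ux (y, r)) - w' y * (LBINT r:{-S..s}. ux (0, r)) + w' y * (LBINT r:{-S..s}. (LBINT x:{0..y}. h (x, r))))"
  proof (rule set_lebesgue_integral_cong, simp, intro allI impI)
    fix y assume y: "y \<in> {0..l}"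
    have i: "set_integrable lborel {-S..s} (\<lambda>r. ux (y, r))" by (rule sub, rule sqint_integrable[OF d(11)[OF y]]) auto
    show "w' y * (LBINT x:{0..y}. ut (x, s)) = w' y * (LBINT r:{-S..s}. ux (y, r)) - w' y * (LBINT r:{-S..s}. ux (0, r)) + w' y * (LBINT r:{-S..s}. (LBINT x:{0..y}. h (x, r)))"
      unfolding d(17)[OF y s] set_integral_diff(2)[OF i sub[OF i0]] by (simp add: algebra_simps)
  qed
  also have "\<dots> = (LBINT r:{-S..s}. (LBINT y:{0..l}. ux (y, r) * w' y)) + w 0 * (LBINT r:{-S..s}. ux (0, r)) - (LBINT r:{-S..s}. Jh r)"
  proof -
    define ind where "ind r = indicat_real {-S..s} r" for r
    have cut: "integrable (lborel2) (case_prod (\<lambda>r y. ind r * X r y))" if "integrable (lborel2) (case_prod X)" for X :: "real \<Rightarrow> real \<Rightarrow> real"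
    proof (rule LINT_integrable_bound[OF that])
      have [measurable]: "case_prod X \<in> borel_measurable (lborel2)" using that by simp
      have "(\<lambda>z. ind (fst z) * case_prod X z) \<in> borel_measurable (lborel2)" unfolding ind_def by measurable
      thus "(\<lambda>(r, y). ind r * X r y) \<in> borel_measurable (lborel2)" by (simp add: case_prod_unfold)
    qed (auto simp: ind_def indicator_def)
    have indS: "ind r * indicator {-S..0} r = indicator {-S..s} r" for r using s by (auto simp: ind_def indicator_def)
    have a1: "(LBINT r. ind r * A r y) = indicator {0..l} y *\<^sub>R (w' y * (LBINT r:{-S..s}. ux (y, r)))" for y
    proof -
      have "(LBINT r. ind r * A r y) = (LBINT r. (indicator {0..l} y * w' y) * (indicator {-S..s} r * ux (y, r)))"
        by (rule LINT_cong) (auto simp: A_def indS[symmetric])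
      thus ?thesis by (simp add: set_LINT_def)
    qed
    have a2: "(LBINT y. ind r * A r y) = indicator {-S..s} r *\<^sub>R (LBINT y:{0..l}. ux (y, r) * w' y)" for r
    proof -
      have "(LBINT y. ind r * A r y) = (LBINT y. indicator {-S..s} r * (indicator {0..l} y * (ux (y, r) * w' y)))"
        by (rule LINT_cong) (auto simp: A_def indS[symmetric])
      thus ?thesis by (simp add: set_LINT_def)
    qed
    have c1: "(LBINT r. ind r * C r y) = indicator {0..l} y *\<^sub>R (w' y * (LBINT r:{-S..s}. (LBINT x:{0..y}. h (x, r))))" for y
    proof -
      have "(LBINT r. ind r * C r y) = (LBINT r. (indicator {0..l} y * w' y) * (indicator {-S..s} r * (LBINT x:{0..y}. h (x, r))))"
        by (rule LINT_cong) (auto simp: C_def indS[symmetric])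
      thus ?thesis by (simp add: set_LINT_def[of _ "{-S..s}"])
    qed
    have c2: "(LBINT y. ind r * C r y) = - (indicator {-S..s} r *\<^sub>R Jh r)" for r
    proof -
      have "(LBINT y. ind r * C r y) = (LBINT y. indicator {-S..s} r * (indicator {0..l} y * (w' y * (LBINT x:{0..y}. h (x, r)))))"
        by (rule LINT_cong) (auto simp: C_def indS[symmetric])
      also have "\<dots> = indicator {-S..s} r * (LBINT y:{0..l}. w' y * (LBINT x:{0..y}. h (x, r)))"
        by (simp add: set_LINT_def[of _ "{0..l}"])
      finally show ?thesis unfolding Cw by simp
    qed
    have fA: "(LBINT y:{0..l}. w' y * (LBINT r:{-S..s}. ux (y, r))) = (LBINT r:{-S..s}. (LBINT y:{0..l}. ux (y, r) * w' y))"
      unfolding set_LINT_def[of _ "{0..l}" "\<lambda>y. w' y * (LBINT r:{-S..s}. ux (y, r))"]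
        set_LINT_def[of _ "{-S..s}" "\<lambda>r. (LBINT y:{0..l}. ux (y, r) * w' y)"] a1[symmetric] a2[symmetric]
      by (rule lborel_pair.Fubini_integral[OF cut[OF iA]])
    have fC: "(LBINT y:{0..l}. w' y * (LBINT r:{-S..s}. (LBINT x:{0..y}. h (x, r)))) = - (LBINT r:{-S..s}. Jh r)"
    proof -
      have "(LBINT y:{0..l}. w' y * (LBINT r:{-S..s}. (LBINT x:{0..y}. h (x, r)))) = (LBINT r. - (indicator {-S..s} r *\<^sub>R Jh r))"
        unfolding set_LINT_def[of _ "{0..l}" "\<lambda>y. w' y * (LBINT r:{-S..s}. (LBINT x:{0..y}. h (x, r)))"]
          c1[symmetric] c2[symmetric]
        by (rule lborel_pair.Fubini_integral[OF cut[OF iC]])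
      thus ?thesis by (simp add: set_LINT_def)
    qed
    have j1: "set_integrable lborel {0..l} (\<lambda>y. w' y * (LBINT r:{-S..s}. ux (y, r)))"
      unfolding set_integrable_def a1[symmetric] using lborel_pair.integrable_snd[OF cut[OF iA]] .
    have j3: "set_integrable lborel {0..l} (\<lambda>y. w' y * (LBINT r:{-S..s}. (LBINT x:{0..y}. h (x, r))))"
      unfolding set_integrable_def c1[symmetric] using lborel_pair.integrable_snd[OF cut[OF iC]] .
    have j2: "set_integrable lborel {0..l} (\<lambda>y. w' y * (LBINT r:{-S..s}. ux (0, r)))" using wi by simp
    show ?thesis
      unfolding set_integral_add(2)[OF set_integral_diff(1)[OF j1 j2] j3] set_integral_diff(2)[OF j1 j2] fA fC
      using wl0 by simp
  qed
  finally have "(LBINT x:{0..l}. ut (x, s) * w x) = - w 0 * (LBINT r:{-S..s}. ux (0, r)) - (LBINT r:{-S..s}. (LBINT y:{0..l}. ux (y, r) * w' y)) + (LBINT r:{-S..s}. Jh r)"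
    by simp
  also have "\<dots> = (LBINT r:{-S..s}. J r)"
    unfolding Je
    by (subst set_integral_add(2), (intro set_integral_diff(1) sub iJA iJC set_integrable_mult_right i0)+,
        subst set_integral_diff(2), (intro sub iJA set_integrable_mult_right i0)+) (simp only: set_integral_mult_right)
  finally show "(LBINT x:{0..l}. ut (x, s) * w x) = (LBINT r:{-S..s}. J r)" .
qed

lemma set_integral_lebesgue_open:
  fixes F :: "real \<Rightarrow> real"
  assumes "set_borel_measurable borel {0<..<l} F"
  shows "(LINT x:{0<..<l}|lebesgue. F x) = (LBINT x:{0..l}. F x)"
    "set_integrable lebesgue {0<..<l} F \<longleftrightarrow> set_integrable lborel {0..l} F"
proof -
  have m: "(\<lambda>x. indicator {0<..<l} x *\<^sub>R F x) \<in> borel_measurable lborel"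
    using assms by (simp add: set_borel_measurable_def)
  have "(LINT x:{0<..<l}|lebesgue. F x) = (LBINT x:{0<..<l}. F x)"
    unfolding set_LINT_def by (rule integral_completion[OF m])
  also have "\<dots> = (LBINT x:{0..l}. F x)"
    by (rule set_integral_discrete_difference[where X="{0,l}"]) auto
  finally show "(LINT x:{0<..<l}|lebesgue. F x) = (LBINT x:{0..l}. F x)" .
  have "set_integrable lebesgue {0<..<l} F \<longleftrightarrow> set_integrable lborel {0<..<l} F"
    unfolding set_integrable_def by (rule integrable_completion[OF m])
  also have "\<dots> \<longleftrightarrow> set_integrable lborel {0..l} F"
    by (rule set_integrable_discrete_difference[where X="{0,l}"]) auto
  finally show "set_integrable lebesgue {0<..<l} F \<longleftrightarrow> set_integrable lborel {0..l} F" .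
qed

lemma set_borel_measurable_open:
  fixes F :: "real \<Rightarrow> real"
  assumes "continuous_on {0..l} F" shows "set_borel_measurable borel {0<..<l} F"
  by (rule set_measurable_continuous_on) (auto intro: continuous_on_subset[OF assms])

lemma prim2_continuous_on: "prim2 l f f' \<Longrightarrow> continuous_on {0..l} f"
  using prim_continuous_on by (auto simp: prim2_def)

lemma prim2_diff:
  assumes f: "prim2 l f f'" and g: "prim2 l g g'"
  shows "prim2 l (\<lambda>x. f x - g x) (\<lambda>x. f' x - g' x)"
proof -
  have pf: "prim l f f'" and pg: "prim l g g'" using f g by (auto simp: prim2_def)
  have "sqint 0 l (LBINT x:{0..l}. (f' x)\<^sup>2) f'" using f prim_D(1)[OF pf] by (auto simp: sqint_def prim2_def)
  moreover have "sqint 0 l (LBINT x:{0..l}. (g' x)\<^sup>2) g'" using g prim_D(1)[OF pg] by (auto simp: sqint_def prim2_def)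
  ultimately have "\<exists>K. sqint 0 l K (\<lambda>x. f' x - g' x)"
    using sqint_add[of 0 l _ f' _ "\<lambda>x. -1 * g' x", OF _ sqint_scale[of 0 l _ g' "-1"]] by auto
  moreover have "f x - g x = (f 0 - g 0) + (LBINT y:{0..x}. f' y - g' y)" if x: "x \<in> {0..l}" for x
  proof -
    have i: "set_integrable lborel {0..x} f'" "set_integrable lborel {0..x} g'"
      using x by (auto intro: set_integrable_subset[OF prim_D(2)[OF pf]] set_integrable_subset[OF prim_D(2)[OF pg]])
    show ?thesis unfolding set_integral_diff(2)[OF i] using prim_D(3)[OF pf x] prim_D(3)[OF pg x] by simp
  qed
  moreover have "set_integrable lborel {0..l} (\<lambda>x. f' x - g' x)"
    by (rule set_integral_diff(1)[OF prim_D(2)[OF pf] prim_D(2)[OF pg]])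
  moreover have "(\<lambda>x. f' x - g' x) \<in> borel_measurable borel" using prim_D(1)[OF pf] prim_D(1)[OF pg] by simp
  ultimately show ?thesis unfolding prim2_def prim_def sqint_def by blast
qed

lemma set_integrable_product:
  fixes f g :: "real \<Rightarrow> real"
  assumes [measurable]: "f \<in> borel_measurable borel" "g \<in> borel_measurable borel"
    and f2: "set_integrable lborel {a..b} (\<lambda>x. (f x)\<^sup>2)" and g2: "set_integrable lborel {a..b} (\<lambda>x. (g x)\<^sup>2)"
  shows "set_integrable lborel {a..b} (\<lambda>x. f x * g x)"
  unfolding set_integrable_def
proof (rule LINT_integrable_bound)
  show "integrable lborel (\<lambda>x. indicator {a..b} x *\<^sub>R ((f x)\<^sup>2 + (g x)\<^sup>2))"
    using set_integral_add(1)[OF f2 g2] by (simp add: set_integrable_def)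
  show "AE x in lborel. norm (indicator {a..b} x *\<^sub>R (f x * g x)) \<le> norm (indicator {a..b} x *\<^sub>R ((f x)\<^sup>2 + (g x)\<^sup>2))"
    using abs_mult_le_sq by (intro AE_I2) (auto simp: indicator_def)
qed measurable

lemma star_form_edge:
  assumes l: "l > 0" and f: "prim2 l f f'" and w: "prim2 l w w'" and q: "continuous_on {0..l} q"
  shows "(LINT x:{0<..<l}|lebesgue. wderiv l f x * wderiv l w x + q x * f x * w x) =
    (LBINT x:{0..l}. f' x * w' x) + (LBINT x:{0..l}. q x * f x * w x)"
proof -
  have pf: "prim l f f'" and pw: "prim l w w'" and f2: "set_integrable lborel {0..l} (\<lambda>x. (f' x)\<^sup>2)"
    and w2: "set_integrable lborel {0..l} (\<lambda>x. (w' x)\<^sup>2)" using f w by (auto simp: prim2_def)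
  note mf[measurable] = prim_D(1)[OF pf] and mw[measurable] = prim_D(1)[OF pw]
  have qc: "continuous_on {0..l} (\<lambda>x. q x * f x * w x)"
    by (intro continuous_intros q prim2_continuous_on[OF f] prim2_continuous_on[OF w])
  have qm: "set_borel_measurable borel {0<..<l} (\<lambda>x. q x * f x * w x)" by (rule set_borel_measurable_open[OF qc])
  have fw: "set_borel_measurable borel {0<..<l} (\<lambda>x. f' x * w' x)" unfolding set_borel_measurable_def by measurable
  have m: "set_borel_measurable borel {0<..<l} (\<lambda>x. f' x * w' x + q x * f x * w x)"
    by (rule set_borel_measurable_add[OF fw qm])
  have lb: "set_borel_measurable lebesgue {0<..<l} F" if "set_borel_measurable borel {0<..<l} F" for F :: "real \<Rightarrow> real"
    using that measurable_completion[of _ lborel] by (simp add: set_borel_measurable_def)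
  have "(LINT x:{0<..<l}|lebesgue. wderiv l f x * wderiv l w x + q x * f x * w x) =
     (LINT x:{0<..<l}|lebesgue. f' x * w' x + q x * f x * w x)"
  proof (rule set_integral_cong_AE_lebesgue(1))
    have "L2_space l (wderiv l f)" "L2_space l (wderiv l w)"
      using H1_space_D(2)[OF l prim2_H1(1)[OF l f]] H1_space_D(2)[OF l prim2_H1(1)[OF l w]] by auto
    thus "set_borel_measurable lebesgue {0<..<l} (\<lambda>x. wderiv l f x * wderiv l w x + q x * f x * w x)"
      by (intro set_borel_measurable_add set_borel_measurable_mult[of _ _ "wderiv l f"] lb[OF qm]) (auto simp: L2_space_def)
    show "set_borel_measurable lebesgue {0<..<l} (\<lambda>x. f' x * w' x + q x * f x * w x)" by (rule lb[OF m])
    show "AE x in lebesgue. x \<in> {0<..<l} \<longrightarrow> wderiv l f x * wderiv l w x + q x * f x * w x = f' x * w' x + q x * f x * w x"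
      using prim2_H1(2)[OF l f] prim2_H1(2)[OF l w] by eventually_elim auto
  qed
  also have "\<dots> = (LBINT x:{0..l}. f' x * w' x + q x * f x * w x)" by (rule set_integral_lebesgue_open(1)[OF m])
  also have "\<dots> = (LBINT x:{0..l}. f' x * w' x) + (LBINT x:{0..l}. q x * f x * w x)"
    by (rule set_integral_add(2)[OF set_integrable_product[OF mf mw f2 w2] borel_integrable_atLeastAtMost'[OF qc]])
  finally show ?thesis .
qed

lemma edge_sol_prim2:
  assumes "edge_sol l S K h u ux ut" "s \<le> 0"
  shows "prim2 l (\<lambda>x. u (x, s)) (\<lambda>x. ux (x, s))"
proof -
  note d = edge_solD[OF assms(1)]
  have "sqint 0 l K (\<lambda>x. ux (x, s))" by (rule d(9)[OF assms(2)])
  moreover from sqint_integrable[OF this, of 0 l] have "set_integrable lborel {0..l} (\<lambda>x. ux (x, s))" by simp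
  ultimately show ?thesis unfolding prim2_def prim_def sqint_def using d(13)[OF _ assms(2)] by blast
qed

text \<open>Extends the time clause to all times before 0. The last conclusion is a Hoelder bound of
  exponent 1/2, uniform in x, which later yields continuity in time of u itself.\<close>

lemma edge_sol_time:
  assumes E: "edge_sol l S K h u ux ut" and S: "S \<ge> 0" and x: "x \<in> {0..l}" and sr: "s \<le> r" "r \<le> 0"
  shows "sqint s r K (\<lambda>\<rho>. ut (x, \<rho>))" "u (x, r) - u (x, s) = (LBINT \<rho>:{s..r}. ut (x, \<rho>))"
    "(u (x, r) - u (x, s))\<^sup>2 \<le> (r - s) * K"
proof -
  note d = edge_solD[OF E]
  note [measurable] = d(2)
  \<comment> \<open>The clauses of \<open>edge_sol\<close> integrate over [- S, 0] only; extending
    u_t by zero covers earlier times, at which the edge rests.\<close>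
  define F where "F \<rho> = indicator {-S..0} \<rho> * ut (x, \<rho>)" for \<rho>
  have Fe: "F \<rho> = ut (x, \<rho>)" if "\<rho> \<le> 0" for \<rho> using d(7)[OF x, of \<rho>] that by (auto simp: F_def indicator_def)
  have F2: "integrable lborel (\<lambda>\<rho>. (F \<rho>)\<^sup>2)"
  proof -
    have "(\<lambda>\<rho>. (F \<rho>)\<^sup>2) = (\<lambda>\<rho>. indicator {-S..0} \<rho> *\<^sub>R (ut (x, \<rho>))\<^sup>2)" by (auto simp: F_def indicator_def)
    thus ?thesis using d(12)[OF x] by (simp add: sqint_def set_integrable_def)
  qed
  have F2K: "(LBINT \<rho>. (F \<rho>)\<^sup>2) \<le> K"
  proof -
    have "(\<lambda>\<rho>. (F \<rho>)\<^sup>2) = (\<lambda>\<rho>. indicator {-S..0} \<rho> *\<^sub>R (ut (x, \<rho>))\<^sup>2)" by (auto simp: F_def indicator_def)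
    thus ?thesis using d(12)[OF x] by (simp add: sqint_def set_LINT_def)
  qed
  have Fi: "integrable lborel F"
    unfolding F_def using sqint_integrable[OF d(12)[OF x], of "-S" 0] by (simp add: set_integrable_def)
  have sF: "set_integrable lborel {s..r} (\<lambda>\<rho>. (F \<rho>)\<^sup>2)" by (rule set_integrable_if_integrable[OF F2]) simp
  have sF': "(LBINT \<rho>:{s..r}. (F \<rho>)\<^sup>2) \<le> K"
  proof -
    have "(LBINT \<rho>:{s..r}. (F \<rho>)\<^sup>2) \<le> (LBINT \<rho>. (F \<rho>)\<^sup>2)"
      unfolding set_LINT_def
      by (rule integral_mono[OF sF[unfolded set_integrable_def] F2]) (auto simp: indicator_def)
    thus ?thesis using F2K by simp
  qed
  show sq: "sqint s r K (\<lambda>\<rho>. ut (x, \<rho>))"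
    unfolding sqint_def
  proof (intro conjI)
    show "set_integrable lborel {s..r} (\<lambda>\<rho>. (ut (x, \<rho>))\<^sup>2)"
      using sF by (rule set_integrable_cong[THEN iffD1, rotated -1]) (use Fe sr in auto)
    have "(LBINT \<rho>:{s..r}. (ut (x, \<rho>))\<^sup>2) = (LBINT \<rho>:{s..r}. (F \<rho>)\<^sup>2)"
      by (rule set_lebesgue_integral_cong) (use Fe sr in auto)
    thus "(LBINT \<rho>:{s..r}. (ut (x, \<rho>))\<^sup>2) \<le> K" using sF' by simp
  qed measurable
  have uF: "u (x, s) = (LBINT \<rho>:{..s}. F \<rho>)" if "s \<le> 0" for s
  proof (cases "s \<ge> - S")
    case True
    have "(LBINT \<rho>:{..s}. F \<rho>) = (LBINT \<rho>:{-S..s}. ut (x, \<rho>))"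
      unfolding set_LINT_def
      by (rule LINT_cong) (use that in \<open>auto simp: F_def indicator_def\<close>)
    thus ?thesis using d(14)[OF x, of s] True that by simp
  next
    case False
    have "(LBINT \<rho>:{..s}. F \<rho>) = (LBINT \<rho>:{..s}. 0)"
      by (rule set_lebesgue_integral_cong) (use False in \<open>auto simp: F_def indicator_def\<close>)
    thus ?thesis using d(5)[OF x, of s] False by simp
  qed
  have "u (x, r) - u (x, s) = (LBINT \<rho>:{s..r}. F \<rho>)"
    using uF[of r] uF[of s] sr integral_atMost_diff[OF Fi sr(1)] by simp
  also have "\<dots> = (LBINT \<rho>:{s..r}. ut (x, \<rho>))"
    by (rule set_lebesgue_integral_cong) (use Fe sr in auto)
  finally show e: "u (x, r) - u (x, s) = (LBINT \<rho>:{s..r}. ut (x, \<rho>))" .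
  have "(u (x, r) - u (x, s))\<^sup>2 \<le> (r - s) * (LBINT \<rho>:{s..r}. (ut (x, \<rho>))\<^sup>2)"
    unfolding e by (rule set_integral_CS(2)[OF sr(1)]) (use sq in \<open>auto simp: sqint_def\<close>)
  also have "\<dots> \<le> (r - s) * K" using sq sr by (intro mult_left_mono) (auto simp: sqint_def)
  finally show "(u (x, r) - u (x, s))\<^sup>2 \<le> (r - s) * K" .
qed

lemma edge_sol_H1_continuous:
  assumes E: "edge_sol l S K h u ux ut" and l: "l > 0" and S: "S \<ge> 0" and s: "s \<le> 0"
  shows "((\<lambda>r. (L2_norm l (wderiv l (\<lambda>x. u (x, r) - u (x, s))))\<^sup>2 + (L2_norm l (\<lambda>x. u (x, r) - u (x, s)))\<^sup>2) \<longlongrightarrow> 0) (at s within {..0})"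
proof -
  note d = edge_solD[OF E]
  have K: "K \<ge> 0" using order_trans[OF zero_le_power2 d(8)[of 0 s]] l s by auto
  have ev: "\<forall>\<^sub>F r in at s within {..0}. r \<le> 0" by (auto simp: eventually_at_filter)
  have 1: "((\<lambda>r. (L2_norm l (wderiv l (\<lambda>x. u (x, r) - u (x, s))))\<^sup>2) \<longlongrightarrow> 0) (at s within {..0})"
  proof (rule Lim_transform_eventually[OF d(15)[OF s]])
    show "\<forall>\<^sub>F r in at s within {..0}. (LBINT x:{0..l}. (ux (x, r) - ux (x, s))\<^sup>2) = (L2_norm l (wderiv l (\<lambda>x. u (x, r) - u (x, s))))\<^sup>2"
      using ev
    proof eventually_elim
      case (elim r)
      show ?case
        using prim2_H1(3)[OF l prim2_diff[OF edge_sol_prim2[OF E elim] edge_sol_prim2[OF E s]]] by simp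
    qed
  qed
  have 2: "((\<lambda>r. (L2_norm l (\<lambda>x. u (x, r) - u (x, s)))\<^sup>2) \<longlongrightarrow> 0) (at s within {..0})"
  proof (rule tendsto_sandwich[OF _ _ tendsto_const])
    have "((\<lambda>r. l * (\<bar>r - s\<bar> * K)) \<longlongrightarrow> l * (\<bar>s - s\<bar> * K)) (at s within {..0})" by (intro tendsto_intros)
    thus "((\<lambda>r. l * (\<bar>r - s\<bar> * K)) \<longlongrightarrow> 0) (at s within {..0})" by simp
    show "\<forall>\<^sub>F r in at s within {..0}. (L2_norm l (\<lambda>x. u (x, r) - u (x, s)))\<^sup>2 \<le> l * (\<bar>r - s\<bar> * K)"
      using ev
    proof eventually_elim
      case (elim r)
      have c: "continuous_on {0..l} (\<lambda>x. (u (x, r) - u (x, s))\<^sup>2)"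
        by (intro continuous_intros prim2_continuous_on[OF edge_sol_prim2[OF E elim]] prim2_continuous_on[OF edge_sol_prim2[OF E s]])
      have b: "(u (x, r) - u (x, s))\<^sup>2 \<le> \<bar>r - s\<bar> * K" if "x \<in> {0..l}" for x
        using edge_sol_time(3)[OF E S that, of s r] edge_sol_time(3)[OF E S that, of r s] elim s
        by (cases "s \<le> r") (auto simp: power2_commute)
      have "(L2_norm l (\<lambda>x. u (x, r) - u (x, s)))\<^sup>2 = (LBINT x:{0..l}. (u (x, r) - u (x, s))\<^sup>2)"
        unfolding L2_norm_def set_integral_lebesgue_open(1)[OF set_borel_measurable_open[OF c]]
        by (simp add: set_LINT_def)
      also have "\<dots> \<le> (LBINT x:{0..l}. \<bar>r - s\<bar> * K)"
        by (rule set_integral_mono[OF borel_integrable_atLeastAtMost'[OF c] set_integrable_const_Icc b])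
      also have "\<dots> = l * (\<bar>r - s\<bar> * K)" using l by (simp add: set_integral_const)
      finally show ?case .
    qed
  qed auto
  show ?thesis using tendsto_add[OF 1 2] by simp
qed

text \<open>The error of the difference quotient at x is the time average of u_t(\<rho>) - u_t(s)
  between s and r. By Cauchy-Schwarz and Fubini its squared L^2 norm is at most the average of G,
  which is small because u_t is continuous in time with values in L^2.\<close>

lemma edge_sol_quotient:
  assumes E: "edge_sol l S K h u ux ut" and l: "l > 0" and S: "S \<ge> 0" and s: "s \<le> 0"
  shows "((\<lambda>r. (L2_norm l (\<lambda>x. (u (x, r) - u (x, s)) / (r - s) - ut (x, s)))\<^sup>2) \<longlongrightarrow> 0) (at s within {..0})"
proof (rule tendstoI)
  fix e :: real assume e: "e > 0"
  note d = edge_solD[OF E]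
  note [measurable] = d(2)
  define G where "G r = (LBINT x:{0..l}. (ut (x, r) - ut (x, s))\<^sup>2)" for r
  have "\<forall>\<^sub>F r in at s within {..0}. dist (G r) 0 < e / 2" using tendstoD[OF d(16)[OF s], of "e/2"] e by (simp add: G_def)
  then obtain \<delta> where \<delta>: "\<delta> > 0" "\<And>r. r \<le> 0 \<Longrightarrow> r \<noteq> s \<Longrightarrow> dist r s < \<delta> \<Longrightarrow> dist (G r) 0 < e / 2"
    by (auto simp: eventually_at)
  have Gs: "G s = 0" by (simp add: G_def)
  have Ge: "G r \<le> e / 2" if "r \<le> 0" "\<bar>r - s\<bar> < \<delta>" for r
    using \<delta>(2)[of r] that Gs e by (cases "r = s") (auto simp: dist_real_def)
  have main: "(L2_norm l (\<lambda>x. (u (x, r) - u (x, s)) / (r - s) - ut (x, s)))\<^sup>2 \<le> e / 2"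
    if r: "r \<le> 0" "r \<noteq> s" "\<bar>r - s\<bar> < \<delta>" for r
  proof -
    define p where "p = min r s"
    define q where "q = max r s"
    have pq: "p < q" "q \<le> 0" "q - p = \<bar>r - s\<bar>" using r s by (auto simp: p_def q_def)
    define D where "D x = (u (x, r) - u (x, s)) / (r - s) - ut (x, s)" for x
    have De: "D x * (q - p) = (LBINT \<rho>:{p..q}. ut (x, \<rho>) - ut (x, s))" if x: "x \<in> {0..l}" for x
    proof -
      have i: "set_integrable lborel {p..q} (\<lambda>\<rho>. ut (x, \<rho>))"
        using sqint_integrable[OF edge_sol_time(1)[OF E S x, of p q], of p q] pq by simp
      have i': "(LBINT \<rho>:{p..q}. ut (x, \<rho>) - ut (x, s)) = (u (x, q) - u (x, p)) - (q - p) * ut (x, s)"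
        unfolding set_integral_diff(2)[OF i set_integrable_const_Icc] edge_sol_time(2)[OF E S x less_imp_le[OF pq(1)] pq(2)]
        using pq by (simp add: set_integral_const)
      moreover have "(u (x, q) - u (x, p)) / (q - p) = (u (x, r) - u (x, s)) / (r - s)"
        using r by (cases "r < s") (auto simp: p_def q_def divide_simps, auto simp: algebra_simps)
      ultimately have "D x = (u (x, q) - u (x, p)) / (q - p) - ut (x, s)" by (simp add: D_def)
      moreover have "X = A / k - Y \<Longrightarrow> k \<noteq> 0 \<Longrightarrow> X * k = A - k * Y" for X A k Y :: real
        by (simp add: field_simps)
      ultimately have "D x * (q - p) = (u (x, q) - u (x, p)) - (q - p) * ut (x, s)" using pq(1) by auto
      moreover note i'
      ultimately show ?thesis by simp
    qed
    have sqd: "sqint 0 l (2 * K + 2 * K) (\<lambda>x. ut (x, \<rho>) - ut (x, s))" if "\<rho> \<le> 0" for \<rho>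
      using sqint_add[OF d(10)[OF that] sqint_scale[OF d(10)[OF s], of "-1"]] by simp
    have sqt: "\<exists>K'. sqint p q K' (\<lambda>\<rho>. ut (x, \<rho>) - ut (x, s))" if x: "x \<in> {0..l}" for x
    proof -
      have "\<exists>C. sqint p q C (\<lambda>\<rho>. - ut (x, s))" using set_integrable_const_Icc by (auto simp: sqint_def)
      thus ?thesis using sqint_add[OF edge_sol_time(1)[OF E S x less_imp_le[OF pq(1)] pq(2)]] by force
    qed
    have Dsq: "(q - p) * (D x)\<^sup>2 \<le> (LBINT \<rho>:{p..q}. (ut (x, \<rho>) - ut (x, s))\<^sup>2)" if x: "x \<in> {0..l}" for x
    proof -
      have "(D x * (q - p))\<^sup>2 \<le> (q - p) * (LBINT \<rho>:{p..q}. (ut (x, \<rho>) - ut (x, s))\<^sup>2)"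
        unfolding De[OF x] by (rule set_integral_CS(2)) (use pq sqt[OF x] in \<open>auto simp: sqint_def\<close>)
      hence "(q - p) * ((q - p) * (D x)\<^sup>2) \<le> (q - p) * (LBINT \<rho>:{p..q}. (ut (x, \<rho>) - ut (x, s))\<^sup>2)"
        by (simp add: power2_eq_square mult_ac)
      thus ?thesis using pq(1) by simp
    qed
    define ff where "ff z = ut z - ut (fst z, s)" for z
    have [measurable]: "ff \<in> borel_measurable borel" unfolding ff_def[abs_def] by measurable
    have ipr: "integrable (lborel2) (\<lambda>(\<rho>, x). indicator {p..q} \<rho> * (indicator {0..l} x * (ff (x, \<rho>))\<^sup>2))"
      by (rule sqint_product_integrable[where K="2 * K + 2 * K"]) (use sqd pq in \<open>auto simp: ff_def\<close>)
    have inner: "(LBINT \<rho>. indicator {p..q} \<rho> * (indicator {0..l} x * (ff (x, \<rho>))\<^sup>2)) = indicator {0..l} x *\<^sub>R (LBINT \<rho>:{p..q}. (ut (x, \<rho>) - ut (x, s))\<^sup>2)" for x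
      by (subst mult.left_commute) (simp add: set_LINT_def ff_def)
    have i1: "set_integrable lborel {0..l} (\<lambda>x. LBINT \<rho>:{p..q}. (ut (x, \<rho>) - ut (x, s))\<^sup>2)"
      using lborel_pair.integrable_snd[OF ipr] unfolding inner set_integrable_def .
    have "(LBINT x:{0..l}. (LBINT \<rho>:{p..q}. (ut (x, \<rho>) - ut (x, s))\<^sup>2)) = (LBINT x. (LBINT \<rho>. indicator {p..q} \<rho> * (indicator {0..l} x * (ff (x, \<rho>))\<^sup>2)))"
      unfolding inner by (simp add: set_LINT_def[of _ "{0..l}"])
    also have "\<dots> = (LBINT \<rho>. (LBINT x. indicator {p..q} \<rho> * (indicator {0..l} x * (ff (x, \<rho>))\<^sup>2)))"
      by (rule lborel_pair.Fubini_integral[OF ipr])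
    also have "\<dots> = (LBINT \<rho>:{p..q}. G \<rho>)"
      by (simp add: set_LINT_def G_def ff_def)
    also have "\<dots> \<le> (LBINT \<rho>:{p..q}. e / 2)"
    proof (rule set_integral_mono[OF _ set_integrable_const_Icc])
      show "set_integrable lborel {p..q} G"
        using lborel_pair.integrable_fst'[OF ipr] by (simp add: set_integrable_def set_LINT_def G_def[abs_def] ff_def)
      fix \<rho> assume "\<rho> \<in> {p..q}"
      thus "G \<rho> \<le> e / 2" using Ge[of \<rho>] pq r s by (auto simp: p_def q_def split: if_splits)
    qed
    also have "\<dots> = (q - p) * (e / 2)" using pq by (simp add: set_integral_const)
    finally have *: "(LBINT x:{0..l}. (LBINT \<rho>:{p..q}. (ut (x, \<rho>) - ut (x, s))\<^sup>2)) \<le> (q - p) * (e / 2)" .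
    have c: "continuous_on {0..l} (\<lambda>x. (u (x, r) - u (x, s)) / (r - s))"
      using r by (intro continuous_intros prim2_continuous_on[OF edge_sol_prim2[OF E r(1)]] prim2_continuous_on[OF edge_sol_prim2[OF E s]]) auto
    have mD: "set_borel_measurable borel {0<..<l} D"
      unfolding D_def diff_conv_add_uminus
      by (rule set_borel_measurable_add[OF set_borel_measurable_open[OF c[unfolded diff_conv_add_uminus]]])
         (unfold set_borel_measurable_def, measurable)
    have mD2: "set_borel_measurable borel {0<..<l} (\<lambda>x. (D x)\<^sup>2)"
      using set_borel_measurable_mult[OF mD mD] by (simp add: power2_eq_square)
    have "(L2_norm l D)\<^sup>2 = (LBINT x:{0..l}. (D x)\<^sup>2)"
      unfolding L2_norm_def set_integral_lebesgue_open(1)[OF mD2] by (simp add: set_LINT_def)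
    moreover have "(q - p) * (LBINT x:{0..l}. (D x)\<^sup>2) \<le> (q - p) * (e / 2)"
    proof -
      have "(LBINT x:{0..l}. (q - p) * (D x)\<^sup>2) \<le> (LBINT x:{0..l}. (LBINT \<rho>:{p..q}. (ut (x, \<rho>) - ut (x, s))\<^sup>2))"
        unfolding set_LINT_def[of _ "{0..l}"]
        by (rule integral_mono'[OF i1[unfolded set_integrable_def]])
           (use Dsq pq in \<open>auto simp: indicator_def set_LINT_def intro!: LINT_nonneg\<close>)
      thus ?thesis using * by simp
    qed
    ultimately show ?thesis using pq(1) by (simp add: D_def[abs_def])
  qed
  have "\<forall>\<^sub>F r in at s within {..0}. r \<le> 0 \<and> r \<noteq> s \<and> \<bar>r - s\<bar> < \<delta>"
    using \<delta>(1) by (auto simp: eventually_at dist_real_def intro!: exI[of _ \<delta>])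
  thus "\<forall>\<^sub>F r in at s within {..0}. dist ((L2_norm l (\<lambda>x. (u (x, r) - u (x, s)) / (r - s) - ut (x, s)))\<^sup>2) 0 < e"
  proof eventually_elim
    case (elim r)
    thus ?case using main[of r] e by simp
  qed
qed

lemma edges_123: "{1..3::nat} = {1, 2, 3}" by auto

lemma sum_123: "(\<Sum>j=1..3. f j) = f 1 + f 2 + f (3::nat)" for f :: "nat \<Rightarrow> real"
  unfolding edges_123 by (simp add: add.assoc)

text \<open>All edge solutions vanish for s \<le> - S, so placing the final time at T means rest
  during [0, T - S]. In this way a single construction serves every T \<ge> S. The control
  \<open>f2\<close> is whatever flux difference the edges produce at v0.\<close>

lemma edge_sols_weak_solution:
  assumes l: "\<And>j. j \<in> {1..3} \<Longrightarrow> l j > 0" and q: "\<And>j. j \<in> {1..3} \<Longrightarrow> continuous_on {0..l j} (q j)"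
    and E: "\<And>j. j \<in> {1..3::nat} \<Longrightarrow> edge_sol (l j) S K (h j) (u j) (ux j) (ut j)" and S: "S \<ge> 0" and T: "T > 0" "T \<ge> S"
    and hq: "\<And>j x s. j \<in> {1..3} \<Longrightarrow> x \<in> {0<..<l j} \<Longrightarrow> s \<in> {-S..0} \<Longrightarrow> h j (x, s) = - (q j x * u j (x, s))"
    and bc: "\<And>s. s \<le> 0 \<Longrightarrow> u 2 (l 2, s) = 0" "\<And>s. s \<le> 0 \<Longrightarrow> u 3 (l 3, s) = 0"
      "\<And>s. s \<le> 0 \<Longrightarrow> u 1 (0, s) + u 2 (0, s) + u 3 (0, s) = 0" "\<And>s. s \<le> 0 \<Longrightarrow> ux 3 (0, s) = ux 1 (0, s)"
  shows "weak_solution q l T (\<lambda>t. u 1 (l 1, t - T)) (\<lambda>t. ux 2 (0, t - T) - ux 1 (0, t - T)) (\<lambda>t j x. u j (x, t - T))"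
proof -
  note d = edge_solD[OF E]
  have fl: "filterlim (\<lambda>s. s - T) (at (t - T) within {..0}) (at t within {0..T})" for t
  proof -
    have "((\<lambda>s. s - T) \<longlongrightarrow> t - T) (at t within {0..T})" by (intro tendsto_intros)
    thus ?thesis by (auto simp: filterlim_at eventually_at_filter)
  qed
  have pr: "prim2 (l j) (\<lambda>x. u j (x, t - T)) (\<lambda>x. ux j (x, t - T))" if "j \<in> {1..3}" "t \<in> {0..T}" for j t
    using edge_sol_prim2[OF E[OF that(1)], of "t - T"] that by simp
  have H1: "star_H1 l (\<lambda>j x. u j (x, t - T))" if "t \<in> {0..T}" for t
    unfolding star_H1_def using prim2_H1(1)[OF l pr[OF _ that]] by blast
  have H1c: "((\<lambda>s. star_H1_norm l (\<lambda>j x. u j (x, s - T) - u j (x, t - T))) \<longlongrightarrow> 0) (at t within {0..T})" if t: "t \<in> {0..T}" for t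
  proof -
    have "((\<lambda>s. sqrt (\<Sum>j=1..3. (L2_norm (l j) (wderiv (l j) (\<lambda>x. u j (x, s - T) - u j (x, t - T))))\<^sup>2 +
       (L2_norm (l j) (\<lambda>x. u j (x, s - T) - u j (x, t - T)))\<^sup>2)) \<longlongrightarrow> sqrt (\<Sum>j=1..3::nat. 0)) (at t within {0..T})"
    proof (intro tendsto_real_sqrt tendsto_sum)
      fix j :: nat assume j: "j \<in> {1..3}"
      have "t - T \<le> 0" using t by simp
      from filterlim_compose[OF edge_sol_H1_continuous[OF E[OF j] l[OF j] S this] fl]
      show "((\<lambda>s. (L2_norm (l j) (wderiv (l j) (\<lambda>x. u j (x, s - T) - u j (x, t - T))))\<^sup>2 +
       (L2_norm (l j) (\<lambda>x. u j (x, s - T) - u j (x, t - T)))\<^sup>2) \<longlongrightarrow> 0) (at t within {0..T})" .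
    qed
    thus ?thesis by (simp add: star_H1_norm_def)
  qed
  define v where "v t j x = ut j (x, t - T)" for t j x
  have vL2: "star_L2 l (v t)" if t: "t \<in> {0..T}" for t
    unfolding star_L2_def v_def
  proof
    fix j :: nat assume j: "j \<in> {1..3}"
    have m: "(\<lambda>x. ut j (x, t - T)) \<in> borel_measurable borel" using slice_measurable(1)[OF d(2)[OF j]] .
    show "L2_space (l j) (\<lambda>x. ut j (x, t - T))" unfolding L2_space_borel_iff[OF m]
      using d(10)[OF j, of "t - T"] t by (simp add: sqint_def)
  qed
  have vq: "((\<lambda>s. star_L2_norm l (\<lambda>j x. (u j (x, s - T) - u j (x, t - T)) / (s - t) - v t j x)) \<longlongrightarrow> 0) (at t within {0..T})"
    if t: "t \<in> {0..T}" for t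
  proof -
    have "((\<lambda>s. sqrt (\<Sum>j=1..3. (L2_norm (l j) (\<lambda>x. (u j (x, s - T) - u j (x, t - T)) / (s - t) - v t j x))\<^sup>2)) \<longlongrightarrow> sqrt (\<Sum>j=1..3::nat. 0)) (at t within {0..T})"
    proof (intro tendsto_real_sqrt tendsto_sum)
      fix j :: nat assume j: "j \<in> {1..3}"
      have "t - T \<le> 0" using t by simp
      from filterlim_compose[OF edge_sol_quotient[OF E[OF j] l[OF j] S this] fl]
      show "((\<lambda>s. (L2_norm (l j) (\<lambda>x. (u j (x, s - T) - u j (x, t - T)) / (s - t) - v t j x))\<^sup>2) \<longlongrightarrow> 0) (at t within {0..T})"
        by (simp add: v_def)
    qed
    thus ?thesis by (simp add: star_L2_norm_def)
  qed
  have vc: "((\<lambda>s. star_L2_norm l (\<lambda>j x. v s j x - v t j x)) \<longlongrightarrow> 0) (at t within {0..T})"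
    if t: "t \<in> {0..T}" for t
  proof -
    have "((\<lambda>s. sqrt (\<Sum>j=1..3. (L2_norm (l j) (\<lambda>x. v s j x - v t j x))\<^sup>2)) \<longlongrightarrow> sqrt (\<Sum>j=1..3::nat. 0)) (at t within {0..T})"
    proof (intro tendsto_real_sqrt tendsto_sum)
      fix j :: nat assume j: "j \<in> {1..3}"
      have "t - T \<le> 0" using t by simp
      from filterlim_compose[OF d(16)[OF j this] fl]
      have L: "((\<lambda>s. LBINT x:{0..l j}. (v s j x - v t j x)\<^sup>2) \<longlongrightarrow> 0) (at t within {0..T})" by (simp add: v_def)
      have "(L2_norm (l j) (\<lambda>x. v s j x - v t j x))\<^sup>2 = (LBINT x:{0..l j}. (v s j x - v t j x)\<^sup>2)" for s
      proof -
        have "(\<lambda>x. v s j x - v t j x) \<in> borel_measurable borel" unfolding v_def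
          using slice_measurable(1)[OF d(2)[OF j]] by (intro borel_measurable_diff)
        from L2_norm_borel[OF this] show ?thesis by (simp add: set_LINT_def)
      qed
      thus "((\<lambda>s. (L2_norm (l j) (\<lambda>x. v s j x - v t j x))\<^sup>2) \<longlongrightarrow> 0) (at t within {0..T})" using L by simp
    qed
    thus ?thesis by (simp add: star_L2_norm_def)
  qed
  have v0: "star_L2_norm l (v 0) = 0"
  proof -
    have "L2_norm (l j) (v 0 j) = 0" if j: "j \<in> {1..3}" for j
    proof -
      have m: "v 0 j \<in> borel_measurable borel" unfolding v_def[abs_def] using slice_measurable(1)[OF d(2)[OF j]] .
      have "(LBINT x:{0..l j}. (v 0 j x)\<^sup>2) = (LBINT x:{0..l j}. 0)"
        by (rule set_lebesgue_integral_cong) (use d(7)[OF j] T in \<open>auto simp: v_def\<close>)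
      thus ?thesis by (simp add: L2_norm_borel[OF m])
    qed
    thus ?thesis by (simp add: star_L2_norm_def)
  qed
  have weak: "weak_deriv T (\<lambda>t. star_L2_inner l (v t) w) (\<lambda>t. - (star_form q l (\<lambda>j x. u j (x, t - T)) w + (ux 2 (0, t - T) - ux 1 (0, t - T)) * w 2 0))"
    if w: "star_H10 l w" for w
  proof -
    have wH: "H1_space (l j) (w j)" and wl: "w j (l j) = 0" if "j \<in> {1..3}" for j
      using w that by (auto simp: star_H10_def star_H1_def)
    have w0: "w 1 0 + w 2 0 + w 3 0 = 0" using w unfolding star_H10_def sum_123 by blast
    have "\<forall>j\<in>{1..3}. \<exists>g. prim2 (l j) (w j) g" using H1_space_D(1)[OF l wH] by blast
    then obtain w' where w': "\<And>j. j \<in> {1..3} \<Longrightarrow> prim2 (l j) (w j) (w' j)" by metis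
    define J where "J j r = - w j 0 * ux j (0, r) - (LBINT y:{0..l j}. ux j (y, r) * w' j y) + (LBINT x:{0..l j}. h j (x, r) * w j x)" for j r
    have lge: "l j \<ge> 0" if "j \<in> {1..3}" for j using l[OF that] by simp
    have J: "set_integrable lborel {-S..0} (J j)" "J j \<in> borel_measurable borel"
      "s \<in> {-S..0} \<Longrightarrow> (LBINT x:{0..l j}. ut j (x, s) * w j x) = (LBINT r:{-S..s}. J j r)"
      if j: "j \<in> {1..3}" for j s
      using edge_sol_weak[OF E[OF j] lge[OF j] S w'[OF j] wl[OF j]] unfolding J_def[abs_def] by blast+
    \<comment> \<open>The derivative of the pairing, set to zero before - S: one primitive then
      describes the pairing on all of [0,T].\<close>
    define Jt where "Jt r = indicator {-S..0} r * (J 1 r + J 2 r + J 3 r)" for r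
    have Ji: "set_integrable lborel {-S..0} (\<lambda>r. J 1 r + J 2 r + J 3 r)"
      by (intro set_integral_add(1) J(1)) auto
    hence Jti: "integrable lborel Jt" by (simp add: Jt_def[abs_def] set_integrable_def)
    define g where "g t = Jt (t - T)" for t
    have [measurable]: "Jt \<in> borel_measurable borel" using Jti by simp
    have gm: "g \<in> borel_measurable borel" unfolding g_def[abs_def] by measurable
    have gi: "integrable lborel g"
      using lborel_integrable_real_affine[OF Jti, of 1 "-T"] by (simp add: g_def[abs_def] add.commute)
    have inner: "star_L2_inner l (v t) w = (\<Sum>j=1..3. LBINT x:{0..l j}. ut j (x, t - T) * w j x)" for t
      unfolding star_L2_inner_def v_def
    proof (rule sum.cong)
      fix j :: nat assume j: "j \<in> {1..3}"
      have "set_borel_measurable borel {0<..<l j} (\<lambda>x. ut j (x, t - T) * w j x)"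
      proof (rule set_borel_measurable_mult)
        show "set_borel_measurable borel {0<..<l j} (\<lambda>x. ut j (x, t - T))"
          using slice_measurable(1)[OF d(2)[OF j]] unfolding set_borel_measurable_def by measurable
        show "set_borel_measurable borel {0<..<l j} (\<lambda>x. w j x)"
          using set_borel_measurable_open[OF prim2_continuous_on[OF w'[OF j]]] by simp
      qed
      from set_integral_lebesgue_open(1)[OF this]
      show "(LINT x:{0<..<l j}|lebesgue. ut j (x, t - T) * w j x) = (LBINT x:{0..l j}. ut j (x, t - T) * w j x)" .
    qed simp
    have N: "star_L2_inner l (v t) w = (LBINT r:{..t - T}. Jt r)" if t: "t \<in> {0..T}" for t
    proof (cases "t - T \<ge> - S")
      case True
      hence s: "t - T \<in> {-S..0}" using t by simp
      have i: "set_integrable lborel {-S..t - T} (J j)" if "j \<in> {1..3}" for j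
        by (rule set_integrable_subset[OF J(1)[OF that]]) (use s in auto)
      have "(LBINT r:{..t - T}. Jt r) = (LBINT r:{-S..t - T}. J 1 r + J 2 r + J 3 r)"
        unfolding set_LINT_def using s
        by (intro LINT_cong) (auto simp: Jt_def indicator_def)
      also have "\<dots> = (LBINT r:{-S..t - T}. J 1 r) + (LBINT r:{-S..t - T}. J 2 r) + (LBINT r:{-S..t - T}. J 3 r)"
        by (subst set_integral_add(2), (intro set_integral_add(1) i, simp, simp)[1], (intro i, simp)[1], subst set_integral_add(2), (intro i, simp)+) simp
      also have "\<dots> = star_L2_inner l (v t) w" unfolding inner sum_123 using J(3)[OF _ s] by simp
      finally show ?thesis by simp
    next
      case False
      have "(LBINT r:{..t - T}. Jt r) = (LBINT r:{..t - T}. 0)"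
        by (rule set_lebesgue_integral_cong) (use False in \<open>auto simp: Jt_def\<close>)
      moreover have "(LBINT x:{0..l j}. ut j (x, t - T) * w j x) = (LBINT x:{0..l j}. 0)" if j: "j \<in> {1..3}" for j
        by (rule set_lebesgue_integral_cong) (use d(7)[OF j] False in auto)
      ultimately show ?thesis unfolding inner by simp
    qed
    have "prim T (\<lambda>t. star_L2_inner l (v t) w) g"
      unfolding prim_def
    proof (intro conjI ballI)
      show "set_integrable lborel {0..T} g" by (rule set_integrable_if_integrable[OF gi]) simp
      fix t assume t: "t \<in> {0..T}"
      have "(LBINT y:{0..t}. g y) = (LBINT y. indicator {0..t} (T + 1 * y) *\<^sub>R g (T + 1 * y))"
        unfolding set_LINT_def by (subst lborel_integral_real_affine[where c=1 and t=T]) auto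
      also have "\<dots> = (LBINT y:{-T..t - T}. Jt y)"
        unfolding set_LINT_def by (rule LINT_cong) (auto simp: g_def indicator_def)
      also have "\<dots> = (LBINT y:{..t - T}. Jt y) - (LBINT y:{..-T}. Jt y)"
        by (rule integral_atMost_diff[OF Jti, symmetric]) (use t in auto)
      also have "\<dots> = star_L2_inner l (v t) w - star_L2_inner l (v 0) w" using N[OF t] N[of 0] T by simp
      finally show "star_L2_inner l (v t) w = star_L2_inner l (v 0) w + (LBINT y:{0..t}. g y)" by simp
    qed (rule gm)
    from prim_imp_weak_deriv[OF this T(1)] have wd: "weak_deriv T (\<lambda>t. star_L2_inner l (v t) w) g" .
    have form: "star_form q l (\<lambda>j x. u j (x, t - T)) w = (\<Sum>j=1..3. (LBINT y:{0..l j}. ux j (y, t - T) * w' j y) + (LBINT x:{0..l j}. q j x * u j (x, t - T) * w j x))"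
      if t: "t \<in> {0..T}" for t
      unfolding star_form_def by (rule sum.cong[OF refl]) (rule star_form_edge[OF l pr[OF _ t] w' q])
    let ?G = "\<lambda>t. - (star_form q l (\<lambda>j x. u j (x, t - T)) w + (ux 2 (0, t - T) - ux 1 (0, t - T)) * w 2 0)"
    have G: "?G t = g t" if t: "t \<in> {0<..<T}" for t
    proof -
      have t': "t \<in> {0..T}" and s0: "t - T \<le> 0" using t by auto
      show ?thesis
      proof (cases "t - T \<ge> - S")
        case True
        hence s: "t - T \<in> {-S..0}" using t by simp
        have hw: "(LBINT x:{0..l j}. h j (x, t - T) * w j x) = - (LBINT x:{0..l j}. q j x * u j (x, t - T) * w j x)" if j: "j \<in> {1..3}" for j
        proof -
          have op: "(LBINT x:{0..l j}. F x) = (LBINT x:{0<..<l j}. F x)" for F :: "real \<Rightarrow> real"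
            by (rule set_integral_discrete_difference[where X="{0,l j}"]) auto
          have "(LBINT x:{0<..<l j}. h j (x, t - T) * w j x) = (LBINT x:{0<..<l j}. - (q j x * u j (x, t - T) * w j x))"
            by (rule set_lebesgue_integral_cong) (use hq[OF j _ s] in auto)
          thus ?thesis unfolding op by (simp add: set_LINT_def)
        qed
        define a where "a j = (LBINT y:{0..l j}. ux j (y, t - T) * w' j y)" for j
        define b where "b j = (LBINT x:{0..l j}. q j x * u j (x, t - T) * w j x)" for j
        define p where "p = ux 1 (0, t - T)"
        \<comment> \<open>Eliminating w 3 0 by the sum condition and ux 3 by ux 1 leaves the flux
          difference ux 2 - ux 1 times w 2 0, the control term of the variational equation.\<close>
        have w3: "w 3 0 = - w 1 0 - w 2 0" using w0 by simp
        have "g t = J 1 (t - T) + J 2 (t - T) + J 3 (t - T)" using s by (simp add: g_def Jt_def)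
        also have "\<dots> = - (w 1 0 * p + w 2 0 * ux 2 (0, t - T) + w 3 0 * p) - (a 1 + a 2 + a 3) - (b 1 + b 2 + b 3)"
          using hw bc(4)[OF s0] by (simp add: J_def a_def b_def p_def)
        also have "\<dots> = - ((a 1 + a 2 + a 3) + (b 1 + b 2 + b 3) + (ux 2 (0, t - T) - p) * w 2 0)"
          unfolding w3 by (simp add: algebra_simps)
        finally show ?thesis unfolding form[OF t'] sum_123 by (simp add: a_def b_def p_def)
      next
        case False
        have z: "ux j (x, t - T) = 0" "u j (x, t - T) = 0" if "j \<in> {1..3}" "x \<in> {0..l j}" for j x
          using d(5)[OF that] d(6)[OF that] False by auto
        have "(LBINT y:{0..l j}. ux j (y, t - T) * w' j y) = (LBINT x:{0..l j}. 0)" if j: "j \<in> {1..3}" for j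
          by (rule set_lebesgue_integral_cong) (use z[OF j] in auto)
        moreover have "(LBINT x:{0..l j}. q j x * u j (x, t - T) * w j x) = (LBINT x:{0..l j}. 0)" if j: "j \<in> {1..3}" for j
          by (rule set_lebesgue_integral_cong) (use z[OF j] in auto)
        moreover have "ux 1 (0, t - T) = 0" "ux 2 (0, t - T) = 0" using z(1)[of 1 0] z(1)[of 2 0] lge[of 1] lge[of 2] by auto
        ultimately show ?thesis unfolding form[OF t'] using False by (simp add: g_def Jt_def)
      qed
    qed
    have gmm: "set_borel_measurable lebesgue {0<..<T} g" by (rule borel_imp_set_borel_measurable_lebesgue[OF gm])
    have Gm: "set_borel_measurable lebesgue {0<..<T} ?G"
    proof -
      have "(\<lambda>t. indicator {0<..<T} t *\<^sub>R ?G t) = (\<lambda>t. indicator {0<..<T} t *\<^sub>R g t)"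
      proof
        fix t show "indicator {0<..<T} t *\<^sub>R ?G t = indicator {0<..<T} t *\<^sub>R g t"
          using G[of t] by (cases "t \<in> {0<..<T}") auto
      qed
      thus ?thesis using gmm unfolding set_borel_measurable_def by simp
    qed
    show ?thesis by (rule weak_deriv_cong[OF wd gmm Gm _ refl]) (use G in auto)
  qed
  show ?thesis
    unfolding weak_solution_def
  proof (intro conjI)
    show "\<forall>t\<in>{0..T}. star_H1 l (\<lambda>j x. u j (x, t - T)) \<and>
       ((\<lambda>s. star_H1_norm l (\<lambda>j x. u j (x, s - T) - u j (x, t - T))) \<longlongrightarrow> 0) (at t within {0..T})"
      using H1 H1c by blast
    show "\<exists>v. (\<forall>t\<in>{0..T}. star_L2 l (v t) \<and>
            ((\<lambda>s. star_L2_norm l (\<lambda>j x. (u j (x, s - T) - u j (x, t - T)) / (s - t) - v t j x)) \<longlongrightarrow> 0) (at t within {0..T}) \<and>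
            ((\<lambda>s. star_L2_norm l (\<lambda>j x. v s j x - v t j x)) \<longlongrightarrow> 0) (at t within {0..T})) \<and>
          star_L2_norm l (v 0) = 0 \<and>
          (\<forall>w. star_H10 l w \<longrightarrow> weak_deriv T (\<lambda>t. star_L2_inner l (v t) w)
             (\<lambda>t. - (star_form q l (\<lambda>j x. u j (x, t - T)) w + (ux 2 (0, t - T) - ux 1 (0, t - T)) * w 2 0)))"
      by (intro exI[of _ v] conjI ballI allI impI vL2 vq vc v0 weak)
    show "\<forall>j\<in>{1..3}. \<forall>x\<in>{0..l j}. u j (x, 0 - T) = 0" using d(5) T by simp
    show "\<forall>t\<in>{0..T}. u 1 (l 1, t - T) = u 1 (l 1, t - T) \<and> u 2 (l 2, t - T) = 0 \<and> u 3 (l 3, t - T) = 0 \<and> (\<Sum>j=1..3. u j (0, t - T)) = 0"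
      unfolding sum_123 using bc by simp
  qed
qed

section \<open>Uniqueness\<close>

lemma set_integral_FTC_within:
  fixes F f :: "real \<Rightarrow> real"
  assumes "a \<le> b" "\<And>x. x \<in> {a..b} \<Longrightarrow> (F has_real_derivative f x) (at x within {a..b})" "continuous_on {a..b} f"
  shows "(LBINT x:{a..b}. f x) = F b - F a"
proof -
  have "(f has_integral (F b - F a)) {a..b}"
    using assms by (intro fundamental_theorem_of_calculus)
      (auto simp: has_real_derivative_iff_has_vector_derivative[symmetric])
  moreover have "(LBINT x:{a..b}. f x) = integral {a..b} f"
    by (rule set_borel_integral_eq_integral(2)) (intro borel_integrable_atLeastAtMost' assms)
  ultimately show ?thesis by (simp add: integral_unique)
qed

text \<open>Writes each point as a grid point plus an offset in [0,h]; applied in both variables it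
  turns a double integral into an average of grid sums.\<close>

lemma set_integral_split_sum:
  fixes f :: "real \<Rightarrow> real"
  assumes c: "continuous_on UNIV f" and h: "h \<ge> 0"
  shows "(LBINT s:{0..real n * h}. f s) = (LBINT s:{0..h}. (\<Sum>i<n. f (s + real i * h)))"
proof (induction n)
  case 0
  have "(LBINT s:{0..real 0 * h}. f s) = 0" unfolding set_LINT_def
    by (rule integral_eq_zero_AE, use AE_lborel_singleton[of 0] in eventually_elim) (auto simp: indicator_def)
  thus ?case by simp
next
  case (Suc n)
  have si: "set_integrable lborel {a..b} (\<lambda>s. f (s + e))" for a b e
    by (rule borel_integrable_atLeastAtMost', rule continuous_on_compose2[OF c]) (auto intro!: continuous_intros)
  have si': "set_integrable lborel {a..b} f" for a b using si[of a b 0] by simp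
  have "{0..real (Suc n) * h} = {0..real n * h} \<union> {real n * h<..real (Suc n) * h}"
  proof -
    have "{0..r} = {0..p} \<union> {p<..r}" if "0 \<le> p" "p \<le> r" for p r :: real using that by auto
    from this[of "real n * h" "real (Suc n) * h"] show ?thesis using h by (simp add: mult_right_mono)
  qed
  hence "(LBINT s:{0..real (Suc n) * h}. f s) = (LBINT s:{0..real n * h}. f s) + (LBINT s:{real n * h<..real (Suc n) * h}. f s)"
    by (simp only:) (rule set_integral_Un, auto intro: set_integrable_subset[OF si'[of "0" "real (Suc n) * h"]])
  also have "(LBINT s:{real n * h<..real (Suc n) * h}. f s) = (LBINT s:{real n * h..real (Suc n) * h}. f s)"
    by (rule set_integral_discrete_difference[where X="{real n * h}"]) auto
  also have "\<dots> = (LBINT s. indicator {real n * h..real (Suc n) * h} (real n * h + 1 * s) *\<^sub>R f (real n * h + 1 * s))"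
    unfolding set_LINT_def by (subst lborel_integral_real_affine[where c=1 and t="real n * h"]) auto
  also have "\<dots> = (LBINT s:{0..h}. f (s + real n * h))"
    unfolding set_LINT_def by (rule LINT_cong) (auto simp: indicator_def algebra_simps)
  also have "(LBINT s:{0..real n * h}. f s) + (LBINT s:{0..h}. f (s + real n * h)) =
      (LBINT s:{0..h}. (\<Sum>i<n. f (s + real i * h)) + f (s + real n * h))"
  proof -
    have "set_integrable lborel {0..h} (\<lambda>s. \<Sum>i<n. f (s + real i * h))"
      by (rule borel_integrable_atLeastAtMost', intro continuous_intros, rule continuous_on_compose2[OF c]) (auto intro!: continuous_intros)
    thus ?thesis using Suc si[of 0 h "real n * h"] by simp
  qed
  finally show ?case by simp
qed

lemma set_integral_sum:
  fixes f :: "'i \<Rightarrow> 'a \<Rightarrow> real"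
  assumes "\<And>i. set_integrable M A (f i)"
  shows "(LINT x:A|M. (\<Sum>i\<in>I. f i x)) = (\<Sum>i\<in>I. LINT x:A|M. f i x)"
  unfolding set_LINT_def scaleR_sum_right
  by (rule Bochner_Integration.integral_sum) (use assms in \<open>simp add: set_integrable_def\<close>)

text \<open>When k is a Gram kernel, the double integral is the squared norm of an integrated curve.
  This form avoids integrating function-valued maps: only finite Gram sums are used, and by uniform
  continuity a shifted grid sum differs from them by at most n^2 \<epsilon>.\<close>

lemma psd_kernel_square_nonneg:
  fixes k :: "real \<Rightarrow> real \<Rightarrow> real"
  assumes c: "continuous_on UNIV (\<lambda>z. k (fst z) (snd z))" and t: "t > 0"
    and psd: "\<And>n. (\<Sum>i<n. \<Sum>j<n. k (p n i) (p n j)) \<ge> 0" and p: "\<And>n i. p n i = real i * (t / real n)"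
  shows "(LBINT \<tau>:{0..t}. (LBINT s:{0..t}. k s \<tau>)) \<ge> 0"
proof (rule field_le_epsilon)
  fix e :: real assume e: "e > 0"
  \<comment> \<open>With n h = t the accumulated error n^2 \<epsilon> h^2 equals e.\<close>
  define \<epsilon> where "\<epsilon> = e / t\<^sup>2"
  have \<epsilon>: "\<epsilon> > 0" using e t by (simp add: \<epsilon>_def)
  have "uniformly_continuous_on ({0..t} \<times> {0..t}) (\<lambda>z. k (fst z) (snd z))"
    by (rule compact_uniformly_continuous) (auto intro: compact_Times continuous_on_subset[OF c])
  from this[unfolded uniformly_continuous_on_def, rule_format, OF \<epsilon>]
  obtain \<delta> where \<delta>: "\<delta> > 0" and uc: "\<And>z z'. z \<in> {0..t} \<times> {0..t} \<Longrightarrow> z' \<in> {0..t} \<times> {0..t} \<Longrightarrow> dist z' z < \<delta> \<Longrightarrow>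
      dist (k (fst z') (snd z')) (k (fst z) (snd z)) < \<epsilon>" by blast
  obtain n where n: "n > 0" "2 * (t / real n) < \<delta>"
  proof -
    obtain n where "real n > 2 * t / \<delta>" using reals_Archimedean2 by blast
    moreover have "2 * t / \<delta> > 0" using t \<delta> by simp
    ultimately have n0: "real n > 0" and "2 * t / \<delta> < real n" by linarith+
    hence "2 * (t / real n) < \<delta>" using \<delta> by (simp add: field_simps)
    thus ?thesis using n0 by (intro that[of n]) auto
  qed
  define h where "h = t / real n"
  have h: "h \<ge> 0" "real n * h = t" "2 * h < \<delta>" using n t by (auto simp: h_def)
  have cs: "continuous_on UNIV (\<lambda>s. k (f s) (g s))" if "continuous_on UNIV f" "continuous_on UNIV g" for f g :: "real \<Rightarrow> real"
    using continuous_on_compose2[OF c continuous_on_Pair[OF that]] by simp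
  have inner: "(LBINT s:{0..t}. k s \<tau>) = (LBINT s:{0..h}. (\<Sum>i<n. k (s + real i * h) \<tau>))" for \<tau>
    using set_integral_split_sum[OF cs[OF continuous_on_id continuous_on_const] h(1), of n \<tau>] h(2) by simp
  have inth: "(LBINT s:{0..t}. k s \<tau>) = (\<Sum>i<n. LBINT s:{0..h}. k (s + real i * h) \<tau>)" for \<tau>
  proof -
    have i: "set_integrable lborel {0..h} (\<lambda>s. k (s + real i * h) \<tau>)" for i
      by (rule borel_integrable_atLeastAtMost', rule continuous_on_subset[OF cs]) (auto intro!: continuous_intros)
    show ?thesis unfolding inner by (rule set_integral_sum[OF i])
  qed
  define KK where "KK i j = k (real i * h) (real j * h)" for i j :: nat
  have lower: "(\<Sum>i<n. \<Sum>j<n. KK i j) - real n * real n * \<epsilon> \<le> (\<Sum>i<n. \<Sum>j<n. k (s + real i * h) (\<tau> + real j * h))"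
    if s: "s \<in> {0..h}" and \<tau>: "\<tau> \<in> {0..h}" for s \<tau>
  proof -
    have "KK i j - \<epsilon> \<le> k (s + real i * h) (\<tau> + real j * h)" if ij: "i < n" "j < n" for i j
    proof -
      have b: "x + real m * h \<in> {0..t}" if "x \<in> {0..h}" "m < n" for x m
      proof -
        have "x + real m * h \<le> h + real m * h" using that by simp
        also have "\<dots> = real (Suc m) * h" by (simp add: algebra_simps)
        also have "\<dots> \<le> real n * h" using that h by (intro mult_right_mono) auto
        finally show ?thesis using h that by auto
      qed
      have "dist (s + real i * h, \<tau> + real j * h) (real i * h, real j * h) < \<delta>"
      proof -
        have "dist (s + real i * h, \<tau> + real j * h) (real i * h, real j * h) \<le> \<bar>s\<bar> + \<bar>\<tau>\<bar>"
          by (simp add: dist_prod_def dist_real_def sqrt_sum_squares_le_sum_abs)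
        also have "\<dots> < \<delta>" using s \<tau> h by auto
        finally show ?thesis .
      qed
      from uc[OF _ _ this] b[OF s ij(1)] b[OF \<tau> ij(2)] b[of 0 i] b[of 0 j] ij h(1)
      have "dist (k (s + real i * h) (\<tau> + real j * h)) (KK i j) < \<epsilon>" by (simp add: KK_def)
      thus ?thesis by (simp add: dist_real_def)
    qed
    hence "(\<Sum>i<n. \<Sum>j<n. KK i j - \<epsilon>) \<le> (\<Sum>i<n. \<Sum>j<n. k (s + real i * h) (\<tau> + real j * h))"
      by (intro sum_mono) auto
    thus ?thesis by (simp add: sum_subtractf)
  qed
  have KK0: "(\<Sum>i<n. \<Sum>j<n. KK i j) \<ge> 0" using psd[of n] by (simp add: KK_def p h_def)
  have lb: "- (real n * real n * \<epsilon>) * h \<le> (\<Sum>j<n. LBINT s:{0..t}. k s (\<tau> + real j * h))" if \<tau>: "\<tau> \<in> {0..h}" for \<tau>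
  proof -
    have i: "set_integrable lborel {0..h} (\<lambda>s. k (s + real i * h) (\<tau> + real j * h))" for i j
      by (rule borel_integrable_atLeastAtMost', rule continuous_on_subset[OF cs]) (auto intro!: continuous_intros)
    have ii: "set_integrable lborel {0..h} (\<lambda>s. \<Sum>i<n. \<Sum>j<n. k (s + real i * h) (\<tau> + real j * h))"
      by (rule borel_integrable_atLeastAtMost', intro continuous_intros, rule continuous_on_subset[OF cs]) (auto intro!: continuous_intros)
    have "(LBINT s:{0..h}. - (real n * real n * \<epsilon>)) \<le> (LBINT s:{0..h}. (\<Sum>i<n. \<Sum>j<n. k (s + real i * h) (\<tau> + real j * h)))"
    proof (rule set_integral_mono[OF set_integrable_const_Icc ii])
      fix s assume "s \<in> {0..h}"
      from lower[OF this \<tau>] KK0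
      show "- (real n * real n * \<epsilon>) \<le> (\<Sum>i<n. \<Sum>j<n. k (s + real i * h) (\<tau> + real j * h))" by linarith
    qed
    also have "\<dots> = (\<Sum>j<n. LBINT s:{0..t}. k s (\<tau> + real j * h))"
    proof -
      have "(LBINT s:{0..h}. (\<Sum>i<n. \<Sum>j<n. k (s + real i * h) (\<tau> + real j * h))) = (LBINT s:{0..h}. (\<Sum>j<n. \<Sum>i<n. k (s + real i * h) (\<tau> + real j * h)))"
        by (subst sum.swap) simp
      also have "\<dots> = (\<Sum>j<n. LBINT s:{0..h}. (\<Sum>i<n. k (s + real i * h) (\<tau> + real j * h)))"
      proof (rule set_integral_sum)
        show "set_integrable lborel {0..h} (\<lambda>s. \<Sum>i<n. k (s + real i * h) (\<tau> + real j * h))" for j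
          by (rule borel_integrable_atLeastAtMost', intro continuous_intros, rule continuous_on_subset[OF cs]) (auto intro!: continuous_intros)
      qed
      finally show ?thesis by (simp add: inner)
    qed
    finally show ?thesis using h(1) by (simp add: set_integral_const mult.commute)
  qed
  define I where "I \<tau> = (LBINT s:{0..t}. k s \<tau>)" for \<tau>
  have Ic: "continuous_on UNIV I"
  proof -
    have "continuous_on UNIV (\<lambda>\<tau>. integral {0..t} (\<lambda>s. k s \<tau>))"
    proof (rule integral_continuous_on_param[of UNIV 0 t "\<lambda>\<tau> s. k s \<tau>", simplified])
      show "continuous_on (UNIV \<times> {0..t}) (\<lambda>(\<tau>, s). k s \<tau>)"
      proof -
        have "continuous_on (UNIV \<times> {0..t}) (\<lambda>z::real \<times> real. (snd z, fst z))" by (intro continuous_intros)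
        from continuous_on_compose2[OF c this] show ?thesis by (simp add: case_prod_unfold)
      qed
    qed
    moreover have "I \<tau> = integral {0..t} (\<lambda>s. k s \<tau>)" for \<tau>
      unfolding I_def
      by (rule set_borel_integral_eq_integral(2), rule borel_integrable_atLeastAtMost', rule continuous_on_subset[OF cs]) (auto intro!: continuous_intros)
    ultimately show ?thesis by simp
  qed
  have "(LBINT \<tau>:{0..t}. I \<tau>) = (LBINT \<tau>:{0..h}. (\<Sum>j<n. I (\<tau> + real j * h)))"
    using set_integral_split_sum[OF Ic h(1), of n] h(2) by simp
  also have "\<dots> \<ge> (LBINT \<tau>:{0..h}. - (real n * real n * \<epsilon>) * h)"
  proof (rule set_integral_mono[OF set_integrable_const_Icc])
    show "set_integrable lborel {0..h} (\<lambda>\<tau>. \<Sum>j<n. I (\<tau> + real j * h))"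
      by (rule borel_integrable_atLeastAtMost', intro continuous_intros, rule continuous_on_compose2[OF Ic]) (auto intro!: continuous_intros)
    show "- (real n * real n * \<epsilon>) * h \<le> (\<Sum>j<n. I (\<tau> + real j * h))" if "\<tau> \<in> {0..h}" for \<tau>
      using lb[OF that] by (simp add: I_def)
  qed
  moreover have "(LBINT \<tau>:{0..h}. - (real n * real n * \<epsilon>) * h) = - e"
  proof -
    have "h * (real n * real n * \<epsilon> * h) = (real n * h) * (real n * h) * \<epsilon>" by (simp add: mult_ac)
    also have "\<dots> = e" unfolding h(2) using t by (simp add: \<epsilon>_def power2_eq_square)
    finally show ?thesis using h(1) by (simp add: set_integral_const)
  qed
  ultimately show "0 \<le> (LBINT \<tau>:{0..t}. (LBINT s:{0..t}. k s \<tau>)) + e" by (simp add: I_def)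
qed

text \<open>Fubini and symmetry make the integrals over the two triangles of the square equal. For a
  Gram kernel this corresponds to the derivative of the squared norm of an integrated curve being
  twice a pairing.\<close>

lemma symmetric_kernel_triangle:
  fixes k :: "real \<Rightarrow> real \<Rightarrow> real"
  assumes c: "continuous_on UNIV (\<lambda>z. k (fst z) (snd z))" and b: "\<And>s \<tau>. \<bar>k s \<tau>\<bar> \<le> B" and sym: "\<And>s \<tau>. k s \<tau> = k \<tau> s"
  shows "2 * (LBINT \<tau>:{0..t}. (LBINT s:{0..\<tau>}. k s \<tau>)) = (LBINT \<tau>:{0..t}. (LBINT s:{0..t}. k s \<tau>))"
    "set_integrable lborel {0..t} (\<lambda>\<tau>. LBINT s:{0..\<tau>}. k s \<tau>)"
proof -
  have B0: "B \<ge> 0" using order_trans[OF abs_ge_zero b[of undefined undefined]] .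
  have km: "(\<lambda>z. k (fst z) (snd z)) \<in> borel_measurable borel" by (rule borel_measurable_continuous_onI[OF c])
  have km2[measurable]: "(\<lambda>z. k (fst z) (snd z)) \<in> borel_measurable (borel \<Otimes>\<^sub>M borel)" using km by (simp add: borel_prod)
  define F where "F \<tau> s = (if 0 \<le> \<tau> \<and> \<tau> \<le> t \<and> 0 \<le> s \<and> s \<le> t \<and> s \<le> \<tau> then k s \<tau> else 0)" for \<tau> s
  define G where "G \<tau> s = (if 0 \<le> \<tau> \<and> \<tau> \<le> t \<and> 0 \<le> s \<and> s \<le> t \<and> \<tau> \<le> s then k s \<tau> else 0)" for \<tau> s
  have ks: "k s \<tau> = k \<tau> s" for s \<tau> by (rule sym)
  have Fm: "case_prod F \<in> borel_measurable borel" "case_prod G \<in> borel_measurable borel"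
    unfolding F_def G_def case_prod_unfold borel_prod[symmetric] ks[of "snd z" "fst z" for z] by measurable
  have Fi: "integrable (lborel2) (case_prod F)"
    by (rule integrable_bounded_support_plane[where M=B and a=0 and b=t and c=0 and d=t, OF Fm(1)]) (use b B0 in \<open>auto simp: F_def\<close>)
  have Gi: "integrable (lborel2) (case_prod G)"
    by (rule integrable_bounded_support_plane[where M=B and a=0 and b=t and c=0 and d=t, OF Fm(2)]) (use b B0 in \<open>auto simp: G_def\<close>)
  have eF: "indicator {0..t} \<tau> *\<^sub>R (LBINT s:{0..\<tau>}. k s \<tau>) = (LBINT s. F \<tau> s)" for \<tau>
  proof -
    have "(LBINT s. F \<tau> s) = (LBINT s. indicator {0..t} \<tau> * (indicator {0..\<tau>} s * k s \<tau>))"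
      by (rule LINT_cong) (auto simp: F_def indicator_def)
    thus ?thesis by (simp add: set_LINT_def)
  qed
  show "set_integrable lborel {0..t} (\<lambda>\<tau>. LBINT s:{0..\<tau>}. k s \<tau>)"
    unfolding set_integrable_def eF using lborel_pair.integrable_fst'[OF Fi] by simp
  have T: "(LBINT \<tau>:{0..t}. (LBINT s:{0..\<tau>}. k s \<tau>)) = (LBINT \<tau>. (LBINT s. F \<tau> s))"
    unfolding set_LINT_def[of _ "{0..t}"] eF ..
  have FG: "F \<tau> s = G s \<tau>" for \<tau> s using sym by (auto simp: F_def G_def)
  have "(LBINT \<tau>. (LBINT s. F \<tau> s)) = (LBINT \<tau>. (LBINT s. G \<tau> s))"
    unfolding FG by (rule lborel_pair.Fubini_integral[OF Gi])
  hence "2 * (LBINT \<tau>. (LBINT s. F \<tau> s)) = (LBINT \<tau>. (LBINT s. F \<tau> s)) + (LBINT \<tau>. (LBINT s. G \<tau> s))" by simp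
  also have "\<dots> = (LBINT \<tau>. (LBINT s. F \<tau> s) + (LBINT s. G \<tau> s))"
    using lborel_pair.integrable_fst'[OF Fi] lborel_pair.integrable_fst'[OF Gi] by simp
  also have "\<dots> = (LBINT \<tau>:{0..t}. (LBINT s:{0..t}. k s \<tau>))"
    unfolding set_LINT_def[of _ "{0..t}" "\<lambda>\<tau>. (LBINT s:{0..t}. k s \<tau>)"]
  proof (rule LINT_cong)
    fix \<tau>
    have cs: "continuous_on UNIV (\<lambda>s. k s \<tau>)"
      using continuous_on_compose2[OF c, of UNIV "\<lambda>s. (s, \<tau>)"] by (simp add: continuous_intros)
    have [measurable]: "(\<lambda>s. k s \<tau>) \<in> borel_measurable borel" by (rule borel_measurable_continuous_onI[OF cs])
    have "F \<tau> \<in> borel_measurable borel" unfolding F_def[abs_def] by measurable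
    hence i1: "integrable lborel (F \<tau>)"
      by (rule integrable_bounded_support[where M=B and a=0 and b=t]) (use b B0 in \<open>auto simp: F_def\<close>)
    have "G \<tau> \<in> borel_measurable borel" unfolding G_def[abs_def] by measurable
    hence i2: "integrable lborel (G \<tau>)"
      by (rule integrable_bounded_support[where M=B and a=0 and b=t]) (use b B0 in \<open>auto simp: G_def\<close>)
    note i = i1 i2
    have "(LBINT s. F \<tau> s) + (LBINT s. G \<tau> s) = (LBINT s. F \<tau> s + G \<tau> s)" using i by simp
    also have "\<dots> = (LBINT s. indicator {0..t} \<tau> * (indicator {0..t} s * k s \<tau>))"
    proof (rule integral_cong_AE)
      show "(\<lambda>s. F \<tau> s + G \<tau> s) \<in> borel_measurable lborel" using i by simp
      show "AE s in lborel. F \<tau> s + G \<tau> s = indicator {0..t} \<tau> * (indicator {0..t} s * k s \<tau>)"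
        using AE_lborel_singleton[of \<tau>] by eventually_elim (auto simp: F_def G_def indicator_def)
    qed measurable
    finally show "(LBINT s. F \<tau> s) + (LBINT s. G \<tau> s) = indicator {0..t} \<tau> *\<^sub>R (LBINT s:{0..t}. k s \<tau>)"
      by (simp add: set_LINT_def)
  qed simp
  finally show "2 * (LBINT \<tau>:{0..t}. (LBINT s:{0..\<tau>}. k s \<tau>)) = (LBINT \<tau>:{0..t}. (LBINT s:{0..t}. k s \<tau>))"
    unfolding T .
qed

text \<open>At the point where exp(- lam t) f(t) attains its maximum m the hypothesis gives m \<le>
  (C / lam) m, and lam > C forces m = 0.\<close>

lemma gronwall_zero:
  fixes f :: "real \<Rightarrow> real"
  assumes c: "continuous_on {0..T} f" and n: "\<And>t. t \<in> {0..T} \<Longrightarrow> f t \<ge> 0" and C: "C \<ge> 0"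
    and g: "\<And>t. t \<in> {0..T} \<Longrightarrow> f t \<le> C * (LBINT s:{0..t}. f s)" and t: "t \<in> {0..T}"
  shows "f t = 0"
proof -
  define lam where "lam = 2 * C + 1"
  have lam: "lam > 0" using C by (simp add: lam_def)
  have "continuous_on {0..T} (\<lambda>t. exp (- lam * t) * f t)" by (intro continuous_intros c)
  from continuous_attains_sup[OF _ _ this] t
  obtain t0 where t0: "t0 \<in> {0..T}" and mx: "\<And>s. s \<in> {0..T} \<Longrightarrow> exp (- lam * s) * f s \<le> exp (- lam * t0) * f t0" by auto
  define m where "m = exp (- lam * t0) * f t0"
  have m: "m \<ge> 0" using n[OF t0] by (simp add: m_def)
  have fs: "f s \<le> m * exp (lam * s)" if "s \<in> {0..T}" for s
    using mult_right_mono[OF mx[OF that], of "exp (lam * s)"] by (simp add: m_def mult_ac exp_minus field_simps)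
  have "(LBINT s:{0..t0}. f s) \<le> (LBINT s:{0..t0}. m * exp (lam * s))"
    using t0 fs by (intro set_integral_mono borel_integrable_atLeastAtMost' continuous_on_subset[OF c] continuous_intros) auto
  also have "\<dots> = m / lam * exp (lam * t0) - m / lam * exp (lam * 0)"
    by (rule set_integral_FTC) (use lam t0 in \<open>auto intro!: derivative_eq_intros continuous_intros\<close>)
  also have "\<dots> \<le> m / lam * exp (lam * t0)" using m lam by simp
  finally have "f t0 \<le> C * (m / lam * exp (lam * t0))" using g[OF t0] mult_left_mono[OF _ C] by (meson order_trans)
  hence "m \<le> C * m / lam"
    using mult_left_mono[of "f t0" "C * (m / lam * exp (lam * t0))" "exp (- lam * t0)"] by (simp add: m_def exp_minus field_simps)
  hence "m * lam \<le> C * m" using lam by (simp add: field_simps)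
  hence "m * (C + 1) \<le> 0" by (simp add: lam_def algebra_simps)
  hence "m = 0" using m C by (auto simp: mult_le_0_iff)
  thus ?thesis using fs[OF t] n[OF t] by simp
qed

text \<open>Uniqueness reduces to scalar functions: \<open>m\<close>, \<open>k\<close>, \<open>p\<close> and \<open>n\<close> stand for the pairings of
  \<open>u(s)\<close> with \<open>u(t)\<close>, of their derivatives, of \<open>q u(s)\<close> with \<open>u(t)\<close>, and of \<open>u\<^sub>t(t)\<close> with \<open>u(s)\<close>. Testing
  the equation at time \<open>t\<close> with \<open>u(t)\<close> itself and integrating gives the energy of \<open>\<integral> u\<close>, whose principal
  part is nonnegative.\<close>

lemma energy_zero:
  fixes k p n :: "real \<Rightarrow> real \<Rightarrow> real" and m :: "real \<Rightarrow> real"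
  assumes T: "T \<ge> 0"
    and kc: "continuous_on ({0..T} \<times> {0..T}) (\<lambda>z. k (fst z) (snd z))" and ksym: "\<And>s \<tau>. k s \<tau> = k \<tau> s"
    and kpsd: "\<And>(I :: nat set) x. finite I \<Longrightarrow> (\<And>i. i \<in> I \<Longrightarrow> x i \<in> {0..T}) \<Longrightarrow> (\<Sum>i\<in>I. \<Sum>j\<in>I. k (x i) (x j)) \<ge> (0::real)"
    and pc: "continuous_on ({0..T} \<times> {0..T}) (\<lambda>z. p (fst z) (snd z))"
    and pb: "\<And>s \<tau>. s \<in> {0..T} \<Longrightarrow> \<tau> \<in> {0..T} \<Longrightarrow> \<bar>p s \<tau>\<bar> \<le> Q * (sqrt (m s) * sqrt (m \<tau>))" and Q: "Q \<ge> 0"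
    and n: "\<And>t \<tau>. t \<in> {0..T} \<Longrightarrow> \<tau> \<in> {0..T} \<Longrightarrow> n t \<tau> = - (LBINT s:{0..t}. k s \<tau> + p s \<tau>)"
    and nc: "continuous_on {0..T} (\<lambda>t. n t t)"
    and md: "\<And>t. t \<in> {0..T} \<Longrightarrow> (m has_real_derivative 2 * n t t) (at t within {0..T})"
    and m0: "m 0 = 0" and mn: "\<And>t. m t \<ge> 0"
    and t: "t \<in> {0..T}"
  shows "m t = 0"
proof -
  have mc: "continuous_on {0..T} m" by (rule DERIV_continuous_on[OF md])
  define \<phi> where "\<phi> s = sqrt (m s)" for s
  have \<phi>c: "continuous_on {0..T} \<phi>" unfolding \<phi>_def by (intro continuous_intros mc)
  \<comment> \<open>With \<Phi> the integral of \<phi> over [0,t], m(t) is at most minus twice the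
    triangle integral of k plus 2 Q \<Phi>^2. The first term is nonpositive, and taking square roots
    leaves a linear inequality for \<phi>.\<close>
  have main: "\<phi> t \<le> sqrt (2 * Q) * (LBINT s:{0..t}. \<phi> s)" if t: "t \<in> {0..T}" for t
  proof (cases "t = 0")
    case True
    have "\<phi> 0 = 0" using m0 by (simp add: \<phi>_def)
    moreover have "(LBINT s:{0..t}. \<phi> s) \<ge> 0"
      unfolding set_LINT_def by (rule LINT_nonneg) (simp add: \<phi>_def mn)
    ultimately show ?thesis using True Q by simp
  next
    case False
    hence t0: "t > 0" using t by simp
    \<comment> \<open>Clamping to [0,T] extends the kernels continuously and boundedly to the whole
      plane.\<close>
    define cl where "cl s = max 0 (min T s)" for s
    have cl: "cl s \<in> {0..T}" for s using T by (auto simp: cl_def)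
    have cle: "cl s = s" if "s \<in> {0..T}" for s using that by (auto simp: cl_def)
    have clc: "continuous_on UNIV cl" unfolding cl_def by (intro continuous_intros)
    have ext: "continuous_on UNIV (\<lambda>z. f (cl (fst z)) (cl (snd z)))" if f: "continuous_on ({0..T} \<times> {0..T}) (\<lambda>z. f (fst z) (snd z))" for f :: "real \<Rightarrow> real \<Rightarrow> real"
    proof -
      have "continuous_on UNIV (\<lambda>z::real\<times>real. (cl (fst z), cl (snd z)))" unfolding cl_def by (intro continuous_intros)
      moreover have "(\<lambda>z::real\<times>real. (cl (fst z), cl (snd z))) ` UNIV \<subseteq> {0..T} \<times> {0..T}" using cl by blast
      ultimately have "continuous_on UNIV (\<lambda>z::real\<times>real. f (fst (cl (fst z), cl (snd z))) (snd (cl (fst z), cl (snd z))))"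
        by (rule continuous_on_compose2[OF f])
      thus ?thesis by simp
    qed
    have bnd: "\<exists>B. \<forall>s \<tau>. \<bar>f (cl s) (cl \<tau>)\<bar> \<le> B" if f: "continuous_on ({0..T} \<times> {0..T}) (\<lambda>z. f (fst z) (snd z))" for f :: "real \<Rightarrow> real \<Rightarrow> real"
    proof -
      have "compact ((\<lambda>z. f (fst z) (snd z)) ` ({0..T} \<times> {0..T}))" by (rule compact_continuous_image[OF f]) (intro compact_Times compact_Icc)
      from compact_imp_bounded[OF this] obtain B where B: "\<And>y. y \<in> (\<lambda>z. f (fst z) (snd z)) ` ({0..T} \<times> {0..T}) \<Longrightarrow> norm y \<le> B"
        unfolding bounded_iff by blast
      have "\<bar>f (cl s) (cl \<tau>)\<bar> \<le> B" for s \<tau>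
        using B[OF imageI[of "(cl s, cl \<tau>)"]] cl by simp
      thus ?thesis by blast
    qed
    define k' where "k' s \<tau> = k (cl s) (cl \<tau>)" for s \<tau>
    obtain B where B: "\<And>s \<tau>. \<bar>k' s \<tau>\<bar> \<le> B" using bnd[OF kc] by (auto simp: k'_def)
    have k'c: "continuous_on UNIV (\<lambda>z. k' (fst z) (snd z))" unfolding k'_def by (rule ext[OF kc])
    have k'sym: "k' s \<tau> = k' \<tau> s" for s \<tau> by (simp add: k'_def ksym)
    have sqpos: "(LBINT \<tau>:{0..t}. (LBINT s:{0..t}. k' s \<tau>)) \<ge> 0"
    proof (rule psd_kernel_square_nonneg[OF k'c t0, where p="\<lambda>n i. real i * (t / real n)"])
      show "0 \<le> (\<Sum>i<n. \<Sum>j<n. k' (real i * (t / real n)) (real j * (t / real n)))" for n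
        unfolding k'_def by (rule kpsd) (use cl in simp_all)
    qed simp
    have tri: "(LBINT \<tau>:{0..t}. (LBINT s:{0..\<tau>}. k' s \<tau>)) \<ge> 0"
      using symmetric_kernel_triangle(1)[OF k'c B k'sym, of t] sqpos by simp
    have tI: "{0..t} \<subseteq> {0..T}" using t by auto
    have slice: "continuous_on {0..\<tau>} (\<lambda>s. f s \<tau>)" if f: "continuous_on ({0..T} \<times> {0..T}) (\<lambda>z. f (fst z) (snd z))" and \<tau>: "\<tau> \<in> {0..T}" for f :: "real \<Rightarrow> real \<Rightarrow> real" and \<tau>
    proof -
      have "continuous_on {0..\<tau>} (\<lambda>s. (s, \<tau>))" by (intro continuous_intros)
      moreover have "(\<lambda>s. (s, \<tau>)) ` {0..\<tau>} \<subseteq> {0..T} \<times> {0..T}" using \<tau> by auto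
      ultimately have "continuous_on {0..\<tau>} (\<lambda>s. f (fst (s, \<tau>)) (snd (s, \<tau>)))"
        by (rule continuous_on_compose2[OF f])
      thus ?thesis by simp
    qed
    have i\<phi>: "set_integrable lborel {0..\<tau>} \<phi>" if "\<tau> \<in> {0..T}" for \<tau>
      by (rule borel_integrable_atLeastAtMost', rule continuous_on_subset[OF \<phi>c]) (use that in auto)
    define \<Phi> where "\<Phi> = (LBINT s:{0..t}. \<phi> s)"
    have \<Phi>: "(LBINT s:{0..\<tau>}. \<phi> s) \<le> \<Phi>" if "\<tau> \<in> {0..t}" for \<tau>
      unfolding \<Phi>_def set_LINT_def
      by (rule integral_mono[OF i\<phi>[unfolded set_integrable_def] i\<phi>[unfolded set_integrable_def]])
         (use that t in \<open>auto simp: indicator_def \<phi>_def mn\<close>)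
    define L where "L \<tau> = (LBINT s:{0..\<tau>}. k' s \<tau>)" for \<tau>
    have Li: "set_integrable lborel {0..t} (\<lambda>\<tau>. - 1 * L \<tau> + Q * \<Phi> * \<phi> \<tau>)"
      unfolding L_def
      by (intro set_integral_add(1) set_integrable_mult_right symmetric_kernel_triangle(2)[OF k'c B k'sym] i\<phi> t)
    have nb: "n \<tau> \<tau> \<le> - 1 * L \<tau> + Q * \<Phi> * \<phi> \<tau>" if \<tau>: "\<tau> \<in> {0..t}" for \<tau>
    proof -
      have \<tau>T: "\<tau> \<in> {0..T}" using \<tau> t by auto
      have ik: "set_integrable lborel {0..\<tau>} (\<lambda>s. k s \<tau>)" by (rule borel_integrable_atLeastAtMost'[OF slice[OF kc \<tau>T]])
      have ip: "set_integrable lborel {0..\<tau>} (\<lambda>s. p s \<tau>)" by (rule borel_integrable_atLeastAtMost'[OF slice[OF pc \<tau>T]])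
      have "(LBINT s:{0..\<tau>}. k s \<tau>) = (LBINT s:{0..\<tau>}. k' s \<tau>)"
        by (rule set_lebesgue_integral_cong) (use \<tau>T cle in \<open>auto simp: k'_def\<close>)
      moreover have "- (LBINT s:{0..\<tau>}. p s \<tau>) \<le> Q * \<Phi> * \<phi> \<tau>"
      proof -
        have "- (LBINT s:{0..\<tau>}. p s \<tau>) \<le> (LBINT s:{0..\<tau>}. \<bar>p s \<tau>\<bar>)"
          using set_integral_abs_bound[of lborel "{0..\<tau>}" "\<lambda>s. p s \<tau>"] by linarith
        also have "\<dots> \<le> (LBINT s:{0..\<tau>}. (Q * \<phi> \<tau>) * \<phi> s)"
        proof (rule set_integral_mono[OF set_integrable_abs[OF ip] set_integrable_mult_right[OF i\<phi>[OF \<tau>T]]])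
          fix s assume "s \<in> {0..\<tau>}"
          thus "\<bar>p s \<tau>\<bar> \<le> (Q * \<phi> \<tau>) * \<phi> s" using pb[of s \<tau>] \<tau>T by (simp add: \<phi>_def mult_ac)
        qed
        also have "\<dots> = (Q * \<phi> \<tau>) * (LBINT s:{0..\<tau>}. \<phi> s)" by simp
        also have "\<dots> \<le> (Q * \<phi> \<tau>) * \<Phi>" using Q mn by (intro mult_left_mono \<Phi> \<tau>) (auto simp: \<phi>_def)
        finally show ?thesis by (simp add: mult_ac)
      qed
      ultimately show ?thesis unfolding n[OF \<tau>T \<tau>T] set_integral_add(2)[OF ik ip] L_def by simp
    qed
    have "m t = (LBINT \<tau>:{0..t}. 2 * n \<tau> \<tau>)"
    proof -
      have "(LBINT \<tau>:{0..t}. 2 * n \<tau> \<tau>) = m t - m 0"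
      proof (rule set_integral_FTC_within)
        show "(m has_real_derivative 2 * n x x) (at x within {0..t})" if "x \<in> {0..t}" for x
          by (rule DERIV_subset[OF md tI]) (use that tI in auto)
        show "continuous_on {0..t} (\<lambda>\<tau>. 2 * n \<tau> \<tau>)" by (intro continuous_intros continuous_on_subset[OF nc tI])
      qed (use t0 in simp)
      thus ?thesis using m0 by simp
    qed
    also have "\<dots> \<le> (LBINT \<tau>:{0..t}. 2 * (- 1 * L \<tau> + Q * \<Phi> * \<phi> \<tau>))"
    proof (rule set_integral_mono)
      show "set_integrable lborel {0..t} (\<lambda>\<tau>. 2 * n \<tau> \<tau>)"
        by (rule borel_integrable_atLeastAtMost') (intro continuous_intros continuous_on_subset[OF nc tI])
      show "set_integrable lborel {0..t} (\<lambda>\<tau>. 2 * (- 1 * L \<tau> + Q * \<Phi> * \<phi> \<tau>))"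
        by (rule set_integrable_mult_right[OF Li])
      show "2 * n \<tau> \<tau> \<le> 2 * (- 1 * L \<tau> + Q * \<Phi> * \<phi> \<tau>)" if "\<tau> \<in> {0..t}" for \<tau>
        by (rule mult_left_mono[OF nb[OF that]]) simp
    qed
    also have "\<dots> = 2 * (LBINT \<tau>:{0..t}. - 1 * L \<tau> + Q * \<Phi> * \<phi> \<tau>)" by (rule set_integral_mult_right)
    also have "(LBINT \<tau>:{0..t}. - 1 * L \<tau> + Q * \<Phi> * \<phi> \<tau>) = - 1 * (LBINT \<tau>:{0..t}. L \<tau>) + Q * \<Phi> * \<Phi>"
      unfolding set_integral_add(2)[OF set_integrable_mult_right[of "- 1", OF symmetric_kernel_triangle(2)[OF k'c B k'sym, of t], folded L_def] set_integrable_mult_right[of "Q * \<Phi>", OF i\<phi>[OF t]]]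
        set_integral_mult_right by (simp only: \<Phi>_def)
    also have "2 * (- 1 * (LBINT \<tau>:{0..t}. L \<tau>) + Q * \<Phi> * \<Phi>) \<le> (sqrt (2 * Q) * \<Phi>)\<^sup>2"
    proof -
      have "(sqrt (2 * Q) * \<Phi>)\<^sup>2 = 2 * Q * (\<Phi> * \<Phi>)" using Q by (simp add: power_mult_distrib) (simp add: power2_eq_square)
      thus ?thesis using tri by (simp add: L_def)
    qed
    finally have "sqrt (m t) \<le> sqrt ((sqrt (2 * Q) * \<Phi>)\<^sup>2)" by (rule real_sqrt_le_mono)
    moreover have "\<Phi> \<ge> 0"
      unfolding \<Phi>_def set_LINT_def by (rule LINT_nonneg) (simp add: \<phi>_def mn)
    ultimately show ?thesis using Q by (simp add: \<phi>_def \<Phi>_def)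
  qed
  have "\<phi> t = 0"
    by (rule gronwall_zero[OF \<phi>c _ _ main t]) (use Q mn in \<open>auto simp: \<phi>_def\<close>)
  thus ?thesis by (simp add: \<phi>_def)
qed

section \<open>The L^2 pairing on the star\<close>

lemma set_borel_measurable_cmult:
  fixes f :: "real \<Rightarrow> real"
  assumes "set_borel_measurable M S f" shows "set_borel_measurable M S (\<lambda>x. c * f x)"
proof -
  have "(\<lambda>x. indicator S x *\<^sub>R (c * f x)) = (\<lambda>x. c * (indicator S x *\<^sub>R f x))" by auto
  thus ?thesis using assms unfolding set_borel_measurable_def by simp
qed

lemma L2_space_mult_integrable:
  assumes f: "L2_space l f" and g: "L2_space l g"
  shows "set_integrable lebesgue {0<..<l} (\<lambda>x. f x * g x)"
  unfolding set_integrable_def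
proof (rule LINT_integrable_bound)
  show "integrable lebesgue (\<lambda>x. indicator {0<..<l} x *\<^sub>R ((f x)\<^sup>2 + (g x)\<^sup>2))"
    using set_integral_add(1)[of lebesgue "{0<..<l}" "\<lambda>x. (f x)\<^sup>2" "\<lambda>x. (g x)\<^sup>2"] f g
    by (simp add: L2_space_def set_integrable_def)
  show "(\<lambda>x. indicator {0<..<l} x *\<^sub>R (f x * g x)) \<in> borel_measurable lebesgue"
    using set_borel_measurable_mult[of lebesgue "{0<..<l}" f g] f g by (auto simp: L2_space_def set_borel_measurable_def)
  show "AE x in lebesgue. norm (indicator {0<..<l} x *\<^sub>R (f x * g x)) \<le> norm (indicator {0<..<l} x *\<^sub>R ((f x)\<^sup>2 + (g x)\<^sup>2))"
    using abs_mult_le_sq by (intro AE_I2) (auto simp: indicator_def)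
qed

lemma L2_space_lincomb:
  assumes f: "L2_space l f" and g: "L2_space l g"
  shows "L2_space l (\<lambda>x. a * f x + b * g x)"
  unfolding L2_space_def
proof
  show m: "set_borel_measurable lebesgue {0<..<l} (\<lambda>x. a * f x + b * g x)"
    using f g by (intro set_borel_measurable_add set_borel_measurable_cmult) (auto simp: L2_space_def)
  have "set_integrable lebesgue {0<..<l} (\<lambda>x. a\<^sup>2 * (f x * f x) + (2 * a * b) * (f x * g x) + b\<^sup>2 * (g x * g x))"
    using L2_space_mult_integrable[OF f f] L2_space_mult_integrable[OF f g] L2_space_mult_integrable[OF g g]
    by (intro set_integral_add(1) set_integrable_mult_right) auto
  moreover have "(\<lambda>x. a\<^sup>2 * (f x * f x) + (2 * a * b) * (f x * g x) + b\<^sup>2 * (g x * g x)) = (\<lambda>x. (a * f x + b * g x)\<^sup>2)"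
    by (auto simp: power2_eq_square algebra_simps)
  ultimately show "set_integrable lebesgue {0<..<l} (\<lambda>x. (a * f x + b * g x)\<^sup>2)" by simp
qed

lemma L2_space_continuous_mult:
  assumes c: "continuous_on {0..l} q" and f: "L2_space l f"
  shows "L2_space l (\<lambda>x. q x * f x)"
proof -
  obtain Q where Q: "\<And>x. x \<in> {0..l} \<Longrightarrow> \<bar>q x\<bar> \<le> Q"
  proof -
    have "compact (q ` {0..l})" by (rule compact_continuous_image[OF c]) simp
    from compact_imp_bounded[OF this] show ?thesis using that unfolding bounded_iff by force
  qed
  have m: "set_borel_measurable lebesgue {0<..<l} (\<lambda>x. q x * f x)"
    using continuous_imp_set_borel_measurable_lebesgue[OF c] f by (intro set_borel_measurable_mult) (auto simp: L2_space_def)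
  have "set_integrable lebesgue {0<..<l} (\<lambda>x. (q x * f x)\<^sup>2)"
    unfolding set_integrable_def
  proof (rule LINT_integrable_bound)
    show "integrable lebesgue (\<lambda>x. indicator {0<..<l} x *\<^sub>R (Q\<^sup>2 * (f x)\<^sup>2))"
      using set_integrable_mult_right[of "Q\<^sup>2" lebesgue "{0<..<l}" "\<lambda>x. (f x)\<^sup>2"] f
      by (simp add: L2_space_def set_integrable_def)
    show "(\<lambda>x. indicator {0<..<l} x *\<^sub>R (q x * f x)\<^sup>2) \<in> borel_measurable lebesgue"
      using set_borel_measurable_mult[OF m m] by (simp add: set_borel_measurable_def power2_eq_square)
    show "AE x in lebesgue. norm (indicator {0<..<l} x *\<^sub>R (q x * f x)\<^sup>2) \<le> norm (indicator {0<..<l} x *\<^sub>R (Q\<^sup>2 * (f x)\<^sup>2))"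
    proof (intro AE_I2)
      fix x
      have "(q x * f x)\<^sup>2 \<le> Q\<^sup>2 * (f x)\<^sup>2" if "x \<in> {0<..<l}"
        using power_mono[OF Q[of x], of 2] that by (simp add: power_mult_distrib mult_right_mono)
      thus "norm (indicator {0<..<l} x *\<^sub>R (q x * f x)\<^sup>2) \<le> norm (indicator {0<..<l} x *\<^sub>R (Q\<^sup>2 * (f x)\<^sup>2))"
        by (auto simp: indicator_def)
    qed
  qed
  with m show ?thesis by (simp add: L2_space_def)
qed

lemma L2_space_continuous:
  assumes "continuous_on {0..l} f" shows "L2_space l f"
proof -
  have "L2_space l (\<lambda>x. 1)" by (subst L2_space_borel_iff) (auto intro: set_integrable_const_Icc)
  from L2_space_continuous_mult[OF assms this] show ?thesis by simp
qed

lemma star_L2_lincomb: "star_L2 l f \<Longrightarrow> star_L2 l g \<Longrightarrow> star_L2 l (\<lambda>j x. a * f j x + b * g j x)"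
  unfolding star_L2_def using L2_space_lincomb by blast

lemma star_L2_diff: "star_L2 l f \<Longrightarrow> star_L2 l g \<Longrightarrow> star_L2 l (\<lambda>j x. f j x - g j x)"
  using star_L2_lincomb[of l f g 1 "-1"] by simp

lemma star_L2_inner_commute: "star_L2_inner l f g = star_L2_inner l g f"
  by (simp add: star_L2_inner_def mult.commute)

lemma star_L2_inner_lincomb:
  assumes "star_L2 l f" "star_L2 l g" "star_L2 l w"
  shows "star_L2_inner l (\<lambda>j x. a * f j x + b * g j x) w = a * star_L2_inner l f w + b * star_L2_inner l g w"
proof -
  have "(LINT x:{0<..<l j}|lebesgue. (a * f j x + b * g j x) * w j x) =
     a * (LINT x:{0<..<l j}|lebesgue. f j x * w j x) + b * (LINT x:{0<..<l j}|lebesgue. g j x * w j x)" if j: "j \<in> {1..3}" for j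
  proof -
    have i: "set_integrable lebesgue {0<..<l j} (\<lambda>x. f j x * w j x)" "set_integrable lebesgue {0<..<l j} (\<lambda>x. g j x * w j x)"
      using assms j L2_space_mult_integrable by (auto simp: star_L2_def)
    have "(LINT x:{0<..<l j}|lebesgue. (a * f j x + b * g j x) * w j x) = (LINT x:{0<..<l j}|lebesgue. a * (f j x * w j x) + b * (g j x * w j x))"
      by (simp add: algebra_simps)
    also have "\<dots> = a * (LINT x:{0<..<l j}|lebesgue. f j x * w j x) + b * (LINT x:{0<..<l j}|lebesgue. g j x * w j x)"
      unfolding set_integral_add(2)[OF set_integrable_mult_right[OF i(1)] set_integrable_mult_right[OF i(2)]] by simp
    finally show ?thesis .
  qed
  thus ?thesis by (simp add: star_L2_inner_def sum.distrib sum_distrib_left)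
qed

lemma star_L2_inner_diff:
  assumes "star_L2 l f" "star_L2 l g" "star_L2 l w"
  shows "star_L2_inner l (\<lambda>j x. f j x - g j x) w = star_L2_inner l f w - star_L2_inner l g w"
    "star_L2_inner l w (\<lambda>j x. f j x - g j x) = star_L2_inner l w f - star_L2_inner l w g"
  using star_L2_inner_lincomb[OF assms, of 1 "-1"] by (simp_all add: star_L2_inner_commute[of l w])

lemma star_L2_inner_nonneg: "star_L2_inner l f f \<ge> 0"
  unfolding star_L2_inner_def set_LINT_def
  by (intro sum_nonneg LINT_nonneg) auto

lemma star_L2_norm_eq: "star_L2_norm l f = sqrt (star_L2_inner l f f)"
proof -
  have "(L2_norm (l j) (f j))\<^sup>2 = (LINT x:{0<..<l j}|lebesgue. f j x * f j x)" for j
    unfolding L2_norm_def power2_eq_square[of "f j x" for x]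
    by (simp add: set_LINT_def)
  thus ?thesis by (simp add: star_L2_norm_def star_L2_inner_def)
qed

lemma star_L2_norm_nonneg: "star_L2_norm l f \<ge> 0"
  by (simp add: star_L2_norm_eq star_L2_inner_nonneg)

text \<open>The discriminant argument at a = - B / C. For C = 0 the affine function of a must be
  constant, since otherwise it takes the value - 1. Working with the quadratic form alone makes
  Cauchy-Schwarz available although \<open>star_L2_norm\<close> is only a seminorm on
  functions.\<close>

lemma quadratic_nonneg_imp:
  fixes A B C :: real
  assumes n: "\<And>a. 0 \<le> A + 2 * a * B + a\<^sup>2 * C" and A: "A \<ge> 0" and C: "C \<ge> 0"
  shows "\<bar>B\<bar> \<le> sqrt A * sqrt C"
proof -
  have "B\<^sup>2 \<le> A * C"
  proof (cases "C = 0")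
    case True
    have "B = 0"
    proof (rule ccontr)
      assume "B \<noteq> 0"
      have "2 * (- (A + 1) / (2 * B)) * B = - (A + 1)" using \<open>B \<noteq> 0\<close> by (simp add: field_simps)
      thus False using n[of "- (A + 1) / (2 * B)"] True by simp
    qed
    thus ?thesis using True by simp
  next
    case False
    have "A + 2 * (- B / C) * B + (- B / C)\<^sup>2 * C = A - B\<^sup>2 / C" using False by (simp add: power2_eq_square field_simps)
    hence "B\<^sup>2 / C \<le> A" using n[of "- B / C"] by simp
    thus ?thesis using False C by (simp add: field_simps)
  qed
  hence "sqrt (B\<^sup>2) \<le> sqrt (A * C)" by (rule real_sqrt_le_mono)
  thus ?thesis by (simp add: real_sqrt_mult)
qed

lemma star_L2_CS:
  assumes f: "star_L2 l f" and g: "star_L2 l g"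
  shows "\<bar>star_L2_inner l f g\<bar> \<le> star_L2_norm l f * star_L2_norm l g"
  unfolding star_L2_norm_eq
proof (rule quadratic_nonneg_imp)
  fix a :: real
  have fg: "star_L2 l (\<lambda>j x. 1 * f j x + a * g j x)" by (rule star_L2_lincomb[OF f g])
  have "0 \<le> star_L2_inner l (\<lambda>j x. 1 * f j x + a * g j x) (\<lambda>j x. 1 * f j x + a * g j x)" by (rule star_L2_inner_nonneg)
  also have "\<dots> = star_L2_inner l f f + 2 * a * star_L2_inner l f g + a\<^sup>2 * star_L2_inner l g g"
    unfolding star_L2_inner_lincomb[OF f g fg]
    unfolding star_L2_inner_commute[of l f "\<lambda>j x. 1 * f j x + a * g j x"] star_L2_inner_commute[of l g "\<lambda>j x. 1 * f j x + a * g j x"]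
      star_L2_inner_lincomb[OF f g f] star_L2_inner_lincomb[OF f g g]
    by (simp add: star_L2_inner_commute[of l g f] power2_eq_square algebra_simps)
  finally show "0 \<le> star_L2_inner l f f + 2 * a * star_L2_inner l f g + a\<^sup>2 * star_L2_inner l g g" .
qed (rule star_L2_inner_nonneg)+

lemma star_L2_norm_diff_le:
  assumes f: "star_L2 l f" and g: "star_L2 l g"
  shows "star_L2_norm l (\<lambda>j x. f j x - g j x) \<le> star_L2_norm l f + star_L2_norm l g"
proof -
  have fg: "star_L2 l (\<lambda>j x. f j x - g j x)" by (rule star_L2_diff[OF f g])
  have "star_L2_inner l (\<lambda>j x. f j x - g j x) (\<lambda>j x. f j x - g j x) = star_L2_inner l f f - 2 * star_L2_inner l f g + star_L2_inner l g g"
    unfolding star_L2_inner_diff(1)[OF f g fg] star_L2_inner_diff(2)[OF f g f] star_L2_inner_diff(2)[OF f g g]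
    by (simp add: star_L2_inner_commute[of l g f])
  also have "\<dots> \<le> (star_L2_norm l f + star_L2_norm l g)\<^sup>2"
    using star_L2_CS[OF f g] by (simp add: power2_sum star_L2_norm_eq star_L2_inner_nonneg)
  finally have "sqrt (star_L2_inner l (\<lambda>j x. f j x - g j x) (\<lambda>j x. f j x - g j x)) \<le> sqrt ((star_L2_norm l f + star_L2_norm l g)\<^sup>2)"
    by (rule real_sqrt_le_mono)
  thus ?thesis using star_L2_norm_nonneg[of l f] star_L2_norm_nonneg[of l g] by (simp add: star_L2_norm_eq[symmetric])
qed

lemma star_L2_inner_cong_AE:
  assumes "star_L2 l f" "star_L2 l f'" "star_L2 l w"
    "\<And>j. j \<in> {1..3} \<Longrightarrow> AE x in lebesgue. x \<in> {0<..<l j} \<longrightarrow> f j x = f' j x"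
  shows "star_L2_inner l f w = star_L2_inner l f' w" "star_L2_inner l w f = star_L2_inner l w f'"
proof -
  show "star_L2_inner l f w = star_L2_inner l f' w"
    unfolding star_L2_inner_def
  proof (rule sum.cong[OF refl], rule set_integral_cong_AE_lebesgue(1))
    fix j :: nat assume j: "j \<in> {1..3}"
    show "set_borel_measurable lebesgue {0<..<l j} (\<lambda>x. f j x * w j x)" "set_borel_measurable lebesgue {0<..<l j} (\<lambda>x. f' j x * w j x)"
      using assms(1-3) j by (auto simp: star_L2_def L2_space_def intro!: set_borel_measurable_mult)
    show "AE x in lebesgue. x \<in> {0<..<l j} \<longrightarrow> f j x * w j x = f' j x * w j x"
      using assms(4)[OF j] by eventually_elim auto
  qed
  thus "star_L2_inner l w f = star_L2_inner l w f'" by (simp add: star_L2_inner_commute[of l w])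
qed

section \<open>Curves of states, continuous in mean square\<close>

definition L2cont :: "(nat \<Rightarrow> real) \<Rightarrow> real \<Rightarrow> (real \<Rightarrow> nat \<Rightarrow> real \<Rightarrow> real) \<Rightarrow> bool" where
  "L2cont l T X \<longleftrightarrow> (\<forall>t\<in>{0..T}. star_L2 l (X t) \<and>
     ((\<lambda>s. star_L2_norm l (\<lambda>j x. X s j x - X t j x)) \<longlongrightarrow> 0) (at t within {0..T}))"

text \<open>The increment of the pairing is split into three pairings, each with at least one small
  factor, and Cauchy-Schwarz bounds them.\<close>

lemma L2cont_inner:
  assumes X: "L2cont l T X" and Y: "L2cont l T Y"
  shows "continuous_on ({0..T} \<times> {0..T}) (\<lambda>z. star_L2_inner l (X (fst z)) (Y (snd z)))"
  unfolding continuous_on_def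
proof
  fix z :: "real \<times> real" assume z: "z \<in> {0..T} \<times> {0..T}"
  define S where "S = {0..T} \<times> {0..T}"
  obtain t \<tau> where t: "z = (t, \<tau>)" "t \<in> {0..T}" "\<tau> \<in> {0..T}" using z by auto
  have Xt: "star_L2 l (X s)" "star_L2 l (Y s)" if "s \<in> {0..T}" for s using X Y that by (auto simp: L2cont_def)
  define A where "A s = star_L2_norm l (\<lambda>j x. X s j x - X t j x)" for s
  define B where "B s = star_L2_norm l (\<lambda>j x. Y s j x - Y \<tau> j x)" for s
  have zero: "star_L2_norm l (\<lambda>j x. 0) = 0" by (simp add: star_L2_norm_def L2_norm_def)
  have "continuous (at t within {0..T}) A" "continuous (at \<tau> within {0..T}) B"
    using X Y t zero by (auto simp: continuous_within A_def[abs_def] B_def[abs_def] L2cont_def)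
  moreover have "A t = 0" "B \<tau> = 0" using zero by (auto simp: A_def B_def)
  ultimately have At: "(A \<longlongrightarrow> 0) (at t within {0..T})" and Bt: "(B \<longlongrightarrow> 0) (at \<tau> within {0..T})" by (auto simp: continuous_within)
  have c0: "((\<lambda>w. A (fst w)) \<longlongrightarrow> 0) (at z within S)"
  proof -
    have "continuous (at t within fst ` S) A"
      using \<open>continuous (at t within {0..T}) A\<close> by (rule continuous_within_subset) (auto simp: S_def)
    moreover have "continuous (at z within S) fst" by (intro continuous_intros)
    ultimately have "continuous (at z within S) (\<lambda>w. A (fst w))"
      using continuous_within_compose[of z S fst A] by (simp add: t comp_def)
    thus ?thesis using \<open>A t = 0\<close> t by (simp add: continuous_within)
  qed
  have c1: "((\<lambda>w. B (snd w)) \<longlongrightarrow> 0) (at z within S)"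
  proof -
    have "continuous (at \<tau> within snd ` S) B"
      using \<open>continuous (at \<tau> within {0..T}) B\<close> by (rule continuous_within_subset) (auto simp: S_def)
    moreover have "continuous (at z within S) snd" by (intro continuous_intros)
    ultimately have "continuous (at z within S) (\<lambda>w. B (snd w))"
      using continuous_within_compose[of z S snd B] by (simp add: t comp_def)
    thus ?thesis using \<open>B \<tau> = 0\<close> t by (simp add: continuous_within)
  qed
  have "((\<lambda>w. star_L2_inner l (X (fst w)) (Y (snd w)) - star_L2_inner l (X t) (Y \<tau>)) \<longlongrightarrow> 0) (at z within S)"
  proof (rule Lim_null_comparison)
    have "((\<lambda>w. A (fst w) * B (snd w) + A (fst w) * star_L2_norm l (Y \<tau>) + star_L2_norm l (X t) * B (snd w)) \<longlongrightarrow>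
       0 * 0 + 0 * star_L2_norm l (Y \<tau>) + star_L2_norm l (X t) * 0) (at z within S)" by (intro tendsto_intros c0 c1)
    thus "((\<lambda>w. A (fst w) * B (snd w) + A (fst w) * star_L2_norm l (Y \<tau>) + star_L2_norm l (X t) * B (snd w)) \<longlongrightarrow> 0) (at z within S)" by simp
    have "\<forall>\<^sub>F w in at z within S. w \<in> S" by (auto simp: eventually_at_filter)
    thus "\<forall>\<^sub>F w in at z within S. norm (star_L2_inner l (X (fst w)) (Y (snd w)) - star_L2_inner l (X t) (Y \<tau>))
       \<le> A (fst w) * B (snd w) + A (fst w) * star_L2_norm l (Y \<tau>) + star_L2_norm l (X t) * B (snd w)"
    proof eventually_elim
      case (elim w)
      obtain s \<sigma> where w: "w = (s, \<sigma>)" "s \<in> {0..T}" "\<sigma> \<in> {0..T}" using elim by (auto simp: S_def)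
      note xs = Xt(1)[OF w(2)] and xt = Xt(1)[OF t(2)] and ys = Xt(2)[OF w(3)] and yt = Xt(2)[OF t(3)]
      note dx = star_L2_diff[OF xs xt] and dy = star_L2_diff[OF ys yt]
      have "star_L2_inner l (X s) (Y \<sigma>) - star_L2_inner l (X t) (Y \<tau>) =
        star_L2_inner l (\<lambda>j x. X s j x - X t j x) (\<lambda>j x. Y \<sigma> j x - Y \<tau> j x) + star_L2_inner l (\<lambda>j x. X s j x - X t j x) (Y \<tau>)
        + star_L2_inner l (X t) (\<lambda>j x. Y \<sigma> j x - Y \<tau> j x)"
        unfolding star_L2_inner_diff(1)[OF xs xt dy] star_L2_inner_diff(1)[OF xs xt yt]
          star_L2_inner_diff(2)[OF ys yt xs] star_L2_inner_diff(2)[OF ys yt xt] by simp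
      thus ?case using star_L2_CS[OF dx dy] star_L2_CS[OF dx yt] star_L2_CS[OF xt dy]
        unfolding w A_def B_def fst_conv snd_conv real_norm_def by linarith
    qed
  qed
  thus "((\<lambda>z. star_L2_inner l (X (fst z)) (Y (snd z))) \<longlongrightarrow> star_L2_inner l (X (fst z)) (Y (snd z))) (at z within {0..T} \<times> {0..T})"
    unfolding S_def[symmetric] t fst_conv snd_conv by (rule Lim_null[THEN iffD2])
qed

lemma L2cont_diff:
  assumes X: "L2cont l T X" and Y: "L2cont l T Y"
  shows "L2cont l T (\<lambda>t j x. X t j x - Y t j x)"
  unfolding L2cont_def
proof (intro ballI conjI)
  fix t assume t: "t \<in> {0..T}"
  have S: "star_L2 l (X s)" "star_L2 l (Y s)" if "s \<in> {0..T}" for s using X Y that by (auto simp: L2cont_def)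
  show "star_L2 l (\<lambda>j x. X t j x - Y t j x)" by (rule star_L2_diff[OF S[OF t]])
  show "((\<lambda>s. star_L2_norm l (\<lambda>j x. (X s j x - Y s j x) - (X t j x - Y t j x))) \<longlongrightarrow> 0) (at t within {0..T})"
  proof (rule tendsto_sandwich[OF _ _ tendsto_const])
    have "((\<lambda>s. star_L2_norm l (\<lambda>j x. X s j x - X t j x) + star_L2_norm l (\<lambda>j x. Y s j x - Y t j x)) \<longlongrightarrow> 0 + 0) (at t within {0..T})"
      using X Y t unfolding L2cont_def by (intro tendsto_add) blast+
    thus "((\<lambda>s. star_L2_norm l (\<lambda>j x. X s j x - X t j x) + star_L2_norm l (\<lambda>j x. Y s j x - Y t j x)) \<longlongrightarrow> 0) (at t within {0..T})" by simp
    have "\<forall>\<^sub>F s in at t within {0..T}. s \<in> {0..T}" by (auto simp: eventually_at_filter)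
    thus "\<forall>\<^sub>F s in at t within {0..T}. star_L2_norm l (\<lambda>j x. (X s j x - Y s j x) - (X t j x - Y t j x)) \<le>
       star_L2_norm l (\<lambda>j x. X s j x - X t j x) + star_L2_norm l (\<lambda>j x. Y s j x - Y t j x)"
    proof eventually_elim
      case (elim s)
      have "star_L2_norm l (\<lambda>j x. (X s j x - X t j x) - (Y s j x - Y t j x)) \<le>
       star_L2_norm l (\<lambda>j x. X s j x - X t j x) + star_L2_norm l (\<lambda>j x. Y s j x - Y t j x)"
        by (rule star_L2_norm_diff_le; rule star_L2_diff; rule S; rule elim t)
      thus ?case by (simp add: algebra_simps)
    qed
  qed (use star_L2_norm_nonneg in auto)
qed

definition star_wderiv :: "(nat \<Rightarrow> real) \<Rightarrow> (nat \<Rightarrow> real \<Rightarrow> real) \<Rightarrow> nat \<Rightarrow> real \<Rightarrow> real" where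
  "star_wderiv l f j = wderiv (l j) (f j)"

lemma star_H1_wderiv_diff:
  assumes l: "\<And>j. j \<in> {1..3} \<Longrightarrow> l j > 0" and f: "star_H1 l f" and g: "star_H1 l g"
  shows "star_H1 l (\<lambda>j x. f j x - g j x)"
    "j \<in> {1..3} \<Longrightarrow> AE x in lebesgue. x \<in> {0<..<l j} \<longrightarrow> star_wderiv l (\<lambda>j x. f j x - g j x) j x = star_wderiv l f j x - star_wderiv l g j x"
proof -
  have *: "H1_space (l j) (\<lambda>x. f j x - g j x) \<and> (AE x in lebesgue. x \<in> {0<..<l j} \<longrightarrow> wderiv (l j) (\<lambda>x. f j x - g j x) x = wderiv (l j) (f j) x - wderiv (l j) (g j) x)"
    if j: "j \<in> {1..3}" for j
  proof -
    have fH: "H1_space (l j) (f j)" and gH: "H1_space (l j) (g j)" using f g j by (auto simp: star_H1_def)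
    obtain f' where f': "prim2 (l j) (f j) f'" "AE x in lebesgue. x \<in> {0<..<l j} \<longrightarrow> wderiv (l j) (f j) x = f' x"
      using H1_space_D(1)[OF l[OF j] fH] by blast
    obtain g' where g': "prim2 (l j) (g j) g'" "AE x in lebesgue. x \<in> {0<..<l j} \<longrightarrow> wderiv (l j) (g j) x = g' x"
      using H1_space_D(1)[OF l[OF j] gH] by blast
    note p = prim2_diff[OF f'(1) g'(1)]
    have "AE x in lebesgue. x \<in> {0<..<l j} \<longrightarrow> wderiv (l j) (\<lambda>x. f j x - g j x) x = wderiv (l j) (f j) x - wderiv (l j) (g j) x"
      using prim2_H1(2)[OF l[OF j] p] f'(2) g'(2) by eventually_elim auto
    thus ?thesis using prim2_H1(1)[OF l[OF j] p] by simp
  qed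
  show "star_H1 l (\<lambda>j x. f j x - g j x)" unfolding star_H1_def using * by blast
  show "j \<in> {1..3} \<Longrightarrow> AE x in lebesgue. x \<in> {0<..<l j} \<longrightarrow> star_wderiv l (\<lambda>j x. f j x - g j x) j x = star_wderiv l f j x - star_wderiv l g j x"
    unfolding star_wderiv_def using * by blast
qed

lemma star_H1_L2:
  assumes l: "\<And>j. j \<in> {1..3} \<Longrightarrow> l j > 0" and f: "star_H1 l f"
  shows "star_L2 l f" "star_L2 l (star_wderiv l f)"
  using f H1_space_D(2)[OF l] L2_space_continuous
  unfolding star_L2_def star_H1_def star_wderiv_def H1_space_def by blast+

lemma star_form_inner:
  assumes l: "\<And>j. j \<in> {1..3} \<Longrightarrow> l j > 0" and f: "star_H1 l f" and w: "star_H1 l w"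
    and q: "\<And>j. j \<in> {1..3} \<Longrightarrow> continuous_on {0..l j} (q j)"
  shows "star_form q l f w = star_L2_inner l (star_wderiv l f) (star_wderiv l w) + star_L2_inner l (\<lambda>j x. q j x * f j x) w"
proof -
  have "(LINT x:{0<..<l j}|lebesgue. wderiv (l j) (f j) x * wderiv (l j) (w j) x + q j x * f j x * w j x) =
    (LINT x:{0<..<l j}|lebesgue. star_wderiv l f j x * star_wderiv l w j x) + (LINT x:{0<..<l j}|lebesgue. (q j x * f j x) * w j x)"
    if j: "j \<in> {1..3}" for j
  proof -
    have "L2_space (l j) (f j)" "L2_space (l j) (w j)" "L2_space (l j) (star_wderiv l f j)" "L2_space (l j) (star_wderiv l w j)"
      using star_H1_L2[OF l f] star_H1_L2[OF l w] j by (auto simp: star_L2_def)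
    thus ?thesis unfolding star_wderiv_def
      by (intro set_integral_add(2) L2_space_mult_integrable L2_space_continuous_mult q j)
  qed
  thus ?thesis by (simp add: star_form_def star_L2_inner_def sum.distrib)
qed

lemma star_H1_norm_ge:
  "star_L2_norm l f \<le> star_H1_norm l f" "star_L2_norm l (star_wderiv l f) \<le> star_H1_norm l f"
  unfolding star_L2_norm_def star_H1_norm_def star_wderiv_def
  by (intro real_sqrt_le_mono sum_mono, simp)+

lemma H1_continuous_L2cont:
  assumes l: "\<And>j. j \<in> {1..3} \<Longrightarrow> l j > 0" and q: "\<And>j. j \<in> {1..3} \<Longrightarrow> continuous_on {0..l j} (q j)"
    and u: "\<And>t. t \<in> {0..T} \<Longrightarrow> star_H1 l (u t)"
      "\<And>t. t \<in> {0..T} \<Longrightarrow> ((\<lambda>s. star_H1_norm l (\<lambda>j x. u s j x - u t j x)) \<longlongrightarrow> 0) (at t within {0..T})"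
  shows "L2cont l T u" "L2cont l T (\<lambda>t. star_wderiv l (u t))"
proof -
  have sand: "(f \<longlongrightarrow> 0) F" if "\<forall>\<^sub>F s in F. 0 \<le> f s \<and> f s \<le> g s" "(g \<longlongrightarrow> 0) F" for f g :: "real \<Rightarrow> real" and F
    by (rule tendsto_sandwich[OF _ _ tendsto_const that(2)]) (use that(1) in \<open>auto elim: eventually_mono\<close>)
  show "L2cont l T u"
    unfolding L2cont_def
  proof (intro ballI conjI)
    fix t assume t: "t \<in> {0..T}"
    show "star_L2 l (u t)" by (rule star_H1_L2(1)[OF l u(1)[OF t]])
    show "((\<lambda>s. star_L2_norm l (\<lambda>j x. u s j x - u t j x)) \<longlongrightarrow> 0) (at t within {0..T})"
      by (rule sand[OF _ u(2)[OF t]]) (auto intro!: always_eventually star_L2_norm_nonneg star_H1_norm_ge)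
  qed
  show "L2cont l T (\<lambda>t. star_wderiv l (u t))"
    unfolding L2cont_def
  proof (intro ballI conjI)
    fix t assume t: "t \<in> {0..T}"
    show "star_L2 l (star_wderiv l (u t))" by (rule star_H1_L2(2)[OF l u(1)[OF t]])
    show "((\<lambda>s. star_L2_norm l (\<lambda>j x. star_wderiv l (u s) j x - star_wderiv l (u t) j x)) \<longlongrightarrow> 0) (at t within {0..T})"
    proof (rule sand[OF _ u(2)[OF t]])
      have "\<forall>\<^sub>F s in at t within {0..T}. s \<in> {0..T}" by (auto simp: eventually_at_filter)
      thus "\<forall>\<^sub>F s in at t within {0..T}. 0 \<le> star_L2_norm l (\<lambda>j x. star_wderiv l (u s) j x - star_wderiv l (u t) j x) \<and>
        star_L2_norm l (\<lambda>j x. star_wderiv l (u s) j x - star_wderiv l (u t) j x) \<le> star_H1_norm l (\<lambda>j x. u s j x - u t j x)"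
      proof eventually_elim
        case (elim s)
        note us = u(1)[OF elim] and ut = u(1)[OF t]
        note D = star_L2_diff[OF star_H1_L2(2)[OF l us] star_H1_L2(2)[OF l ut]]
        note D' = star_H1_L2(2)[OF l star_H1_wderiv_diff(1)[OF l us ut]]
        note ae = star_H1_wderiv_diff(2)[OF l us ut]
        \<comment> \<open>The chosen derivative of a difference is the difference of the chosen
          derivatives only almost everywhere; the norms are identified through pairings, which do
          not see null sets.\<close>
        have "star_L2_inner l (\<lambda>j x. star_wderiv l (u s) j x - star_wderiv l (u t) j x) (\<lambda>j x. star_wderiv l (u s) j x - star_wderiv l (u t) j x)
          = star_L2_inner l (star_wderiv l (\<lambda>j x. u s j x - u t j x)) (star_wderiv l (\<lambda>j x. u s j x - u t j x))"
          using star_L2_inner_cong_AE(1)[OF D' D D ae] star_L2_inner_cong_AE(2)[OF D' D D' ae] by simp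
        hence "star_L2_norm l (\<lambda>j x. star_wderiv l (u s) j x - star_wderiv l (u t) j x) = star_L2_norm l (star_wderiv l (\<lambda>j x. u s j x - u t j x))"
          by (simp add: star_L2_norm_eq)
        thus ?case using star_H1_norm_ge(2) star_L2_norm_nonneg by simp
      qed
    qed
  qed
qed

lemma star_L2_inner_sum_left:
  assumes "finite I" "\<And>i. i \<in> I \<Longrightarrow> star_L2 l (F i)" "star_L2 l w"
  shows "star_L2 l (\<lambda>j x. \<Sum>i\<in>I. F i j x)" "star_L2_inner l (\<lambda>j x. \<Sum>i\<in>I. F i j x) w = (\<Sum>i\<in>I. star_L2_inner l (F i) w)"
proof -
  have "star_L2 l (\<lambda>j x. \<Sum>i\<in>I. F i j x) \<and> star_L2_inner l (\<lambda>j x. \<Sum>i\<in>I. F i j x) w = (\<Sum>i\<in>I. star_L2_inner l (F i) w)"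
    using assms(1,2)
  proof (induction I rule: finite_induct)
    case empty
    have "star_L2 l (\<lambda>j x. 0 * w j x + 0 * w j x)" by (rule star_L2_lincomb[OF assms(3) assms(3)])
    thus ?case by (simp add: star_L2_inner_def)
  next
    case (insert i I)
    have Fi: "star_L2 l (F i)" and FI: "star_L2 l (\<lambda>j x. \<Sum>i\<in>I. F i j x)" using insert by auto
    from star_L2_lincomb[OF Fi FI, of 1 1] star_L2_inner_lincomb[OF Fi FI assms(3), of 1 1] insert
    show ?case by simp
  qed
  thus "star_L2 l (\<lambda>j x. \<Sum>i\<in>I. F i j x)" "star_L2_inner l (\<lambda>j x. \<Sum>i\<in>I. F i j x) w = (\<Sum>i\<in>I. star_L2_inner l (F i) w)"
    by auto
qed

text \<open>The double sum is the squared norm of the sum of the functions.\<close>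

lemma star_L2_gram_nonneg:
  assumes I: "finite I" and F: "\<And>i. i \<in> I \<Longrightarrow> star_L2 l (F i)"
  shows "(\<Sum>i\<in>I. \<Sum>j\<in>I. star_L2_inner l (F i) (F j)) \<ge> 0"
proof (cases "I = {}")
  case False
  then obtain i where i: "i \<in> I" by blast
  define G where "G j x = (\<Sum>i\<in>I. F i j x)" for j x
  have G: "star_L2 l G" unfolding G_def[abs_def] by (rule star_L2_inner_sum_left(1)[OF I F F[OF i]])
  have "star_L2_inner l G G = (\<Sum>i\<in>I. star_L2_inner l (F i) G)"
    using star_L2_inner_sum_left(2)[OF I F G] by (simp add: G_def[abs_def])
  also have "\<dots> = (\<Sum>i\<in>I. \<Sum>j\<in>I. star_L2_inner l (F i) (F j))"
  proof (rule sum.cong[OF refl])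
    fix i assume i: "i \<in> I"
    have "star_L2_inner l G (F i) = (\<Sum>j\<in>I. star_L2_inner l (F j) (F i))"
      using star_L2_inner_sum_left(2)[OF I F F[OF i]] by (simp add: G_def[abs_def])
    thus "star_L2_inner l (F i) G = (\<Sum>j\<in>I. star_L2_inner l (F i) (F j))" by (simp add: star_L2_inner_commute)
  qed
  finally show ?thesis using star_L2_inner_nonneg[of l G] by simp
qed simp

lemma star_norm_mult_le:
  assumes q: "\<And>j x. j \<in> {1..3} \<Longrightarrow> x \<in> {0..l j} \<Longrightarrow> \<bar>q j x\<bar> \<le> Q" "\<And>j. j \<in> {1..3} \<Longrightarrow> continuous_on {0..l j} (q j)"
    and Q: "Q \<ge> 0" and f: "star_L2 l f"
  shows "star_L2 l (\<lambda>j x. q j x * f j x)" "star_L2_norm l (\<lambda>j x. q j x * f j x) \<le> Q * star_L2_norm l f"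
proof -
  show qf: "star_L2 l (\<lambda>j x. q j x * f j x)" using f q(2) L2_space_continuous_mult by (auto simp: star_L2_def)
  have "(L2_norm (l j) (\<lambda>x. q j x * f j x))\<^sup>2 \<le> Q\<^sup>2 * (L2_norm (l j) (f j))\<^sup>2" if j: "j \<in> {1..3}" for j
  proof -
    have i: "set_integrable lebesgue {0<..<l j} (\<lambda>x. (q j x * f j x)\<^sup>2)" "set_integrable lebesgue {0<..<l j} (\<lambda>x. (f j x)\<^sup>2)"
      using f qf j by (auto simp: star_L2_def L2_space_def)
    have "(LINT x:{0<..<l j}|lebesgue. (q j x * f j x)\<^sup>2) \<le> (LINT x:{0<..<l j}|lebesgue. Q\<^sup>2 * (f j x)\<^sup>2)"
    proof (rule set_integral_mono[OF i(1) set_integrable_mult_right[OF i(2)]])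
      fix x assume "x \<in> {0<..<l j}"
      thus "(q j x * f j x)\<^sup>2 \<le> Q\<^sup>2 * (f j x)\<^sup>2"
        using power_mono[OF q(1)[OF j, of x], of 2] by (simp add: power_mult_distrib mult_right_mono)
    qed
    moreover have "(L2_norm (l j) g)\<^sup>2 = (LINT x:{0<..<l j}|lebesgue. (g x)\<^sup>2)" for g
      by (simp add: L2_norm_def set_LINT_def)
    ultimately show ?thesis by simp
  qed
  hence "(\<Sum>j=1..3. (L2_norm (l j) (\<lambda>x. q j x * f j x))\<^sup>2) \<le> Q\<^sup>2 * (\<Sum>j=1..3. (L2_norm (l j) (f j))\<^sup>2)"
    unfolding sum_distrib_left by (intro sum_mono)
  hence "sqrt (\<Sum>j=1..3. (L2_norm (l j) (\<lambda>x. q j x * f j x))\<^sup>2) \<le> sqrt (Q\<^sup>2 * (\<Sum>j=1..3. (L2_norm (l j) (f j))\<^sup>2))"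
    by (rule real_sqrt_le_mono)
  thus "star_L2_norm l (\<lambda>j x. q j x * f j x) \<le> Q * star_L2_norm l f"
    using Q by (simp add: star_L2_norm_def real_sqrt_mult)
qed

lemma L2cont_mult:
  assumes q: "\<And>j x. j \<in> {1..3} \<Longrightarrow> x \<in> {0..l j} \<Longrightarrow> \<bar>q j x\<bar> \<le> Q" "\<And>j. j \<in> {1..3} \<Longrightarrow> continuous_on {0..l j} (q j)"
    and Q: "Q \<ge> 0" and X: "L2cont l T X"
  shows "L2cont l T (\<lambda>t j x. q j x * X t j x)"
  unfolding L2cont_def
proof (intro ballI conjI)
  fix t assume t: "t \<in> {0..T}"
  have S: "star_L2 l (X s)" if "s \<in> {0..T}" for s using X that by (auto simp: L2cont_def)
  show "star_L2 l (\<lambda>j x. q j x * X t j x)" by (rule star_norm_mult_le(1)[OF q Q S[OF t]])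
  show "((\<lambda>s. star_L2_norm l (\<lambda>j x. q j x * X s j x - q j x * X t j x)) \<longlongrightarrow> 0) (at t within {0..T})"
  proof (rule tendsto_sandwich[OF _ _ tendsto_const])
    have "((\<lambda>s. Q * star_L2_norm l (\<lambda>j x. X s j x - X t j x)) \<longlongrightarrow> Q * 0) (at t within {0..T})"
      using X t unfolding L2cont_def by (intro tendsto_mult tendsto_const) blast
    thus "((\<lambda>s. Q * star_L2_norm l (\<lambda>j x. X s j x - X t j x)) \<longlongrightarrow> 0) (at t within {0..T})" by simp
    have "\<forall>\<^sub>F s in at t within {0..T}. s \<in> {0..T}" by (auto simp: eventually_at_filter)
    thus "\<forall>\<^sub>F s in at t within {0..T}. star_L2_norm l (\<lambda>j x. q j x * X s j x - q j x * X t j x) \<le> Q * star_L2_norm l (\<lambda>j x. X s j x - X t j x)"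
    proof eventually_elim
      case (elim s)
      from star_norm_mult_le(2)[OF q Q star_L2_diff[OF S[OF elim] S[OF t]]] show ?case by (simp add: right_diff_distrib)
    qed
  qed (use star_L2_norm_nonneg in auto)
qed

text \<open>The two solutions are compared through the same representative \<open>b\<close> of the control \<open>f2\<close>.\<close>

lemma weak_solution_pairing:
  assumes l: "\<And>j. j \<in> {1..3} \<Longrightarrow> l j > 0" and q: "\<And>j. j \<in> {1..3} \<Longrightarrow> continuous_on {0..l j} (q j)"
    and qQ: "\<And>j x. j \<in> {1..3} \<Longrightarrow> x \<in> {0..l j} \<Longrightarrow> \<bar>q j x\<bar> \<le> Q" "Q \<ge> 0" and T: "T > 0"
    and f2: "L2_space T f2" and b: "b \<in> borel_measurable borel" "set_integrable lborel {0..T} b"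
      "AE t in lebesgue. t \<in> {0<..<T} \<longrightarrow> f2 t = b t"
    and u: "L2cont l T u" "L2cont l T (\<lambda>t. star_wderiv l (u t))" "\<And>t. t \<in> {0..T} \<Longrightarrow> star_H1 l (u t)"
    and v: "L2cont l T v" "star_L2_norm l (v 0) = 0"
    and wd: "weak_deriv T (\<lambda>t. star_L2_inner l (v t) w) (\<lambda>t. - (star_form q l (u t) w + f2 t * w 2 0))"
    and w: "star_H1 l w" and t: "t \<in> {0..T}"
  shows "star_L2_inner l (v t) w = - (LBINT s:{0..t}. star_L2_inner l (star_wderiv l (u s)) (star_wderiv l w) + star_L2_inner l (\<lambda>j x. q j x * u s j x) w)
     - w 2 0 * (LBINT s:{0..t}. b s)"
    "continuous_on {0..T} (\<lambda>s. star_L2_inner l (star_wderiv l (u s)) (star_wderiv l w) + star_L2_inner l (\<lambda>j x. q j x * u s j x) w)"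
proof -
  note wL = star_H1_L2[OF l w]
  have cst: "L2cont l T (\<lambda>_. g)" if "star_L2 l g" for g
  proof -
    have "star_L2_norm l (\<lambda>j x. 0) = 0" by (simp add: star_L2_norm_def L2_norm_def)
    thus ?thesis using that by (simp add: L2cont_def)
  qed
  have icont: "continuous_on {0..T} (\<lambda>s. star_L2_inner l (X s) g)" if X: "L2cont l T X" and g: "star_L2 l g" for X g
  proof -
    have "continuous_on {0..T} (\<lambda>s. (s, s))" by (intro continuous_intros)
    moreover have "(\<lambda>s. (s, s)) ` {0..T} \<subseteq> {0..T} \<times> {0..T}" by auto
    ultimately have "continuous_on {0..T} (\<lambda>s. star_L2_inner l (X (fst (s, s))) ((\<lambda>_. g) (snd (s, s))))"
      by (rule continuous_on_compose2[OF L2cont_inner[OF X cst[OF g]]])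
    thus ?thesis by simp
  qed
  define A where "A s = star_L2_inner l (star_wderiv l (u s)) (star_wderiv l w) + star_L2_inner l (\<lambda>j x. q j x * u s j x) w" for s
  show Ac: "continuous_on {0..T} (\<lambda>s. star_L2_inner l (star_wderiv l (u s)) (star_wderiv l w) + star_L2_inner l (\<lambda>j x. q j x * u s j x) w)"
    by (intro continuous_on_add icont u wL L2cont_mult[OF qQ(1) q qQ(2)])
  \<comment> \<open>The continuous extension of A by clamping; it makes the weak derivative g a
    Borel function on the line.\<close>
  define A' where "A' s = A (max 0 (min T s))" for s
  have A'c: "continuous_on UNIV A'" unfolding A'_def A_def
    by (rule continuous_on_compose2[OF Ac]) (use T in \<open>auto intro!: continuous_intros\<close>)
  have A'e: "A' s = A s" if "s \<in> {0..T}" for s using that by (auto simp: A'_def)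
  have [measurable]: "A' \<in> borel_measurable borel" using A'c by (rule borel_measurable_continuous_onI)
  note [measurable] = b(1)
  define g where "g s = - A' s - w 2 0 * b s" for s
  have gm: "g \<in> borel_measurable borel" unfolding g_def[abs_def] by measurable
  have Ai: "set_integrable lborel {0..T} A'" by (rule borel_integrable_atLeastAtMost'[OF continuous_on_subset[OF A'c]]) simp
  have gi: "set_integrable lborel {0..T} (\<lambda>s. - 1 * A' s - w 2 0 * b s)"
    by (intro set_integral_diff(1) set_integrable_mult_right Ai b(2))
  have form: "star_form q l (u s) w = A s" if "s \<in> {0..T}" for s
    unfolding A_def by (rule star_form_inner[OF l u(3)[OF that] w q])
  have f2m: "set_borel_measurable lebesgue {0<..<T} f2" using f2 by (simp add: L2_space_def)
  have Gm: "set_borel_measurable lebesgue {0<..<T} (\<lambda>t. - (star_form q l (u t) w + f2 t * w 2 0))"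
  proof -
    have "set_borel_measurable lebesgue {0<..<T} (\<lambda>t. - 1 * A' t + (- w 2 0) * f2 t)"
      by (intro set_borel_measurable_add set_borel_measurable_cmult f2m borel_imp_set_borel_measurable_lebesgue) measurable
    moreover have "(\<lambda>t. indicator {0<..<T} t *\<^sub>R (- (star_form q l (u t) w + f2 t * w 2 0))) = (\<lambda>t. indicator {0<..<T} t *\<^sub>R (- 1 * A' t + (- w 2 0) * f2 t))"
    proof
      fix t show "indicator {0<..<T} t *\<^sub>R (- (star_form q l (u t) w + f2 t * w 2 0)) = indicator {0<..<T} t *\<^sub>R (- 1 * A' t + (- w 2 0) * f2 t)"
        using form[of t] A'e[of t] by (cases "t \<in> {0<..<T}") (auto simp: algebra_simps)
    qed
    ultimately show ?thesis unfolding set_borel_measurable_def by simp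
  qed
  have "weak_deriv T (\<lambda>t. star_L2_inner l (v t) w) g"
  proof (rule weak_deriv_cong[OF wd Gm borel_imp_set_borel_measurable_lebesgue[OF gm] _ refl])
    show "AE x in lebesgue. x \<in> {0<..<T} \<longrightarrow> - (star_form q l (u x) w + f2 x * w 2 0) = g x"
      using b(3)
    proof eventually_elim
      case (elim x) thus ?case using form[of x] A'e[of x] by (auto simp: g_def)
    qed
  qed
  from weak_deriv_imp_prim[OF T icont[OF v(1) wL(1)] gm _ this] gi
  have p: "prim T (\<lambda>t. star_L2_inner l (v t) w) g" by (simp add: g_def[abs_def])
  \<comment> \<open>The initial velocity has norm zero, so its pairing with w vanishes by
    Cauchy-Schwarz and the primitive starts at zero.\<close>
  have "\<bar>star_L2_inner l (v 0) w\<bar> \<le> star_L2_norm l (v 0) * star_L2_norm l w"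
    using v(1) T by (intro star_L2_CS wL) (auto simp: L2cont_def)
  hence "star_L2_inner l (v 0) w = 0" using v(2) by simp
  hence "star_L2_inner l (v t) w = (LBINT s:{0..t}. g s)" using prim_D(3)[OF p t] by simp
  also have "\<dots> = (LBINT s:{0..t}. - 1 * A s - w 2 0 * b s)"
    by (rule set_lebesgue_integral_cong) (use t A'e in \<open>auto simp: g_def\<close>)
  also have "\<dots> = - 1 * (LBINT s:{0..t}. A s) - w 2 0 * (LBINT s:{0..t}. b s)"
  proof -
    have i1: "set_integrable lborel {0..t} A"
      unfolding A_def[abs_def] by (rule borel_integrable_atLeastAtMost'[OF continuous_on_subset[OF Ac]]) (use t in auto)
    have i2: "set_integrable lborel {0..t} b" by (rule set_integrable_subset[OF b(2)]) (use t in auto)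
    show ?thesis unfolding set_integral_diff(2)[OF set_integrable_mult_right[of "- 1", OF i1] set_integrable_mult_right[of "w 2 0", OF i2]]
        set_integral_mult_right ..
  qed
  finally show "star_L2_inner l (v t) w = - (LBINT s:{0..t}. star_L2_inner l (star_wderiv l (u s)) (star_wderiv l w) + star_L2_inner l (\<lambda>j x. q j x * u s j x) w)
     - w 2 0 * (LBINT s:{0..t}. b s)" by (simp add: A_def)
qed

text \<open>The product rule for a squared norm when the curve is differentiable only in mean
  square.\<close>

lemma L2cont_norm_deriv:
  assumes d: "L2cont l T d" and v: "\<And>t. t \<in> {0..T} \<Longrightarrow> star_L2 l (v t)" and t: "t \<in> {0..T}"
    and lim: "((\<lambda>s. star_L2_norm l (\<lambda>j x. (d s j x - d t j x) / (s - t) - v t j x)) \<longlongrightarrow> 0) (at t within {0..T})"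
  shows "((\<lambda>s. star_L2_inner l (d s) (d s)) has_real_derivative 2 * star_L2_inner l (v t) (d t)) (at t within {0..T})"
  unfolding has_field_derivative_iff
proof (rule Lim_null[THEN iffD2], rule Lim_null_comparison)
  have S: "star_L2 l (d s)" if "s \<in> {0..T}" for s using d that by (auto simp: L2cont_def)
  note vt = v[OF t] and dt = S[OF t]
  define A where "A s = star_L2_norm l (\<lambda>j x. (d s j x - d t j x) / (s - t) - v t j x)" for s
  define B where "B s = star_L2_norm l (\<lambda>j x. d s j x - d t j x)" for s
  have A: "(A \<longlongrightarrow> 0) (at t within {0..T})" using lim by (simp add: A_def[abs_def])
  have B: "(B \<longlongrightarrow> 0) (at t within {0..T})" using d t by (simp add: B_def[abs_def] L2cont_def)
  have "((\<lambda>s. A s * B s + 2 * A s * star_L2_norm l (d t) + star_L2_norm l (v t) * B s) \<longlongrightarrow> 0 * 0 + 2 * 0 * star_L2_norm l (d t) + star_L2_norm l (v t) * 0) (at t within {0..T})"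
    by (intro tendsto_intros A B)
  thus "((\<lambda>s. A s * B s + 2 * A s * star_L2_norm l (d t) + star_L2_norm l (v t) * B s) \<longlongrightarrow> 0) (at t within {0..T})" by simp
  have "\<forall>\<^sub>F s in at t within {0..T}. s \<in> {0..T} \<and> s \<noteq> t" by (auto simp: eventually_at_filter)
  thus "\<forall>\<^sub>F s in at t within {0..T}. norm ((star_L2_inner l (d s) (d s) - star_L2_inner l (d t) (d t)) / (s - t) - 2 * star_L2_inner l (v t) (d t))
     \<le> A s * B s + 2 * A s * star_L2_norm l (d t) + star_L2_norm l (v t) * B s"
  proof eventually_elim
    case (elim s)
    hence ds: "star_L2 l (d s)" and st: "s - t \<noteq> 0" using S by auto
    \<comment> \<open>Here e is the increment of the curve and a the error of its difference
      quotient. The error of the product rule is a sum of pairings each of which contains e or a, so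
      it tends to zero.\<close>
    define r where "r = 1 / (s - t)"
    define e where "e j x = d s j x - d t j x" for j x
    define a where "a j x = r * e j x + (- 1) * v t j x" for j x
    have e: "star_L2 l e" unfolding e_def[abs_def] by (rule star_L2_diff[OF ds dt])
    have a: "star_L2 l a" unfolding a_def[abs_def] by (rule star_L2_lincomb[OF e vt])
    have ae: "star_L2_inner l a w = r * star_L2_inner l e w - star_L2_inner l (v t) w" if "star_L2 l w" for w
      unfolding a_def[abs_def] star_L2_inner_lincomb[OF e vt that] by simp
    have ee: "star_L2_inner l e w = star_L2_inner l (d s) w - star_L2_inner l (d t) w" if "star_L2 l w" for w
      unfolding e_def[abs_def] by (rule star_L2_inner_diff(1)[OF ds dt that])
    have An: "star_L2_norm l a = A s" unfolding A_def a_def e_def r_def by (simp add: diff_divide_distrib[symmetric])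
    have Bn: "star_L2_norm l e = B s" unfolding B_def e_def ..
    have "star_L2_inner l (d s) (d s) - star_L2_inner l (d t) (d t) = star_L2_inner l e e + 2 * star_L2_inner l e (d t)"
      unfolding ee[OF e] ee[OF dt] star_L2_inner_commute[of l "d s" e] star_L2_inner_commute[of l "d t" e] ee[OF ds] ee[OF dt]
      by (simp add: star_L2_inner_commute[of l "d s" "d t"])
    hence "(star_L2_inner l (d s) (d s) - star_L2_inner l (d t) (d t)) / (s - t) - 2 * star_L2_inner l (v t) (d t)
      = star_L2_inner l a e + 2 * star_L2_inner l a (d t) + star_L2_inner l (v t) e"
      unfolding ae[OF e] ae[OF dt] by (simp add: r_def add_divide_distrib)
    moreover have "\<bar>star_L2_inner l a e + 2 * star_L2_inner l a (d t) + star_L2_inner l (v t) e\<bar> \<le> A s * B s + 2 * (A s * star_L2_norm l (d t)) + star_L2_norm l (v t) * B s"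
      using star_L2_CS[OF a e] star_L2_CS[OF a dt] star_L2_CS[OF vt e] unfolding An Bn by linarith
    ultimately show ?case by simp
  qed
qed

lemma zero_if_L2_norm_zero:
  fixes f :: "real \<Rightarrow> real"
  assumes c: "continuous_on {0..l} f" and z: "(LINT x:{0<..<l}|lebesgue. f x * f x) = 0" and l: "l > 0" and x: "x \<in> {0..l}"
  shows "f x = 0"
proof -
  have c2: "continuous_on {0..l} (\<lambda>x. f x * f x)" by (intro continuous_intros c)
  have "(LBINT x:{0..l}. f x * f x) = 0"
    using z set_integral_lebesgue_open(1)[OF set_borel_measurable_open[OF c2]] by simp
  hence "((\<lambda>x. f x * f x) has_integral 0) {0..l}"
    using set_borel_integral_eq_integral[OF borel_integrable_atLeastAtMost'[OF c2]] by (metis has_integral_integral)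
  thus ?thesis using has_integral_0_cbox_imp_0[of 0 l "\<lambda>x. f x * f x" x] c2 x l by auto
qed

lemma bounded_potential:
  fixes l :: "nat \<Rightarrow> real" and q :: "nat \<Rightarrow> real \<Rightarrow> real"
  assumes "\<And>j. j \<in> {1..3::nat} \<Longrightarrow> continuous_on {0..l j} (q j)"
  shows "\<exists>Q\<ge>0::real. \<forall>j\<in>{1..3}. \<forall>x\<in>{0..l j}. \<bar>q j x\<bar> \<le> Q"
proof -
  have "\<exists>B. \<forall>x\<in>{0..l j}. \<bar>q j x\<bar> \<le> B" if "j \<in> {1..3}" for j
  proof -
    have "compact (q j ` {0..l j})" by (rule compact_continuous_image[OF assms[OF that]]) simp
    from compact_imp_bounded[OF this] show ?thesis unfolding bounded_iff by force
  qed
  then obtain B where B: "\<And>j x. j \<in> {1..3} \<Longrightarrow> x \<in> {0..l j} \<Longrightarrow> \<bar>q j x\<bar> \<le> B j" by metis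
  have "\<bar>q j x\<bar> \<le> max 0 (max (B 1) (max (B 2) (B 3)))" if "j \<in> {1..3}" "x \<in> {0..l j}" for j x
    using B[OF that] that(1) unfolding edges_123 by auto
  thus ?thesis by (intro exI[of _ "max 0 (max (B 1) (max (B 2) (B 3)))"]) auto
qed

text \<open>In the difference d of two solutions the boundary data cancel, so every state of d lies
  in \<open>star_H10\<close> and is an admissible test function; the control at v0 cancels as well.
  The functions k, p and n are the pairings for \<open>energy_zero\<close>. The kernel k uses the
  difference D of the chosen weak derivatives, which is a weak derivative of d up to null
  sets.\<close>

theorem weak_solution_unique:
  assumes l: "\<And>j. j \<in> {1..3} \<Longrightarrow> l j > 0" and q: "\<And>j. j \<in> {1..3} \<Longrightarrow> continuous_on {0..l j} (q j)" and T: "T > 0"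
    and f2: "L2_space T f2" and 1: "weak_solution q l T f1 f2 u" and 2: "weak_solution q l T f1 f2 u'"
    and t: "t \<in> {0..T}" and j: "j \<in> {1..3}" and x: "x \<in> {0..l j}"
  shows "u t j x = u' t j x"
proof -
  obtain Q where Q: "Q \<ge> 0" "\<And>j x. j \<in> {1..3} \<Longrightarrow> x \<in> {0..l j} \<Longrightarrow> \<bar>q j x\<bar> \<le> Q"
    using bounded_potential[of l q] q by blast
  obtain b where b: "b \<in> borel_measurable borel" "set_integrable lborel {0..T} (\<lambda>t. (b t)\<^sup>2)"
    "AE t in lebesgue. t \<in> {0<..<T} \<longrightarrow> f2 t = b t" using L2_space_rep[OF f2] by blast
  have bi: "set_integrable lborel {0..T} b" by (rule set_integrable_if_square[OF b(1,2)])
  have uH: "star_H1 l (u t)" "((\<lambda>s. star_H1_norm l (\<lambda>j x. u s j x - u t j x)) \<longlongrightarrow> 0) (at t within {0..T})"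
    "star_H1 l (u' t)" "((\<lambda>s. star_H1_norm l (\<lambda>j x. u' s j x - u' t j x)) \<longlongrightarrow> 0) (at t within {0..T})"
    if "t \<in> {0..T}" for t using 1 2 that unfolding weak_solution_def by blast+
  have ini: "u 0 j x = u' 0 j x" if "j \<in> {1..3}" "x \<in> {0..l j}" for j x
    using 1 2 that unfolding weak_solution_def by simp
  have bd: "u t 1 (l 1) = f1 t" "u' t 1 (l 1) = f1 t" "u t 2 (l 2) = 0" "u' t 2 (l 2) = 0" "u t 3 (l 3) = 0" "u' t 3 (l 3) = 0"
    "(\<Sum>j=1..3. u t j 0) = 0" "(\<Sum>j=1..3. u' t j 0) = 0"
    if "t \<in> {0..T}" for t using 1 2 that unfolding weak_solution_def by blast+
  obtain v where v: "\<And>t. t \<in> {0..T} \<Longrightarrow> star_L2 l (v t)"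
    "\<And>t. t \<in> {0..T} \<Longrightarrow> ((\<lambda>s. star_L2_norm l (\<lambda>j x. (u s j x - u t j x) / (s - t) - v t j x)) \<longlongrightarrow> 0) (at t within {0..T})"
    "\<And>t. t \<in> {0..T} \<Longrightarrow> ((\<lambda>s. star_L2_norm l (\<lambda>j x. v s j x - v t j x)) \<longlongrightarrow> 0) (at t within {0..T})"
    "star_L2_norm l (v 0) = 0"
    "\<And>w. star_H10 l w \<Longrightarrow> weak_deriv T (\<lambda>t. star_L2_inner l (v t) w) (\<lambda>t. - (star_form q l (u t) w + f2 t * w 2 0))"
    using 1 unfolding weak_solution_def by blast
  obtain v' where v': "\<And>t. t \<in> {0..T} \<Longrightarrow> star_L2 l (v' t)"
    "\<And>t. t \<in> {0..T} \<Longrightarrow> ((\<lambda>s. star_L2_norm l (\<lambda>j x. (u' s j x - u' t j x) / (s - t) - v' t j x)) \<longlongrightarrow> 0) (at t within {0..T})"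
    "\<And>t. t \<in> {0..T} \<Longrightarrow> ((\<lambda>s. star_L2_norm l (\<lambda>j x. v' s j x - v' t j x)) \<longlongrightarrow> 0) (at t within {0..T})"
    "star_L2_norm l (v' 0) = 0"
    "\<And>w. star_H10 l w \<Longrightarrow> weak_deriv T (\<lambda>t. star_L2_inner l (v' t) w) (\<lambda>t. - (star_form q l (u' t) w + f2 t * w 2 0))"
    using 2 unfolding weak_solution_def by blast
  note cu = H1_continuous_L2cont[OF l q uH(1,2)] and cu' = H1_continuous_L2cont[OF l q uH(3,4)]
  have cv: "L2cont l T v" "L2cont l T v'" using v v' by (auto simp: L2cont_def)
  define d where "d t j x = u t j x - u' t j x" for t j x
  define D where "D t j x = star_wderiv l (u t) j x - star_wderiv l (u' t) j x" for t j x
  define dv where "dv t j x = v t j x - v' t j x" for t j x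
  have cd: "L2cont l T d" unfolding d_def[abs_def] by (rule L2cont_diff[OF cu(1) cu'(1)])
  have cD: "L2cont l T D" unfolding D_def[abs_def] by (rule L2cont_diff[OF cu(2) cu'(2)])
  have cdv: "L2cont l T dv" unfolding dv_def[abs_def] by (rule L2cont_diff[OF cv])
  have cq: "L2cont l T (\<lambda>t j x. q j x * d t j x)" by (rule L2cont_mult[OF Q(2) q Q(1) cd])
  have S: "star_L2 l (d t)" "star_L2 l (D t)" "star_L2 l (dv t)" "star_L2 l (\<lambda>j x. q j x * d t j x)" if "t \<in> {0..T}" for t
    using cd cD cdv cq that by (auto simp: L2cont_def)
  have dH: "star_H10 l (d t)" if t: "t \<in> {0..T}" for t
    unfolding star_H10_def
  proof (intro conjI)
    show "star_H1 l (d t)" unfolding d_def[abs_def] by (rule star_H1_wderiv_diff(1)[OF l uH(1,3)[OF t]])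
    show "\<forall>j\<in>{1..3}. d t j (l j) = 0" unfolding edges_123 using bd[OF t] by (simp add: d_def)
    show "(\<Sum>j=1..3. d t j 0) = 0" using bd(7,8)[OF t] by (simp add: d_def sum_subtractf)
  qed
  have dH1: "star_H1 l (d t)" if "t \<in> {0..T}" for t using dH[OF that] by (simp add: star_H10_def)
  define k where "k s \<tau> = star_L2_inner l (D s) (D \<tau>)" for s \<tau>
  define p where "p s \<tau> = star_L2_inner l (\<lambda>j x. q j x * d s j x) (d \<tau>)" for s \<tau>
  define n where "n t \<tau> = star_L2_inner l (dv t) (d \<tau>)" for t \<tau>
  have "star_L2_inner l (d t) (d t) = 0"
  proof (rule energy_zero[where k=k and p=p and n=n and Q=Q and T=T and m="\<lambda>t. star_L2_inner l (d t) (d t)" and t=t])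
    show "continuous_on ({0..T} \<times> {0..T}) (\<lambda>z. k (fst z) (snd z))" unfolding k_def by (rule L2cont_inner[OF cD cD])
    show "k s \<tau> = k \<tau> s" for s \<tau> unfolding k_def by (rule star_L2_inner_commute)
    show "(\<Sum>i\<in>I. \<Sum>j\<in>I. k (x i) (x j)) \<ge> 0" if "finite I" "\<And>i. i \<in> I \<Longrightarrow> x i \<in> {0..T}" for I :: "nat set" and x
      unfolding k_def by (rule star_L2_gram_nonneg[OF that(1)]) (rule S(2)[OF that(2)])
    show "continuous_on ({0..T} \<times> {0..T}) (\<lambda>z. p (fst z) (snd z))" unfolding p_def by (rule L2cont_inner[OF cq cd])
    show "\<bar>p s \<tau>\<bar> \<le> Q * (sqrt (star_L2_inner l (d s) (d s)) * sqrt (star_L2_inner l (d \<tau>) (d \<tau>)))" if "s \<in> {0..T}" "\<tau> \<in> {0..T}" for s \<tau>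
    proof -
      have "\<bar>p s \<tau>\<bar> \<le> star_L2_norm l (\<lambda>j x. q j x * d s j x) * star_L2_norm l (d \<tau>)"
        unfolding p_def by (rule star_L2_CS[OF S(4)[OF that(1)] S(1)[OF that(2)]])
      also have "\<dots> \<le> Q * star_L2_norm l (d s) * star_L2_norm l (d \<tau>)"
        by (rule mult_right_mono[OF star_norm_mult_le(2)[OF Q(2) q Q(1) S(1)[OF that(1)]] star_L2_norm_nonneg])
      finally show ?thesis by (simp add: star_L2_norm_eq mult_ac)
    qed
    show "n t \<tau> = - (LBINT s:{0..t}. k s \<tau> + p s \<tau>)" if t: "t \<in> {0..T}" and \<tau>: "\<tau> \<in> {0..T}" for t \<tau>
    proof -
      let ?e = "\<lambda>w s. star_L2_inner l (star_wderiv l (w s)) (star_wderiv l (d \<tau>)) + star_L2_inner l (\<lambda>j x. q j x * w s j x) (d \<tau>)"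
      note w = dH1[OF \<tau>] and wL = star_H1_L2[OF l dH1[OF \<tau>]]
      note P = weak_solution_pairing[OF l q Q(2) Q(1) T f2 b(1) bi b(3) cu uH(1) cv(1) v(4) v(5)[OF dH[OF \<tau>]] w t]
      note P' = weak_solution_pairing[OF l q Q(2) Q(1) T f2 b(1) bi b(3) cu' uH(3) cv(2) v'(4) v'(5)[OF dH[OF \<tau>]] w t]
      have i: "set_integrable lborel {0..t} (?e u)"
        by (rule borel_integrable_atLeastAtMost'[OF continuous_on_subset[OF P(2)]]) (use t in auto)
      have i': "set_integrable lborel {0..t} (?e u')"
        by (rule borel_integrable_atLeastAtMost'[OF continuous_on_subset[OF P'(2)]]) (use t in auto)
      have vL: "star_L2 l (v t)" "star_L2 l (v' t)" using v(1) v'(1) t by auto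
      have "n t \<tau> = star_L2_inner l (v t) (d \<tau>) - star_L2_inner l (v' t) (d \<tau>)"
        unfolding n_def dv_def[abs_def] by (rule star_L2_inner_diff(1)[OF vL wL(1)])
      also have "\<dots> = - (LBINT s:{0..t}. ?e u s - ?e u' s)"
        using P(1) P'(1) set_integral_diff(2)[OF i i'] by linarith
      also have "(LBINT s:{0..t}. ?e u s - ?e u' s)
        = (LBINT s:{0..t}. k s \<tau> + p s \<tau>)"
      proof (rule set_lebesgue_integral_cong, simp, intro allI impI)
        fix s assume "s \<in> {0..t}"
        hence s: "s \<in> {0..T}" using t by auto
        have k1: "star_L2_inner l (D s) (star_wderiv l (d \<tau>)) = star_L2_inner l (star_wderiv l (u s)) (star_wderiv l (d \<tau>)) - star_L2_inner l (star_wderiv l (u' s)) (star_wderiv l (d \<tau>))"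
          unfolding D_def[abs_def] by (rule star_L2_inner_diff(1)[OF star_H1_L2(2)[OF l uH(1)[OF s]] star_H1_L2(2)[OF l uH(3)[OF s]] wL(2)])
        have ae: "AE x in lebesgue. x \<in> {0<..<l j} \<longrightarrow> star_wderiv l (d \<tau>) j x = D \<tau> j x" if "j \<in> {1..3}" for j
          unfolding D_def d_def[abs_def] by (rule star_H1_wderiv_diff(2)[OF l uH(1,3)[OF \<tau>] that])
        have k2: "star_L2_inner l (D s) (star_wderiv l (d \<tau>)) = k s \<tau>"
          unfolding k_def by (rule star_L2_inner_cong_AE(2)[OF wL(2) S(2)[OF \<tau>] S(2)[OF s] ae])
        have qu: "star_L2 l (\<lambda>j x. q j x * u s j x)" "star_L2 l (\<lambda>j x. q j x * u' s j x)"
          using star_norm_mult_le(1)[OF Q(2) q Q(1) star_H1_L2(1)[OF l uH(1)[OF s]]]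
            star_norm_mult_le(1)[OF Q(2) q Q(1) star_H1_L2(1)[OF l uH(3)[OF s]]] by blast+
        have p1: "p s \<tau> = star_L2_inner l (\<lambda>j x. q j x * u s j x) (d \<tau>) - star_L2_inner l (\<lambda>j x. q j x * u' s j x) (d \<tau>)"
          using star_L2_inner_diff(1)[OF qu wL(1)] by (simp add: p_def d_def[of s] right_diff_distrib)
        show "?e u s - ?e u' s = k s \<tau> + p s \<tau>"
          using k1 k2 p1 by simp
      qed
      finally show ?thesis .
    qed
    show "continuous_on {0..T} (\<lambda>t. n t t)"
    proof -
      have "continuous_on {0..T} (\<lambda>s. (s, s))" by (intro continuous_intros)
      moreover have "(\<lambda>s. (s, s)) ` {0..T} \<subseteq> {0..T} \<times> {0..T}" by auto
      ultimately have "continuous_on {0..T} (\<lambda>s. star_L2_inner l (dv (fst (s, s))) (d (snd (s, s))))"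
        by (rule continuous_on_compose2[OF L2cont_inner[OF cdv cd]])
      thus ?thesis by (simp add: n_def)
    qed
    show "((\<lambda>t. star_L2_inner l (d t) (d t)) has_real_derivative 2 * n t t) (at t within {0..T})" if t: "t \<in> {0..T}" for t
      unfolding n_def
    proof (rule L2cont_norm_deriv[OF cd S(3) t])
      let ?r = "\<lambda>w z s. star_L2_norm l (\<lambda>j x. (w s j x - w t j x) / (s - t) - z t j x)"
      show "((\<lambda>s. ?r d dv s) \<longlongrightarrow> 0) (at t within {0..T})"
      proof (rule tendsto_sandwich[OF _ _ tendsto_const])
        show "((\<lambda>s. ?r u v s + ?r u' v' s) \<longlongrightarrow> 0) (at t within {0..T})"
          using tendsto_add[OF v(2)[OF t] v'(2)[OF t]] by simp
        have "\<forall>\<^sub>F s in at t within {0..T}. s \<in> {0..T}" by (auto simp: eventually_at_filter)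
        thus "\<forall>\<^sub>F s in at t within {0..T}. ?r d dv s \<le>
           ?r u v s + ?r u' v' s"
        proof eventually_elim
          case (elim s)
          have X: "star_L2 l (\<lambda>j x. (y s j x - y t j x) / (s - t) - z t j x)"
            if "star_L2 l (y s)" "star_L2 l (y t)" "star_L2 l (z t)" for y z :: "real \<Rightarrow> nat \<Rightarrow> real \<Rightarrow> real"
            using star_L2_lincomb[OF star_L2_diff[OF that(1,2)] that(3), of "1 / (s - t)" "- 1"] by simp
          have "star_L2_norm l (\<lambda>j x. ((u s j x - u t j x) / (s - t) - v t j x) - ((u' s j x - u' t j x) / (s - t) - v' t j x)) \<le>
             ?r u v s + ?r u' v' s"
            by (intro star_L2_norm_diff_le X star_H1_L2(1)[OF l] uH(1,3) v(1) v'(1) elim t)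
          also have "(\<lambda>j x. ((u s j x - u t j x) / (s - t) - v t j x) - ((u' s j x - u' t j x) / (s - t) - v' t j x)) = (\<lambda>j x. (d s j x - d t j x) / (s - t) - dv t j x)"
            by (simp add: fun_eq_iff d_def dv_def diff_divide_distrib)
          finally show ?case .
        qed
      qed (use star_L2_norm_nonneg in auto)
    qed
    have "star_L2_inner l (d 0) (d 0) = (\<Sum>j=1..3. LINT x:{0<..<l j}|lebesgue. 0)"
      unfolding star_L2_inner_def
      by (rule sum.cong[OF refl], rule set_lebesgue_integral_cong) (use ini in \<open>auto simp: d_def\<close>)
    thus "star_L2_inner l (d 0) (d 0) = 0" by simp
  qed (use T Q star_L2_inner_nonneg t in auto)
  hence "(\<Sum>j=1..3. LINT x:{0<..<l j}|lebesgue. d t j x * d t j x) = 0" by (simp add: star_L2_inner_def)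
  moreover have "0 \<le> (LINT x:{0<..<l j}|lebesgue. d t j x * d t j x)" for j
    unfolding set_LINT_def by (rule LINT_nonneg) auto
  ultimately have z: "(LINT x:{0<..<l j}|lebesgue. d t j x * d t j x) = 0"
    using j by (subst (asm) sum_nonneg_eq_0_iff) auto
  have "continuous_on {0..l j} (d t j)" using dH1[OF t] j by (auto simp: star_H1_def H1_space_def)
  from zero_if_L2_norm_zero[OF this z l[OF j] x] show ?thesis by (simp add: d_def)
qed

section \<open>Waves on a string\<close>

lemma AC2_C1:
  assumes d: "\<And>x. (f has_real_derivative f' x) (at x)" and c: "continuous_on UNIV f'"
    and z: "\<And>x. R < \<bar>x\<bar> \<Longrightarrow> f' x = 0" and f0: "\<And>x. x \<le> x0 \<Longrightarrow> f x = 0"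
  shows "AC2 f f'"
proof -
  have [measurable]: "f' \<in> borel_measurable borel" by (rule borel_measurable_continuous_onI[OF c])
  have "compact (f' ` {-R..R})" by (rule compact_continuous_image[OF continuous_on_subset[OF c]]) auto
  from compact_imp_bounded[OF this] obtain B where B: "\<And>x. x \<in> {-R..R} \<Longrightarrow> \<bar>f' x\<bar> \<le> B"
    unfolding bounded_iff by force
  have B': "\<bar>f' x\<bar> \<le> max 0 B" for x using B[of x] z[of x] by (cases "\<bar>x\<bar> \<le> R") (auto simp: abs_le_iff)
  have i: "integrable lborel f'"
    by (rule integrable_bounded_support[where M="max 0 B" and a="-R" and b=R]) (use B' z in \<open>auto simp: abs_le_iff\<close>)
  have i2: "integrable lborel (\<lambda>x. (f' x)\<^sup>2)"
  proof (rule integrable_bounded_support[where M="(max 0 B)\<^sup>2" and a="-R" and b=R])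
    show "\<bar>(f' x)\<^sup>2\<bar> \<le> (max 0 B)\<^sup>2" for x using power_mono[OF B'[of x], of 2] by simp
  qed (use z in \<open>auto simp: abs_le_iff\<close>)
  define F where "F x = (LBINT y:{..x}. f' y)" for x
  have "((\<lambda>x. f x - F x) has_real_derivative 0) (at x)" for x
    using DERIV_diff[OF d DERIV_integral_atMost[OF i c], of x] by (simp add: F_def)
  from DERIV_isconst_all[OF allI[OF this]] have const: "f x - F x = f y - F y" for x y by blast
  \<comment> \<open>A point so far to the left that both f and the primitive F vanish there; it
    fixes the constant of integration.\<close>
  define w where "w = min x0 (- R - 1)"
  have "F w = (LBINT y:{..w}. 0)" unfolding F_def
    by (rule set_lebesgue_integral_cong) (auto simp: w_def intro!: z)
  hence "f w - F w = 0" using f0[of w] by (simp add: w_def)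
  hence "f x = F x" for x using const[of x w] by simp
  thus ?thesis unfolding AC2_def F_def using i2 z by auto
qed

text \<open>The value of A at any point is the integral of a over a part of [p,q], to which
  Cauchy-Schwarz applies.\<close>

lemma AC2_sup:
  assumes A: "AC2 A a" and z: "\<And>x. x \<notin> {p..q} \<Longrightarrow> a x = 0" and pq: "p \<le> q"
  shows "(A x)\<^sup>2 \<le> (q - p) * (LBINT x. (a x)\<^sup>2)"
proof -
  note [measurable] = AC2_D(1)[OF A]
  define c where "c = max p (min q x)"
  have c: "p \<le> c" "c \<le> q" using pq by (auto simp: c_def)
  have "A x = (LBINT y:{p..c}. a y)"
    unfolding AC2_D(4)[OF A, of x] set_LINT_def
  proof (rule integral_cong_AE)
    show "AE y in lborel. indicator {..x} y *\<^sub>R a y = indicator {p..c} y *\<^sub>R a y"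
      using AE_lborel_singleton[of p]
    proof eventually_elim
      case (elim y)
      thus ?case using z[of y] pq by (cases "y \<in> {p..q}") (auto simp: c_def indicator_def max_def min_def split: if_splits)
    qed
  qed measurable
  moreover have si: "set_integrable lborel {p..c} (\<lambda>x. (a x)\<^sup>2)" by (rule set_integrable_if_integrable[OF AC2_D(2)[OF A]]) simp
  ultimately have "(A x)\<^sup>2 \<le> (c - p) * (LBINT y:{p..c}. (a y)\<^sup>2)" using set_integral_CS(2)[OF c(1) AC2_D(1)[OF A]] by simp
  also have "\<dots> \<le> (q - p) * (LBINT x. (a x)\<^sup>2)"
  proof (rule mult_mono)
    show "(LBINT y:{p..c}. (a y)\<^sup>2) \<le> (LBINT x. (a x)\<^sup>2)" unfolding set_LINT_def
      by (rule integral_mono[OF si[unfolded set_integrable_def] AC2_D(2)[OF A]]) (auto simp: indicator_def)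
    show "0 \<le> (LBINT y:{p..c}. (a y)\<^sup>2)"
      unfolding set_LINT_def by (rule LINT_nonneg) auto
  qed (use c in auto)
  finally show ?thesis .
qed

lemma AC2_add_norm:
  assumes A: "AC2 A a" and B: "AC2 B b"
  shows "(LBINT x. (a x + b x)\<^sup>2) \<le> 2 * (LBINT x. (a x)\<^sup>2) + 2 * (LBINT x. (b x)\<^sup>2)"
proof -
  have "(LBINT x. (a x + b x)\<^sup>2) \<le> (LBINT x. 2 * (a x)\<^sup>2 + 2 * (b x)\<^sup>2)"
    by (rule integral_mono[OF AC2_D(2)[OF AC2_add[OF A B]]]) (use AC2_D(2)[OF A] AC2_D(2)[OF B] sum_sq_le in auto)
  also have "\<dots> = 2 * (LBINT x. (a x)\<^sup>2) + 2 * (LBINT x. (b x)\<^sup>2)" using AC2_D(2)[OF A] AC2_D(2)[OF B] by simp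
  finally show ?thesis .
qed

text \<open>In characteristic coordinates b = c + e a is a line of constant position for e = 1 and
  of constant time for e = - 1. The trace on it is again a wave profile: its derivative is bounded
  by 2 M R and vanishes outside [0, R + |c|], whence the last bound.\<close>

lemma gours_trace:
  fixes c e :: real
  assumes H: "pc R M N H" and e: "e = 1 \<or> e = -1"
  defines "P \<equiv> \<lambda>a. gours H a (c + e * a)"
    and "p \<equiv> \<lambda>a. row H a (c + e * a) + e * row (flip H) (c + e * a) a"
  shows "AC2 P p" "\<bar>P a\<bar> \<le> M * R * R" "a \<le> 0 \<Longrightarrow> p a = 0"
    "(LBINT a. (p a)\<^sup>2) \<le> (R + \<bar>c\<bar>) * (4 * (M * R)\<^sup>2)"
proof -
  note Hs = pc_swap[OF H]
  have B: "bsrc R M H" and Bs: "bsrc R M (flip H)" using H Hs by (auto simp: pc_def)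
  have R: "R \<ge> 0" and M: "M \<ge> 0" using bsrc_D[OF B] by auto
  have dP: "(P has_real_derivative p a) (at a)" for a
  proof -
    have d: "((\<lambda>a. a) has_real_derivative 1) (at a)" "((\<lambda>a. c + e * a) has_real_derivative e) (at a)"
      by (auto intro!: derivative_eq_intros)
    from gours_DERIV[OF H d] show ?thesis by (simp add: P_def p_def mult.commute)
  qed
  have cp: "continuous_on UNIV p" unfolding p_def
    by (intro continuous_on_add continuous_on_mult continuous_on_const row_compose_continuous[OF H] row_compose_continuous[OF Hs])
       (auto intro!: continuous_intros)
  have z0: "p a = 0" if "a \<le> 0" for a
    using row_zero'[OF H] row_zero'[OF Hs] that by (simp add: p_def)
  show "a \<le> 0 \<Longrightarrow> p a = 0" by (rule z0)
  have z1: "p a = 0" if "a > R + \<bar>c\<bar>" for a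
  proof -
    have "R < a" using that by linarith
    hence "row H a (c + e * a) = 0" using row_zero[OF B, of a] by auto
    moreover have "row (flip H) (c + e * a) a = 0"
      by (rule row_zero[OF Bs]) (use e that R in auto)
    ultimately show ?thesis by (simp add: p_def)
  qed
  show AC: "AC2 P p"
  proof (rule AC2_C1[OF dP cp])
    show "p x = 0" if "R + \<bar>c\<bar> < \<bar>x\<bar>" for x using z0[of x] z1[of x] that by (cases "x \<le> 0") auto
    show "P x = 0" if "x \<le> 0" for x using gours_zero[OF B] that by (simp add: P_def)
  qed
  show "\<bar>P a\<bar> \<le> M * R * R" unfolding P_def by (rule gours_le[OF B])
  have pb: "(p a)\<^sup>2 \<le> 4 * (M * R)\<^sup>2" for a
  proof -
    have "\<bar>p a\<bar> \<le> \<bar>2 * (M * R)\<bar>"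
      using row_le[OF B, of a "c + e * a"] row_le[OF Bs, of "c + e * a" a] e by (auto simp: p_def)
    thus ?thesis by (subst (asm) abs_le_square_iff) (simp add: power_mult_distrib)
  qed
  have "(LBINT a. (p a)\<^sup>2) \<le> (LBINT a. indicator {0..R + \<bar>c\<bar>} a * (4 * (M * R)\<^sup>2))"
  proof (rule integral_mono')
    show "integrable lborel (\<lambda>a. indicator {0..R + \<bar>c\<bar>} a * (4 * (M * R)\<^sup>2))"
      by (rule integrable_bounded_support[where M="4 * (M * R)\<^sup>2" and a=0 and b="R + \<bar>c\<bar>"]) (auto simp: indicator_def)
    show "(p a)\<^sup>2 \<le> indicator {0..R + \<bar>c\<bar>} a * (4 * (M * R)\<^sup>2)" for a
      using pb[of a] z0[of a] z1[of a] by (cases "0 \<le> a \<and> a \<le> R + \<bar>c\<bar>") (auto simp: indicator_def)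
  qed auto
  also have "\<dots> = (R + \<bar>c\<bar>) * (4 * (M * R)\<^sup>2)" using R by simp
  finally show "(LBINT a. (p a)\<^sup>2) \<le> (R + \<bar>c\<bar>) * (4 * (M * R)\<^sup>2)" .
qed

text \<open>At a boundary point of the quadrant the truncated function is dominated by |G|, which
  tends to zero there.\<close>

lemma isCont_quadrant_cutoff:
  fixes G :: "real \<times> real \<Rightarrow> real"
  assumes c: "isCont G (a, b)" and z: "(a = 0 \<and> b \<ge> 0) \<or> (b = 0 \<and> a \<ge> 0) \<Longrightarrow> G (a, b) = 0"
  shows "isCont (\<lambda>z. if fst z \<ge> 0 \<and> snd z \<ge> 0 then G z else 0) (a, b)"
proof -
  consider "a > 0 \<and> b > 0" | "a < 0 \<or> b < 0" | "(a = 0 \<and> b \<ge> 0) \<or> (b = 0 \<and> a \<ge> 0)" by linarith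
  thus ?thesis
  proof cases
    case 1
    have "open {z::real\<times>real. fst z > 0 \<and> snd z > 0}" by (intro open_Collect_conj open_Collect_less continuous_intros)
    hence "\<forall>\<^sub>F z in nhds (a, b). fst z > 0 \<and> snd z > 0" using 1 by (auto dest!: eventually_nhds_in_open[where x="(a,b)"])
    hence "\<forall>\<^sub>F z in nhds (a, b). (if fst z \<ge> 0 \<and> snd z \<ge> 0 then G z else 0) = G z" by eventually_elim auto
    thus ?thesis using c by (subst isCont_cong) auto
  next
    case 2
    have "open {z::real\<times>real. fst z < 0 \<or> snd z < 0}" by (intro open_Collect_disj open_Collect_less continuous_intros)
    hence "\<forall>\<^sub>F z in nhds (a, b). fst z < 0 \<or> snd z < 0" using 2 by (auto dest!: eventually_nhds_in_open[where x="(a,b)"])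
    hence "\<forall>\<^sub>F z in nhds (a, b). (if fst z \<ge> 0 \<and> snd z \<ge> 0 then G z else 0) = 0" by eventually_elim auto
    thus ?thesis by (subst isCont_cong) auto
  next
    case 3
    have G0: "G (a, b) = 0" by (rule z[OF 3])
    have "((\<lambda>z. if fst z \<ge> 0 \<and> snd z \<ge> 0 then G z else 0) \<longlongrightarrow> 0) (at (a, b))"
    proof (rule Lim_null_comparison)
      show "((\<lambda>z. \<bar>G z\<bar>) \<longlongrightarrow> 0) (at (a, b))" using c G0 unfolding isCont_def by (auto intro: tendsto_rabs_zero)
      show "\<forall>\<^sub>F z in at (a, b). norm (if fst z \<ge> 0 \<and> snd z \<ge> 0 then G z else 0) \<le> \<bar>G z\<bar>" by (intro always_eventually) auto
    qed
    thus ?thesis using G0 by (simp add: isCont_def)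
  qed
qed

text \<open>Only \<open>s \<le> 0\<close> matters; the cutoff gives the sources bounded support.\<close>

definition cutoff :: "real \<Rightarrow> real" where "cutoff s = max 0 (min 1 (1 - s))"

lemma cutoff_bounds: "\<bar>cutoff s\<bar> \<le> 1" "s \<le> 0 \<Longrightarrow> cutoff s = 1" "s \<ge> 1 \<Longrightarrow> cutoff s = 0"
  by (auto simp: cutoff_def)

lemma isCont_cutoff: "isCont cutoff s"
proof -
  have "continuous_on UNIV cutoff" unfolding cutoff_def[abs_def] by (intro continuous_intros)
  thus ?thesis by (simp add: continuous_on_eq_continuous_at)
qed

section \<open>Quantitative bounds and the equation for the source\<close>

text \<open>Extending by zero and gluing two edges create jumps at finitely many points, which are
  collected in N.\<close>

definition potential :: "real \<Rightarrow> real \<Rightarrow> real set \<Rightarrow> (real \<Rightarrow> real) \<Rightarrow> bool" where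
  "potential L M N r \<longleftrightarrow> r \<in> borel_measurable borel \<and> (\<forall>x. \<bar>r x\<bar> \<le> M) \<and> finite N \<and>
     (\<forall>x. x \<notin> N \<longrightarrow> isCont r x) \<and> (\<forall>x. x \<notin> {0..L} \<longrightarrow> r x = 0)"

lemma potentialD:
  assumes "potential L M N r"
  shows "r \<in> borel_measurable borel" "\<bar>r x\<bar> \<le> M" "finite N" "x \<notin> N \<Longrightarrow> isCont r x" "x \<notin> {0..L} \<Longrightarrow> r x = 0" "M \<ge> 0"
  using assms order_trans[OF abs_ge_zero, of "r 0" M] unfolding potential_def by blast+

text \<open>From here on bounds are kept on squares, so that every construction multiplies K, a
  squared norm of the data, by a constant. Of the jump lines only their finiteness is
  remembered.\<close>

definition pc_le :: "real \<Rightarrow> real \<Rightarrow> (real \<times> real \<Rightarrow> real) \<Rightarrow> bool" where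
  "pc_le R K H \<longleftrightarrow> (\<exists>M N. pc R M N H \<and> M\<^sup>2 \<le> K)"

definition AC2_le :: "real \<Rightarrow> (real \<Rightarrow> real) \<Rightarrow> (real \<Rightarrow> real) \<Rightarrow> bool" where
  "AC2_le K A a \<longleftrightarrow> AC2 A a \<and> (\<forall>z. (A z)\<^sup>2 \<le> K) \<and> (LBINT z. (a z)\<^sup>2) \<le> K"

lemma AC2_leD:
  assumes "AC2_le K A a"
  shows "AC2 A a" "(A z)\<^sup>2 \<le> K" "(LBINT z. (a z)\<^sup>2) \<le> K" "K \<ge> 0" "K \<le> K' \<Longrightarrow> AC2_le K' A a"
  using assms order_trans[OF zero_le_power2, of "A 0" K] unfolding AC2_le_def by (blast, blast, blast, blast, meson order_trans)

lemma pc_leD: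
  assumes "pc_le R K H"
  shows "bsrc R (sqrt K) H" "K \<ge> 0" "K \<le> K' \<Longrightarrow> pc_le R K' H" "a \<le> 0 \<or> b \<le> 0 \<Longrightarrow> row H a b = 0" "a \<le> 0 \<or> b \<le> 0 \<Longrightarrow> row (flip H) a b = 0"
proof -
  obtain M N where M: "pc R M N H" "M\<^sup>2 \<le> K" using assms by (auto simp: pc_le_def)
  show K: "K \<ge> 0" using order_trans[OF zero_le_power2 M(2)] .
  have "M \<le> sqrt K" using M(2) by (rule real_le_rsqrt)
  thus "bsrc R (sqrt K) H" using M(1) K unfolding pc_def bsrc_def by (meson order_trans real_sqrt_ge_zero)
  show "K \<le> K' \<Longrightarrow> pc_le R K' H" using M unfolding pc_le_def by (meson order_trans)
  show "a \<le> 0 \<or> b \<le> 0 \<Longrightarrow> row H a b = 0" "a \<le> 0 \<or> b \<le> 0 \<Longrightarrow> row (flip H) a b = 0"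
    using row_zero'[OF M(1)] row_zero'[OF pc_swap[OF M(1)]] by auto
qed

lemma AC2_le_combine:
  assumes A: "AC2_le K A a" and B: "AC2_le K' B b" and c: "c\<^sup>2 = 1"
  shows "AC2_le (2 * K + 2 * K') (\<lambda>x. A x + c * B x) (\<lambda>x. a x + c * b x)"
  unfolding AC2_le_def
proof (intro conjI allI)
  note sB = AC2_scale[OF AC2_leD(1)[OF B], of c]
  show "AC2 (\<lambda>x. A x + c * B x) (\<lambda>x. a x + c * b x)" by (rule AC2_add[OF AC2_leD(1)[OF A] sB])
  show "(A z + c * B z)\<^sup>2 \<le> 2 * K + 2 * K'" for z
    using sum_sq_le[of "A z" "c * B z"] AC2_leD(2)[OF A, of z] AC2_leD(2)[OF B, of z] c by (simp add: power_mult_distrib)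
  show "(LBINT z. (a z + c * b z)\<^sup>2) \<le> 2 * K + 2 * K'"
    using AC2_add_norm[OF AC2_leD(1)[OF A] sB] AC2_leD(3)[OF A] AC2_leD(3)[OF B] c by (simp add: power_mult_distrib)
qed

lemma AC2_le_shift:
  assumes "AC2_le K A a" shows "AC2_le K (\<lambda>x. A (x + c)) (\<lambda>x. a (x + c))"
proof -
  have "(LBINT x. (a (x + c))\<^sup>2) = (LBINT x. (a x)\<^sup>2)"
    by (subst (2) lborel_integral_real_affine[where c=1 and t=c]) (auto simp: add.commute)
  thus ?thesis using AC2_shift[of A a c] assms by (simp add: AC2_le_def)
qed

text \<open>The two summands are the bounds of \<open>gours_trace\<close> for M = 1: the square of R
  R for the values, and the square integral of the derivative.\<close>

definition trace_const :: "real \<Rightarrow> real \<Rightarrow> real" where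
  "trace_const c R = R ^ 4 + 4 * (R + \<bar>c\<bar>) * R\<^sup>2"

lemma gours_trace_le:
  assumes H: "pc_le R K H" and e: "e = 1 \<or> e = -1"
  shows "AC2_le (trace_const c R * K) (\<lambda>a. gours H a (c + e * a)) (\<lambda>a. row H a (c + e * a) + e * row (flip H) (c + e * a) a)"
    "trace_const c R \<ge> 0"
proof -
  obtain M N where M: "pc R M N H" "M\<^sup>2 \<le> K" using H by (auto simp: pc_le_def)
  have R: "R \<ge> 0" using M(1) bsrc_D(2) by (auto simp: pc_def)
  have K: "K \<ge> 0" by (rule pc_leD(2)[OF H])
  show "trace_const c R \<ge> 0" using R by (simp add: trace_const_def)
  have e1: "trace_const c R * K = R ^ 4 * K + 4 * (R + \<bar>c\<bar>) * R\<^sup>2 * K" by (simp add: trace_const_def algebra_simps)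
  have nn: "0 \<le> R ^ 4 * K" "0 \<le> 4 * (R + \<bar>c\<bar>) * R\<^sup>2 * K" using R K by auto
  show "AC2_le (trace_const c R * K) (\<lambda>a. gours H a (c + e * a)) (\<lambda>a. row H a (c + e * a) + e * row (flip H) (c + e * a) a)"
    unfolding AC2_le_def
  proof (intro conjI allI)
    show "AC2 (\<lambda>a. gours H a (c + e * a)) (\<lambda>a. row H a (c + e * a) + e * row (flip H) (c + e * a) a)" by (rule gours_trace(1)[OF M(1) e])
    fix a
    have "(gours H a (c + e * a))\<^sup>2 \<le> (M * R * R)\<^sup>2" using power_mono[OF gours_trace(2)[OF M(1) e, of a c], of 2] by simp
    also have "\<dots> = R ^ 4 * M\<^sup>2" by algebra
    also have "\<dots> \<le> R ^ 4 * K" using M(2) R by (intro mult_left_mono) auto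
    finally show "(gours H a (c + e * a))\<^sup>2 \<le> trace_const c R * K" using e1 nn by linarith
  next
    have "(R + \<bar>c\<bar>) * (4 * (M * R)\<^sup>2) = 4 * (R + \<bar>c\<bar>) * R\<^sup>2 * M\<^sup>2" by algebra
    also have "\<dots> \<le> 4 * (R + \<bar>c\<bar>) * R\<^sup>2 * K" using M(2) R by (intro mult_left_mono) auto
    finally show "(LBINT a. (row H a (c + e * a) + e * row (flip H) (c + e * a) a)\<^sup>2) \<le> trace_const c R * K"
      using gours_trace(4)[OF M(1) e, of c] e1 nn by linarith
  qed
qed

text \<open>The factor \<open>1/4\<close> comes from \<open>u\<^sub>t\<^sub>t - u\<^sub>x\<^sub>x = 4 u\<^sub>a\<^sub>b\<close> in the characteristic coordinates. The function \<open>pos\<close>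
  recovers the position from them, and the curve \<open>b = \<beta> a\<close> is where the free part \<open>u0\<close> prescribes the solution.\<close>

definition volterra_source :: "(real \<Rightarrow> real) \<Rightarrow> (real \<times> real \<Rightarrow> real) \<Rightarrow> real \<Rightarrow> (real \<Rightarrow> real) \<Rightarrow>
    (real \<times> real \<Rightarrow> real) \<Rightarrow> (real \<times> real \<Rightarrow> real) \<Rightarrow> bool" where
  "volterra_source r pos d \<beta> u0 H \<longleftrightarrow> (\<forall>a\<ge>0. \<forall>b\<ge>0. H (a, b) =
     r (pos (a, b)) / 4 * cutoff ((a + b) / 2 - d) * (u0 (a, b) + gours H a (\<beta> a) - gours H a b))"

text \<open>The square of M / 4, the bound of the coefficient in the source, times the growth factor
  of \<open>volterra_exists\<close> for this bound and for the square of side 2 (1 + d).\<close>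

definition volterra_const :: "real \<Rightarrow> real \<Rightarrow> real" where
  "volterra_const M d = (M / 4 * (2 * exp ((4 * (M / 4) * (2 * (1 + d)) + 1) * (2 * (1 + d)))))\<^sup>2"

text \<open>The bounded solution u comes from \<open>volterra_exists\<close>; the point is that H =
  Q u jumps only along lines of fixed position. Restriction to the quadrant could add jumps along
  the axes, so H has to vanish there: on a = 0 because u0 and the Goursat integrals do, on b = 0
  because either the potential vanishes or u0 = 0 and the curve \<beta> lies below the axis.\<close>

lemma volterra_pc:
  fixes r \<beta> :: "real \<Rightarrow> real" and \<sigma> x0 d :: real and u0 :: "real \<times> real \<Rightarrow> real"
  assumes r: "potential L M N r" and pos: "\<And>z. pos z = \<sigma> * (fst z - snd z) / 2 + x0" and \<sigma>: "\<sigma> = 1 \<or> \<sigma> = -1" and d: "d \<ge> 0"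
    and \<beta>: "continuous_on UNIV \<beta>" and u0m: "u0 \<in> borel_measurable borel" and u0K: "\<And>z. (u0 z)\<^sup>2 \<le> K"
    and u0c: "\<And>z. pos z \<notin> N \<Longrightarrow> isCont u0 z" and za: "\<And>b. u0 (0, b) = 0"
    and zb: "\<And>a. a > 0 \<Longrightarrow> r (pos (a, 0)) \<noteq> 0 \<Longrightarrow> u0 (a, 0) = 0 \<and> \<beta> a \<le> 0"
  shows "\<exists>H. pc_le (2 * (1 + d)) (volterra_const M d * K) H \<and> volterra_source r pos d \<beta> u0 H"
proof -
  note rD = potentialD[OF r] and [measurable] = potentialD(1)[OF r]
  \<comment> \<open>For a, b \<ge> 0 outside the square of side R the sum a + b exceeds R, so the
    time (a + b) / 2 - d exceeds 1 and the cutoff vanishes.\<close>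
  define R where "R = 2 * (1 + d)"
  define tm where "tm z = (fst z + snd z) / 2 - d" for z :: "real \<times> real"
  have pos_def: "pos = (\<lambda>z. \<sigma> * (fst z - snd z) / 2 + x0)" using pos by blast
  note M = rD(6)
  have R: "R \<ge> 0" using d by (simp add: R_def)
  have [measurable]: "cutoff \<in> borel_measurable borel" unfolding cutoff_def[abs_def] by measurable
  define Q0 where "Q0 z = r (pos z) / 4 * cutoff (tm z)" for z
  define Q where "Q z = (if fst z \<ge> 0 \<and> snd z \<ge> 0 then Q0 z else 0)" for z
  have Q0m[measurable]: "Q0 \<in> borel_measurable borel" unfolding Q0_def[abs_def] pos_def tm_def[abs_def] by measurable
  have Q0b: "\<bar>Q0 z\<bar> \<le> M / 4" for z
  proof -
    have "\<bar>r (pos z)\<bar> * \<bar>cutoff (tm z)\<bar> \<le> M * 1" by (rule mult_mono) (use rD(2) cutoff_bounds(1) M in auto)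
    thus ?thesis by (simp add: Q0_def abs_mult)
  qed
  have Q: "bsrc R (M / 4) Q"
    unfolding bsrc_def
  proof (intro conjI allI impI)
    show "Q \<in> borel_measurable borel" unfolding Q_def[abs_def] by measurable
    show "\<bar>Q z\<bar> \<le> M / 4" for z using Q0b[of z] M by (simp add: Q_def)
    fix a b assume ab: "\<not> (0 \<le> a \<and> a \<le> R \<and> 0 \<le> b \<and> b \<le> R)"
    show "Q (a, b) = 0"
    proof (cases "a \<ge> 0 \<and> b \<ge> 0")
      case True
      hence "a + b > R" using ab by auto
      hence "tm (a, b) \<ge> 1" by (simp add: tm_def R_def field_simps)
      thus ?thesis by (simp add: Q_def Q0_def cutoff_bounds(3))
    qed (auto simp: Q_def)
  qed (use R M in auto)
  have \<beta>m: "\<beta> \<in> borel_measurable borel" by (rule borel_measurable_continuous_onI[OF \<beta>])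
  define C0 where "C0 = 2 * exp ((4 * (M / 4) * R + 1) * R)"
  have C0: "C0 \<ge> 0" by (simp add: C0_def)
  define m where "m = sqrt K"
  have K: "K \<ge> 0" using order_trans[OF zero_le_power2 u0K[of 0]] .
  have m: "m \<ge> 0" "m\<^sup>2 = K" using K by (auto simp: m_def)
  have u0b: "\<bar>u0 z\<bar> \<le> m" for z using real_sqrt_le_mono[OF u0K[of z]] by (simp add: m_def)
  obtain u where um: "u \<in> borel_measurable borel" and ub: "\<And>z. \<bar>u z\<bar> \<le> C0 * m"
    and ue: "\<And>a b. u (a, b) = u0 (a, b) + gours (\<lambda>z. Q z * u z) a (\<beta> a) - gours (\<lambda>z. Q z * u z) a b"
    using volterra_exists[OF Q \<beta>m u0m u0b] unfolding C0_def by blast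
  define H where "H z = Q z * u z" for z
  have HB: "bsrc R (M / 4 * (C0 * m)) H"
    unfolding H_def[abs_def] by (rule bsrc_mult[OF Q um ub]) (use C0 m(1) in simp)
  have ue': "u z = u0 z + gours H (fst z) (\<beta> (fst z)) - gours H (fst z) (snd z)" for z
    using ue[of "fst z" "snd z"] by (simp add: H_def[abs_def])
  have gc: "continuous_on UNIV (\<lambda>z. gours H (fst z) (snd z))" by (rule gours_continuous[OF HB])
  have gc': "continuous_on UNIV (\<lambda>z::real\<times>real. gours H (fst z) (\<beta> (fst z)))"
  proof -
    have "continuous_on UNIV (\<lambda>z::real\<times>real. (fst z, \<beta> (fst z)))"
      by (intro continuous_intros continuous_on_compose2[OF \<beta>]) auto
    from continuous_on_compose2[OF gc this] show ?thesis by simp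
  qed
  have uc: "isCont u z" if "pos z \<notin> N" for z
  proof -
    have "isCont (\<lambda>z. u0 z + gours H (fst z) (\<beta> (fst z)) - gours H (fst z) (snd z)) z"
      using u0c that gc gc' by (intro isCont_add isCont_diff) (auto simp: continuous_on_eq_continuous_at simp del: split_paired_All)
    moreover have "u = (\<lambda>z. u0 z + gours H (fst z) (\<beta> (fst z)) - gours H (fst z) (snd z))" using ue' by blast
    ultimately show ?thesis by simp
  qed
  have Q0c: "isCont Q0 z" if "pos z \<notin> N" for z
  proof -
    have "isCont pos z" "isCont tm z" unfolding pos_def tm_def[abs_def] by (intro continuous_intros, simp)+
    from isCont_o2[OF this(1) rD(4)[OF that]] isCont_o2[OF this(2) isCont_cutoff]
    show ?thesis unfolding Q0_def[abs_def] by (intro continuous_intros) auto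
  qed
  have Hc: "isCont H (a, b)" if ab: "pos (a, b) \<notin> N" for a b
  proof -
    have "isCont (\<lambda>z. if fst z \<ge> 0 \<and> snd z \<ge> 0 then Q0 z * u z else 0) (a, b)"
    proof (rule isCont_quadrant_cutoff)
      show "isCont (\<lambda>z. Q0 z * u z) (a, b)" by (intro isCont_mult Q0c uc ab)
      assume "(a = 0 \<and> b \<ge> 0) \<or> (b = 0 \<and> a \<ge> 0)"
      hence "a = 0 \<or> (b = 0 \<and> a > 0)" by linarith
      thus "Q0 (a, b) * u (a, b) = 0"
      proof
        assume "a = 0"
        thus ?thesis using za gours_zero[OF HB] ue'[of "(a, b)"] by simp
      next
        assume b0: "b = 0 \<and> a > 0"
        show ?thesis
        proof (cases "r (pos (a, 0)) = 0")
          case True thus ?thesis using b0 by (simp add: Q0_def)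
        next
          case False
          with zb b0 have "u0 (a, 0) = 0" "\<beta> a \<le> 0" by auto
          thus ?thesis using gours_zero[OF HB] ue'[of "(a, b)"] b0 by simp
        qed
      qed
    qed
    moreover have "H = (\<lambda>z. if fst z \<ge> 0 \<and> snd z \<ge> 0 then Q0 z * u z else 0)" by (auto simp: H_def Q_def)
    ultimately show ?thesis by simp
  qed
  \<comment> \<open>On the line a - b = k the position is \<sigma> k / 2 + x0, so the finite set N
    of positions yields finitely many lines.\<close>
  have fin: "finite {k. \<sigma> * k / 2 + x0 \<in> N}"
  proof -
    have "{k. \<sigma> * k / 2 + x0 \<in> N} = (\<lambda>k. \<sigma> * k / 2 + x0) -` N" by auto
    moreover have "inj (\<lambda>k. \<sigma> * k / 2 + x0)" using \<sigma> by (auto simp: inj_def)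
    ultimately show ?thesis using finite_vimageI[OF rD(3)] by simp
  qed
  have pcH: "pc R (M / 4 * C0 * m) {k. \<sigma> * k / 2 + x0 \<in> N} H"
    unfolding pc_def using HB fin Hc by (simp add: pos_def mult.assoc)
  have "(M / 4 * C0 * m)\<^sup>2 = (M / 4 * C0)\<^sup>2 * K" unfolding power_mult_distrib m(2) ..
  hence "(M / 4 * C0 * m)\<^sup>2 \<le> volterra_const M d * K" by (simp add: volterra_const_def C0_def R_def)
  with pcH have "pc_le (2 * (1 + d)) (volterra_const M d * K) H" unfolding pc_le_def R_def by blast
  moreover have "volterra_source r pos d \<beta> u0 H" unfolding volterra_source_def
    using ue' by (simp add: H_def Q_def Q0_def tm_def)
  ultimately show ?thesis by blast
qed

text \<open>Solution on a string of length \<open>l\<close> that vanishes for \<open>s < x - l\<close> and at \<open>x = l\<close>, and reaches the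
  state \<open>\<Psi> (l - x)\<close> at \<open>s = 0\<close>.\<close>

definition picard_const :: "real \<Rightarrow> real \<Rightarrow> real" where
  "picard_const M l = 2 * (1 + l) + (2 * trace_const (2 * l) (2 * (1 + l)) + 1) * (volterra_const M l * (1 + l))"

lemma picard:
  assumes l: "l > 0" and r: "potential l M N r" and A: "AC2 \<Psi> \<psi>" and z: "\<And>z. z \<notin> {0<..l} \<Longrightarrow> \<psi> z = 0" and K: "(LBINT z. (\<psi> z)\<^sup>2) \<le> K"
  obtains A a H where "AC2_le (picard_const M l * K) A a" "\<And>z. z \<le> 0 \<Longrightarrow> a z = 0" "pc_le (2 * (1 + l)) (picard_const M l * K) H"
    "\<And>x. x \<in> {0..l} \<Longrightarrow> A (l - x) - gours H (l - x) (l + x) = \<Psi> (l - x)"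
    "\<And>x s. x \<in> {0..l} \<Longrightarrow> s \<le> 0 \<Longrightarrow> H (s - x + l, s + x + l) = r x / 4 * (A (s - x + l) - gours H (s - x + l) (s + x + l))"
proof -
  define R where "R = 2 * (1 + l)"
  define V where "V = volterra_const M l * ((1 + l) * K)"
  have K0: "K \<ge> 0" using K by (rule order_trans[rotated]) simp
  have \<Psi>0: "\<Psi> x = 0" if "x \<le> 0" for x by (rule AC2_zero[OF A]) (use that z in auto)
  have \<Psi>K: "AC2_le ((1 + l) * K) \<Psi> \<psi>" unfolding AC2_le_def
  proof (intro conjI allI)
    fix x
    have "(\<Psi> x)\<^sup>2 \<le> (l - 0) * (LBINT x. (\<psi> x)\<^sup>2)" by (rule AC2_sup[OF A]) (use z l in auto)
    also have "\<dots> \<le> (1 + l) * K" using K l K0 by (intro mult_mono) auto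
    finally show "(\<Psi> x)\<^sup>2 \<le> (1 + l) * K" .
    show "(LBINT z. (\<psi> z)\<^sup>2) \<le> (1 + l) * K" using K l K0 by (simp add: algebra_simps add_nonneg_nonneg order_trans)
  qed (rule A)
  have "continuous_on UNIV \<Psi>" using AC2_isCont[OF A] by (simp add: continuous_on_eq_continuous_at)
  hence [measurable]: "\<Psi> \<in> borel_measurable borel" by (rule borel_measurable_continuous_onI)
  \<comment> \<open>The characteristic coordinates are a = s - x + l and b = s + x + l: the position
    is (b - a) / 2, the time (a + b) / 2 - l, and the curve b = 2 l - a is the final time s = 0,
    where the state \<Psi> is prescribed.\<close>
  have "\<exists>H. pc_le (2 * (1 + l)) V H \<and> volterra_source r (\<lambda>z. (snd z - fst z) / 2) l (\<lambda>a. 2 * l - a) (\<lambda>z. \<Psi> (fst z)) H"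
    unfolding V_def
  proof (rule volterra_pc[OF r, where \<sigma>="- 1" and ?x0.0=0])
    show "(\<lambda>z. \<Psi> (fst z)) \<in> borel_measurable (borel :: (real \<times> real) measure)"
      unfolding borel_prod[symmetric] by measurable
    show "isCont (\<lambda>z. \<Psi> (fst z)) z" for z :: "real \<times> real"
      by (rule isCont_o2[OF _ AC2_isCont[OF A]]) (intro continuous_intros)
    \<comment> \<open>The hypotheses are contradictory: b = 0 and a > 0 mean the position - a / 2 <
      0, where the potential vanishes.\<close>
    show "\<Psi> (fst (a, 0)) = 0 \<and> 2 * l - a \<le> 0" if "a > 0" "r ((snd (a, 0) - fst (a, 0)) / 2) \<noteq> 0" for a
      using that potentialD(5)[OF r, of "- a / 2"] by auto
    show "continuous_on UNIV (\<lambda>a. 2 * l - a)" by (intro continuous_intros)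
  qed (use AC2_leD(2)[OF \<Psi>K] \<Psi>0 l in auto)
  then obtain H where H: "pc_le R V H" and He: "\<And>a b. a \<ge> 0 \<Longrightarrow> b \<ge> 0 \<Longrightarrow>
    H (a, b) = r ((b - a) / 2) / 4 * cutoff ((a + b) / 2 - l) * (\<Psi> a + gours H a (2 * l - a) - gours H a b)"
    by (auto simp: volterra_source_def R_def)
  note HB = pc_leD(1)[OF H]
  \<comment> \<open>On the line of final time the Goursat integral is a function of a alone and a
    wave profile. Adding it to \<Psi> gives the wave A for which A - gours H equals \<Psi> at s =
    0.\<close>
  define P where "P a = gours H a (2 * l + - 1 * a)" for a
  define p where "p a = row H a (2 * l + - 1 * a) + - 1 * row (flip H) (2 * l + - 1 * a) a" for a
  have P: "AC2_le (trace_const (2 * l) R * V) P p" unfolding P_def[abs_def] p_def[abs_def] by (rule gours_trace_le(1)[OF H]) simp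
  have p0: "p a = 0" if "a \<le> 0" for a using pc_leD(4,5)[OF H] that by (simp add: p_def)
  have CK: "picard_const M l * K = 2 * ((1 + l) * K) + 2 * (trace_const (2 * l) R * V) + V"
    by (simp add: picard_const_def V_def R_def algebra_simps)
  have nn: "0 \<le> (1 + l) * K" "0 \<le> trace_const (2 * l) R * V" "0 \<le> V" using AC2_leD(4)[OF \<Psi>K] AC2_leD(4)[OF P] pc_leD(2)[OF H] by auto
  have \<Psi>P: "AC2_le (2 * ((1 + l) * K) + 2 * (trace_const (2 * l) R * V)) (\<lambda>x. \<Psi> x + 1 * P x) (\<lambda>x. \<psi> x + 1 * p x)"
    by (rule AC2_le_combine[OF \<Psi>K P]) simp
  show ?thesis
  proof (rule that)
    show "AC2_le (picard_const M l * K) (\<lambda>x. \<Psi> x + 1 * P x) (\<lambda>x. \<psi> x + 1 * p x)"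
      by (rule AC2_leD(5)[OF \<Psi>P]) (use CK nn in linarith)
    show "pc_le (2 * (1 + l)) (picard_const M l * K) H" using pc_leD(3)[OF H, of "picard_const M l * K"] CK nn by (simp add: R_def)
    show "\<psi> x + 1 * p x = 0" if "x \<le> 0" for x using z[of x] p0[OF that] that by auto
    show "\<Psi> (l - x) + 1 * P (l - x) - gours H (l - x) (l + x) = \<Psi> (l - x)" for x by (simp add: P_def)
    fix x s :: real assume x: "x \<in> {0..l}" and s: "s \<le> 0"
    show "H (s - x + l, s + x + l) = r x / 4 * (\<Psi> (s - x + l) + 1 * P (s - x + l) - gours H (s - x + l) (s + x + l))"
    proof (cases "s - x + l \<ge> 0")
      case True
      hence b: "s + x + l \<ge> 0" using x by simp
      have e: "(s + x + l - (s - x + l)) / 2 = x" "(s - x + l + (s + x + l)) / 2 - l = s" by (simp_all add: field_simps)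
      show ?thesis unfolding He[OF True b] e using cutoff_bounds(2)[OF s] by (simp add: P_def)
    next
      case False
      thus ?thesis using bsrc_D(5)[OF HB, of "s - x + l"] \<Psi>0[of "s - x + l"] gours_zero[OF HB, of "s - x + l"] by (simp add: P_def)
    qed
  qed
qed

text \<open>On the string \<open>[0, l1 + l3]\<close> with a jump \<open>g\<close> across \<open>l1\<close> the free solution with zero Dirichlet
  condition at the right end consists of the waves leaving \<open>l1\<close> and their reflection; in the coordinates
  \<open>a = s + l2 + y - l1\<close>, \<open>b = s + l2 - y + l1\<close> the point lies left of the jump iff \<open>a \<le> b\<close>.\<close>

definition jump_free :: "(real \<Rightarrow> real) \<Rightarrow> real \<Rightarrow> real \<Rightarrow> real \<Rightarrow> real \<Rightarrow> real" where
  "jump_free g l2 l3 a b = - (1/2) * g (a - l2 - 2 * l3) + (if a \<le> b then - (1/2) * g (a - l2) else (1/2) * g (b - l2))"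

text \<open>The 1 lets the constant dominate K itself, so that g, B and H share one bound.\<close>

definition jump_const :: "real \<Rightarrow> real \<Rightarrow> real \<Rightarrow> real" where
  "jump_const M l2 l3 = 1 + (trace_const (- 2 * l3) (2 * (1 + l2)) + 1) * volterra_const M l2"

text \<open>The solution is \<open>jump_free\<close> plus B(a) minus the Goursat integral. The end
  v3 is the line b = a - 2 l3; there the two halves of g cancel in \<open>jump_free\<close>, and B,
  the trace of the Goursat integral on this line, cancels the latter. The point l1 belongs to N
  because the jump of the solution makes the source jump there.\<close>

lemma jump_wave:
  assumes l: "l1 > 0" "l2 > 0" "l3 > 0" and r: "potential (l1 + l3) M N r" and N: "l1 \<in> N"
    and g: "AC2_le K g \<gamma>" and z: "\<And>z. z \<le> - l2 \<Longrightarrow> \<gamma> z = 0"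
  obtains B b H where "AC2_le (jump_const M l2 l3 * K) B b" "\<And>z. z \<le> 2 * l3 \<Longrightarrow> b z = 0" "pc_le (2 * (1 + l2)) (jump_const M l2 l3 * K) H"
    "\<And>a. B a = gours H a (a - 2 * l3)" "K \<le> jump_const M l2 l3 * K"
    "\<And>y s. y \<in> {0..l1 + l3} \<Longrightarrow> s \<le> 0 \<Longrightarrow> H (s + l2 + y - l1, s + l2 - y + l1) = r y / 4 *
       (jump_free g l2 l3 (s + l2 + y - l1) (s + l2 - y + l1) + B (s + l2 + y - l1) - gours H (s + l2 + y - l1) (s + l2 - y + l1))"
proof -
  define R where "R = 2 * (1 + l2)"
  define V where "V = volterra_const M l2 * K"
  note A = AC2_leD(1)[OF g]
  have g0: "g x = 0" if "x \<le> - l2" for x by (rule AC2_zero[OF A]) (use z that in auto)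
  have "continuous_on UNIV g" using AC2_isCont[OF A] by (simp add: continuous_on_eq_continuous_at)
  hence [measurable]: "g \<in> borel_measurable borel" by (rule borel_measurable_continuous_onI)
  define u0 where "u0 z = jump_free g l2 l3 (fst z) (snd z)" for z
  have "\<exists>H. pc_le (2 * (1 + l2)) V H \<and> volterra_source r (\<lambda>z. (fst z - snd z) / 2 + l1) l2 (\<lambda>a. a - 2 * l3) u0 H"
    unfolding V_def
  proof (rule volterra_pc[OF r, where \<sigma>=1 and ?x0.0=l1])
    show "u0 \<in> borel_measurable borel" unfolding u0_def[abs_def] jump_free_def by measurable
    show "continuous_on UNIV (\<lambda>a. a - 2 * l3)" by (intro continuous_intros)
    show "(u0 z)\<^sup>2 \<le> K" for z
    proof -
      \<comment> \<open>On either side of the jump the free part is half the sum of two values of g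
        up to sign, so the bound K of g is kept.\<close>
      have "(x / 2 + y / 2)\<^sup>2 \<le> K" if "x\<^sup>2 \<le> K" "y\<^sup>2 \<le> K" for x y :: real
        using sum_sq_le[of "x / 2" "y / 2"] that by (simp add: power_divide)
      from this[of "- g (fst z - l2)" "- g (fst z - l2 - 2 * l3)"] this[of "- g (fst z - l2 - 2 * l3)" "g (snd z - l2)"]
      show ?thesis using AC2_leD(2)[OF g] by (simp add: u0_def jump_free_def)
    qed
    show "isCont u0 z" if zN: "(fst z - snd z) / 2 + l1 \<notin> N" for z
    proof -
      have gc: "isCont (\<lambda>z. g (f z)) z" if "isCont f z" for f :: "real \<times> real \<Rightarrow> real"
        by (rule isCont_o2[OF that AC2_isCont[OF A]])
      have cont: "isCont (\<lambda>z. - (1/2) * g (fst z - l2 - 2 * l3) + - (1/2) * g (fst z - l2)) z"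
         "isCont (\<lambda>z. - (1/2) * g (fst z - l2 - 2 * l3) + (1/2) * g (snd z - l2)) z"
        by (intro continuous_intros gc)+
      have "fst z \<noteq> snd z" using zN N by auto
      then consider "fst z < snd z" | "fst z > snd z" by linarith
      thus ?thesis
      proof cases
        case 1
        have "open {z::real\<times>real. fst z < snd z}" by (intro open_Collect_less continuous_intros)
        hence "\<forall>\<^sub>F w in nhds z. fst w < snd w" using 1 by (auto dest!: eventually_nhds_in_open[where x=z])
        hence "\<forall>\<^sub>F w in nhds z. u0 w = - (1/2) * g (fst w - l2 - 2 * l3) + - (1/2) * g (fst w - l2)"
          by eventually_elim (auto simp: u0_def jump_free_def)
        thus ?thesis using cont(1) by (subst isCont_cong)
      next
        case 2
        have "open {z::real\<times>real. fst z > snd z}" by (intro open_Collect_less continuous_intros)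
        hence "\<forall>\<^sub>F w in nhds z. fst w > snd w" using 2 by (auto dest!: eventually_nhds_in_open[where x=z])
        hence "\<forall>\<^sub>F w in nhds z. u0 w = - (1/2) * g (fst w - l2 - 2 * l3) + (1/2) * g (snd w - l2)"
          by eventually_elim (auto simp: u0_def jump_free_def)
        thus ?thesis using cont(2) by (subst isCont_cong)
      qed
    qed
    \<comment> \<open>On a = 0 every value of g that occurs has argument at most - l2, before g
      starts.\<close>
    show "u0 (0, b) = 0" for b using g0 l by (auto simp: u0_def jump_free_def)
    \<comment> \<open>A nonzero potential forces the position a / 2 + l1 to be at most l1 + l3. Then
      a \<le> 2 l3: the wave reflected at v3 has not yet started, and the curve lies on or below the
      axis.\<close>
    show "u0 (a, 0) = 0 \<and> a - 2 * l3 \<le> 0" if "a > 0" "r ((fst (a, 0) - snd (a, 0)) / 2 + l1) \<noteq> 0" for a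
    proof -
      have "a \<le> 2 * l3" using potentialD(5)[OF r, of "a / 2 + l1"] that l by (cases "a \<le> 2 * l3") auto
      thus ?thesis using g0 that by (simp add: u0_def jump_free_def)
    qed
  qed (use l in auto)
  then obtain H where H: "pc_le R V H" and He: "\<And>a b. a \<ge> 0 \<Longrightarrow> b \<ge> 0 \<Longrightarrow>
    H (a, b) = r ((a - b) / 2 + l1) / 4 * cutoff ((a + b) / 2 - l2) * (u0 (a, b) + gours H a (a - 2 * l3) - gours H a b)"
    by (auto simp: volterra_source_def R_def)
  note HB = pc_leD(1)[OF H]
  define P where "P a = gours H a (- 2 * l3 + 1 * a)" for a
  define p where "p a = row H a (- 2 * l3 + 1 * a) + 1 * row (flip H) (- 2 * l3 + 1 * a) a" for a
  have P: "AC2_le (trace_const (- 2 * l3) R * V) P p" unfolding P_def[abs_def] p_def[abs_def] by (rule gours_trace_le(1)[OF H]) simp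
  have Pe: "P a = gours H a (a - 2 * l3)" for a by (simp add: P_def)
  have CK: "jump_const M l2 l3 * K = K + trace_const (- 2 * l3) R * V + V"
    by (simp add: jump_const_def V_def R_def algebra_simps)
  have nn: "0 \<le> K" "0 \<le> trace_const (- 2 * l3) R * V" "0 \<le> V" using AC2_leD(4)[OF g] AC2_leD(4)[OF P] pc_leD(2)[OF H] by auto
  show ?thesis
  proof (rule that[OF _ _ _ Pe])
    show "AC2_le (jump_const M l2 l3 * K) P p" by (rule AC2_leD(5)[OF P]) (use CK nn in linarith)
    show "p x = 0" if "x \<le> 2 * l3" for x using pc_leD(4,5)[OF H] that by (simp add: p_def)
    show "pc_le (2 * (1 + l2)) (jump_const M l2 l3 * K) H" using pc_leD(3)[OF H, of "jump_const M l2 l3 * K"] CK nn by (simp add: R_def)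
    show "K \<le> jump_const M l2 l3 * K" using CK nn by linarith
    fix y s :: real assume y: "y \<in> {0..l1 + l3}" and s: "s \<le> 0"
    define a where "a = s + l2 + y - l1"
    define b where "b = s + l2 - y + l1"
    have ab: "a - b = 2 * (y - l1)" by (simp add: a_def b_def)
    have "H (a, b) = r y / 4 * (jump_free g l2 l3 a b + P a - gours H a b)"
    proof (cases "a \<ge> 0 \<and> b \<ge> 0")
      case True
      have e: "(a - b) / 2 + l1 = y" "(a + b) / 2 - l2 = s" by (simp_all add: a_def b_def field_simps)
      show ?thesis using He[of a b] True cutoff_bounds(2)[OF s] unfolding e by (simp add: u0_def Pe)
    next
      case False
      have "jump_free g l2 l3 a b = 0"
        using False g0 l ab y by (auto simp: jump_free_def)
      moreover have "P a = 0" unfolding Pe by (rule gours_zero[OF HB]) (use False ab y in auto)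
      moreover have "gours H a b = 0" by (rule gours_zero[OF HB]) (use False in auto)
      moreover have "H (a, b) = 0" by (rule bsrc_D(5)[OF HB]) (use False in auto)
      ultimately show ?thesis by simp
    qed
    thus "H (s + l2 + y - l1, s + l2 - y + l1) = r y / 4 *
        (jump_free g l2 l3 (s + l2 + y - l1) (s + l2 - y + l1) + P (s + l2 + y - l1) - gours H (s + l2 + y - l1) (s + l2 - y + l1))"
      by (simp add: a_def b_def)
  qed
qed

section \<open>Transfer of string solutions to the edges\<close>

lemma edge_sol_mono: "edge_sol l S K h u ux ut \<Longrightarrow> K \<le> K' \<Longrightarrow> edge_sol l S K' h u ux ut"
  unfolding edge_sol_def by (meson order_trans sqint_mono)

lemma prim2_reflect:
  assumes p: "prim2 l f f'" and l: "l \<ge> 0"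
  shows "prim2 l (\<lambda>x. f (l - x)) (\<lambda>x. - f' (l - x))" "(LBINT x:{0..l}. (- f' (l - x))\<^sup>2) = (LBINT x:{0..l}. (f' x)\<^sup>2)"
proof -
  have pr: "prim l f f'" and i2: "set_integrable lborel {0..l} (\<lambda>x. (f' x)\<^sup>2)" using p by (auto simp: prim2_def)
  note [measurable] = prim_D(1)[OF pr]
  have i: "set_integrable lborel {0..l} f'" by (rule prim_D(2)[OF pr])
  show "(LBINT x:{0..l}. (- f' (l - x))\<^sup>2) = (LBINT x:{0..l}. (f' x)\<^sup>2)"
    using set_integral_reflect_Icc(1)[where f="\<lambda>x. (f' x)\<^sup>2" and a=0 and b=l and c=l] by simp
  have i2': "set_integrable lborel {0..l} (\<lambda>x. (- f' (l - x))\<^sup>2)"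
    using set_integral_reflect_Icc(2)[where f="\<lambda>x. (f' x)\<^sup>2" and a=0 and b=l and c=l] i2 by simp
  have i': "set_integrable lborel {0..l} (\<lambda>x. - f' (l - x))"
    by (rule set_integrable_if_square[OF _ i2']) measurable
  have "f (l - x) = f l + (LBINT y:{0..x}. - f' (l - y))" if x: "x \<in> {0..l}" for x
  proof -
    have F: "f' \<in> borel_measurable borel" by simp
    have "(LBINT y:{0..x}. - f' (l - y)) = - (LBINT y:{l - x..l}. f' y)"
      using set_integral_reflect_Icc(1)[where f=f' and a=0 and b=x and c=l] by (simp add: set_integral_uminus set_LINT_def)
    moreover have "f l - f (l - x) = (LBINT y:{l - x..l}. f' y)"
    proof -
      define F where "F y = indicator {0..l} y *\<^sub>R f' y" for y
      have Fi: "integrable lborel F" using i unfolding F_def[abs_def] set_integrable_def .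
      have e: "f y = f 0 + (LBINT z:{..y}. F z)" if "y \<in> {0..l}" for y
        using prim_D(3)[OF pr that] that
        by (auto simp: F_def set_LINT_def indicator_def intro!: LINT_cong)
      have "f l - f (l - x) = (LBINT y:{l - x..l}. F y)"
        using e[of l] e[of "l - x"] x integral_atMost_diff[OF Fi, of "l - x" l] by simp
      also have "\<dots> = (LBINT y:{l - x..l}. f' y)"
        by (rule set_lebesgue_integral_cong) (use x in \<open>auto simp: F_def\<close>)
      finally show ?thesis .
    qed
    ultimately show ?thesis by simp
  qed
  thus "prim2 l (\<lambda>x. f (l - x)) (\<lambda>x. - f' (l - x))" unfolding prim2_def prim_def using i' i2' by simp
qed

lemma prim2_AC2:
  assumes p: "prim2 l f f'" and l: "l \<ge> 0"
  obtains F \<phi> where "AC2 F \<phi>" "\<And>z. z \<notin> {0<..l} \<Longrightarrow> \<phi> z = 0" "(LBINT z. (\<phi> z)\<^sup>2) = (LBINT x:{0..l}. (f' x)\<^sup>2)"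
    "\<And>x. x \<le> 0 \<Longrightarrow> F x = 0" "\<And>x. x \<in> {0..l} \<Longrightarrow> F x = f x - f 0" "\<And>x. x \<ge> l \<Longrightarrow> F x = f l - f 0"
proof -
  have pr: "prim l f f'" and i2: "set_integrable lborel {0..l} (\<lambda>x. (f' x)\<^sup>2)" using p by (auto simp: prim2_def)
  note [measurable] = prim_D(1)[OF pr]
  \<comment> \<open>The half-open interval changes f' on a null set only and makes the profile
    derivative vanish at 0 as well, as the lemmas on waves starting at 0 require.\<close>
  define \<phi> where "\<phi> z = indicator {0<..l} z * f' z" for z
  define F where "F x = (LBINT y:{..x}. \<phi> y)" for x
  have ae: "AE z in lborel. (\<phi> z)\<^sup>2 = indicator {0..l} z *\<^sub>R (f' z)\<^sup>2"
    using AE_lborel_singleton[of 0] by eventually_elim (auto simp: \<phi>_def indicator_def)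
  have m: "\<phi> \<in> borel_measurable borel" unfolding \<phi>_def[abs_def] by measurable
  have AC: "AC2 F \<phi>" unfolding AC2_def
  proof (intro conjI)
    show "\<phi> \<in> borel_measurable borel" by (rule m)
    show "integrable lborel (\<lambda>x. (\<phi> x)\<^sup>2)"
      using i2 unfolding set_integrable_def by (subst integrable_cong_AE[OF _ _ ae]) (use m in measurable)
    show "\<exists>R. \<forall>x. R < \<bar>x\<bar> \<longrightarrow> \<phi> x = 0" by (rule exI[of _ l]) (auto simp: \<phi>_def indicator_def)
  qed (simp add: F_def)
  have n: "(LBINT z. (\<phi> z)\<^sup>2) = (LBINT x:{0..l}. (f' x)\<^sup>2)"
    unfolding set_LINT_def by (rule integral_cong_AE[OF _ _ ae]) (use m in measurable)
  have F0: "F x = 0" if "x \<le> 0" for x by (rule AC2_zero[OF AC]) (use that in \<open>auto simp: \<phi>_def\<close>)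
  have F1: "F x = f x - f 0" if x: "x \<in> {0..l}" for x
  proof -
    have "F x = (LBINT y:{0..x}. f' y)"
      unfolding F_def set_LINT_def
    proof (rule integral_cong_AE)
      show "AE y in lborel. indicator {..x} y *\<^sub>R \<phi> y = indicator {0..x} y *\<^sub>R f' y"
        using AE_lborel_singleton[of 0] by eventually_elim (use x in \<open>auto simp: \<phi>_def indicator_def\<close>)
    qed (use m in measurable)
    thus ?thesis using prim_D(3)[OF pr x] by simp
  qed
  have F2: "F x = f l - f 0" if x: "x \<ge> l" for x
  proof -
    have "F x = F l" unfolding F_def set_LINT_def
      by (rule LINT_cong) (use x in \<open>auto simp: \<phi>_def indicator_def\<close>)
    thus ?thesis using F1[of l] l by simp
  qed
  show ?thesis by (rule that[OF AC _ n F0 F1 F2]) (auto simp: \<phi>_def)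
qed

text \<open>The factor of \<open>edge_sol_gours\<close> for M = 1; the additional 1 covers
  travelling waves, whose bound is K itself.\<close>

definition gconst :: "real \<Rightarrow> real \<Rightarrow> real \<Rightarrow> real" where
  "gconst l S R = 1 + (1 + l + S) * (R * R + 2 * R)\<^sup>2"

lemma gconst_bounds:
  assumes "l \<ge> 0" "S \<ge> 0" "M\<^sup>2 \<le> K" "K \<ge> 0"
  shows "(1 + l + S) * (M * (R * R + 2 * R))\<^sup>2 \<le> gconst l S R * K" "K \<le> gconst l S R * K" "gconst l S R \<ge> 1"
proof -
  have g: "0 \<le> (1 + l + S) * (R * R + 2 * R)\<^sup>2" using assms by simp
  have "(1 + l + S) * (M * (R * R + 2 * R))\<^sup>2 = (1 + l + S) * (R * R + 2 * R)\<^sup>2 * M\<^sup>2" by (simp add: power_mult_distrib)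
  also have "\<dots> \<le> (1 + l + S) * (R * R + 2 * R)\<^sup>2 * K" by (rule mult_left_mono[OF assms(3) g])
  also have "\<dots> \<le> gconst l S R * K" using assms(4) by (simp add: gconst_def algebra_simps)
  finally show "(1 + l + S) * (M * (R * R + 2 * R))\<^sup>2 \<le> gconst l S R * K" .
  show "gconst l S R \<ge> 1" using g by (simp add: gconst_def)
  thus "K \<le> gconst l S R * K" using mult_right_mono[of 1 "gconst l S R" K] assms(4) by simp
qed

lemma edge_sol_combine:
  assumes 1: "edge_sol l S K h u ux ut" and 2: "edge_sol l S K h' u' ux' ut'" and l: "l \<ge> 0" and S: "S \<ge> 0"
  obtains h'' v vx vt where "edge_sol l S (2 * (c\<^sup>2 * K) + 2 * (d\<^sup>2 * K)) h'' v vx vt" "\<And>z. h'' z = c * h z + d * h' z" "\<And>z. v z = c * u z + d * u' z"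
    "\<And>z. vx z = c * ux z + d * ux' z" "\<And>z. vt z = c * ut z + d * ut' z"
  by (rule that[OF edge_sol_add[OF edge_sol_scale[OF 1, of c] edge_sol_scale[OF 2, of d] l S]]) auto

text \<open>The length L is a common upper bound, so that both edges of a string receive the same
  constant.\<close>

lemma AC2_le_edge_sol:
  assumes A: "AC2_le K A a" and \<sigma>: "\<sigma> = 1 \<or> \<sigma> = -1" and z: "\<And>x s. x \<in> {0..l} \<Longrightarrow> s \<le> - S \<Longrightarrow> a (s + \<sigma> * x + c) = 0"
    and l: "0 \<le> l" "l \<le> L" "0 \<le> S"
  shows "edge_sol l S (gconst L S R * K) (\<lambda>_. 0) (\<lambda>(x, s). A (s + \<sigma> * x + c)) (\<lambda>(x, s). \<sigma> * a (s + \<sigma> * x + c)) (\<lambda>(x, s). a (s + \<sigma> * x + c))"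
proof (rule edge_sol_mono[OF edge_sol_wave[OF AC2_leD(1)[OF A] \<sigma> AC2_leD(2,3)[OF A] z l(1)]])
  show "K \<le> gconst L S R * K" by (rule gconst_bounds(2)[of L S 0]) (use l AC2_leD(4)[OF A] in auto)
qed auto

lemma pc_le_edge_sol:
  assumes H: "pc_le R K H" and l: "0 \<le> l" "l \<le> L" "0 \<le> S" and supp: "\<And>x. x \<in> {0..l} \<Longrightarrow> c - x \<le> S \<or> x + d \<le> S"
  shows "edge_sol l S (gconst L S R * K) (\<lambda>(x, s). 4 * H (s - x + c, s + x + d)) (\<lambda>(x, s). gours H (s - x + c) (s + x + d))
      (\<lambda>(x, s). - row H (s - x + c) (s + x + d) + row (flip H) (s + x + d) (s - x + c))
      (\<lambda>(x, s). row H (s - x + c) (s + x + d) + row (flip H) (s + x + d) (s - x + c))" (is ?A)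
    and "edge_sol l S (gconst L S R * K) (\<lambda>(x, s). 4 * H (s + x + d, s - x + c)) (\<lambda>(x, s). gours H (s + x + d) (s - x + c))
      (\<lambda>(x, s). row H (s + x + d) (s - x + c) - row (flip H) (s - x + c) (s + x + d))
      (\<lambda>(x, s). row H (s + x + d) (s - x + c) + row (flip H) (s - x + c) (s + x + d))" (is ?B)
proof -
  obtain M N where M: "pc R M N H" "M\<^sup>2 \<le> K" using H by (auto simp: pc_le_def)
  have "(1 + l + S) * (M * (R * R + 2 * R))\<^sup>2 \<le> (1 + L + S) * (M * (R * R + 2 * R))\<^sup>2" using l by (intro mult_right_mono) auto
  also have "\<dots> \<le> gconst L S R * K" by (rule gconst_bounds(1)) (use l M pc_leD(2)[OF H] in auto)
  finally have K: "(1 + l + S) * (M * (R * R + 2 * R))\<^sup>2 \<le> gconst L S R * K" .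
  show ?A by (rule edge_sol_mono[OF edge_sol_gours[OF M(1) l(1,3) supp] K])
  show ?B by (rule edge_sol_mono[OF edge_sol_gours'[OF M(1) l(1,3) supp] K])
qed

text \<open>The summand with \<open>gconst\<close> is the cost of adding the wave and the Goursat
  part on the edge, the remaining ones the cost of their traces in g.\<close>

definition edge2_const :: "real \<Rightarrow> real \<Rightarrow> real \<Rightarrow> real" where
  "edge2_const M l S = (4 * gconst l S (2 * (1 + l)) + 2 + 2 * trace_const 0 (2 * (1 + l))) * picard_const M l"

text \<open>The solution of \<open>picard\<close> for the state read from the far end, \<Psi>(z) =
  \<phi>(l - z). It vanishes for a \<le> 0, which gives both rest before - l and the Dirichlet
  condition at v2.\<close>

lemma edge2_solution:
  assumes l: "l > 0" and S: "S \<ge> l" and r: "potential l M N r"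
    and p: "prim2 l \<phi> \<phi>'" and \<phi>l: "\<phi> l = 0" and K: "(LBINT x:{0..l}. (\<phi>' x)\<^sup>2) \<le> K"
  obtains h u ux ut g \<gamma> where "edge_sol l S (edge2_const M l S * K) h u ux ut" "\<And>x. x \<in> {0..l} \<Longrightarrow> u (x, 0) = \<phi> x"
    "\<And>s. s \<le> 0 \<Longrightarrow> u (l, s) = 0" "\<And>x s. x \<in> {0..l} \<Longrightarrow> s \<le> 0 \<Longrightarrow> h (x, s) = - (r x * u (x, s))"
    "AC2_le (edge2_const M l S * K) g \<gamma>" "\<And>z. z \<le> - l \<Longrightarrow> \<gamma> z = 0" "\<And>s. u (0, s) = g s"
proof -
  define R where "R = 2 * (1 + l)"
  define C1 where "C1 = picard_const M l * K"
  have S0: "S \<ge> 0" and l0: "l \<ge> 0" using S l by auto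
  obtain \<Psi> \<psi> where \<Psi>: "AC2 \<Psi> \<psi>" "\<And>z. z \<notin> {0<..l} \<Longrightarrow> \<psi> z = 0"
    "(LBINT z. (\<psi> z)\<^sup>2) = (LBINT x:{0..l}. (- \<phi>' (l - x))\<^sup>2)" "\<And>x. x \<in> {0..l} \<Longrightarrow> \<Psi> x = \<phi> (l - x) - \<phi> (l - 0)"
    by (rule prim2_AC2[OF prim2_reflect(1)[OF p l0] l0], rule that, assumption, blast, assumption, blast)
  have \<psi>K: "(LBINT z. (\<psi> z)\<^sup>2) \<le> K" using \<Psi>(3) prim2_reflect(2)[OF p l0] K by simp
  obtain A a H where A: "AC2_le C1 A a" "\<And>z. z \<le> 0 \<Longrightarrow> a z = 0" and H: "pc_le R C1 H"
    and fin: "\<And>x. x \<in> {0..l} \<Longrightarrow> A (l - x) - gours H (l - x) (l + x) = \<Psi> (l - x)"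
    and eq: "\<And>x s. x \<in> {0..l} \<Longrightarrow> s \<le> 0 \<Longrightarrow> H (s - x + l, s + x + l) = r x / 4 * (A (s - x + l) - gours H (s - x + l) (s + x + l))"
    unfolding R_def C1_def by (rule picard[OF l r \<Psi>(1,2) \<psi>K]) (assumption | blast)+
  have w: "edge_sol l S (gconst l S R * C1) (\<lambda>_. 0) (\<lambda>(x, s). A (s + - 1 * x + l)) (\<lambda>(x, s). - 1 * a (s + - 1 * x + l)) (\<lambda>(x, s). a (s + - 1 * x + l))"
    by (rule AC2_le_edge_sol[OF A(1)]) (use S l in \<open>auto intro!: A(2)\<close>)
  have gg: "edge_sol l S (gconst l S R * C1) (\<lambda>(x, s). 4 * H (s - x + l, s + x + l)) (\<lambda>(x, s). gours H (s - x + l) (s + x + l))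
     (\<lambda>(x, s). - row H (s - x + l) (s + x + l) + row (flip H) (s + x + l) (s - x + l))
     (\<lambda>(x, s). row H (s - x + l) (s + x + l) + row (flip H) (s + x + l) (s - x + l))"
    by (rule pc_le_edge_sol(1)[OF H]) (use S l in auto)
  obtain h u ux ut where u: "edge_sol l S (2 * (1\<^sup>2 * (gconst l S R * C1)) + 2 * ((- 1)\<^sup>2 * (gconst l S R * C1))) h u ux ut"
    "\<And>x s. h (x, s) = - 4 * H (s - x + l, s + x + l)" "\<And>x s. u (x, s) = A (s - x + l) - gours H (s - x + l) (s + x + l)"
    by (rule edge_sol_combine[OF w gg l0 S0, of 1 "- 1"]) auto
  \<comment> \<open>At x = 0 both characteristic coordinates equal s + l, so g is a trace on the
    diagonal.\<close>
  have G: "AC2_le (trace_const 0 R * C1) (\<lambda>a. gours H a (0 + 1 * a)) (\<lambda>a. row H a (0 + 1 * a) + 1 * row (flip H) (0 + 1 * a) a)"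
    and t0: "trace_const 0 R \<ge> 0" using gours_trace_le(1)[OF H, of 1 0] gours_trace_le(2)[OF H, of 1 0] by simp_all
  have g: "AC2_le (2 * C1 + 2 * (trace_const 0 R * C1)) (\<lambda>s. A (s + l) + - 1 * gours H (s + l) (0 + 1 * (s + l)))
     (\<lambda>s. a (s + l) + - 1 * (row H (s + l) (0 + 1 * (s + l)) + 1 * row (flip H) (0 + 1 * (s + l)) (s + l)))"
    by (rule AC2_le_combine[OF AC2_le_shift[OF A(1)] AC2_le_shift[OF G]]) simp
  have CK: "edge2_const M l S * K = 4 * (gconst l S R * C1) + 2 * C1 + 2 * (trace_const 0 R * C1)"
    by (simp add: edge2_const_def C1_def R_def algebra_simps)
  have nn: "0 \<le> gconst l S R * C1" "0 \<le> trace_const 0 R * C1" "0 \<le> C1"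
    using AC2_leD(4)[OF A(1)] t0 gconst_bounds(3)[OF l0 S0, of 0 0 R] by auto
  show ?thesis
  proof (rule that)
    show "edge_sol l S (edge2_const M l S * K) h u ux ut" by (rule edge_sol_mono[OF u(1)]) (use CK nn in simp)
    show "u (x, 0) = \<phi> x" if "x \<in> {0..l}" for x
      using fin[OF that] \<Psi>(4)[of "l - x"] that \<phi>l by (simp add: u(3) add.commute)
    show "u (l, s) = 0" if "s \<le> 0" for s
      using AC2_zero[OF AC2_leD(1)[OF A(1)], of s] A(2) gours_zero[OF pc_leD(1)[OF H], of s] that by (simp add: u(3))
    show "h (x, s) = - (r x * u (x, s))" if "x \<in> {0..l}" "s \<le> 0" for x s
      unfolding u(2,3) eq[OF that] by simp
    show "AC2_le (edge2_const M l S * K) (\<lambda>s. A (s + l) + - 1 * gours H (s + l) (0 + 1 * (s + l)))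
      (\<lambda>s. a (s + l) + - 1 * (row H (s + l) (0 + 1 * (s + l)) + 1 * row (flip H) (0 + 1 * (s + l)) (s + l)))"
      by (rule AC2_leD(5)[OF g]) (use CK nn in linarith)
    show "a (z + l) + - 1 * (row H (z + l) (0 + 1 * (z + l)) + 1 * row (flip H) (0 + 1 * (z + l)) (z + l)) = 0" if "z \<le> - l" for z
      using A(2) pc_leD(4,5)[OF H] that by simp
    show "u (0, s) = A (s + l) + - 1 * gours H (s + l) (0 + 1 * (s + l))" for s by (simp add: u(3))
  qed
qed

text \<open>The edges 1 and 3 form the string \<open>[0, l1 + l3]\<close>, with \<open>y = l1 - x\<close> on edge 1 and \<open>y = l1 + x\<close>
  on edge 3, where the sign of \<open>u\<close> is reversed: then \<open>u1 + u3 = 0\<close> and \<open>ux1 = ux3\<close> at the centre say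
  that nothing happens at \<open>y = l1\<close>, and \<open>u1 + u3 = - g\<close> prescribes a jump there.\<close>

definition string_pair where
  "string_pair l1 l3 S K r g h u ux ut h' u' ux' ut' \<longleftrightarrow> edge_sol l1 S K h u ux ut \<and> edge_sol l3 S K h' u' ux' ut' \<and>
     (\<forall>s\<le>0. u' (l3, s) = 0 \<and> u (0, s) + u' (0, s) = - (g s :: real) \<and> ux (0, s) = ux' (0, s)) \<and>
     (\<forall>x\<in>{0<..<l1}. \<forall>s\<le>0. h (x, s) = - (r (l1 - x) * u (x, s))) \<and> (\<forall>x\<in>{0<..<l3}. \<forall>s\<le>0. h' (x, s) = - (r (l1 + x) * u' (x, s)))"

lemma string_pair_add:
  assumes "string_pair l1 l3 S K r g h u ux ut h' u' ux' ut'" "string_pair l1 l3 S J r f k v vx vt k' v' vx' vt'" "l1 \<ge> 0" "l3 \<ge> 0" "S \<ge> 0"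
  shows "string_pair l1 l3 S (2 * K + 2 * J) r (\<lambda>s. g s + f s) (\<lambda>z. h z + k z) (\<lambda>z. u z + v z) (\<lambda>z. ux z + vx z) (\<lambda>z. ut z + vt z)
    (\<lambda>z. h' z + k' z) (\<lambda>z. u' z + v' z) (\<lambda>z. ux' z + vx' z) (\<lambda>z. ut' z + vt' z)"
  unfolding string_pair_def
proof (intro conjI)
  have 1: "edge_sol l1 S K h u ux ut" "edge_sol l3 S K h' u' ux' ut'" "edge_sol l1 S J k v vx vt" "edge_sol l3 S J k' v' vx' vt'"
    using assms(1,2) by (auto simp: string_pair_def)
  show "edge_sol l1 S (2 * K + 2 * J) (\<lambda>z. h z + k z) (\<lambda>z. u z + v z) (\<lambda>z. ux z + vx z) (\<lambda>z. ut z + vt z)"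
    "edge_sol l3 S (2 * K + 2 * J) (\<lambda>z. h' z + k' z) (\<lambda>z. u' z + v' z) (\<lambda>z. ux' z + vx' z) (\<lambda>z. ut' z + vt' z)"
    by (rule edge_sol_add[OF 1(1,3) assms(3,5)], rule edge_sol_add[OF 1(2,4) assms(4,5)])
  have "u (0, s) + v (0, s) + (u' (0, s) + v' (0, s)) = - (g s + f s)" if "s \<le> 0" for s
  proof -
    have "u (0, s) + u' (0, s) = - g s" "v (0, s) + v' (0, s) = - f s" using assms(1,2) that by (auto simp: string_pair_def)
    thus ?thesis by linarith
  qed
  thus "\<forall>s\<le>0. u' (l3, s) + v' (l3, s) = 0 \<and> u (0, s) + v (0, s) + (u' (0, s) + v' (0, s)) = - (g s + f s) \<and>
      ux (0, s) + vx (0, s) = ux' (0, s) + vx' (0, s)" using assms(1,2) by (auto simp: string_pair_def)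
qed (use assms(1,2) in \<open>auto simp: string_pair_def algebra_simps\<close>)

definition smooth_const :: "real \<Rightarrow> real \<Rightarrow> real \<Rightarrow> real" where
  "smooth_const M L S = 4 * (gconst L S (2 * (1 + L)) * picard_const M L)"

text \<open>The correcting wave: \<open>picard\<close> on the string of length l1 + l3 with its
  entrance y = 0 at v1 and its far end at v3. Continuity of u and u_y at y = l1 becomes the pair of
  homogeneous conditions at v0, the sign reversal compensating the opposite orientation of edge
  1.\<close>

lemma string_smooth_solution:
  assumes l: "l1 > 0" "l3 > 0" and S: "S \<ge> l1 + l3" and r: "potential (l1 + l3) M N r"
    and \<Psi>: "AC2 \<Psi> \<psi>" "\<And>z. z \<notin> {0<..l1 + l3} \<Longrightarrow> \<psi> z = 0" "(LBINT z. (\<psi> z)\<^sup>2) \<le> K"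
  obtains h u ux ut h' u' ux' ut' where "string_pair l1 l3 S (smooth_const M (l1 + l3) S * K) r (\<lambda>_. 0) h u ux ut h' u' ux' ut'"
    "\<And>x. x \<in> {0..l1} \<Longrightarrow> u (x, 0) = \<Psi> (x + l3)" "\<And>x. x \<in> {0..l3} \<Longrightarrow> u' (x, 0) = - \<Psi> (l3 - x)"
proof -
  define L where "L = l1 + l3"
  define R where "R = 2 * (1 + L)"
  define C1 where "C1 = picard_const M L * K"
  have S0: "S \<ge> 0" and l0: "l1 \<ge> 0" "l3 \<ge> 0" and L: "L > 0" using S l by (auto simp: L_def)
  \<comment> \<open>The second characteristic coordinate s + y + L at y = l1 and s = 0.\<close>
  define d where "d = L + l1"
  obtain A a H where A: "AC2_le C1 A a" "\<And>z. z \<le> 0 \<Longrightarrow> a z = 0" and H: "pc_le R C1 H"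
    and fin: "\<And>x. x \<in> {0..L} \<Longrightarrow> A (L - x) - gours H (L - x) (L + x) = \<Psi> (L - x)"
    and eq: "\<And>x s. x \<in> {0..L} \<Longrightarrow> s \<le> 0 \<Longrightarrow> H (s - x + L, s + x + L) = r x / 4 * (A (s - x + L) - gours H (s - x + L) (s + x + L))"
    unfolding R_def C1_def by (rule picard[OF L r[folded L_def] \<Psi>[folded L_def]]) (assumption | blast)+
  note B = pc_leD(1)[OF H]
  define \<kappa> where "\<kappa> = gconst L S R * C1"
  have CK: "smooth_const M L S * K = 2 * (1\<^sup>2 * \<kappa>) + 2 * ((- 1)\<^sup>2 * \<kappa>)" by (simp add: smooth_const_def \<kappa>_def C1_def R_def)
  have w1: "edge_sol l1 S \<kappa> (\<lambda>_. 0) (\<lambda>(x, s). A (s + 1 * x + l3)) (\<lambda>(x, s). 1 * a (s + 1 * x + l3)) (\<lambda>(x, s). a (s + 1 * x + l3))"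
    unfolding \<kappa>_def by (rule AC2_le_edge_sol[OF A(1)]) (use S l in \<open>auto simp: L_def intro!: A(2)\<close>)
  have w3: "edge_sol l3 S \<kappa> (\<lambda>_. 0) (\<lambda>(x, s). A (s + - 1 * x + l3)) (\<lambda>(x, s). - 1 * a (s + - 1 * x + l3)) (\<lambda>(x, s). a (s + - 1 * x + l3))"
    unfolding \<kappa>_def by (rule AC2_le_edge_sol[OF A(1)]) (use S l in \<open>auto simp: L_def intro!: A(2)\<close>)
  have g1: "edge_sol l1 S \<kappa> (\<lambda>(x, s). 4 * H (s + x + l3, s - x + d)) (\<lambda>(x, s). gours H (s + x + l3) (s - x + d))
     (\<lambda>(x, s). row H (s + x + l3) (s - x + d) - row (flip H) (s - x + d) (s + x + l3))
     (\<lambda>(x, s). row H (s + x + l3) (s - x + d) + row (flip H) (s - x + d) (s + x + l3))"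
    unfolding \<kappa>_def by (rule pc_le_edge_sol(2)[OF H]) (use S l in \<open>auto simp: L_def\<close>)
  have g3: "edge_sol l3 S \<kappa> (\<lambda>(x, s). 4 * H (s - x + l3, s + x + d)) (\<lambda>(x, s). gours H (s - x + l3) (s + x + d))
     (\<lambda>(x, s). - row H (s - x + l3) (s + x + d) + row (flip H) (s + x + d) (s - x + l3))
     (\<lambda>(x, s). row H (s - x + l3) (s + x + d) + row (flip H) (s + x + d) (s - x + l3))"
    unfolding \<kappa>_def by (rule pc_le_edge_sol(1)[OF H]) (use S l in \<open>auto simp: L_def\<close>)
  obtain h u ux ut where u: "edge_sol l1 S (smooth_const M L S * K) h u ux ut"
    "\<And>x s. h (x, s) = - 4 * H (s + x + l3, s - x + d)" "\<And>x s. u (x, s) = A (s + x + l3) - gours H (s + x + l3) (s - x + d)"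
    "\<And>s. ux (0, s) = a (s + l3) - row H (s + l3) (s + d) + row (flip H) (s + d) (s + l3)"
    by (rule edge_sol_combine[OF w1 g1 l0(1) S0, of 1 "- 1", folded CK]) auto
  obtain h' u' ux' ut' where u': "edge_sol l3 S (2 * ((- 1)\<^sup>2 * \<kappa>) + 2 * (1\<^sup>2 * \<kappa>)) h' u' ux' ut'"
    "\<And>x s. h' (x, s) = 4 * H (s - x + l3, s + x + d)" "\<And>x s. u' (x, s) = - A (s - x + l3) + gours H (s - x + l3) (s + x + d)"
    "\<And>s. ux' (0, s) = a (s + l3) - row H (s + l3) (s + d) + row (flip H) (s + d) (s + l3)"
    by (rule edge_sol_combine[OF w3 g3 l0(2) S0, of "- 1" 1]) auto
  have u'1: "edge_sol l3 S (smooth_const M L S * K) h' u' ux' ut'" by (rule edge_sol_mono[OF u'(1)]) (simp add: CK)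
  have eq1: "H (s + x + l3, s - x + d) = r (l1 - x) / 4 * (A (s + x + l3) - gours H (s + x + l3) (s - x + d))" if "x \<in> {0..l1}" "s \<le> 0" for x s
  proof -
    have e: "s - (l1 - x) + L = s + x + l3" "s + (l1 - x) + L = s - x + d" by (simp_all add: d_def L_def)
    show ?thesis by (rule eq[of "l1 - x" s, unfolded e]) (use that l in \<open>auto simp: L_def\<close>)
  qed
  have eq3: "H (s - x + l3, s + x + d) = r (l1 + x) / 4 * (A (s - x + l3) - gours H (s - x + l3) (s + x + d))" if "x \<in> {0..l3}" "s \<le> 0" for x s
  proof -
    have e: "s - (l1 + x) + L = s - x + l3" "s + (l1 + x) + L = s + x + d" by (simp_all add: d_def L_def)
    show ?thesis by (rule eq[of "l1 + x" s, unfolded e]) (use that l in \<open>auto simp: L_def\<close>)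
  qed
  have fin1: "u (x, 0) = \<Psi> (x + l3)" if "x \<in> {0..l1}" for x
  proof -
    have e: "L - (l1 - x) = x + l3" "L + (l1 - x) = d - x" by (simp_all add: d_def L_def)
    show ?thesis using fin[of "l1 - x", unfolded e] that l by (simp add: u(3) L_def)
  qed
  have fin3: "u' (x, 0) = - \<Psi> (l3 - x)" if "x \<in> {0..l3}" for x
  proof -
    have e: "L - (l1 + x) = l3 - x" "L + (l1 + x) = x + d" by (simp_all add: d_def L_def)
    show ?thesis using fin[of "l1 + x", unfolded e] that l by (simp add: u'(3) L_def)
  qed
  have "string_pair l1 l3 S (smooth_const M L S * K) r (\<lambda>_. 0) h u ux ut h' u' ux' ut'" unfolding string_pair_def
  proof (intro conjI allI ballI impI)
    show "u' (l3, s) = 0" if "s \<le> 0" for s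
      using AC2_zero[OF AC2_leD(1)[OF A(1)], of s] A(2) gours_zero[OF B, of s] that by (simp add: u'(3))
    show "h (x, s) = - (r (l1 - x) * u (x, s))" if "x \<in> {0<..<l1}" "s \<le> 0" for x s
      using eq1[of x s] that by (simp add: u(2,3))
    show "h' (x, s) = - (r (l1 + x) * u' (x, s))" if "x \<in> {0<..<l3}" "s \<le> 0" for x s
      using eq3[of x s] that by (simp add: u'(2,3) algebra_simps)
  qed (use u(1) u'1 in \<open>simp_all add: u(3,4) u'(3,4)\<close>)
  thus ?thesis using fin1 fin3 by (intro that) (simp_all add: L_def)
qed

text \<open>Adding the free part, with bound \<kappa>, to the part due to the potential, with bound
  4 \<kappa>, costs 10 \<kappa> in the proof below; 32 is a convenient upper bound.\<close>

definition jump_string_const :: "real \<Rightarrow> real \<Rightarrow> real \<Rightarrow> real \<Rightarrow> real \<Rightarrow> real" where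
  "jump_string_const M l1 l2 l3 S = 32 * (gconst (l1 + l3) S (2 * (1 + l2)) * jump_const M l2 l3)"

text \<open>At y = l1 the solution is - g / 2 from the left and g / 2 from the right, up to terms
  continuous there. After the sign reversal on edge 3 the two traces at v0 add up to - g, while the
  derivatives agree because both outgoing halves have the same slope.\<close>

lemma string_jump_solution:
  assumes l: "l1 > 0" "l2 > 0" "l3 > 0" and S: "S \<ge> l2" and r: "potential (l1 + l3) M N r" and N: "l1 \<in> N"
    and g: "AC2_le K g \<gamma>" "\<And>z. z \<le> - l2 \<Longrightarrow> \<gamma> z = 0"
  obtains h u ux ut h' u' ux' ut' where "string_pair l1 l3 S (jump_string_const M l1 l2 l3 S * K) r g h u ux ut h' u' ux' ut'"
proof -
  define R where "R = 2 * (1 + l2)"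
  define C1 where "C1 = jump_const M l2 l3 * K"
  have S0: "S \<ge> 0" and l0: "l1 \<ge> 0" "l3 \<ge> 0" using S l by auto
  obtain B b H where B: "AC2_le C1 B b" "\<And>z. z \<le> 2 * l3 \<Longrightarrow> b z = 0" and H: "pc_le R C1 H"
    and Be: "\<And>a. B a = gours H a (a - 2 * l3)" and KC: "K \<le> C1"
    and eq: "\<And>y s. y \<in> {0..l1 + l3} \<Longrightarrow> s \<le> 0 \<Longrightarrow> H (s + l2 + y - l1, s + l2 - y + l1) = r y / 4 *
       (jump_free g l2 l3 (s + l2 + y - l1) (s + l2 - y + l1) + B (s + l2 + y - l1) - gours H (s + l2 + y - l1) (s + l2 - y + l1))"
    unfolding R_def C1_def by (rule jump_wave[OF l r N g]) (assumption | blast)+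
  define \<kappa> where "\<kappa> = gconst (l1 + l3) S R * C1"
  have CK: "jump_string_const M l1 l2 l3 S * K = 32 * \<kappa>" by (simp add: jump_string_const_def \<kappa>_def C1_def R_def)
  have \<kappa>n: "\<kappa> \<ge> 0" using gconst_bounds(3)[of "l1 + l3" S 0 0 R] AC2_leD(4)[OF B(1)] l0 S0 by (auto simp: \<kappa>_def)
  note gC = AC2_leD(5)[OF g(1) KC]
  have \<gamma>0: "\<gamma> z = 0" if "z \<le> - S" for z using g(2) S that by auto
  have w1: "edge_sol l1 S \<kappa> (\<lambda>_. 0) (\<lambda>(x, s). g (s + - 1 * x + 0)) (\<lambda>(x, s). - 1 * \<gamma> (s + - 1 * x + 0)) (\<lambda>(x, s). \<gamma> (s + - 1 * x + 0))"
    unfolding \<kappa>_def by (rule AC2_le_edge_sol[OF gC]) (use S l in \<open>auto intro!: \<gamma>0\<close>)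
  have w1': "edge_sol l1 S \<kappa> (\<lambda>_. 0) (\<lambda>(x, s). g (s + - 1 * x + - 2 * l3)) (\<lambda>(x, s). - 1 * \<gamma> (s + - 1 * x + - 2 * l3)) (\<lambda>(x, s). \<gamma> (s + - 1 * x + - 2 * l3))"
    unfolding \<kappa>_def by (rule AC2_le_edge_sol[OF gC]) (use S l in \<open>auto intro!: \<gamma>0\<close>)
  have w1'': "edge_sol l1 S \<kappa> (\<lambda>_. 0) (\<lambda>(x, s). B (s + - 1 * x + l2)) (\<lambda>(x, s). - 1 * b (s + - 1 * x + l2)) (\<lambda>(x, s). b (s + - 1 * x + l2))"
    unfolding \<kappa>_def by (rule AC2_le_edge_sol[OF B(1)]) (use S l in \<open>auto intro!: B(2)\<close>)
  have w3: "edge_sol l3 S \<kappa> (\<lambda>_. 0) (\<lambda>(x, s). g (s + - 1 * x + 0)) (\<lambda>(x, s). - 1 * \<gamma> (s + - 1 * x + 0)) (\<lambda>(x, s). \<gamma> (s + - 1 * x + 0))"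
    unfolding \<kappa>_def by (rule AC2_le_edge_sol[OF gC]) (use S l in \<open>auto intro!: \<gamma>0\<close>)
  have w3': "edge_sol l3 S \<kappa> (\<lambda>_. 0) (\<lambda>(x, s). g (s + 1 * x + - 2 * l3)) (\<lambda>(x, s). 1 * \<gamma> (s + 1 * x + - 2 * l3)) (\<lambda>(x, s). \<gamma> (s + 1 * x + - 2 * l3))"
    unfolding \<kappa>_def by (rule AC2_le_edge_sol[OF gC]) (use S l in \<open>auto intro!: \<gamma>0\<close>)
  have w3'': "edge_sol l3 S \<kappa> (\<lambda>_. 0) (\<lambda>(x, s). B (s + 1 * x + l2)) (\<lambda>(x, s). 1 * b (s + 1 * x + l2)) (\<lambda>(x, s). b (s + 1 * x + l2))"
    unfolding \<kappa>_def by (rule AC2_le_edge_sol[OF B(1)]) (use S l in \<open>auto intro!: B(2)\<close>)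
  have g1: "edge_sol l1 S \<kappa> (\<lambda>(x, s). 4 * H (s - x + l2, s + x + l2)) (\<lambda>(x, s). gours H (s - x + l2) (s + x + l2))
     (\<lambda>(x, s). - row H (s - x + l2) (s + x + l2) + row (flip H) (s + x + l2) (s - x + l2))
     (\<lambda>(x, s). row H (s - x + l2) (s + x + l2) + row (flip H) (s + x + l2) (s - x + l2))"
    unfolding \<kappa>_def by (rule pc_le_edge_sol(1)[OF H]) (use S l in auto)
  have g3: "edge_sol l3 S \<kappa> (\<lambda>(x, s). 4 * H (s + x + l2, s - x + l2)) (\<lambda>(x, s). gours H (s + x + l2) (s - x + l2))
     (\<lambda>(x, s). row H (s + x + l2) (s - x + l2) - row (flip H) (s - x + l2) (s + x + l2))
     (\<lambda>(x, s). row H (s + x + l2) (s - x + l2) + row (flip H) (s - x + l2) (s + x + l2))"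
    unfolding \<kappa>_def by (rule pc_le_edge_sol(2)[OF H]) (use S l in auto)
  \<comment> \<open>The free waves (a on edge 1, c on edge 3) and the parts due to the potential (b
    and d) are combined separately; the coefficients 1/2 keep the bound of the free parts at
    \<kappa>.\<close>
  obtain ha ua uxa uta where a: "edge_sol l1 S \<kappa> ha ua uxa uta"
    "\<And>x s. ha (x, s) = 0" "\<And>x s. ua (x, s) = - (1/2) * g (s - x) - (1/2) * g (s - x - 2 * l3)"
    "\<And>s. uxa (0, s) = (1/2) * \<gamma> s + (1/2) * \<gamma> (s - 2 * l3)"
    by (rule edge_sol_combine[OF w1 w1' l0(1) S0, of "- (1/2)" "- (1/2)"]) (simp add: power2_eq_square)
  obtain hb ub uxb utb where b: "edge_sol l1 S (4 * \<kappa>) hb ub uxb utb"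
    "\<And>x s. hb (x, s) = - 4 * H (s - x + l2, s + x + l2)" "\<And>x s. ub (x, s) = B (s - x + l2) - gours H (s - x + l2) (s + x + l2)"
    "\<And>s. uxb (0, s) = - b (s + l2) + row H (s + l2) (s + l2) - row (flip H) (s + l2) (s + l2)"
    by (rule edge_sol_combine[OF w1'' g1 l0(1) S0, of 1 "- 1"]) simp
  obtain hc uc uxc utc where c: "edge_sol l3 S \<kappa> hc uc uxc utc"
    "\<And>x s. hc (x, s) = 0" "\<And>x s. uc (x, s) = - (1/2) * g (s - x) + (1/2) * g (s + x - 2 * l3)"
    "\<And>s. uxc (0, s) = (1/2) * \<gamma> s + (1/2) * \<gamma> (s - 2 * l3)"
    by (rule edge_sol_combine[OF w3 w3' l0(2) S0, of "- (1/2)" "1/2"]) (simp add: power2_eq_square)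
  obtain hd ud uxd utd where d: "edge_sol l3 S (4 * \<kappa>) hd ud uxd utd"
    "\<And>x s. hd (x, s) = 4 * H (s + x + l2, s - x + l2)" "\<And>x s. ud (x, s) = - B (s + x + l2) + gours H (s + x + l2) (s - x + l2)"
    "\<And>s. uxd (0, s) = - b (s + l2) + row H (s + l2) (s + l2) - row (flip H) (s + l2) (s + l2)"
    by (rule edge_sol_combine[OF w3'' g3 l0(2) S0, of "- 1" 1]) simp
  define U where "U = (\<lambda>z. ua z + ub z)"
  define V where "V = (\<lambda>z. uc z + ud z)"
  have E1: "edge_sol l1 S (jump_string_const M l1 l2 l3 S * K) (\<lambda>z. ha z + hb z) U (\<lambda>z. uxa z + uxb z) (\<lambda>z. uta z + utb z)" unfolding U_def
    by (rule edge_sol_mono[OF edge_sol_add[OF a(1) b(1) l0(1) S0]]) (use \<kappa>n CK in simp)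
  have E3: "edge_sol l3 S (jump_string_const M l1 l2 l3 S * K) (\<lambda>z. hc z + hd z) V (\<lambda>z. uxc z + uxd z) (\<lambda>z. utc z + utd z)" unfolding V_def
    by (rule edge_sol_mono[OF edge_sol_add[OF c(1) d(1) l0(2) S0]]) (use \<kappa>n CK in simp)
  have U: "U (x, s) = - (1/2) * g (s - x) - (1/2) * g (s - x - 2 * l3) + B (s - x + l2) - gours H (s - x + l2) (s + x + l2)" for x s
    by (simp add: U_def a b)
  have V: "V (x, s) = - (1/2) * g (s - x) + (1/2) * g (s + x - 2 * l3) - B (s + x + l2) + gours H (s + x + l2) (s - x + l2)" for x s
    by (simp add: V_def c d)
  have eq1: "4 * H (s - x + l2, s + x + l2) = r (l1 - x) * U (x, s)" if "x \<in> {0..l1}" "s \<le> 0" for x s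
  proof -
    have e: "s + l2 + (l1 - x) - l1 = s - x + l2" "s + l2 - (l1 - x) + l1 = s + x + l2" by simp_all
    have j: "jump_free g l2 l3 (s - x + l2) (s + x + l2) = - (1/2) * g (s - x) - (1/2) * g (s - x - 2 * l3)"
      using that by (simp add: jump_free_def algebra_simps)
    have "H (s - x + l2, s + x + l2) = r (l1 - x) / 4 *
        (jump_free g l2 l3 (s - x + l2) (s + x + l2) + B (s - x + l2) - gours H (s - x + l2) (s + x + l2))"
      by (rule eq[of "l1 - x" s, unfolded e]) (use that l in auto)
    thus ?thesis unfolding j U by (simp add: field_simps)
  qed
  \<comment> \<open>The open end matters: at x = 0 the two coordinates coincide and
    \<open>jump_free\<close> takes its left value.\<close>
  have eq3: "4 * H (s + x + l2, s - x + l2) = - (r (l1 + x) * V (x, s))" if "x \<in> {0<..l3}" "s \<le> 0" for x s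
  proof -
    have e: "s + l2 + (l1 + x) - l1 = s + x + l2" "s + l2 - (l1 + x) + l1 = s - x + l2" by simp_all
    have j: "jump_free g l2 l3 (s + x + l2) (s - x + l2) = (1/2) * g (s - x) - (1/2) * g (s + x - 2 * l3)"
      using that by (simp add: jump_free_def algebra_simps)
    have "H (s + x + l2, s - x + l2) = r (l1 + x) / 4 *
        (jump_free g l2 l3 (s + x + l2) (s - x + l2) + B (s + x + l2) - gours H (s + x + l2) (s - x + l2))"
      by (rule eq[of "l1 + x" s, unfolded e]) (use that l in auto)
    thus ?thesis unfolding j V by (simp add: field_simps)
  qed
  show ?thesis
  proof (rule that, unfold string_pair_def, rule conjI[OF E1 conjI[OF E3]], intro conjI allI ballI impI)
    \<comment> \<open>The direct and the reflected half of g cancel at v3, and B equals the Goursat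
      integral on the line b = a - 2 l3.\<close>
    show "V (l3, s) = 0" for s using Be[of "s + l3 + l2"] by (simp add: V algebra_simps)
    show "U (0, s) + V (0, s) = - g s" for s by (simp add: U V)
    show "uxa (0, s) + uxb (0, s) = uxc (0, s) + uxd (0, s)" for s by (simp add: a b c d)
    show "ha (x, s) + hb (x, s) = - (r (l1 - x) * U (x, s))" if "x \<in> {0<..<l1}" "s \<le> 0" for x s
      using eq1[of x s] that by (simp add: a b)
    show "hc (x, s) + hd (x, s) = - (r (l1 + x) * V (x, s))" if "x \<in> {0<..<l3}" "s \<le> 0" for x s
      using eq3[of x s] that by (simp add: c d)
  qed
qed

section \<open>Steering the star\<close>

definition zext :: "real \<Rightarrow> (real \<Rightarrow> real) \<Rightarrow> real \<Rightarrow> real" where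
  "zext l q x = (if x \<in> {0..l} then q x else 0)"

lemma zext:
  assumes q: "continuous_on {0..l} q" and Q: "\<And>x. x \<in> {0..l} \<Longrightarrow> \<bar>q x\<bar> \<le> Q" "Q \<ge> 0"
  shows "zext l q \<in> borel_measurable borel" "\<bar>zext l q x\<bar> \<le> Q" "x \<notin> {0, l} \<Longrightarrow> isCont (zext l q) x"
proof -
  have "(\<lambda>x. indicator {0..l} x *\<^sub>R q x) \<in> borel_measurable borel"
    by (rule borel_measurable_continuous_on_indicator[OF _ q]) simp
  moreover have "zext l q = (\<lambda>x. indicator {0..l} x *\<^sub>R q x)" by (auto simp: zext_def)
  ultimately show "zext l q \<in> borel_measurable borel" by simp
  show "\<bar>zext l q x\<bar> \<le> Q" using Q by (simp add: zext_def)
  assume x: "x \<notin> {0, l}"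
  show "isCont (zext l q) x"
  proof (cases "x \<in> {0<..<l}")
    case True
    have "isCont q x" by (rule continuous_on_interior[OF q]) (use True in simp)
    moreover have "\<forall>\<^sub>F y in nhds x. zext l q y = q y"
      using eventually_nhds_in_open[of "{0<..<l}" x] True by (auto simp: zext_def elim!: eventually_mono)
    ultimately show ?thesis by (subst isCont_cong)
  next
    case False
    hence "x \<in> - {0..l}" using x by auto
    moreover have "open (- {0..l})" by auto
    ultimately have "\<forall>\<^sub>F y in nhds x. zext l q y = 0"
      using eventually_nhds_in_open[of "- {0..l}" x] by (auto simp: zext_def elim!: eventually_mono)
    thus ?thesis by (subst isCont_cong) auto
  qed
qed

lemma prim2_diff_norm:
  assumes f: "prim2 l f f'" and g: "prim2 l g g'"
  shows "(LBINT x:{0..l}. (f' x - g' x)\<^sup>2) \<le> 2 * (LBINT x:{0..l}. (f' x)\<^sup>2) + 2 * (LBINT x:{0..l}. (g' x)\<^sup>2)"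
proof -
  have i: "set_integrable lborel {0..l} (\<lambda>x. (f' x)\<^sup>2)" "set_integrable lborel {0..l} (\<lambda>x. (g' x)\<^sup>2)"
    "set_integrable lborel {0..l} (\<lambda>x. (f' x - g' x)\<^sup>2)"
    using f g prim2_diff[OF f g] by (auto simp: prim2_def)
  have "(LBINT x:{0..l}. (f' x - g' x)\<^sup>2) \<le> (LBINT x:{0..l}. 2 * (f' x)\<^sup>2 + 2 * (g' x)\<^sup>2)"
    by (rule set_integral_mono[OF i(3)]) (use i sum_sq_le[of "f' x" "- g' x" for x] in \<open>auto intro!: set_integral_add\<close>)
  also have "\<dots> = 2 * (LBINT x:{0..l}. (f' x)\<^sup>2) + 2 * (LBINT x:{0..l}. (g' x)\<^sup>2)"
    using i by (simp add: set_integral_add)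
  finally show ?thesis .
qed

text \<open>The argument of \<Psi> is the distance from v3. The profile of D3, read backwards, stays
  constant from z = l3 on, and the profile of D1 - D1 0 is added there; equality of the values at v0
  makes the sum continue as D1. Adding two profiles costs the factor 4.\<close>

lemma string_target:
  assumes p3: "prim2 l3 D3 d3" and p1: "prim2 l1 D1 d1" and l: "l1 \<ge> 0" "l3 \<ge> 0" and z: "D3 l3 = 0" "D3 0 = D1 0"
    and K: "(LBINT x:{0..l3}. (d3 x)\<^sup>2) \<le> K" "(LBINT x:{0..l1}. (d1 x)\<^sup>2) \<le> K"
  obtains \<Psi> \<psi> where "AC2 \<Psi> \<psi>" "\<And>z. z \<notin> {0<..l1 + l3} \<Longrightarrow> \<psi> z = 0" "(LBINT z. (\<psi> z)\<^sup>2) \<le> 4 * K"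
    "\<And>x. x \<in> {0..l1} \<Longrightarrow> \<Psi> (x + l3) = D1 x" "\<And>x. x \<in> {0..l3} \<Longrightarrow> \<Psi> (l3 - x) = D3 x"
proof -
  obtain F f where F: "AC2 F f" "\<And>z. z \<notin> {0<..l3} \<Longrightarrow> f z = 0" "(LBINT z. (f z)\<^sup>2) = (LBINT x:{0..l3}. (- d3 (l3 - x))\<^sup>2)"
    "\<And>x. x \<in> {0..l3} \<Longrightarrow> F x = D3 (l3 - x) - D3 (l3 - 0)" "\<And>x. x \<ge> l3 \<Longrightarrow> F x = D3 (l3 - l3) - D3 (l3 - 0)"
    by (rule prim2_AC2[OF prim2_reflect(1)[OF p3 l(2)] l(2)], rule that, assumption, blast, assumption, blast, blast)
  obtain G g where G: "AC2 G g" "\<And>z. z \<notin> {0<..l1} \<Longrightarrow> g z = 0" "(LBINT z. (g z)\<^sup>2) = (LBINT x:{0..l1}. (d1 x)\<^sup>2)"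
    "\<And>x. x \<le> 0 \<Longrightarrow> G x = 0" "\<And>x. x \<in> {0..l1} \<Longrightarrow> G x = D1 x - D1 0"
    by (rule prim2_AC2[OF p1 l(1)], rule that, assumption, blast, assumption, blast, blast)
  have sh: "(LBINT x. (g (x + - l3))\<^sup>2) = (LBINT x. (g x)\<^sup>2)"
    by (subst (2) lborel_integral_real_affine[where c=1 and t="- l3"]) (auto simp: add.commute)
  show ?thesis
  proof (rule that)
    show "AC2 (\<lambda>x. F x + G (x + - l3)) (\<lambda>x. f x + g (x + - l3))" by (rule AC2_add[OF F(1) AC2_shift[OF G(1)]])
    show "f z + g (z + - l3) = 0" if "z \<notin> {0<..l1 + l3}" for z
    proof -
      from that have "z \<notin> {0<..l3}" "z + - l3 \<notin> {0<..l1}" using l by auto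
      thus ?thesis using F(2)[of z] G(2)[of "z + - l3"] by simp
    qed
    show "(LBINT z. (f z + g (z + - l3))\<^sup>2) \<le> 4 * K"
      using AC2_add_norm[OF F(1) AC2_shift[OF G(1)], of "- l3"] K F(3) G(3) prim2_reflect(2)[OF p3 l(2)] unfolding sh by linarith
    show "F (x + l3) + G (x + l3 + - l3) = D1 x" if "x \<in> {0..l1}" for x using F(5)[of "x + l3"] G(5)[of x] that z by simp
    show "F (l3 - x) + G (l3 - x + - l3) = D3 x" if "x \<in> {0..l3}" for x using F(4)[of "l3 - x"] G(4)[of "- x"] that z by simp
  qed
qed

lemma edge_prim2:
  assumes H: "star_H1 l \<phi>" and j: "j \<in> {1..3}" and l: "l j > 0"
  obtains g where "prim2 (l j) (\<phi> j) g" "(LBINT x:{0..l j}. (g x)\<^sup>2) \<le> (star_H1_norm l \<phi>)\<^sup>2"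
proof -
  have "H1_space (l j) (\<phi> j)" using H j by (auto simp: star_H1_def)
  from H1_space_D(1)[OF l this] obtain g where g: "prim2 (l j) (\<phi> j) g" by blast
  have "(L2_norm (l j) (wderiv (l j) (\<phi> j)))\<^sup>2 + (L2_norm (l j) (\<phi> j))\<^sup>2
      \<le> (\<Sum>j=1..3. (L2_norm (l j) (wderiv (l j) (\<phi> j)))\<^sup>2 + (L2_norm (l j) (\<phi> j))\<^sup>2)"
    by (rule member_le_sum[OF j]) auto
  also have "\<dots> = (star_H1_norm l \<phi>)\<^sup>2" unfolding star_H1_norm_def by (subst real_sqrt_pow2) (auto intro!: sum_nonneg)
  finally have "(LBINT x:{0..l j}. (g x)\<^sup>2) + (L2_norm (l j) (\<phi> j))\<^sup>2 \<le> (star_H1_norm l \<phi>)\<^sup>2" using prim2_H1(3)[OF l g] by simp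
  with zero_le_power2[of "L2_norm (l j) (\<phi> j)"] have "(LBINT x:{0..l j}. (g x)\<^sup>2) \<le> (star_H1_norm l \<phi>)\<^sup>2" by linarith
  with g show ?thesis by (rule that)
qed

lemma potential_zext:
  assumes "continuous_on {0..l} q" "\<And>x. x \<in> {0..l} \<Longrightarrow> \<bar>q x\<bar> \<le> Q" "Q \<ge> 0"
  shows "potential l Q {0, l} (zext l q)"
  using zext[OF assms] by (auto simp: potential_def zext_def)

text \<open>Both summands can be nonzero at the joint y = l1, so the pointwise bound is taken as 2
  Q.\<close>

lemma potential_join:
  assumes 1: "potential l1 Q {0, l1} r1" and 3: "potential l3 Q {0, l3} r3" and l: "l1 \<ge> 0" "l3 \<ge> 0"
  shows "potential (l1 + l3) (2 * Q) {0, l1, l1 + l3} (\<lambda>y. r1 (l1 - y) + r3 (y - l1))"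
  unfolding potential_def
proof (intro conjI allI impI)
  note [measurable] = potentialD(1)[OF 1] potentialD(1)[OF 3]
  show "(\<lambda>y. r1 (l1 - y) + r3 (y - l1)) \<in> borel_measurable borel" by measurable
  fix y
  show "\<bar>r1 (l1 - y) + r3 (y - l1)\<bar> \<le> 2 * Q" using potentialD(2)[OF 1, of "l1 - y"] potentialD(2)[OF 3, of "y - l1"] by linarith
  show "r1 (l1 - y) + r3 (y - l1) = 0" if "y \<notin> {0..l1 + l3}"
    using potentialD(5)[OF 1, of "l1 - y"] potentialD(5)[OF 3, of "y - l1"] that l by auto
  assume y: "y \<notin> {0, l1, l1 + l3}"
  have "isCont (\<lambda>y. r1 (l1 - y)) y"
    by (rule isCont_o2[where g=r1]) (use y in \<open>auto intro!: potentialD(4)[OF 1] continuous_intros\<close>)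
  moreover have "isCont (\<lambda>y. r3 (y - l1)) y"
    by (rule isCont_o2[where g=r3]) (use y in \<open>auto intro!: potentialD(4)[OF 3] continuous_intros\<close>)
  ultimately show "isCont (\<lambda>y. r1 (l1 - y) + r3 (y - l1)) y" by (rule isCont_add)
qed auto

section \<open>The solution that reaches a given state\<close>

definition steering where
  "steering q l S K \<phi> h u ux ut \<longleftrightarrow> (\<forall>j\<in>{1..3::nat}. edge_sol (l j) S K (h j) (u j) (ux j) (ut j) \<and>
      (\<forall>x\<in>{0<..<l j}. \<forall>s\<le>0. h j (x, s) = - (q j x * u j (x, s))) \<and> (\<forall>x\<in>{0..l j}. u j (x, 0) = \<phi> j x)) \<and>
    (\<forall>s\<le>0. u 2 (l 2, s) = 0 \<and> u 3 (l 3, s) = 0 \<and> u 1 (0, s) + u 2 (0, s) + u 3 (0, s) = 0 \<and> ux 3 (0, s) = ux 1 (0, s))"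

text \<open>Edge 2 comes first, since its trace g is the data of the jump on the string. The jump
  solution in turn determines the deviation from \<phi> that the smooth string solution has to
  produce at s = 0. All maps are bounded, so the constants multiply.\<close>

lemma steering_solution:
  fixes l :: "nat \<Rightarrow> real" and q :: "nat \<Rightarrow> real \<Rightarrow> real"
  assumes l: "\<And>j. j \<in> {1..3} \<Longrightarrow> l j > 0" and q: "\<And>j. j \<in> {1..3} \<Longrightarrow> continuous_on {0..l j} (q j)"
  defines "S \<equiv> max (l 2) (l 1 + l 3)"
  shows "\<exists>C\<ge>0. \<forall>\<phi>. star_H10 l \<phi> \<longrightarrow> (\<exists>h u ux ut. steering q l S (C * (star_H1_norm l \<phi>)\<^sup>2) \<phi> h u ux ut)"
proof -
  have l': "l 1 > 0" "l 2 > 0" "l 3 > 0" using l[of 1] l[of 2] l[of 3] by auto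
  have S: "S \<ge> l 2" "S \<ge> l 1 + l 3" "S \<ge> 0" using l' by (auto simp: S_def)
  have l0: "l 1 \<ge> 0" "l 2 \<ge> 0" "l 3 \<ge> 0" using l' by auto
  have "\<exists>Q\<ge>0::real. \<forall>j\<in>{1..3}. \<forall>x\<in>{0..l j}. \<bar>q j x\<bar> \<le> Q" by (rule bounded_potential[OF q])
  then obtain Q where Q: "Q \<ge> 0" "\<And>j x. j \<in> {1..3} \<Longrightarrow> x \<in> {0..l j} \<Longrightarrow> \<bar>q j x\<bar> \<le> Q"
    by blast
  have z: "potential (l j) Q {0, l j} (zext (l j) (q j))" if "j \<in> {1..3}" for j
    by (rule potential_zext[OF q[OF that] Q(2)[OF that] Q(1)])
  have r2: "potential (l 2) Q {0, l 2} (zext (l 2) (q 2))" by (rule z) simp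
  define r where "r y = zext (l 1) (q 1) (l 1 - y) + zext (l 3) (q 3) (y - l 1)" for y
  have r: "potential (l 1 + l 3) (2 * Q) {0, l 1, l 1 + l 3} r"
    unfolding r_def[abs_def] by (rule potential_join[OF z z]) (use l0 in auto)
  have r1: "r (l 1 - x) = q 1 x" if "x \<in> {0<..<l 1}" for x using that by (auto simp: r_def zext_def)
  have r3: "r (l 1 + x) = q 3 x" if "x \<in> {0<..<l 3}" for x using that by (auto simp: r_def zext_def)
  define C2 where "C2 = edge2_const Q (l 2) S"
  define Ka where "Ka = jump_string_const (2 * Q) (l 1) (l 2) (l 3) S * C2"
  \<comment> \<open>The squared norms of the derivatives of the deviation are at most (2 + 2 Ka)
    times that of \<phi>, and joining the two edges in \<open>string_target\<close> costs the factor
    4.\<close>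
  define Kb where "Kb = smooth_const (2 * Q) (l 1 + l 3) S * (4 * (2 + 2 * Ka))"
  \<comment> \<open>Absolute values give C \<ge> 0 without inspecting the signs of the constants;
    the factors 2 come from adding the jump and the smooth solution.\<close>
  define C where "C = \<bar>C2\<bar> + 2 * \<bar>Ka\<bar> + 2 * \<bar>Kb\<bar>"
  show ?thesis
  proof (intro exI[of _ C] conjI allI impI)
    show "C \<ge> 0" by (simp add: C_def)
    fix \<phi> assume \<phi>: "star_H10 l \<phi>"
    define n where "n = (star_H1_norm l \<phi>)\<^sup>2"
    have n: "n \<ge> 0" by (simp add: n_def)
    have H1: "star_H1 l \<phi>" and \<phi>l: "\<phi> 1 (l 1) = 0" "\<phi> 2 (l 2) = 0" "\<phi> 3 (l 3) = 0" and \<phi>0: "\<phi> 1 0 + \<phi> 2 0 + \<phi> 3 0 = 0"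
      using \<phi> sum_123[of "\<lambda>j. \<phi> j 0"] by (auto simp: star_H10_def)
    obtain \<phi>1 where \<phi>1: "prim2 (l 1) (\<phi> 1) \<phi>1" "(LBINT x:{0..l 1}. (\<phi>1 x)\<^sup>2) \<le> n" using edge_prim2[OF H1, of 1] l'(1) by (auto simp: n_def)
    obtain \<phi>2 where \<phi>2: "prim2 (l 2) (\<phi> 2) \<phi>2" "(LBINT x:{0..l 2}. (\<phi>2 x)\<^sup>2) \<le> n" using edge_prim2[OF H1, of 2] l'(2) by (auto simp: n_def)
    obtain \<phi>3 where \<phi>3: "prim2 (l 3) (\<phi> 3) \<phi>3" "(LBINT x:{0..l 3}. (\<phi>3 x)\<^sup>2) \<le> n" using edge_prim2[OF H1, of 3] l'(3) by (auto simp: n_def)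
    obtain h2 u2 x2 t2 g \<gamma> where u2: "edge_sol (l 2) S (C2 * n) h2 u2 x2 t2" "\<And>x. x \<in> {0..l 2} \<Longrightarrow> u2 (x, 0) = \<phi> 2 x"
      "\<And>s. s \<le> 0 \<Longrightarrow> u2 (l 2, s) = 0" "\<And>x s. x \<in> {0..l 2} \<Longrightarrow> s \<le> 0 \<Longrightarrow> h2 (x, s) = - (zext (l 2) (q 2) x * u2 (x, s))"
      and g: "AC2_le (C2 * n) g \<gamma>" "\<And>z. z \<le> - l 2 \<Longrightarrow> \<gamma> z = 0" "\<And>s. u2 (0, s) = g s"
      unfolding C2_def by (rule edge2_solution[OF l'(2) S(1) r2 \<phi>2(1) \<phi>l(2) \<phi>2(2)]) (assumption | blast)+
    have l1N: "l 1 \<in> {0, l 1, l 1 + l 3}" by simp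
    obtain ha ua xa ta hc uc xc tc where ac: "string_pair (l 1) (l 3) S (Ka * n) r g ha ua xa ta hc uc xc tc"
      by (rule string_jump_solution[OF l' S(1) r l1N g(1,2)]) (simp_all add: Ka_def mult.assoc)
    have a: "edge_sol (l 1) S (Ka * n) ha ua xa ta" and c: "edge_sol (l 3) S (Ka * n) hc uc xc tc"
      and ac0: "ua (0, 0) + uc (0, 0) = - g 0" "uc (l 3, 0) = 0" using ac by (auto simp: string_pair_def)
    have pa: "prim2 (l 1) (\<lambda>x. ua (x, 0)) (\<lambda>x. xa (x, 0))" by (rule edge_sol_prim2[OF a]) simp
    have pc: "prim2 (l 3) (\<lambda>x. uc (x, 0)) (\<lambda>x. xc (x, 0))" by (rule edge_sol_prim2[OF c]) simp
    have na: "(LBINT x:{0..l 1}. (xa (x, 0))\<^sup>2) \<le> Ka * n" using edge_solD(9)[OF a, of 0] by (simp add: sqint_def)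
    have nc: "(LBINT x:{0..l 3}. (xc (x, 0))\<^sup>2) \<le> Ka * n" using edge_solD(9)[OF c, of 0] by (simp add: sqint_def)
    have p1: "prim2 (l 1) (\<lambda>x. \<phi> 1 x - ua (x, 0)) (\<lambda>x. \<phi>1 x - xa (x, 0))" by (rule prim2_diff[OF \<phi>1(1) pa])
    have p3: "prim2 (l 3) (\<lambda>x. uc (x, 0) - \<phi> 3 x) (\<lambda>x. xc (x, 0) - \<phi>3 x)" by (rule prim2_diff[OF pc \<phi>3(1)])
    have n1: "(LBINT x:{0..l 1}. (\<phi>1 x - xa (x, 0))\<^sup>2) \<le> (2 + 2 * Ka) * n"
      using prim2_diff_norm[OF \<phi>1(1) pa] \<phi>1(2) na by (simp add: algebra_simps)
    have n3: "(LBINT x:{0..l 3}. (xc (x, 0) - \<phi>3 x)\<^sup>2) \<le> (2 + 2 * Ka) * n"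
      using prim2_diff_norm[OF pc \<phi>3(1)] \<phi>3(2) nc by (simp add: algebra_simps)
    have e3: "uc (l 3, 0) - \<phi> 3 (l 3) = 0" using ac0 \<phi>l by simp
    \<comment> \<open>Continuity of the target across v0: the traces of the jump solution sum to - g
      0 = - \<phi> 2 0, those of \<phi> on edges 1 and 3 sum to the same value, and the deviation on
      edge 3 is taken with reversed sign.\<close>
    have e0: "uc (0, 0) - \<phi> 3 0 = \<phi> 1 0 - ua (0, 0)"
    proof -
      have "g 0 = \<phi> 2 0" using u2(2)[of 0] g(3)[of 0] l0(2) by simp
      thus ?thesis using \<phi>0 ac0(1) by linarith
    qed
    obtain \<Psi> \<psi> where \<Psi>: "AC2 \<Psi> \<psi>" "\<And>z. z \<notin> {0<..l 1 + l 3} \<Longrightarrow> \<psi> z = 0" "(LBINT z. (\<psi> z)\<^sup>2) \<le> 4 * ((2 + 2 * Ka) * n)"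
      and \<Psi>1: "\<And>x. x \<in> {0..l 1} \<Longrightarrow> \<Psi> (x + l 3) = \<phi> 1 x - ua (x, 0)" and \<Psi>3: "\<And>x. x \<in> {0..l 3} \<Longrightarrow> \<Psi> (l 3 - x) = uc (x, 0) - \<phi> 3 x"
      by (rule string_target[OF p3 p1 l0(1,3) e3 e0 n3 n1], rule that, assumption, blast, assumption, blast, blast)
    have Kbn: "smooth_const (2 * Q) (l 1 + l 3) S * (4 * ((2 + 2 * Ka) * n)) = Kb * n" by (simp add: Kb_def)
    obtain hb ub xb tb hd ud xd td where bd: "string_pair (l 1) (l 3) S (Kb * n) r (\<lambda>_. 0) hb ub xb tb hd ud xd td"
      and b0: "\<And>x. x \<in> {0..l 1} \<Longrightarrow> ub (x, 0) = \<Psi> (x + l 3)" and d0: "\<And>x. x \<in> {0..l 3} \<Longrightarrow> ud (x, 0) = - \<Psi> (l 3 - x)"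
      by (rule string_smooth_solution[OF l'(1,3) S(2) r \<Psi>, unfolded Kbn]) (assumption | blast)+
    have sp: "string_pair (l 1) (l 3) S (2 * (Ka * n) + 2 * (Kb * n)) r (\<lambda>s. g s + 0) (\<lambda>z. ha z + hb z) (\<lambda>z. ua z + ub z) (\<lambda>z. xa z + xb z)
      (\<lambda>z. ta z + tb z) (\<lambda>z. hc z + hd z) (\<lambda>z. uc z + ud z) (\<lambda>z. xc z + xd z) (\<lambda>z. tc z + td z)"
      by (rule string_pair_add[OF ac bd l0(1,3) S(3)])
    have "C2 * n \<le> \<bar>C2\<bar> * n" "Ka * n \<le> \<bar>Ka\<bar> * n" "Kb * n \<le> \<bar>Kb\<bar> * n" "0 \<le> \<bar>C2\<bar> * n" "0 \<le> \<bar>Ka\<bar> * n" "0 \<le> \<bar>Kb\<bar> * n"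
      using n by (simp_all add: mult_right_mono)
    moreover have "C * n = \<bar>C2\<bar> * n + (2 * (\<bar>Ka\<bar> * n) + 2 * (\<bar>Kb\<bar> * n))" by (simp add: C_def algebra_simps)
    ultimately have Cn: "C2 * n \<le> C * n" "2 * (Ka * n) + 2 * (Kb * n) \<le> C * n" by linarith+
    define h where "h j = (if j = (1::nat) then (\<lambda>z. ha z + hb z) else if j = 2 then h2 else (\<lambda>z. hc z + hd z))" for j
    define u where "u j = (if j = (1::nat) then (\<lambda>z. ua z + ub z) else if j = 2 then u2 else (\<lambda>z. uc z + ud z))" for j
    define ux where "ux j = (if j = (1::nat) then (\<lambda>z. xa z + xb z) else if j = 2 then x2 else (\<lambda>z. xc z + xd z))" for j
    define ut where "ut j = (if j = (1::nat) then (\<lambda>z. ta z + tb z) else if j = 2 then t2 else (\<lambda>z. tc z + td z))" for j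
    have E1: "edge_sol (l 1) S (C * n) (h 1) (u 1) (ux 1) (ut 1)"
      using sp by (auto simp: string_pair_def h_def u_def ux_def ut_def intro: edge_sol_mono[OF _ Cn(2)])
    have E2: "edge_sol (l 2) S (C * n) (h 2) (u 2) (ux 2) (ut 2)"
      using edge_sol_mono[OF u2(1) Cn(1)] by (simp add: h_def u_def ux_def ut_def)
    have E3: "edge_sol (l 3) S (C * n) (h 3) (u 3) (ux 3) (ut 3)"
      using sp by (auto simp: string_pair_def h_def u_def ux_def ut_def intro: edge_sol_mono[OF _ Cn(2)])
    have q1: "h 1 (x, s) = - (q 1 x * u 1 (x, s))" if "x \<in> {0<..<l 1}" "s \<le> 0" for x s
      using sp that r1[OF that(1)] by (simp add: string_pair_def h_def u_def)
    have q2: "h 2 (x, s) = - (q 2 x * u 2 (x, s))" if "x \<in> {0<..<l 2}" "s \<le> 0" for x s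
      using u2(4) that by (simp add: h_def u_def zext_def)
    have q3: "h 3 (x, s) = - (q 3 x * u 3 (x, s))" if "x \<in> {0<..<l 3}" "s \<le> 0" for x s
      using sp that r3[OF that(1)] by (simp add: string_pair_def h_def u_def)
    have f1: "u 1 (x, 0) = \<phi> 1 x" if "x \<in> {0..l 1}" for x using b0 \<Psi>1[OF that] that by (simp add: u_def)
    have f2: "u 2 (x, 0) = \<phi> 2 x" if "x \<in> {0..l 2}" for x using u2(2) that by (simp add: u_def)
    have f3: "u 3 (x, 0) = \<phi> 3 x" if "x \<in> {0..l 3}" for x using d0 \<Psi>3[OF that] that by (simp add: u_def)
    have bc: "u 2 (l 2, s) = 0 \<and> u 3 (l 3, s) = 0 \<and> u 1 (0, s) + u 2 (0, s) + u 3 (0, s) = 0 \<and> ux 3 (0, s) = ux 1 (0, s)" if "s \<le> 0" for s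
    proof -
      have "ua (0, s) + ub (0, s) + (uc (0, s) + ud (0, s)) = - u2 (0, s)" using sp g(3) that by (simp add: string_pair_def)
      hence "ua (0, s) + ub (0, s) + u2 (0, s) + (uc (0, s) + ud (0, s)) = 0" by linarith
      moreover have "uc (l 3, s) + ud (l 3, s) = 0" "xa (0, s) + xb (0, s) = xc (0, s) + xd (0, s)" using sp that by (auto simp: string_pair_def)
      ultimately show ?thesis using u2(3)[OF that] by (simp add: u_def ux_def)
    qed
    show "\<exists>h u ux ut. steering q l S (C * (star_H1_norm l \<phi>)\<^sup>2) \<phi> h u ux ut"
      unfolding steering_def
    proof (intro exI conjI ballI allI impI)
      fix j :: nat assume "j \<in> {1..3}"
      hence j: "j = 1 \<or> j = 2 \<or> j = 3" by auto
      show "edge_sol (l j) S (C * (star_H1_norm l \<phi>)\<^sup>2) (h j) (u j) (ux j) (ut j)" using E1 E2 E3 j by (auto simp: n_def)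
      show "h j (x, s) = - (q j x * u j (x, s))" if "x \<in> {0<..<l j}" "s \<le> 0" for x s using q1 q2 q3 that j by blast
      show "u j (x, 0) = \<phi> j x" if "x \<in> {0..l j}" for x using f1 f2 f3 that j by blast
    qed (use bc in auto)
  qed
qed

section \<open>Bounds of the controls\<close>

text \<open>After the shift by T only the last S units of time contribute, so the integral is the
  same for every T \<ge> S.\<close>

lemma set_integral_delay:
  fixes f :: "real \<Rightarrow> real"
  assumes T: "T \<ge> S" and f: "set_integrable lborel {-S..0} f" and z: "\<And>s. s \<le> - S \<Longrightarrow> f s = 0"
  shows "set_integrable lborel {0..T} (\<lambda>t. f (t - T))" "(LBINT t:{0..T}. f (t - T)) = (LBINT s:{-S..0}. f s)"
proof -
  have e: "indicator {0..T} t *\<^sub>R f (t - T) = indicator {-S..0} (- T + 1 * t) *\<^sub>R f (- T + 1 * t)" for t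
    using z[of "t - T"] T by (cases "t - T \<le> - S") (auto simp: indicator_def)
  show "set_integrable lborel {0..T} (\<lambda>t. f (t - T))"
    using lborel_integrable_real_affine[OF f[unfolded set_integrable_def], of 1 "- T"] unfolding set_integrable_def e by simp
  show "(LBINT t:{0..T}. f (t - T)) = (LBINT s:{-S..0}. f s)"
    unfolding set_LINT_def e by (subst (2) lborel_integral_real_affine[where c=1 and t="- T"]) auto
qed

text \<open>The bound does not depend on T: the trace lives on the last S units of time, where its
  square is at most K, and its derivative has square integral at most K.\<close>

lemma edge_sol_trace_H1:
  assumes E: "edge_sol l S K h u ux ut" and x: "x \<in> {0..l}" and S: "S \<ge> 0" and T: "T > 0" "T \<ge> S"
  shows "H1_space T (\<lambda>t. u (x, t - T))" "u (x, 0 - T) = 0" "(H1_norm T (\<lambda>t. u (x, t - T)))\<^sup>2 \<le> (1 + S) * K"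
proof -
  have d: "sqint (- S) 0 K (\<lambda>s. ut (x, s))" by (rule edge_solD(12)[OF E x])
  have m: "(\<lambda>s. ut (x, s)) \<in> borel_measurable borel" using d by (simp add: sqint_def)
  have z: "ut (x, s) = 0" "u (x, s) = 0" if "s \<le> - S" for s using edge_solD(5,7)[OF E x that] by auto
  have K: "K \<ge> 0" using order_trans[OF zero_le_power2 edge_solD(8)[OF E x, of 0]] by simp
  show u0: "u (x, 0 - T) = 0" using z(2)[of "- T"] T by simp
  have i2: "set_integrable lborel {0..T} (\<lambda>t. (ut (x, t - T))\<^sup>2)" "(LBINT t:{0..T}. (ut (x, t - T))\<^sup>2) = (LBINT s:{-S..0}. (ut (x, s))\<^sup>2)"
    using set_integral_delay[OF T(2), of "\<lambda>s. (ut (x, s))\<^sup>2"] d z by (auto simp: sqint_def)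
  have m': "(\<lambda>t. ut (x, t - T)) \<in> borel_measurable borel" using measurable_compose[OF _ m, of "\<lambda>t. t - T" borel] by simp
  have p: "prim2 T (\<lambda>t. u (x, t - T)) (\<lambda>t. ut (x, t - T))"
    unfolding prim2_def prim_def
  proof (intro conjI ballI)
    show "set_integrable lborel {0..T} (\<lambda>t. ut (x, t - T))" by (rule set_integrable_if_square[OF m' i2(1)])
    fix t assume t: "t \<in> {0..T}"
    have "u (x, t - T) - u (x, 0 - T) = (LBINT r:{0 - T..t - T}. ut (x, r))"
      by (rule edge_sol_time(2)[OF E S x]) (use t in auto)
    also have "\<dots> = (LBINT r:{0..t}. ut (x, r - T))"
      unfolding set_LINT_def
      by (subst lborel_integral_real_affine[where c=1 and t="- T"]) (auto simp: indicator_def intro!: LINT_cong)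
    finally show "u (x, t - T) = u (x, 0 - T) + (LBINT r:{0..t}. ut (x, r - T))" by simp
  qed (rule m', rule i2(1))
  show "H1_space T (\<lambda>t. u (x, t - T))" by (rule prim2_H1(1)[OF T(1) p])
  have "(L2_norm T (\<lambda>t. u (x, t - T)))\<^sup>2 \<le> S * K"
  proof -
    have c: "continuous_on {0..T} (\<lambda>t. u (x, t - T))" by (rule prim2_continuous_on[OF p])
    define w where "w t = indicator {0..T} t *\<^sub>R u (x, t - T)" for t
    have wm: "w \<in> borel_measurable borel" unfolding w_def[abs_def] by (rule borel_measurable_continuous_on_indicator[OF _ c]) simp
    have "(L2_norm T (\<lambda>t. u (x, t - T))) = L2_norm T w" unfolding L2_norm_def
      by (rule arg_cong[where f=sqrt], rule set_lebesgue_integral_cong) (auto simp: w_def)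
    also have "(\<dots>)\<^sup>2 = (LBINT t:{0..T}. (w t)\<^sup>2)" unfolding L2_norm_borel[OF wm]
      by (rule real_sqrt_pow2) (auto simp: set_LINT_def intro!: LINT_nonneg)
    also have "\<dots> \<le> (LBINT t. indicator {T - S..T} t *\<^sub>R K)"
      unfolding set_LINT_def
    proof (rule integral_mono')
      show "integrable lborel (\<lambda>t. indicator {T - S..T} t *\<^sub>R K)"
        by (rule integrable_bounded_support[where M=K and a="T - S" and b=T]) (use K in \<open>auto simp: indicator_def\<close>)
      show "indicator {0..T} t *\<^sub>R (w t)\<^sup>2 \<le> indicator {T - S..T} t *\<^sub>R K" for t
        using z(2)[of "t - T"] edge_solD(8)[OF E x, of "t - T"] T K
        by (cases "t - T \<le> - S") (auto simp: w_def indicator_def)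
      show "0 \<le> indicator {T - S..T} t *\<^sub>R K" for t using K by (simp add: indicator_def)
    qed
    also have "\<dots> = S * K" using S by simp
    finally show ?thesis .
  qed
  moreover have "(L2_norm T (wderiv T (\<lambda>t. u (x, t - T))))\<^sup>2 \<le> K"
    unfolding prim2_H1(3)[OF T(1) p] i2(2) using d by (simp add: sqint_def)
  moreover have "(H1_norm T (\<lambda>t. u (x, t - T)))\<^sup>2 = (L2_norm T (wderiv T (\<lambda>t. u (x, t - T))))\<^sup>2 + (L2_norm T (\<lambda>t. u (x, t - T)))\<^sup>2"
    unfolding H1_norm_def by (rule real_sqrt_pow2) simp
  ultimately show "(H1_norm T (\<lambda>t. u (x, t - T)))\<^sup>2 \<le> (1 + S) * K" by (simp add: algebra_simps)
qed

text \<open>The factor 4 comes from splitting the square of the difference of two fluxes, each with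
  square integral at most K.\<close>

lemma edge_sol_trace_L2:
  assumes E: "edge_sol l S K h u ux ut" "edge_sol l' S K h' u' ux' ut'" and l: "l \<ge> 0" "l' \<ge> 0" and T: "T \<ge> S"
  shows "L2_space T (\<lambda>t. ux (0, t - T) - ux' (0, t - T))" "(L2_norm T (\<lambda>t. ux (0, t - T) - ux' (0, t - T)))\<^sup>2 \<le> 4 * K"
proof -
  have x: "0 \<in> {0..l}" "0 \<in> {0..l'}" using l by auto
  have z: "ux (0, s) - ux' (0, s) = 0" if "s \<le> - S" for s using edge_solD(6)[OF E(1) x(1) that] edge_solD(6)[OF E(2) x(2) that] by simp
  have s': "sqint (- S) 0 ((- 1)\<^sup>2 * K) (\<lambda>s. - 1 * ux' (0, s))" by (rule sqint_scale[OF edge_solD(11)[OF E(2) x(2)]])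
  have "sqint (- S) 0 (2 * K + 2 * ((- 1)\<^sup>2 * K)) (\<lambda>s. ux (0, s) + - 1 * ux' (0, s))"
    by (rule sqint_add[OF edge_solD(11)[OF E(1) x(1)] s'])
  hence d: "sqint (- S) 0 (4 * K) (\<lambda>s. ux (0, s) - ux' (0, s))" by simp
  have f: "(\<lambda>s. ux (0, s) - ux' (0, s)) \<in> borel_measurable borel" using d unfolding sqint_def by blast
  have m: "(\<lambda>t. ux (0, t - T) - ux' (0, t - T)) \<in> borel_measurable borel"
    using measurable_compose[OF _ f, of "\<lambda>t. t - T" borel] by simp
  have i: "set_integrable lborel {0..T} (\<lambda>t. (ux (0, t - T) - ux' (0, t - T))\<^sup>2)"
    "(LBINT t:{0..T}. (ux (0, t - T) - ux' (0, t - T))\<^sup>2) \<le> 4 * K"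
    using set_integral_delay[OF T, of "\<lambda>s. (ux (0, s) - ux' (0, s))\<^sup>2"] d z by (auto simp: sqint_def)
  show "L2_space T (\<lambda>t. ux (0, t - T) - ux' (0, t - T))" unfolding L2_space_borel_iff[OF m] by (rule i(1))
  have "(L2_norm T (\<lambda>t. ux (0, t - T) - ux' (0, t - T)))\<^sup>2 = (LBINT t:{0..T}. (ux (0, t - T) - ux' (0, t - T))\<^sup>2)"
    unfolding L2_norm_borel[OF m] by (rule real_sqrt_pow2) (auto simp: set_LINT_def intro!: LINT_nonneg)
  thus "(L2_norm T (\<lambda>t. ux (0, t - T) - ux' (0, t - T)))\<^sup>2 \<le> 4 * K" using i(2) by simp
qed

theorem theorem3:
  fixes l :: "nat \<Rightarrow> real" and q :: "nat \<Rightarrow> real \<Rightarrow> real"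
  assumes "l 1 > 0" and "l 2 > 0" and "l 3 > 0" and "l 2 \<ge> l 3"
    and "\<forall>j\<in>{1..3}. continuous_on {0..l j} (q j)"
  shows "\<exists>C::real. \<forall>T \<ge> max (l 2) (l 1 + l 3). \<forall>\<phi>. star_H10 l \<phi> \<longrightarrow>
    (\<exists>f1 f2. H10_space T f1 \<and> L2_space T f2 \<and>
       (\<exists>u. weak_solution q l T f1 f2 u) \<and>
       (\<forall>u. weak_solution q l T f1 f2 u \<longrightarrow> (\<forall>j\<in>{1..3}. \<forall>x\<in>{0..l j}. u T j x = \<phi> j x)) \<and>
       H1_norm T f1 + L2_norm T f2 \<le> C * star_H1_norm l \<phi>)"
proof -
  define S where "S = max (l 2) (l 1 + l 3)"
  have S: "S > 0" using assms by (simp add: S_def)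
  have l: "l j > 0" if "j \<in> {1..3}" for j
  proof -
    have "j = 1 \<or> j = 2 \<or> j = 3" using that by auto
    thus ?thesis using assms(1-3) by auto
  qed
  have q: "continuous_on {0..l j} (q j)" if "j \<in> {1..3}" for j using assms(5) that by blast
  have "\<exists>C\<ge>0. \<forall>\<phi>. star_H10 l \<phi> \<longrightarrow> (\<exists>h u ux ut. steering q l S (C * (star_H1_norm l \<phi>)\<^sup>2) \<phi> h u ux ut)"
    unfolding S_def by (rule steering_solution[OF l q])
  then obtain C where C: "C \<ge> 0" and P: "\<And>\<phi>. star_H10 l \<phi> \<Longrightarrow> (\<exists>h u ux ut. steering q l S (C * (star_H1_norm l \<phi>)\<^sup>2) \<phi> h u ux ut)"
    by blast
  \<comment> \<open>The edge bounds are on squares, so the square roots of the trace bounds (1 + S)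
    K and 4 K appear here.\<close>
  have "\<exists>f1 f2. H10_space T f1 \<and> L2_space T f2 \<and> (\<exists>u. weak_solution q l T f1 f2 u) \<and>
       (\<forall>u. weak_solution q l T f1 f2 u \<longrightarrow> (\<forall>j\<in>{1..3}. \<forall>x\<in>{0..l j}. u T j x = \<phi> j x)) \<and>
       H1_norm T f1 + L2_norm T f2 \<le> (sqrt ((1 + S) * C) + sqrt (4 * C)) * star_H1_norm l \<phi>"
    if T: "T \<ge> S" and \<phi>: "star_H10 l \<phi>" for T \<phi>
  proof -
    define K where "K = C * (star_H1_norm l \<phi>)\<^sup>2"
    from P[OF \<phi>] obtain h u ux ut where E: "\<And>j. j \<in> {1..3::nat} \<Longrightarrow> edge_sol (l j) S K (h j) (u j) (ux j) (ut j)"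
      and hq: "\<And>j x s. j \<in> {1..3} \<Longrightarrow> x \<in> {0<..<l j} \<Longrightarrow> s \<le> 0 \<Longrightarrow> h j (x, s) = - (q j x * u j (x, s))"
      and fin: "\<And>j x. j \<in> {1..3} \<Longrightarrow> x \<in> {0..l j} \<Longrightarrow> u j (x, 0) = \<phi> j x"
      and bc: "\<And>s. s \<le> 0 \<Longrightarrow> u 2 (l 2, s) = 0" "\<And>s. s \<le> 0 \<Longrightarrow> u 3 (l 3, s) = 0"
        "\<And>s. s \<le> 0 \<Longrightarrow> u 1 (0, s) + u 2 (0, s) + u 3 (0, s) = 0" "\<And>s. s \<le> 0 \<Longrightarrow> ux 3 (0, s) = ux 1 (0, s)"
      unfolding K_def steering_def by blast
    have E1: "edge_sol (l 1) S K (h 1) (u 1) (ux 1) (ut 1)" and E2: "edge_sol (l 2) S K (h 2) (u 2) (ux 2) (ut 2)" using E by auto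
    have T0: "T > 0" using T S by simp
    have N: "star_H1_norm l \<phi> \<ge> 0" unfolding star_H1_norm_def by (intro real_sqrt_ge_zero sum_nonneg) auto
    define f1 where "f1 t = u 1 (l 1, t - T)" for t
    define f2 where "f2 t = ux 2 (0, t - T) - ux 1 (0, t - T)" for t
    define v where "v t j x = u j (x, t - T)" for t j x
    have W: "weak_solution q l T f1 f2 v" unfolding f1_def[abs_def] f2_def[abs_def] v_def[abs_def]
      by (rule edge_sols_weak_solution[OF l q E _ T0 T _ bc]) (use S hq in auto)
    have x1: "l 1 \<in> {0..l 1}" using assms(1) by simp
    note tr1 = edge_sol_trace_H1[OF E1 x1 less_imp_le[OF S] T0 T]
    have "l 2 \<ge> 0" "l 1 \<ge> 0" using assms by auto
    note tr2 = edge_sol_trace_L2[OF E2 E1 this T]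
    have H: "H10_space T f1"
    proof -
      \<comment> \<open>The trace at v1 starts at rest and ends at the value of \<phi> at v1, which
        vanishes; this puts f1 into H^1_0.\<close>
      have "\<phi> 1 (l 1) = 0" using \<phi> by (auto simp: star_H10_def)
      thus ?thesis using tr1(1,2) fin[of 1 "l 1"] x1 by (simp add: H10_space_def f1_def[abs_def])
    qed
    have L: "L2_space T f2" using tr2(1) by (simp add: f2_def[abs_def])
    have n1: "H1_norm T f1 \<le> sqrt ((1 + S) * C) * star_H1_norm l \<phi>"
    proof -
      have "H1_norm T f1 \<le> sqrt ((1 + S) * K)" by (rule real_le_rsqrt) (use tr1(3) in \<open>simp add: f1_def[abs_def]\<close>)
      also have "\<dots> = sqrt ((1 + S) * C) * star_H1_norm l \<phi>" using N by (simp add: K_def real_sqrt_mult)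
      finally show ?thesis .
    qed
    have n2: "L2_norm T f2 \<le> sqrt (4 * C) * star_H1_norm l \<phi>"
    proof -
      have "L2_norm T f2 \<le> sqrt (4 * K)" by (rule real_le_rsqrt) (use tr2(2) in \<open>simp add: f2_def[abs_def]\<close>)
      also have "\<dots> = sqrt (4 * C) * star_H1_norm l \<phi>" using N by (simp add: K_def real_sqrt_mult)
      finally show ?thesis .
    qed
    \<comment> \<open>By uniqueness any weak solution with these controls is the constructed one,
      whose state at time T is \<phi>.\<close>
    have U: "w T j x = \<phi> j x" if "weak_solution q l T f1 f2 w" "j \<in> {1..3}" "x \<in> {0..l j}" for w j x
      using weak_solution_unique[OF l q T0 L that(1) W, of T j x] that T0 fin[of j x] by (simp add: v_def)
    show ?thesis
      by (rule exI[of _ f1], rule exI[of _ f2]) (use H L W U n1 n2 in \<open>auto simp: distrib_right intro!: add_mono\<close>)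
  qed
  thus ?thesis unfolding S_def by blast
qed

end
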